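(* Define the random vector $\Gamma_N(z)\in\mathbb C^2$, for $z\in\mathbb C\setminus[-\sqrt{t_H},\sqrt{t_H}]$, implicitly by $$\begin{pmatrix}\Phi_{N_H}(z)\\ \Phi_{N_H-1}(z)\end{pmatrix}=\pi_{N_H-1}(z)\,\frac{\exp\big(\sqrt{2/\beta}\,\mathfrak g_{t_H}(z)\big)}{\mathbb E\big[\exp\big(\sqrt{2/\beta}\,\mathfrak g_{t_H}(z)\big)\big]}\begin{bmatrix}\lambda_+(t_H)&\lambda_-(t_H)\\1&1\end{bmatrix}\left(\begin{pmatrix}1\\0\end{pmatrix}+\Gamma_N(z)\right),$$ where $N_H=N_H(z)$ and $t_H=N_H(z)/N$. For every $R>0$ there exists a small constant $c_R=c_R(\beta,\delta)>0$ such that for any $\eta>0$, $$\max_{z\in\mathscr D_H}\mathbb P\big[|\Gamma_N(z)|\ge\eta\big]\le c_R^{-1}\big(N^{-c_R\eta^2\Omega}+N^{4-R\Omega}\big).$$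
   Context: Fix $\beta>0$. Let $b_k\sim\mathcal N(0,2)$ and $a_k\sim\chi_{\beta k}$ ($k\ge1$) be independent, where $\chi_a$ has density proportional to $x^{a-1}e^{-x^2/2}\mathbf 1_{x>0}$. Let $\mathbf A$ be the semi-infinite symmetric tridiagonal matrix with diagonal $(b_1,b_2,\dots)$ and off-diagonal $(a_1,a_2,\dots)$. For fixed $N$ and all $n\ge 1$ let $\Phi_n(z)=\det\big(z-(4N\beta)^{-1/2}[\mathbf A]_n\big)$, with $[\mathbf A]_n$ the top-left $n\times n$ block, $\Phi_0=1$. $\pi_n$ is the monic polynomial of degree $n$ orthogonal with respect to $e^{-2Nx^2}$ on $\mathbb R$ ($N$ fixed; $\pi_n=\mathbb E\Phi_n$). Hyperbolic region. Fix a small $\delta\in(0,\frac12)$. Let $\Omega>0$, allowed to depend on $N$ with $\Omega\le N^{\delta/6}$. Let $N_p(z)=\lfloor N(\operatorname{Re}z)^2\rfloor$, $\omega_N(z)=N_p^{1/3}(\Omega\log N_p)^{2/3}$, $$\mathscr D_H=\{z\in\mathbb C:\ 0\le\operatorname{Im}z\le2\operatorname{Re}z,\ \operatorname{Re}z\ge N^{\delta-\frac12}\},\qquad N_H(z)=\min\big(\lfloor N_p-\omega_N\rfloor,N\big).$$ $N$ is assumed large enough (depending on $\delta$) that $N_p\ge2\omega_N$ and $N_H\ge 2$ on $\mathscr D_H$. For $t\ge 0$, $\lambda_\pm(t)=\frac{z\pm\sqrt{z^2-t}}2$, with the branch of $\sqrt{z^2-t}$ analytic off $[-\sqrt t,\sqrt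 t]$ and behaving like $z$ at infinity. Coupling. Let $X_k=b_k/\sqrt2$ for $k\ge1$, $Y_1=0$ and $Y_k=\frac{a_{k-1}^2-\beta(k-1)}{\sqrt{2\beta(k-1)}}$ for $k\ge2$. The probability space supports two independent standard Brownian motions $\widehat{\mathbf X},\widehat{\mathbf Y}$ such that $\sum_{j=1}^nX_j=\widehat{\mathbf X}_n$ for all $n\ge1$ and, for a constant $C_\beta$ and all $n\ge2$, $\mathcal M_n=\max_{1\le k\le n}|\sum_{j=1}^kY_j-\widehat{\mathbf Y}_k|$ satisfies $\inf\{t\ge0:\mathbb Ee^{\mathcal M_n/t}\le2\}\le C_\beta\log n$ (such a strong embedding exists). Set $\mathbf X_t=N^{-1/2}\widehat{\mathbf X}_{tN}$, $\mathbf Y_t=N^{-1/2}\widehat{\mathbf Y}_{tN}$, $t\in[0,1]$. Let $J(z)=z-\sqrt{z^2-1}$ (conformal map of $\mathbb C\setminus[-1,1]$ into the unit disk). For $t\in[0,1]$ and $z\in\mathbb C\setminus[-\sqrt t,\sqrt t]$, $$\mathfrak g_t(z)=-\frac12\int_0^t\frac{d\mathbf X_u+J(z/\sqrt u)\,d\mathbf Y_u}{\sqrt{z^2-u}}.$$ *)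

theory Defs
  imports
    "HOL-Probability.Probability"
    "HOL-Complex_Analysis.Complex_Analysis"
    "Jordan_Normal_Form.Determinant"
begin

section \<open>Brownian motion and Wiener integrals\<close>

locale brownian_motion = prob_space M
  for M :: "'a measure" and W :: "real \<Rightarrow> 'a \<Rightarrow> real" +
  assumes measurable_W: "\<And>t. 0 \<le> t \<Longrightarrow> random_variable borel (W t)"
    and start_zero: "AE \<omega> in M. W 0 \<omega> = 0"
    and continuous_paths: "AE \<omega> in M. continuous_on {0..} (\<lambda>t. W t \<omega>)"
    and normal_increments: "\<And>s t. 0 \<le> s \<Longrightarrow> s < t \<Longrightarrow>
      distributed M lborel (\<lambda>\<omega>. W t \<omega> - W s \<omega>) (\<lambda>x. ennreal (normal_density 0 (sqrt (t - s)) x))"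
    and indep_increments: "\<And>(t :: nat \<Rightarrow> real) n. 0 \<le> t 0 \<Longrightarrow> incseq t \<Longrightarrow>
      indep_vars (\<lambda>_. borel) (\<lambda>i \<omega>. W (t (Suc i)) \<omega> - W (t i) \<omega>) {..<n}"

text \<open>A list of triples \<open>(s, t, c)\<close> encodes the step function that is the sum of the
  \<open>c * indicator {s<..t}\<close>; the intervals may overlap.\<close>

definition step_fun :: "(real \<times> real \<times> complex) list \<Rightarrow> real \<Rightarrow> complex" where
  "step_fun \<phi> u = (\<Sum>(s, t, c)\<leftarrow>\<phi>. c * indicator {s<..t} u)"

definition step_integral ::
  "(real \<Rightarrow> 'a \<Rightarrow> real) \<Rightarrow> (real \<times> real \<times> complex) list \<Rightarrow> 'a \<Rightarrow> complex" where
  "step_integral W \<phi> \<omega> = (\<Sum>(s, t, c)\<leftarrow>\<phi>. c * of_real (W t \<omega> - W s \<omega>))"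

text \<open>The integral over \<open>[0, T]\<close> of a deterministic square-integrable \<open>f\<close> with respect to a
  (multiple of a) Brownian motion: the limit in \<open>L\<^sup>2(M)\<close> of the integrals of step functions
  that converge to \<open>f\<close> in \<open>L\<^sup>2([0, T])\<close>.\<close>

definition is_wiener_integral ::
  "'a measure \<Rightarrow> (real \<Rightarrow> 'a \<Rightarrow> real) \<Rightarrow> real \<Rightarrow> (real \<Rightarrow> complex) \<Rightarrow> ('a \<Rightarrow> complex) \<Rightarrow> bool" where
  "is_wiener_integral M W T f I \<longleftrightarrow>
     I \<in> borel_measurable M \<and>
     (\<exists>\<phi> :: nat \<Rightarrow> (real \<times> real \<times> complex) list.
        (\<forall>n. \<forall>(s, t, c) \<in> set (\<phi> n). 0 \<le> s \<and> s \<le> t \<and> t \<le> T) \<and>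
        (\<lambda>n. \<integral>\<^sup>+u. ennreal ((cmod (step_fun (\<phi> n) u - f u))\<^sup>2) * indicator {0..T} u \<partial>lborel)
          \<longlonglongrightarrow> 0 \<and>
        (\<lambda>n. \<integral>\<^sup>+\<omega>. ennreal ((cmod (step_integral W (\<phi> n) \<omega> - I \<omega>))\<^sup>2) \<partial>M) \<longlonglongrightarrow> 0)"

text \<open>The integral is determined only up to a null set; a version is chosen.\<close>

definition wiener_integral ::
  "'a measure \<Rightarrow> (real \<Rightarrow> 'a \<Rightarrow> real) \<Rightarrow> real \<Rightarrow> (real \<Rightarrow> complex) \<Rightarrow> 'a \<Rightarrow> complex" where
  "wiener_integral M W T f = (SOME I. is_wiener_integral M W T f I)"


section \<open>The Gaussian beta ensemble and its coupling with Brownian motions\<close>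

definition chi_distributed :: "'a measure \<Rightarrow> real \<Rightarrow> ('a \<Rightarrow> real) \<Rightarrow> bool" where
  "chi_distributed M p Z \<longleftrightarrow>
     (\<exists>c>0. distributed M lborel Z
        (\<lambda>x. ennreal (if x > 0 then c * (x powr (p - 1) * exp (- x\<^sup>2 / 2)) else 0)))"

definition X_var :: "(nat \<Rightarrow> 'a \<Rightarrow> real) \<Rightarrow> nat \<Rightarrow> 'a \<Rightarrow> real" where
  "X_var b k \<omega> = b k \<omega> / sqrt 2"

definition Y_var :: "real \<Rightarrow> (nat \<Rightarrow> 'a \<Rightarrow> real) \<Rightarrow> nat \<Rightarrow> 'a \<Rightarrow> real" where
  "Y_var \<beta> a k \<omega> =
     (if k \<le> 1 then 0
      else ((a (k - 1) \<omega>)\<^sup>2 - \<beta> * real (k - 1)) / sqrt (2 * \<beta> * real (k - 1)))"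

definition max_error ::
  "real \<Rightarrow> (nat \<Rightarrow> 'a \<Rightarrow> real) \<Rightarrow> (real \<Rightarrow> 'a \<Rightarrow> real) \<Rightarrow> nat \<Rightarrow> 'a \<Rightarrow> real" where
  "max_error \<beta> a BY n \<omega> =
     Max ((\<lambda>k. \<bar>(\<Sum>j=1..k. Y_var \<beta> a j \<omega>) - BY (real k) \<omega>\<bar>) ` {1..n})"

text \<open>\<open>t = 0\<close> has to be excluded because of \<open>x / 0 = 0\<close>; the infimum is taken in \<open>ennreal\<close>,
  so that it is infinite if no \<open>t\<close> is admissible.\<close>

definition psi1_norm :: "'a measure \<Rightarrow> ('a \<Rightarrow> real) \<Rightarrow> ennreal" where
  "psi1_norm M Z =
     Inf {ennreal t | t. 0 < t \<and> (\<integral>\<^sup>+\<omega>. ennreal (exp (\<bar>Z \<omega>\<bar> / t)) \<partial>M) \<le> 2}"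

text \<open>The variables \<open>a k\<close>, \<open>b k\<close> are relevant for \<open>k \<ge> 1\<close> only. The variance of \<open>b k\<close> is \<open>2\<close>.\<close>

locale beta_coupling = prob_space M
  for M :: "'a measure" and \<beta> C :: real
    and a b :: "nat \<Rightarrow> 'a \<Rightarrow> real" and BX BY :: "real \<Rightarrow> 'a \<Rightarrow> real" +
  assumes b_normal: "\<And>k. 1 \<le> k \<Longrightarrow>
      distributed M lborel (b k) (\<lambda>x. ennreal (normal_density 0 (sqrt 2) x))"
    and a_chi: "\<And>k. 1 \<le> k \<Longrightarrow> chi_distributed M (\<beta> * real k) (a k)"
    and indep_ab: "indep_vars (\<lambda>_. borel) (case_sum a b) ({1..} <+> {1..})"
    and BX_brownian: "brownian_motion M BX"
    and BY_brownian: "brownian_motion M BY"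
    and indep_BX_BY: "indep_var
      (Pi\<^sub>M {0..} (\<lambda>_. borel)) (\<lambda>\<omega>. \<lambda>t\<in>{0..}. BX t \<omega>)
      (Pi\<^sub>M {0..} (\<lambda>_. borel)) (\<lambda>\<omega>. \<lambda>t\<in>{0..}. BY t \<omega>)"
    and X_embedding: "\<And>n. 1 \<le> n \<Longrightarrow>
      AE \<omega> in M. (\<Sum>j=1..n. X_var b j \<omega>) = BX (real n) \<omega>"
    and Y_embedding: "\<And>n. 2 \<le> n \<Longrightarrow>
      psi1_norm M (max_error \<beta> a BY n) \<le> ennreal (C * ln (real n))"

text \<open>Entries of the tridiagonal matrix with rows and columns indexed from \<open>0\<close>.\<close>

definition A_entry ::
  "(nat \<Rightarrow> 'a \<Rightarrow> real) \<Rightarrow> (nat \<Rightarrow> 'a \<Rightarrow> real) \<Rightarrow> 'a \<Rightarrow> nat \<Rightarrow> nat \<Rightarrow> real" where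
  "A_entry a b \<omega> i j =
     (if i = j then b (Suc i) \<omega>
      else if j = Suc i then a (Suc i) \<omega>
      else if i = Suc j then a (Suc j) \<omega>
      else 0)"

definition Phi ::
  "real \<Rightarrow> nat \<Rightarrow> (nat \<Rightarrow> 'a \<Rightarrow> real) \<Rightarrow> (nat \<Rightarrow> 'a \<Rightarrow> real) \<Rightarrow> nat \<Rightarrow> complex \<Rightarrow> 'a \<Rightarrow> complex" where
  "Phi \<beta> N a b n z \<omega> =
     Determinant.det
       (z \<cdot>\<^sub>m 1\<^sub>m n -
        complex_of_real ((4 * real N * \<beta>) powr (- 1 / 2)) \<cdot>\<^sub>m
          Matrix.mat n n (\<lambda>(i, j). complex_of_real (A_entry a b \<omega> i j)))"

definition orth_poly :: "nat \<Rightarrow> nat \<Rightarrow> real poly" where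
  "orth_poly N n =
     (THE p. degree p = n \<and> lead_coeff p = 1 \<and>
        (\<forall>q. degree q < n \<longrightarrow>
           (LINT x|lborel. poly p x * poly q x * exp (- 2 * real N * x\<^sup>2)) = 0))"

definition pi_poly :: "nat \<Rightarrow> nat \<Rightarrow> complex \<Rightarrow> complex" where
  "pi_poly N n z = poly (map_poly complex_of_real (orth_poly N n)) z"


section \<open>The square root and related functions\<close>

text \<open>The branch of the square root of \<open>z\<^sup>2 - t\<close> that is analytic off
  \<open>[-\<surd>t, \<surd>t]\<close> and behaves like \<open>z\<close> at infinity.\<close>

definition sqrt_branch :: "real \<Rightarrow> complex \<Rightarrow> complex" where
  "sqrt_branch t z = z * csqrt (1 - of_real t / z\<^sup>2)"

definition cut :: "real \<Rightarrow> complex set" where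
  "cut t = of_real ` {- sqrt t..sqrt t}"

lemma cut_nonpos_Reals:
  assumes "0 \<le> t" "z \<notin> cut t"
  shows "z \<noteq> 0" "1 - of_real t / z\<^sup>2 \<notin> \<real>\<^sub>\<le>\<^sub>0"
proof -
  show nz: "z \<noteq> 0" using assms unfolding cut_def by (auto simp: image_iff)
  show "1 - of_real t / z\<^sup>2 \<notin> \<real>\<^sub>\<le>\<^sub>0"
  proof
    assume "1 - of_real t / z\<^sup>2 \<in> \<real>\<^sub>\<le>\<^sub>0"
    then obtain r where r: "1 - of_real t / z\<^sup>2 = complex_of_real r" "r \<le> 0"
      by (elim nonpos_Reals_cases)
    define s where "s = t / (1 - r)"
    have "of_real t / z\<^sup>2 = complex_of_real (1 - r)" using r(1) by (simp add: algebra_simps)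
    hence "of_real t = complex_of_real (1 - r) * z\<^sup>2" using nz by (simp add: field_simps)
    moreover have "complex_of_real (1 - r) \<noteq> 0" using r(2) by (simp only: of_real_eq_0_iff)
    ultimately have "z\<^sup>2 = complex_of_real s" by (simp add: s_def field_simps)
    moreover have s: "0 \<le> s" "s \<le> t" using assms(1) r(2) by (auto simp: s_def divide_simps algebra_simps mult_nonpos_nonneg)
    hence "complex_of_real s = (of_real (sqrt s))\<^sup>2" by (metis of_real_power real_sqrt_pow2)
    ultimately have "z = of_real (sqrt s) \<or> z = of_real (- sqrt s)" by (simp add: power2_eq_iff)
    moreover have "sqrt s \<in> {- sqrt t..sqrt t}" "- sqrt s \<in> {- sqrt t..sqrt t}"
      using real_sqrt_le_mono[OF s(2)] real_sqrt_ge_zero[OF s(1)]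
      unfolding atLeastAtMost_iff by linarith+
    ultimately show False using assms(2) unfolding cut_def by blast
  qed
qed

lemma sqrt_branch_squared:
  assumes "z \<noteq> 0"
  shows "(sqrt_branch t z)\<^sup>2 = z\<^sup>2 - of_real t"
  using assms by (simp add: sqrt_branch_def power_mult_distrib right_diff_distrib)

lemma sqrt_branch_holomorphic:
  assumes "0 \<le> t"
  shows "sqrt_branch t holomorphic_on - cut t"
  unfolding sqrt_branch_def
  using cut_nonpos_Reals[OF assms] by (auto intro!: holomorphic_intros)

lemma sqrt_branch_at_infinity: "((\<lambda>z. sqrt_branch t z / z) \<longlongrightarrow> 1) at_infinity"
proof -
  have "((\<lambda>z. of_real t / z\<^sup>2) \<longlongrightarrow> (0::complex)) at_infinity"
    by (intro tendsto_divide_0[OF tendsto_const] filterlim_power_at_infinity filterlim_ident) simp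
  hence "((\<lambda>z. csqrt (1 - of_real t / z\<^sup>2)) \<longlongrightarrow> csqrt (1 - 0)) at_infinity"
    by (intro isCont_tendsto_compose[OF continuous_at_csqrt] tendsto_diff tendsto_const) auto
  moreover have "eventually (\<lambda>z. csqrt (1 - of_real t / z\<^sup>2) = sqrt_branch t z / z) at_infinity"
    using eventually_not_equal_at_infinity[of 0] by eventually_elim (simp add: sqrt_branch_def)
  ultimately show ?thesis using tendsto_cong by force
qed

definition lambda_plus :: "real \<Rightarrow> complex \<Rightarrow> complex" where
  "lambda_plus t z = (z + sqrt_branch t z) / 2"

definition lambda_minus :: "real \<Rightarrow> complex \<Rightarrow> complex" where
  "lambda_minus t z = (z - sqrt_branch t z) / 2"

definition J_map :: "complex \<Rightarrow> complex" where
  "J_map z = z - sqrt_branch 1 z"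

definition scaled :: "nat \<Rightarrow> (real \<Rightarrow> 'a \<Rightarrow> real) \<Rightarrow> real \<Rightarrow> 'a \<Rightarrow> real" where
  "scaled N W t \<omega> = W (t * real N) \<omega> / sqrt (real N)"

definition g_field ::
  "'a measure \<Rightarrow> nat \<Rightarrow> (real \<Rightarrow> 'a \<Rightarrow> real) \<Rightarrow> (real \<Rightarrow> 'a \<Rightarrow> real) \<Rightarrow> real \<Rightarrow> complex \<Rightarrow> 'a \<Rightarrow> complex" where
  "g_field M N BX BY t z \<omega> =
     - (1 / 2) *
       (wiener_integral M (scaled N BX) t (\<lambda>u. 1 / sqrt_branch u z) \<omega> +
        wiener_integral M (scaled N BY) t
          (\<lambda>u. J_map (z / of_real (sqrt u)) / sqrt_branch u z) \<omega>)"


section \<open>The hyperbolic region\<close>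

definition D_H :: "real \<Rightarrow> nat \<Rightarrow> complex set" where
  "D_H \<delta> N = {z. 0 \<le> Im z \<and> Im z \<le> 2 * Re z \<and> real N powr (\<delta> - 1 / 2) \<le> Re z}"

definition N_p :: "nat \<Rightarrow> complex \<Rightarrow> int" where
  "N_p N z = \<lfloor>real N * (Re z)\<^sup>2\<rfloor>"

definition omega_N :: "real \<Rightarrow> nat \<Rightarrow> complex \<Rightarrow> real" where
  "omega_N \<Omega> N z =
     real_of_int (N_p N z) powr (1 / 3) * (\<Omega> * ln (real_of_int (N_p N z))) powr (2 / 3)"

text \<open>The truncation by \<open>nat\<close> is harmless: \<open>N_H\<close> is used only where it is at least \<open>2\<close>.\<close>

definition N_H :: "real \<Rightarrow> nat \<Rightarrow> complex \<Rightarrow> nat" where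
  "N_H \<Omega> N z = nat (min \<lfloor>real_of_int (N_p N z) - omega_N \<Omega> N z\<rfloor> (int N))"

definition t_H :: "real \<Rightarrow> nat \<Rightarrow> complex \<Rightarrow> real" where
  "t_H \<Omega> N z = real (N_H \<Omega> N z) / real N"

definition N_large :: "real \<Rightarrow> real \<Rightarrow> nat \<Rightarrow> bool" where
  "N_large \<delta> \<Omega> N \<longleftrightarrow>
     (\<forall>z\<in>D_H \<delta> N. 2 * omega_N \<Omega> N z \<le> real_of_int (N_p N z) \<and> 2 \<le> N_H \<Omega> N z)"

text \<open>The unique solution of the linear equation that determines it (on the complement of
  \<open>cut (t_H \<Omega> N z)\<close>, where the matrix is invertible). The norm on \<open>complex ^ 2\<close> is
  the Euclidean one.\<close>

definition Gamma_N ::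
  "'a measure \<Rightarrow> real \<Rightarrow> (nat \<Rightarrow> 'a \<Rightarrow> real) \<Rightarrow> (nat \<Rightarrow> 'a \<Rightarrow> real) \<Rightarrow>
   (real \<Rightarrow> 'a \<Rightarrow> real) \<Rightarrow> (real \<Rightarrow> 'a \<Rightarrow> real) \<Rightarrow> real \<Rightarrow> nat \<Rightarrow> complex \<Rightarrow> 'a \<Rightarrow> complex ^ 2" where
  "Gamma_N M \<beta> a b BX BY \<Omega> N z \<omega> =
     (let n = N_H \<Omega> N z; t = t_H \<Omega> N z;
          e = (\<lambda>\<omega>'. exp (of_real (sqrt (2 / \<beta>)) * g_field M N BX BY t z \<omega>'))
      in THE v :: complex ^ 2.
           (vector [Phi \<beta> N a b n z \<omega>, Phi \<beta> N a b (n - 1) z \<omega>] :: complex ^ 2) =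
           (pi_poly N (n - 1) z * (e \<omega> / (LINT \<omega>'|M. e \<omega>'))) *s
             ((vector [vector [lambda_plus t z, lambda_minus t z], vector [1, 1]] :: complex ^ 2 ^ 2)
                *v (vector [1, 0] + v)))"

end

theory Submission
  imports Defs "HOL-Real_Asymp.Real_Asymp"
begin

text \<open>
  Write \<open>u\<^sub>k = \<Phi>\<^sub>k / \<pi>\<^sub>k\<close> and \<open>v\<^sub>k = u\<^sub>k - u\<^bsub>k-1\<^esub>\<close>. The three-term recursion contracts \<open>v\<close> by the factor
  \<open>1 - \<theta>\<^sub>k\<close>, \<open>\<theta>\<^sub>k = \<surd>((P - k) / P)\<close>, while the combination \<open>s = u + \<kappa> v\<close> is, up to a small drift, multiplied by
  \<open>1 - F\<^sub>k\<close>, where \<open>F\<^sub>k\<close> is linear in the noise and \<open>\<Sum>F\<^sub>k\<close> is a discretization of the stochastic integral \<open>- \<surd>(2/\<beta>) g\<close>. After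
  division by \<open>E\<^sub>n = exp (- \<Sum>F\<^sub>k - \<Sum>E F\<^sub>k\<^sup>2 / 2)\<close>, the weighted sum \<open>V\<close> of \<open>|s - 1|\<^sup>2\<close> and \<open>|v / \<theta>|\<^sup>2\<close> is a Lyapunov
  function: \<open>E V\<^sup>m\<close> grows by a factor \<open>1 + cost\<^sub>k\<close> per step, with \<open>\<Sum>cost\<^sub>k = O(m)\<close>. This gives
  \<open>E V\<^sup>m \<le> (C m / L)\<^sup>m\<close> with \<open>L = \<omega> \<surd>(\<omega> / P) \<approx> \<Omega> ln N\<^sub>p\<close>. The ratio of \<open>E\<^sub>n\<close> to the
  normalized exponential of the field is \<open>exp \<chi>\<close>, where \<open>\<chi>\<close> consists of a Gaussian discretization error and, after summation by
  parts, of a multiple of the coupling error \<open>M\<^sub>n\<close>; both are of order \<open>\<omega>\<^bsup>-1/2\<^esup>\<close>.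
\<close>

section \<open>Moments of the matrix entries\<close>

text \<open>Origin of \<open>\<kappa>\<close>: without noise and with frozen coefficients,
  \<open>u\<close> still gains \<open>v (\<rho> + \<rho>^2 + ...)\<close>, so
  \<open>u + \<kappa> v\<close> with \<open>\<kappa> = \<rho> / (1 - \<rho>)\<close> is the value at
  which \<open>u\<close> would settle. For \<open>\<rho> = \<lambda>_- / \<lambda>_+\<close> this is
  \<open>\<lambda>_+ / S - 1\<close> with \<open>S\<close> the square root branch; it puts the
  factor \<open>1 / S\<close> of the field into the noise of \<open>s\<close>. The obstacle is that
  \<open>V\<close> alone has no multiplicative bound: the noise feeds \<open>v\<close> by an amount
  proportional to \<open>s\<close>, which is near 1 even where \<open>V\<close> vanishes. Hence a
  constant \<open>\<epsilon>\<close> of order \<open>m / L\<close> is added to \<open>V\<close>; it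
  is the origin of \<open>(C m / L)^m\<close>. The weight of \<open>|v / \<theta>|^2\<close> has two
  parts: one of order \<open>m / (sqrt (\<omega> / P) (P - k))\<close>, large enough for the
  contraction to absorb the noise, and one decaying geometrically away from \<open>k = n\<close>,
  which makes the final weight at least 1. The chi-square noise has exponential moments in a bounded
  range only, so a moment of free order \<open>m\<close> replaces an exponential moment of
  \<open>V\<close>. The constant \<open>c\<close> is fixed before the probability space, so every
  constant depends on \<open>\<beta>\<close>, \<open>C\<close>, \<open>\<delta>\<close> and
  \<open>R\<close> only.\<close>

lemma (in prob_space) chi_square_mgf:
 assumes chi: "chi_distributed M p Z" and t: "t < 1 / 2"
 shows "(\<integral>\<^sup>+w. ennreal (exp (t * (Z w)^2)) \<partial>M) = ennreal ((1 - 2 * t) powr (- p / 2))"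
proof -
 obtain c where c: "c > 0" and D: "distributed M lborel Z
    (\<lambda>x. ennreal (if x > 0 then c * (x powr (p - 1) * exp (- x\<^sup>2 / 2)) else 0))"
  using chi unfolding chi_distributed_def by blast
 define g where "g x = (if x > 0 then c * (x powr (p - 1) * exp (- x\<^sup>2 / 2)) else 0)" for x :: real
 have D: "distributed M lborel Z (\<lambda>x. ennreal (g x))" using D by (simp add: g_def)
 have gm[measurable]: "g \<in> borel_measurable borel" unfolding g_def by measurable
 \<comment> \<open>Scaling by \<open>s\<close> carries the tilted density back to the density
   itself, so the unspecified normalizing constant \<open>c\<close> cancels and no Gamma function
   has to be evaluated.\<close>
 define s where "s = sqrt (1 - 2 * t)"
 have s: "s > 0" "s^2 = 1 - 2 * t" using t by (auto simp: s_def)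
 have Zm[measurable]: "Z \<in> borel_measurable M" using D by (auto dest: distributed_measurable)
 have one: "(\<integral>\<^sup>+x. ennreal (g x) \<partial>lborel) = 1"
 proof -
  have "(\<integral>\<^sup>+x. ennreal (g x) * 1 \<partial>lborel) = (\<integral>\<^sup>+w. 1 \<partial>M)"
   by (rule distributed_nn_integral[OF D, of "\<lambda>_. 1"]) simp
  thus ?thesis by (simp add: emeasure_space_1)
 qed
 have "(\<integral>\<^sup>+w. ennreal (exp (t * (Z w)^2)) \<partial>M)
   = (\<integral>\<^sup>+x. ennreal (g x) * ennreal (exp (t * x^2)) \<partial>lborel)"
  by (rule distributed_nn_integral[OF D, symmetric]) simp
 also have "\<dots> = (\<integral>\<^sup>+x. ennreal (s powr (1 - p)) * ennreal (g (0 + s * x)) \<partial>lborel)"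
 proof (intro nn_integral_cong)
  fix x :: real
  have "g x * exp (t * x^2) = s powr (1 - p) * g (s * x)"
  proof (cases "x > 0")
   case True
   have "- x\<^sup>2 / 2 + t * x^2 = - (s * x)\<^sup>2 / 2"
    by (simp add: power_mult_distrib s field_simps)
   hence "exp (- x\<^sup>2 / 2) * exp (t * x^2) = exp (- (s * x)\<^sup>2 / 2)" by (simp add: exp_add[symmetric])
   moreover have "s powr (1 - p) * (s * x) powr (p - 1) = x powr (p - 1)"
    using s True by (simp add: powr_mult flip: powr_add mult.assoc)
   ultimately show ?thesis using True s
    by (simp add: g_def zero_less_mult_iff mult.assoc)
  next
   case False
   thus ?thesis using s by (simp add: g_def zero_less_mult_iff)
  qed
  moreover have "g x \<ge> 0" "g (s * x) \<ge> 0" using c by (auto simp: g_def)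
  ultimately show "ennreal (g x) * ennreal (exp (t * x^2)) = ennreal (s powr (1 - p)) * ennreal (g (0 + s * x))"
   by (simp add: ennreal_mult[symmetric])
 qed
 also have "\<dots> = ennreal (s powr (1 - p)) * (\<integral>\<^sup>+x. ennreal (g (0 + s * x)) \<partial>lborel)"
  by (rule nn_integral_cmult) measurable
 also have "(\<integral>\<^sup>+x. ennreal (g (0 + s * x)) \<partial>lborel) = ennreal (1 / s)"
 proof -
  have "ennreal s * (\<integral>\<^sup>+x. ennreal (g (0 + s * x)) \<partial>lborel) = 1"
   using nn_integral_real_affine[of "\<lambda>x. ennreal (g x)" s 0] one s by simp
  hence "ennreal (1 / s) * (ennreal s * (\<integral>\<^sup>+x. ennreal (g (0 + s * x)) \<partial>lborel)) = ennreal (1 / s)" by simp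
  moreover have "ennreal (1 / s) * ennreal s = 1" using s by (simp add: ennreal_mult[symmetric])
  ultimately show ?thesis by (simp add: mult.assoc[symmetric])
 qed
 also have "ennreal (s powr (1 - p)) * ennreal (1 / s) = ennreal ((1 - 2 * t) powr (- p / 2))"
 proof -
  have "s powr (1 - p) * (1 / s) = s powr (- p)"
   using s by (simp add: powr_diff powr_minus field_simps)
  also have "\<dots> = (1 - 2 * t) powr (- p / 2)"
   using t by (simp add: s_def powr_half_sqrt[symmetric] powr_powr)
  finally show ?thesis using s by (simp add: ennreal_mult[symmetric])
 qed
 finally show ?thesis .
qed

text \<open>Dominated convergence for the difference quotients of the moment generating function.\<close>

lemma (in prob_space) moments_of_mgf:
 fixes X :: "'a \<Rightarrow> real"
 assumes [measurable]: "X \<in> borel_measurable M" and h: "h > 0"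
  and mgf: "\<And>t. \<bar>t\<bar> \<le> h \<Longrightarrow> (\<integral>\<^sup>+w. ennreal (exp (t * X w)) \<partial>M) = ennreal (G t)"
  and Gpos: "\<And>t. \<bar>t\<bar> \<le> h \<Longrightarrow> 0 \<le> G t"
  and G1: "((\<lambda>t. (G t - 1) / t) \<longlongrightarrow> m1) (at_right 0)"
  and G2: "((\<lambda>t. (G t + G (- t) - 2) / t^2) \<longlongrightarrow> m2) (at_right 0)"
 shows "integrable M X" "expectation X = m1" "integrable M (\<lambda>w. (X w)^2)" "expectation (\<lambda>w. (X w)^2) = m2"
proof -
 have int: "integrable M (\<lambda>w. exp (t * X w))" and ex: "expectation (\<lambda>w. exp (t * X w)) = G t"
  if "\<bar>t\<bar> \<le> h" for t
 proof -
  show I: "integrable M (\<lambda>w. exp (t * X w))"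
   by (rule integrableI_nonneg) (auto simp: mgf[OF that])
  show "expectation (\<lambda>w. exp (t * X w)) = G t"
   by (subst integral_eq_nn_integral) (auto simp: mgf[OF that] Gpos[OF that])
 qed
 define W where "W w = exp (h * X w) + exp (- h * X w)" for w
 have Wint: "integrable M W" unfolding W_def using int[of h] int[of "-h"] h
  by (intro Bochner_Integration.integrable_add) auto
 have exp_abs: "exp \<bar>h * x\<bar> \<le> exp (h * x) + exp (- h * x)" for x :: real
  using h by (cases "x \<ge> 0") (auto simp: abs_mult add_increasing add_increasing2)
 \<comment> \<open>The points stay below \<open>h / 2\<close>: half of the available exponent
   dominates the exponential in the difference quotients, the other half pays for the factors
   \<open>x\<close> and \<open>x^2\<close>.\<close>
 define t where "t n = h / (2 * (real n + 1))" for n :: nat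
 have tpos: "t n > 0" "t n \<le> h / 2" for n using h by (auto simp: t_def divide_simps)
 have t0: "t \<longlonglongrightarrow> 0" unfolding t_def using h by real_asymp
 have tlim: "filterlim t (at_right 0) sequentially"
  unfolding filterlim_at using t0 tpos(1) by (auto intro!: always_eventually simp: less_imp_neq[symmetric])
 define y where "y x = \<bar>h * x / 2\<bar>" for x :: real
 have ybd: "(y x)^2 * exp (y x) \<le> 2 * exp \<bar>h * x\<bar>" for x
 proof -
  have "(y x)^2 / 2 \<le> exp (y x)"
   using exp_lower_Taylor_quadratic[of "y x"] by (auto simp: y_def)
  hence "(y x)^2 / 2 * exp (y x) \<le> exp (y x) * exp (y x)" by (intro mult_right_mono) auto
  also have "\<dots> = exp \<bar>h * x\<bar>" by (simp add: y_def exp_add[symmetric] abs_mult)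
  finally show ?thesis by simp
 qed
 have y1: "y x * exp (y x) \<le> exp \<bar>h * x\<bar>" for x
 proof -
  have "y x * exp (y x) \<le> exp (y x) * exp (y x)"
   using exp_ge_add_one_self[of "y x"] by (intro mult_right_mono exp_ge_zero) linarith
  also have "\<dots> = exp \<bar>h * x\<bar>" by (simp add: y_def exp_add[symmetric] abs_mult)
  finally show ?thesis by simp
 qed
 have quad: "\<bar>exp a - 1\<bar> \<le> \<bar>a\<bar> * exp \<bar>a\<bar>" "\<bar>exp a + exp (- a) - 2\<bar> \<le> a^2 * exp \<bar>a\<bar>" for a :: real
 proof -
  show A: "\<bar>exp a - 1\<bar> \<le> \<bar>a\<bar> * exp \<bar>a\<bar>" for a :: real
  proof -
   obtain r where r: "\<bar>r\<bar> \<le> \<bar>a\<bar>" "exp a = 1 + a * exp r"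
    using Maclaurin_exp_le[of a 1] by (auto simp: mult.commute)
   have "\<bar>exp a - 1\<bar> = \<bar>a\<bar> * exp r" by (simp add: r(2) abs_mult)
   also have "\<dots> \<le> \<bar>a\<bar> * exp \<bar>a\<bar>" using r(1) by (intro mult_left_mono) auto
   finally show ?thesis .
  qed
  have "exp a + exp (- a) - 2 = (exp (a / 2) - exp (- a / 2))^2"
   by (simp add: power2_diff exp_add[symmetric] exp_double[symmetric])
  also have "exp (a / 2) - exp (- a / 2) = exp (- a / 2) * (exp a - 1)"
   by (simp add: right_diff_distrib exp_add[symmetric])
  also have "exp (- a / 2) * (exp a - 1) = (if a \<ge> 0 then exp (-a/2) * (exp a - 1) else exp (a/2) * (1 - exp (- a)))"
   by (simp add: right_diff_distrib exp_add[symmetric])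
  finally have e: "exp a + exp (- a) - 2 = (exp (- \<bar>a\<bar> / 2) * (exp \<bar>a\<bar> - 1))^2"
   by (auto simp: power2_eq_square algebra_simps split: if_splits)
  have "\<bar>exp (- \<bar>a\<bar> / 2) * (exp \<bar>a\<bar> - 1)\<bar> \<le> exp (- \<bar>a\<bar> / 2) * (\<bar>a\<bar> * exp \<bar>a\<bar>)"
   unfolding abs_mult using A[of "\<bar>a\<bar>"] by (intro mult_mono) auto
  also have "\<dots> = \<bar>a\<bar> * exp (\<bar>a\<bar> / 2)" by (simp add: exp_add[symmetric] algebra_simps)
  finally have "(exp (- \<bar>a\<bar> / 2) * (exp \<bar>a\<bar> - 1))^2 \<le> (\<bar>a\<bar> * exp (\<bar>a\<bar> / 2))^2"
   by (metis abs_ge_zero power2_abs power_mono)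
  also have "\<dots> = a^2 * exp \<bar>a\<bar>" by (simp add: power_mult_distrib exp_double[symmetric])
  finally show "\<bar>exp a + exp (- a) - 2\<bar> \<le> a^2 * exp \<bar>a\<bar>" using e by auto
 qed
 have D1: "(\<lambda>n. (exp (t n * x) - 1) / t n) \<longlonglongrightarrow> x" for x
 proof -
  have "((\<lambda>s. (exp (s * x) - 1) / s) \<longlongrightarrow> x) (at_right 0)" by real_asymp
  thus ?thesis using filterlim_compose[OF _ tlim] by blast
 qed
 have D2: "(\<lambda>n. (exp (t n * x) + exp (- t n * x) - 2) / (t n)^2) \<longlonglongrightarrow> x^2" for x
 proof -
  have "((\<lambda>s. (exp (s * x) + exp (- s * x) - 2) / s^2) \<longlongrightarrow> x * x) (at_right 0)" by real_asymp
  from filterlim_compose[OF this tlim] show ?thesis by (simp add: power2_eq_square)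
 qed
 have tx: "\<bar>t n * x\<bar> \<le> y x" for n x
  using tpos[of n] h mult_right_mono[of "t n" "h / 2" "\<bar>x\<bar>"] by (auto simp: y_def abs_mult)
 have b1: "\<bar>(exp (t n * x) - 1) / t n\<bar> \<le> 2 / h * exp \<bar>h * x\<bar>" for n x
 proof -
  have "\<bar>(exp (t n * x) - 1) / t n\<bar> \<le> (\<bar>t n * x\<bar> * exp \<bar>t n * x\<bar>) / t n"
   using quad(1)[of "t n * x"] tpos(1)[of n] by (simp add: divide_right_mono)
  also have "\<dots> = \<bar>x\<bar> * exp \<bar>t n * x\<bar>" using tpos(1)[of n] by (simp add: abs_mult)
  also have "\<dots> \<le> \<bar>x\<bar> * exp (y x)" using tx[of n x] by (intro mult_left_mono) auto
  also have "\<dots> = 2 / h * (y x * exp (y x))" using h by (simp add: y_def abs_mult)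
  also have "\<dots> \<le> 2 / h * exp \<bar>h * x\<bar>" using y1[of x] h by (intro mult_left_mono) auto
  finally show ?thesis .
 qed
 have b2: "\<bar>(exp (t n * x) + exp (- t n * x) - 2) / (t n)^2\<bar> \<le> 8 / h^2 * exp \<bar>h * x\<bar>" for n x
 proof -
  have "\<bar>(exp (t n * x) + exp (- t n * x) - 2) / (t n)^2\<bar> \<le> ((t n * x)^2 * exp \<bar>t n * x\<bar>) / (t n)^2"
   using quad(2)[of "t n * x"] by (simp add: divide_right_mono)
  also have "\<dots> = x^2 * exp \<bar>t n * x\<bar>" using tpos(1)[of n] by (simp add: power_mult_distrib)
  also have "\<dots> \<le> x^2 * exp (y x)" using tx[of n x] by (intro mult_left_mono) auto
  also have "\<dots> = 4 / h^2 * ((y x)^2 * exp (y x))" using h by (simp add: y_def power_divide power_mult_distrib)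
  also have "\<dots> \<le> 4 / h^2 * (2 * exp \<bar>h * x\<bar>)" using ybd[of x] h by (intro mult_left_mono) auto
  finally show ?thesis by simp
 qed
 have c1: "\<bar>(exp (t n * X w) - 1) / t n\<bar> \<le> 2 / h * W w" for n w
  unfolding W_def by (rule order_trans[OF b1 mult_left_mono[OF exp_abs]]) (use h in simp)
 have c2: "\<bar>(exp (t n * X w) + exp (- t n * X w) - 2) / (t n)^2\<bar> \<le> 8 / h^2 * W w" for n w
  unfolding W_def by (rule order_trans[OF b2 mult_left_mono[OF exp_abs]]) (use h in simp)
 have W1: "integrable M (\<lambda>w. 2 / h * W w)" and W2: "integrable M (\<lambda>w. 8 / h^2 * W w)" using Wint by auto
 note lim1 = integrable_dominated_convergence[where s = "\<lambda>n w. (exp (t n * X w) - 1) / t n" and f = X, OF _ _ W1]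
  integral_dominated_convergence[where s = "\<lambda>n w. (exp (t n * X w) - 1) / t n" and f = X, OF _ _ W1]
 have lim1: "integrable M X" "(\<lambda>n. expectation (\<lambda>w. (exp (t n * X w) - 1) / t n)) \<longlonglongrightarrow> expectation X"
  by (rule lim1; use c1 D1 in simp)+
 note lim2 = integrable_dominated_convergence[where s = "\<lambda>n w. (exp (t n * X w) + exp (- t n * X w) - 2) / (t n)^2" and f = "\<lambda>w. (X w)^2", OF _ _ W2]
  integral_dominated_convergence[where s = "\<lambda>n w. (exp (t n * X w) + exp (- t n * X w) - 2) / (t n)^2" and f = "\<lambda>w. (X w)^2", OF _ _ W2]
 have lim2: "integrable M (\<lambda>w. (X w)^2)" "(\<lambda>n. expectation (\<lambda>w. (exp (t n * X w) + exp (- t n * X w) - 2) / (t n)^2)) \<longlonglongrightarrow> expectation (\<lambda>w. (X w)^2)"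
  by (rule lim2; use c2 D2 in simp)+
 have t_le: "\<bar>t n\<bar> \<le> h" for n using tpos[of n] by auto
 have "expectation (\<lambda>w. (exp (t n * X w) - 1) / t n) = (G (t n) - 1) / t n" for n
  using int[OF t_le[of n]] ex[OF t_le[of n]]
  by (subst integral_divide_zero, subst Bochner_Integration.integral_diff) (auto simp: prob_space)
 hence "(\<lambda>n. (G (t n) - 1) / t n) \<longlonglongrightarrow> expectation X" using lim1(2) by (simp only:)
 moreover have "(\<lambda>n. (G (t n) - 1) / t n) \<longlonglongrightarrow> m1" by (rule filterlim_compose[OF G1 tlim])
 ultimately show "integrable M X" "expectation X = m1" using lim1(1) LIMSEQ_unique by blast+
 have "expectation (\<lambda>w. (exp (t n * X w) + exp (- t n * X w) - 2) / (t n)^2) = (G (t n) + G (- t n) - 2) / (t n)^2" for n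
  using int[OF t_le[of n]] ex[OF t_le[of n]] int[of "- t n"] ex[of "- t n"] t_le[of n]
  by (subst integral_divide_zero, subst Bochner_Integration.integral_diff, simp, simp,
    subst Bochner_Integration.integral_add) (auto simp: prob_space)
 hence "(\<lambda>n. (G (t n) + G (- t n) - 2) / (t n)^2) \<longlonglongrightarrow> expectation (\<lambda>w. (X w)^2)" using lim2(2) by (simp only:)
 moreover have "(\<lambda>n. (G (t n) + G (- t n) - 2) / (t n)^2) \<longlonglongrightarrow> m2" by (rule filterlim_compose[OF G2 tlim])
 ultimately show "integrable M (\<lambda>w. (X w)^2)" "expectation (\<lambda>w. (X w)^2) = m2"
  using lim2(1) LIMSEQ_unique by blast+
qed

lemma (in prob_space) chi_square_moments:
 assumes chi: "chi_distributed M p Z"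
 shows "integrable M (\<lambda>w. (Z w)^2)" "expectation (\<lambda>w. (Z w)^2) = p"
  "integrable M (\<lambda>w. ((Z w)^2)^2)" "expectation (\<lambda>w. ((Z w)^2)^2) = p * (p + 2)"
proof -
 have [measurable]: "Z \<in> borel_measurable M"
  using chi unfolding chi_distributed_def by (auto dest: distributed_measurable)
 have 1: "((\<lambda>t. ((1 - 2 * t) powr (- p / 2) - 1) / t) \<longlongrightarrow> p) (at_right (0::real))"
  by real_asymp
 have 2: "((\<lambda>t. ((1 - 2 * t) powr (- p / 2) + (1 - 2 * - t) powr (- p / 2) - 2) / t^2) \<longlongrightarrow> p * (p + 2)) (at_right (0::real))"
  by (real_asymp simp: field_simps)
 note * = moments_of_mgf[where X = "\<lambda>w. (Z w)^2" and h = "1/4", OF _ _ chi_square_mgf[OF chi] _ 1 2]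
 show "integrable M (\<lambda>w. (Z w)^2)" "expectation (\<lambda>w. (Z w)^2) = p"
  "integrable M (\<lambda>w. ((Z w)^2)^2)" "expectation (\<lambda>w. ((Z w)^2)^2) = p * (p + 2)"
  by (rule *; auto)+
qed

text \<open>The logarithm of the transform is expanded with
  \<open>|ln (1 + x) - x| \<le> 2 x^2\<close>; the restriction on \<open>h\<close> is what keeps
  \<open>|x| \<le> 1 / 2\<close>. The variance normalization makes the bound independent of
  \<open>p\<close>, so one constant serves all matrix entries.\<close>

lemma (in prob_space) chi_square_exp_moment:
 assumes chi: "chi_distributed M p Z" and p: "0 < p" and h: "0 \<le> h" "h \<le> sqrt (2 * p) / 4"
 shows "(\<integral>\<^sup>+w. ennreal (exp (h * \<bar>((Z w)^2 - p) / sqrt (2 * p)\<bar>)) \<partial>M) \<le> ennreal (2 * exp (2 * h^2))"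
proof -
 have [measurable]: "Z \<in> borel_measurable M"
  using chi unfolding chi_distributed_def by (auto dest: distributed_measurable)
 define q where "q = sqrt (2 * p)"
 have q: "q > 0" "q^2 = 2 * p" using p by (auto simp: q_def)
 have E: "(\<integral>\<^sup>+w. ennreal (exp (t * (((Z w)^2 - p) / q))) \<partial>M) \<le> ennreal (exp (2 * h^2))"
  if t: "\<bar>t\<bar> = h" for t
 proof -
  have "h \<le> q / 4" using h(2) by (simp add: q_def)
  hence tq: "\<bar>t / q\<bar> \<le> 1 / 4" using q t by (simp add: abs_divide field_simps)
  hence tq': "2 * (t / q) < 1" by linarith
  have "(\<integral>\<^sup>+w. ennreal (exp (t * (((Z w)^2 - p) / q))) \<partial>M)
    = (\<integral>\<^sup>+w. ennreal (exp (- t * p / q)) * ennreal (exp (t / q * (Z w)^2)) \<partial>M)"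
   by (intro nn_integral_cong) (simp add: ennreal_mult[symmetric] exp_add[symmetric] algebra_simps diff_divide_distrib)
  also have "\<dots> = ennreal (exp (- t * p / q)) * ennreal ((1 - 2 * (t / q)) powr (- p / 2))"
   using tq by (subst nn_integral_cmult, simp) (subst chi_square_mgf[OF chi], linarith, simp)
  also have "\<dots> = ennreal (exp (- t * p / q - p / 2 * ln (1 - 2 * (t / q))))"
  proof -
   have "exp (- t * p / q) * (1 - 2 * (t / q)) powr (- p / 2) = exp (- t * p / q - p / 2 * ln (1 - 2 * (t / q)))"
    using tq' by (subst powr_def) (simp add: exp_add[symmetric] del: times_divide_eq_right)
   thus ?thesis by (simp add: ennreal_mult[symmetric])
  qed
  also have "\<dots> \<le> ennreal (exp (2 * h^2))"
  proof -
   define x where "x = - 2 * (t / q)"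
   have "\<bar>ln (1 + x) - x\<bar> \<le> 2 * x^2"
    by (rule abs_ln_one_plus_x_minus_x_bound) (use tq in \<open>simp add: x_def abs_mult mult.commute\<close>)
   hence "p / 2 * (- (ln (1 + x) - x)) \<le> p / 2 * (2 * x^2)"
    using p by (intro mult_left_mono) linarith+
   also have "p / 2 * (2 * x^2) = 2 * h^2"
    using p q t by (simp add: x_def power_divide power_mult_distrib flip: power2_abs[of t])
   finally show ?thesis by (simp add: x_def algebra_simps)
  qed
  finally show ?thesis .
 qed
 have "(\<integral>\<^sup>+w. ennreal (exp (h * \<bar>((Z w)^2 - p) / q\<bar>)) \<partial>M)
   \<le> (\<integral>\<^sup>+w. ennreal (exp (h * (((Z w)^2 - p) / q))) + ennreal (exp (- h * (((Z w)^2 - p) / q))) \<partial>M)"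
  by (intro nn_integral_mono) (auto simp: abs_if ennreal_plus[symmetric] simp del: ennreal_plus intro!: ennreal_leI)
 also have "\<dots> \<le> ennreal (exp (2 * h^2)) + ennreal (exp (2 * h^2))"
  by (subst nn_integral_add, simp, simp) (use E[of h] E[of "-h"] h in \<open>auto intro!: add_mono\<close>)
 finally show ?thesis by (simp add: q_def ennreal_plus[symmetric] del: ennreal_plus)
qed

text \<open>The real part of \<open>c\<close> is removed by completing the square and translating
  the integration variable along the real line; what remains is the characteristic function of the
  normal law.\<close>

lemma gaussian_mgf_complex:
 fixes c :: complex
 assumes s: "0 < s"
 shows "integrable lborel (\<lambda>x. normal_density 0 s x *\<^sub>R exp (c * of_real x))"
  "(LINT x|lborel. normal_density 0 s x *\<^sub>R exp (c * of_real x)) = exp (c^2 * of_real (s^2) / 2)"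
proof -
 define a b where "a = Re c * s" and "b = Im c * s"
 have ab: "c * of_real s = Complex a b" by (simp add: a_def b_def complex_eq_iff)
 interpret std: prob_space std_normal_distribution using prob_space_normal_density[of 1 0] by simp
 have ch: "integrable lborel (\<lambda>x. std_normal_density x *\<^sub>R iexp (b * x))"
   "(LINT x|lborel. std_normal_density x *\<^sub>R iexp (b * x)) = exp (- of_real (b^2) / 2)"
 proof -
  have "integrable std_normal_distribution (\<lambda>x. iexp (b * x))" by (rule std.integrable_iexp) auto
  thus "integrable lborel (\<lambda>x. std_normal_density x *\<^sub>R iexp (b * x))"
   by (subst (asm) integrable_density) auto
  have "(LINT x|lborel. std_normal_density x *\<^sub>R iexp (b * x)) = char std_normal_distribution b"
   unfolding char_def by (subst integral_density) auto
  thus "(LINT x|lborel. std_normal_density x *\<^sub>R iexp (b * x)) = exp (- of_real (b^2) / 2)"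
   by (simp add: char_std_normal_distribution exp_of_real[symmetric])
 qed
 have pw: "\<bar>s\<bar> *\<^sub>R (normal_density 0 s (0 + s * x) *\<^sub>R exp (c * of_real (0 + s * x)))
   = (exp (of_real (a^2 / 2)) * iexp (a * b)) * (std_normal_density (- a + 1 * x) *\<^sub>R iexp (b * (- a + 1 * x)))" for x
 proof -
  have "s * normal_density 0 s (s * x) = std_normal_density x"
   using s by (simp add: normal_density_def real_sqrt_mult power_mult_distrib field_simps)
  moreover have std: "complex_of_real (std_normal_density y) = of_real (1 / sqrt (2 * pi)) * exp (of_real (- y\<^sup>2 / 2))" for y
   by (simp add: std_normal_density_def exp_of_real[symmetric])
  moreover have "exp (c * of_real (s * x)) = exp (of_real (a * x) + \<i> * of_real (b * x))"
   by (rule arg_cong[where f = exp]) (simp add: a_def b_def complex_eq_iff)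
  ultimately have "\<bar>s\<bar> *\<^sub>R (normal_density 0 s (0 + s * x) *\<^sub>R exp (c * of_real (0 + s * x)))
    = of_real (1 / sqrt (2 * pi)) * exp (of_real (- x\<^sup>2 / 2)) * exp (of_real (a * x) + \<i> * of_real (b * x))"
   using s by (simp add: scaleR_conv_of_real flip: of_real_mult mult.assoc)
  also have "\<dots> = of_real (1 / sqrt (2 * pi)) * exp (of_real (- x\<^sup>2 / 2) + (of_real (a * x) + \<i> * of_real (b * x)))"
   by (simp only: exp_add mult.assoc)
  also have "of_real (- x\<^sup>2 / 2) + (of_real (a * x) + \<i> * of_real (b * x)) = (of_real (a^2 / 2) + \<i> * of_real (a * b))
    + (of_real (- (- a + 1 * x)\<^sup>2 / 2) + \<i> * of_real (b * (- a + 1 * x)))"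
   by (simp add: complex_eq_iff power2_eq_square field_simps)
  also have "of_real (1 / sqrt (2 * pi)) * exp \<dots> = (exp (of_real (a^2 / 2)) * iexp (a * b)) * (std_normal_density (- a + 1 * x) *\<^sub>R iexp (b * (- a + 1 * x)))"
   unfolding exp_add scaleR_conv_of_real std by (simp add: mult_ac)
  finally show ?thesis .
 qed
 have int: "integrable lborel (\<lambda>x. std_normal_density (- a + 1 * x) *\<^sub>R iexp (b * (- a + 1 * x)))"
  using ch(1) by (subst lborel_integrable_real_affine_iff[where f = "\<lambda>x. std_normal_density x *\<^sub>R iexp (b * x)"]) auto
 have "integrable lborel (\<lambda>x. \<bar>s\<bar> *\<^sub>R (normal_density 0 s (0 + s * x) *\<^sub>R exp (c * of_real (0 + s * x))))"
  unfolding pw using int by (intro integrable_mult_right)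
 hence "integrable lborel (\<lambda>x. normal_density 0 s (0 + s * x) *\<^sub>R exp (c * of_real (0 + s * x)))"
  using s integrable_scaleR_right[of "1 / s" lborel "\<lambda>x. \<bar>s\<bar> *\<^sub>R (normal_density 0 s (0 + s * x) *\<^sub>R exp (c * of_real (0 + s * x)))"]
  by simp
 thus "integrable lborel (\<lambda>x. normal_density 0 s x *\<^sub>R exp (c * of_real x))"
  using s by (subst (asm) lborel_integrable_real_affine_iff[where f = "\<lambda>x. normal_density 0 s x *\<^sub>R exp (c * of_real x)"]) auto
 have "(LINT x|lborel. normal_density 0 s x *\<^sub>R exp (c * of_real x))
   = \<bar>s\<bar> *\<^sub>R (LINT x|lborel. normal_density 0 s (0 + s * x) *\<^sub>R exp (c * of_real (0 + s * x)))"
  using s by (subst lborel_integral_real_affine[where t = 0 and c = s]) auto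
 also have "\<dots> = (LINT x|lborel. (exp (of_real (a^2 / 2)) * iexp (a * b)) * (std_normal_density (- a + 1 * x) *\<^sub>R iexp (b * (- a + 1 * x))))"
  by (subst integral_scaleR_right[symmetric]) (simp only: pw)
 also have "\<dots> = (exp (of_real (a^2 / 2)) * iexp (a * b)) * (LINT x|lborel. std_normal_density x *\<^sub>R iexp (b * x))"
  by (subst integral_mult_right_zero, subst (2) lborel_integral_real_affine[where t = "-a" and c = 1]) auto
 also have "\<dots> = exp (of_real (a^2 / 2) + \<i> * of_real (a * b) + - of_real (b^2) / 2)"
  unfolding ch(2) by (simp only: exp_add)
 also have "of_real (a^2 / 2) + \<i> * of_real (a * b) + - of_real (b^2) / 2 = (Complex a b)^2 / 2"
  by (simp add: complex_eq_iff power2_eq_square field_simps)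
 also have "(Complex a b)^2 = c^2 * of_real (s^2)" by (simp add: ab[symmetric] power_mult_distrib)
 finally show "(LINT x|lborel. normal_density 0 s x *\<^sub>R exp (c * of_real x)) = exp (c^2 * of_real (s^2) / 2)" .
qed

section \<open>Recursion coefficients away from the turning point\<close>

text \<open>The root \<open>S\<close> stays in the closed first quadrant. If \<open>Re S\<close>
  were too small, the real part of \<open>S^2 = z^2 - t\<close> would force both
  \<open>|Re S| < Re z\<close> and \<open>|Im S| < Im z\<close>, against
  \<open>Re S * Im S = Re z * Im z\<close>.\<close>

lemma sqrt_branch_first_quadrant:
 assumes x: "0 < Re z" and y: "0 \<le> Im z" and t: "0 \<le> t" "t < (Re z)^2"
 shows "sqrt ((Re z)^2 - t) \<le> Re (sqrt_branch t z)" "0 \<le> Im (sqrt_branch t z)"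
proof -
 define S where "S = sqrt_branch t z"
 have z: "z \<noteq> 0" using x by auto
 have sq: "S^2 = z^2 - of_real t" unfolding S_def by (rule sqrt_branch_squared[OF z])
 have re: "(Re S)^2 - (Im S)\<^sup>2 = (Re z)^2 - (Im z)\<^sup>2 - t" and im: "Re S * Im S = Re z * Im z"
  using arg_cong[OF sq, of Re] arg_cong[OF sq, of Im] by (simp_all add: power2_eq_square mult.commute)
 define w where "w = csqrt (1 - of_real t / z^2)"
 have w2: "w^2 = 1 - of_real t / z^2" by (simp add: w_def)
 have "Im (1 - of_real t / z^2) \<ge> 0"
  using x y t(1) by (simp add: Im_divide power2_eq_square divide_nonpos_nonneg mult_nonneg_nonneg)
 hence "Re w * Im w \<ge> 0" unfolding w2[symmetric] by (simp add: power2_eq_square mult.commute)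
 moreover have "0 \<le> Re w" using csqrt_principal[of "1 - of_real t / z^2"] unfolding w_def by linarith
 moreover have "Re w = 0 \<longrightarrow> 0 \<le> Im w" using csqrt_principal[of "1 - of_real t / z^2"] by (auto simp: w_def)
 ultimately have w: "0 \<le> Re w" "0 \<le> Im w" by (auto simp: zero_le_mult_iff)
 have S: "S = z * w" by (simp add: S_def w_def sqrt_branch_def)
 have "0 \<le> Im S" using w x y by (simp add: S)
 moreover have "0 \<le> Re S"
 proof (cases "Im z = 0")
  case True thus ?thesis using w x by (simp add: S)
 next
  case False
  hence "0 < Re S * Im S" using im x y by simp
  thus ?thesis using \<open>0 \<le> Im S\<close> by (simp add: zero_less_mult_iff)
 qed
 moreover have "(Re z)^2 - t \<le> (Re S)^2"
 proof (rule ccontr)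
  assume "\<not> (Re z)^2 - t \<le> (Re S)^2"
  hence a: "(Re S)^2 < (Re z)^2" "(Im S)^2 < (Im z)^2" using re t by auto
  hence "(Re S)^2 * (Im S)^2 < (Re z)^2 * (Im z)^2"
   by (intro mult_strict_mono') auto
  thus False using arg_cong[OF im, of "\<lambda>x. x^2"] by (simp add: power_mult_distrib)
 qed
 ultimately show "sqrt ((Re z)^2 - t) \<le> Re (sqrt_branch t z)" "0 \<le> Im (sqrt_branch t z)"
  unfolding S_def[symmetric] by (auto intro: real_le_lsqrt)
qed

text \<open>The point \<open>z\<close> is fixed; \<open>x = Re z\<close>, \<open>P = N x^2\<close> and the indices \<open>k \<le> n\<close> stay at
 distance at least \<open>\<omega>\<close> from the turning point \<open>P\<close>.\<close>

locale hyperbolic =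
 fixes N n :: nat and z :: complex and \<omega> :: real
 assumes N: "1 \<le> N" and xpos: "0 < Re z" and y0: "0 \<le> Im z" and y2: "Im z \<le> 2 * Re z"
  and \<omega>1: "1 \<le> \<omega>" and gap: "real n + \<omega> \<le> real N * (Re z)^2"
begin

definition x :: real where "x = Re z"
definition P :: real where "P = real N * x^2"
definition \<Delta> :: "nat \<Rightarrow> real" where "\<Delta> k = P - real k"
text \<open>\<open>\<theta>\<close> measures the distance to the turning point:
  \<open>x * \<theta> k\<close> bounds \<open>Re (S k)\<close> from below and
  \<open>1 - \<theta> k\<close> bounds the contraction factor of \<open>v\<close>.
  \<open>\<sigma>\<close> is the size of one step of the noise in \<open>s\<close>; the noise in
  \<open>v\<close> has size \<open>\<sigma> * \<theta>\<close>, which is constant in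
  \<open>k\<close>.\<close>

definition \<theta> :: "nat \<Rightarrow> real" where "\<theta> k = sqrt (\<Delta> k / P)"
definition \<sigma> :: "nat \<Rightarrow> real" where "\<sigma> k = 1 / sqrt (\<Delta> k)"
definition S :: "nat \<Rightarrow> complex" where "S k = sqrt_branch (real k / real N) z"
definition lam :: "nat \<Rightarrow> complex" where "lam k = lambda_plus (real k / real N) z"

text \<open>\<open>r (Suc k)\<close> is the ratio of consecutive orthogonal polynomials at
  \<open>z\<close>. The value \<open>r 0 = z\<close> is a default: it enters \<open>r 1\<close> with
  the factor 0, and it agrees with \<open>lam 0\<close>, which starts the comparison of
  \<open>r\<close> with \<open>lam\<close> at error 0.\<close>

fun r :: "nat \<Rightarrow> complex" where
 "r 0 = z"
| "r (Suc k) = z - of_real (real k / (4 * real N)) / r k"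

text \<open>With \<open>lam\<close> in place of \<open>r\<close> this would be
  \<open>\<lambda>_- / \<lambda>_+\<close>, because \<open>k / (4 N)\<close> is the product of
  \<open>\<lambda>_+\<close> and \<open>\<lambda>_-\<close>.\<close>

definition \<rho> :: "nat \<Rightarrow> complex" where "\<rho> k = of_real (real k / (4 * real N)) / (r k * r (Suc k))"

text \<open>The truncated subtraction gives \<open>\<kappa> 0 = z / z - 1 = 0\<close>. The quantity \<open>err k\<close> is the
 coefficient of \<open>v\<close> in the drift of \<open>s = u + \<kappa> v\<close>.\<close>
definition \<kappa> :: "nat \<Rightarrow> complex" where "\<kappa> k = r k / S (k - 1) - 1"
definition err :: "nat \<Rightarrow> complex" where "err k = (1 + \<kappa> (Suc k)) * \<rho> k - \<kappa> k"

lemma x0: "0 < x" and Npos: "0 < real N" using xpos N by (auto simp: x_def)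
lemma Ppos: "0 < P" using x0 Npos by (simp add: P_def)
lemma \<Delta>_ge: "k \<le> n \<Longrightarrow> \<omega> \<le> \<Delta> k" using gap by (auto simp: \<Delta>_def P_def x_def)
lemma \<Delta>_pos: "k \<le> n \<Longrightarrow> 0 < \<Delta> k" using \<Delta>_ge \<omega>1 by fastforce
lemma \<Delta>_le: "\<Delta> k \<le> P" by (simp add: \<Delta>_def)
lemma \<theta>_pos: "k \<le> n \<Longrightarrow> 0 < \<theta> k" using \<Delta>_pos Ppos by (simp add: \<theta>_def)
lemma \<theta>_le1: "\<theta> k \<le> 1" using Ppos \<Delta>_le by (simp add: \<theta>_def)
lemma \<theta>_sq: "k \<le> n \<Longrightarrow> (\<theta> k)^2 = \<Delta> k / P" using \<Delta>_pos Ppos by (simp add: \<theta>_def less_imp_le)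
lemma \<theta>_antimono: "j \<le> k \<Longrightarrow> k \<le> n \<Longrightarrow> \<theta> k \<le> \<theta> j"
 using Ppos by (simp add: \<theta>_def \<Delta>_def divide_right_mono)
lemma \<sigma>_pos: "k \<le> n \<Longrightarrow> 0 < \<sigma> k" using \<Delta>_pos by (simp add: \<sigma>_def)
lemma \<sigma>_sq: "k \<le> n \<Longrightarrow> (\<sigma> k)^2 = 1 / \<Delta> k" using \<Delta>_pos by (simp add: \<sigma>_def power_divide less_imp_le)
lemma \<sigma>\<theta>: "k \<le> n \<Longrightarrow> \<sigma> k * \<theta> k = 1 / sqrt P"
 using \<Delta>_pos[of k] Ppos by (simp add: \<sigma>_def \<theta>_def real_sqrt_divide)
lemma sqrtP: "sqrt P = x * sqrt (real N)" using x0 by (simp add: P_def real_sqrt_mult)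
lemma Nx_\<sigma>\<theta>: "k \<le> n \<Longrightarrow> real N * (x^2 * ((\<sigma> k)^2 * (\<theta> k)^2)) = 1"
 using Ppos \<Delta>_pos[of k] by (simp add: \<sigma>_sq \<theta>_sq) (simp add: P_def)
lemma kN: "k \<le> n \<Longrightarrow> real k / real N = x^2 * (1 - (\<theta> k)\<^sup>2)"
 using Npos x0 Ppos by (simp add: \<theta>_sq \<Delta>_def diff_divide_distrib) (simp add: P_def field_simps)

lemma kN4: "k \<le> n \<Longrightarrow> real k / (4 * real N) = x^2 * (1 - (\<theta> k)\<^sup>2) / 4"
 using kN[of k] by (simp add: field_simps)

lemma S_props: assumes "k \<le> n" shows "x * \<theta> k \<le> Re (S k)" "0 \<le> Im (S k)" "x * \<theta> k \<le> cmod (S k)"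
proof -
 have "real k / real N < x^2" using kN[OF assms] \<theta>_pos[OF assms] x0 by simp
 note * = sqrt_branch_first_quadrant[OF xpos y0 _ this[unfolded x_def], folded x_def S_def]
 have "sqrt (x^2 - real k / real N) = x * \<theta> k"
  using x0 \<theta>_pos[OF assms] by (simp add: kN[OF assms] algebra_simps real_sqrt_mult)
 thus 1: "x * \<theta> k \<le> Re (S k)" "0 \<le> Im (S k)" using * by auto
 show "x * \<theta> k \<le> cmod (S k)" using 1 complex_Re_le_cmod[of "S k"] by linarith
qed

lemma S_nz: "k \<le> n \<Longrightarrow> S k \<noteq> 0" using S_props(3)[of k] x0 \<theta>_pos[of k] by (auto simp: mult_le_0_iff)

lemma S_sq: "(S k)^2 = z^2 - of_real (real k / real N)"
 unfolding S_def by (rule sqrt_branch_squared) (use xpos in auto)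

lemma lam_eq: "lam k = (z + S k) / 2" by (simp add: lam_def lambda_plus_def S_def)

lemma lam_props: assumes "k \<le> n" shows "x * (1 + \<theta> k) / 2 \<le> Re (lam k)" "x * (1 + \<theta> k) / 2 \<le> cmod (lam k)"
proof -
 show 1: "x * (1 + \<theta> k) / 2 \<le> Re (lam k)" using S_props(1)[OF assms] by (simp add: lam_eq x_def algebra_simps)
 show "x * (1 + \<theta> k) / 2 \<le> cmod (lam k)" using 1 complex_Re_le_cmod[of "lam k"] by linarith
qed

lemma lam_nz: "k \<le> n \<Longrightarrow> lam k \<noteq> 0"
 using lam_props(2)[of k] x0 \<theta>_pos[of k] by (auto simp: mult_le_0_iff)

lemma lam_fixed: "k \<le> n \<Longrightarrow> lam k = z - of_real (real k / (4 * real N)) / lam k"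
proof -
 assume k: "k \<le> n"
 have "(z + S k) * (z - S k) = of_real (real k / real N)" using S_sq[of k] by (simp add: algebra_simps power2_eq_square)
 hence "lam k * (z - lam k) = of_real (real k / (4 * real N))" by (simp add: lam_eq field_simps)
 hence "z - lam k = of_real (real k / (4 * real N)) / lam k" using lam_nz[OF k] by (metis nonzero_mult_div_cancel_left)
 thus ?thesis by (metis diff_diff_eq2 add_diff_cancel_left' diff_add_cancel)
qed

text \<open>The difference of the squares is known exactly; dividing by the sum loses little because
  both roots have positive real part and cannot cancel.\<close>

lemma S_diff: assumes "j < k" "k \<le> n" shows "cmod (S j - S k) \<le> (real k - real j) / (real N * (x * \<theta> j))"
proof -
 have j: "j \<le> n" using assms by simp
 have "(S j - S k) * (S j + S k) = of_real ((real k - real j) / real N)"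
  using S_sq[of j] S_sq[of k] by (simp add: algebra_simps power2_eq_square diff_divide_distrib)
 hence *: "cmod (S j - S k) * cmod (S j + S k) = (real k - real j) / real N"
  using assms by (simp only: norm_mult[symmetric] norm_of_real) simp
 have "x * \<theta> j \<le> Re (S j + S k)" using S_props(1)[OF j] S_props(1)[OF assms(2)] x0 \<theta>_pos[OF assms(2)]
  by (simp add: add_increasing2 order_trans[OF _ S_props(1)[OF assms(2)]])
 hence "x * \<theta> j \<le> cmod (S j + S k)" using complex_Re_le_cmod[of "S j + S k"] by linarith
 hence "cmod (S j - S k) * (x * \<theta> j) \<le> (real k - real j) / real N" unfolding *[symmetric] by (intro mult_left_mono) auto
 thus ?thesis using x0 \<theta>_pos[OF j] Npos by (simp add: field_simps)
qed

text \<open>\<open>x * (1 + \<theta> k) / 2\<close> is the value of \<open>\<lambda>_+\<close> at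
  the real point \<open>x\<close>, the larger fixed point of
  \<open>t \<mapsto> x - (k / (4 N)) / t\<close>. It decreases in \<open>k\<close>, so the bound of
  one step is a valid input for the next.\<close>

lemma r_Suc_ge: "k \<le> n \<Longrightarrow> x * (1 + \<theta> k) / 2 \<le> Re (r (Suc k)) \<and> x * (1 + \<theta> k) / 2 \<le> Re (r k)"
proof (induction k)
 case 0
 have "\<theta> 0 = 1" using Ppos by (simp add: \<theta>_def \<Delta>_def)
 thus ?case by (simp add: x_def)
next
 case (Suc k)
 have rk: "x * (1 + \<theta> (Suc k)) / 2 \<le> Re (r (Suc k))"
  using Suc \<theta>_antimono[of k "Suc k"] x0 by (auto elim!: order_trans[rotated])
 define l where "l = x * (1 + \<theta> (Suc k)) / 2"
 have l: "0 < l" using x0 \<theta>_pos[OF Suc.prems] by (simp add: l_def)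
 have "Re (of_real (real (Suc k) / (4 * real N)) / r (Suc k)) \<le> cmod (of_real (real (Suc k) / (4 * real N)) / r (Suc k))"
  by (rule complex_Re_le_cmod)
 also have "\<dots> = real (Suc k) / (4 * real N) / cmod (r (Suc k))"
  by (simp add: norm_divide norm_mult del: of_nat_Suc)
 also have "\<dots> \<le> real (Suc k) / (4 * real N) / l"
  using rk l complex_Re_le_cmod[of "r (Suc k)"] by (intro divide_left_mono mult_pos_pos) (auto simp: l_def simp del: r.simps)
 also have "\<dots> = x * (1 - \<theta> (Suc k)) / 2"
 proof -
  have "real (Suc k) / (4 * real N) = x^2 * (1 - (\<theta> (Suc k))\<^sup>2) / 4" by (rule kN4[OF Suc.prems])
  also have "\<dots> = x * (1 - \<theta> (Suc k)) / 2 * l" by (simp add: l_def power2_eq_square algebra_simps)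
  finally show ?thesis using l by (metis nonzero_mult_div_cancel_right less_irrefl)
 qed
 finally have "x - x * (1 - \<theta> (Suc k)) / 2 \<le> Re (r (Suc (Suc k)))" by (simp add: x_def)
 moreover have "x - x * (1 - \<theta> (Suc k)) / 2 = l" by (simp add: l_def field_simps)
 ultimately show ?case using rk by (simp only: l_def)
qed

lemma r_ge: assumes "k \<le> n" shows "x * (1 + \<theta> k) / 2 \<le> cmod (r (Suc k))" "x * (1 + \<theta> k) / 2 \<le> cmod (r k)"
  "x / 2 \<le> cmod (r (Suc k))" "x / 2 \<le> cmod (r k)" "r k \<noteq> 0" "r (Suc k) \<noteq> 0"
proof -
 show 1: "x * (1 + \<theta> k) / 2 \<le> cmod (r (Suc k))" "x * (1 + \<theta> k) / 2 \<le> cmod (r k)"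
  using r_Suc_ge[OF assms] complex_Re_le_cmod[of "r (Suc k)"] complex_Re_le_cmod[of "r k"] by linarith+
 have "x / 2 \<le> x * (1 + \<theta> k) / 2" using x0 \<theta>_pos[OF assms] by simp
 thus 2: "x / 2 \<le> cmod (r (Suc k))" "x / 2 \<le> cmod (r k)" using 1 by linarith+
 show "r k \<noteq> 0" "r (Suc k) \<noteq> 0" using 2 x0 by auto
qed

lemma cmod_z: "cmod z \<le> (5/2) * x"
proof -
 have "(cmod z)^2 \<le> (5/2 * x)^2"
 proof -
  have "(Im z)^2 \<le> 4 * (Re z)^2" using power_mono[OF y2 y0, of 2] by (simp add: power_mult_distrib)
  hence "(Re z)^2 + (Im z)^2 \<le> 25 / 4 * (Re z)^2" using zero_le_power2[of "Re z"] by linarith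
  also have "\<dots> = (5/2 * x)^2" by (simp add: x_def power_mult_distrib power_divide)
  finally show ?thesis by (simp only: cmod_power2)
 qed
 thus ?thesis using x0 by (simp add: power2_le_iff_abs_le)
qed

lemma r_le: assumes "k \<le> Suc n" shows "cmod (r k) \<le> 3 * x"
proof (cases k)
 case 0 thus ?thesis using cmod_z x0 by simp
next
 case (Suc j)
 hence j: "j \<le> n" using assms by simp
 have "cmod (r k) \<le> cmod z + real j / (4 * real N) / cmod (r j)"
  using norm_triangle_ineq4[of z "of_real (real j / (4 * real N)) / r j"] by (simp add: Suc norm_divide norm_mult)
 also have "real j / (4 * real N) / cmod (r j) \<le> real j / (4 * real N) / (x / 2)"
  using r_ge(4,5)[OF j] x0 by (intro divide_left_mono mult_pos_pos) auto
 also have "\<dots> = x * (1 - (\<theta> j)\<^sup>2) / 2" unfolding kN4[OF j] using x0 by (simp add: field_simps power2_eq_square)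
 also have "\<dots> \<le> x / 2" using x0 by simp
 finally show ?thesis using cmod_z by simp
qed

lemma lam_le: assumes "k \<le> n" shows "cmod (lam k) \<le> 3 * x"
proof -
 have "cmod (lam k) \<le> cmod z + real k / (4 * real N) / cmod (lam k)"
  using norm_triangle_ineq4[of z "of_real (real k / (4 * real N)) / lam k"]
  by (subst lam_fixed[OF assms]) (simp add: norm_divide norm_mult)
 also have "real k / (4 * real N) / cmod (lam k) \<le> real k / (4 * real N) / (x / 2)"
  using lam_props(2)[OF assms] x0 \<theta>_pos[OF assms] lam_nz[OF assms]
  by (intro divide_left_mono mult_pos_pos) (auto simp: algebra_simps intro: order_trans[rotated])
 also have "\<dots> = x * (1 - (\<theta> k)\<^sup>2) / 2" unfolding kN4[OF assms] using x0 by (simp add: field_simps power2_eq_square)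
 also have "\<dots> \<le> x / 2" using x0 by simp
 finally show ?thesis using cmod_z by simp
qed

text \<open>The numerator is \<open>x^2 (1 - \<theta>^2) / 4\<close>, hence the quotient is at most
  \<open>(1 - \<theta>) / (1 + \<theta>)\<close>. This one estimate gives the contraction of
  \<open>v\<close> as well as that of the ratio recursion around its fixed point.\<close>

lemma quarter: assumes "k \<le> n" "x * (1 + \<theta> k) / 2 \<le> A" "x * (1 + \<theta> k) / 2 \<le> B"
 shows "real k / (4 * real N) / (A * B) \<le> 1 - \<theta> k"
proof -
 define l where "l = x * (1 + \<theta> k) / 2"
 have l: "0 < l" using x0 \<theta>_pos[OF assms(1)] by (simp add: l_def)
 have "real k / (4 * real N) / (A * B) \<le> real k / (4 * real N) / (l * l)"
  using assms l by (intro divide_left_mono mult_mono mult_pos_pos) (auto simp: l_def)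
 also have "\<dots> \<le> 1 - \<theta> k"
 proof -
  have "real k / (4 * real N) = x^2 * (1 - (\<theta> k)\<^sup>2) / 4" by (rule kN4[OF assms(1)])
  also have "\<dots> = (1 - \<theta> k) * (1 + \<theta> k) * (x^2 / 4)" by (simp add: power2_eq_square field_simps)
  also have "\<dots> \<le> (1 - \<theta> k) * (1 + \<theta> k)^2 * (x^2 / 4)"
   using \<theta>_le1[of k] \<theta>_pos[OF assms(1)] by (intro mult_right_mono mult_left_mono) (auto simp: power2_eq_square)
  also have "\<dots> = (1 - \<theta> k) * (l * l)" by (simp add: l_def power2_eq_square algebra_simps)
  finally show ?thesis using l by (simp only: pos_divide_le_eq mult_pos_pos)
 qed
 finally show ?thesis .
qed

lemma \<rho>_le: assumes "k \<le> n" shows "cmod (\<rho> k) \<le> 1 - \<theta> k"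
 using quarter[OF assms r_ge(2)[OF assms] r_ge(1)[OF assms]] by (simp add: \<rho>_def norm_divide norm_mult del: r.simps)

text \<open>\<open>r\<close> chases the moving fixed point \<open>lam\<close>. One step contracts
  the error by \<open>1 - \<theta> k\<close>, and the displacement of \<open>lam\<close> is at most
  \<open>\<theta> k\<close> times the claimed bound, so the two add up to the bound itself;
  \<open>\<sigma>\<close> increases in \<open>k\<close>.\<close>

lemma r_lam: "k \<le> n \<Longrightarrow> cmod (r k - lam k) \<le> x * (\<sigma> k)^2 / 2"
proof (induction k)
 case 0
 have "S 0 = z" by (simp add: S_def sqrt_branch_def)
 thus ?case using x0 by (simp add: lam_eq)
next
 case (Suc k)
 hence k: "k \<le> n" by simp
 define c where "c = complex_of_real (real k / (4 * real N))"
 have "r (Suc k) - lam k = c / lam k - c / r k"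
  by (subst lam_fixed[OF k]) (simp add: c_def)
 also have "\<dots> = c / (r k * lam k) * (r k - lam k)"
  using lam_nz[OF k] r_ge(5)[OF k] by (simp add: field_simps)
 finally have "cmod (r (Suc k) - lam k) = real k / (4 * real N) / (cmod (r k) * cmod (lam k)) * cmod (r k - lam k)"
  by (simp add: norm_mult norm_divide c_def)
 also have "\<dots> \<le> (1 - \<theta> k) * (x * (\<sigma> k)^2 / 2)"
  using quarter[OF k r_ge(2)[OF k] lam_props(2)[OF k]] Suc.IH[OF k] \<theta>_le1[of k] by (intro mult_mono) auto
 finally have 1: "cmod (r (Suc k) - lam k) \<le> (1 - \<theta> k) * (x * (\<sigma> k)^2 / 2)" .
 have "cmod (lam k - lam (Suc k)) = cmod (S k - S (Suc k)) / 2"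
  by (simp add: lam_eq diff_divide_distrib[symmetric] norm_divide)
 also have "\<dots> \<le> 1 / (real N * (x * \<theta> k)) / 2" using S_diff[of k "Suc k"] Suc.prems by simp
 also have "\<dots> = \<theta> k * (x * (\<sigma> k)^2 / 2)"
  using Nx_\<sigma>\<theta>[OF k] x0 Npos \<theta>_pos[OF k] by (simp add: field_simps power2_eq_square)
 finally have 2: "cmod (lam k - lam (Suc k)) \<le> \<theta> k * (x * (\<sigma> k)^2 / 2)" .
 have "cmod (r (Suc k) - lam (Suc k)) \<le> x * (\<sigma> k)^2 / 2"
  using norm_triangle_ineq[of "r (Suc k) - lam k" "lam k - lam (Suc k)"] 1 2 by (simp add: algebra_simps)
 also have "\<dots> \<le> x * (\<sigma> (Suc k))^2 / 2"
  using x0 \<Delta>_pos[OF Suc.prems] by (simp add: \<sigma>_sq[OF k] \<sigma>_sq[OF Suc.prems] del: r.simps) (simp add: \<Delta>_def frac_le)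
 finally show ?case .
qed

lemma \<kappa>_Suc: "k \<le> n \<Longrightarrow> cmod (1 + \<kappa> (Suc k)) \<le> 3 / \<theta> k"
proof -
 assume k: "k \<le> n"
 have "cmod (1 + \<kappa> (Suc k)) = cmod (r (Suc k)) / cmod (S k)" by (simp add: \<kappa>_def norm_divide del: r.simps)
 also have "\<dots> \<le> 3 * x / (x * \<theta> k)" using r_le[of "Suc k"] S_props(3)[OF k] k x0 \<theta>_pos[OF k] by (intro frac_le) auto
 finally show ?thesis using x0 by simp
qed

lemma \<kappa>_0: "\<kappa> 0 = 0" using xpos by (auto simp: \<kappa>_def S_def sqrt_branch_def)

lemma \<kappa>_le: assumes k: "k \<le> n" shows "cmod (\<kappa> k) \<le> 4 / \<theta> k"
proof (cases k)
 case 0 thus ?thesis using \<theta>_pos[OF k] by (simp add: \<kappa>_0)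
next
 case (Suc j)
 have "cmod (\<kappa> k) \<le> cmod (1 + \<kappa> k) + 1" using norm_triangle_ineq4[of "1 + \<kappa> k" 1] by simp
 also have "\<dots> \<le> 3 / \<theta> j + 1" using \<kappa>_Suc[of j] Suc k by simp
 also have "3 / \<theta> j \<le> 3 / \<theta> k" using \<theta>_antimono[of j k] \<theta>_pos[OF k] Suc k by (intro divide_left_mono) auto
 also have "1 \<le> 1 / \<theta> k" using \<theta>_le1[of k] \<theta>_pos[OF k] by simp
 finally show ?thesis by (simp add: add_divide_distrib[symmetric])
qed

text \<open>\<open>err k\<close> is the sum of two small quantities: the defect
  \<open>c / r - r + S\<close>, which vanishes at \<open>r = lam\<close> and is controlled by
  \<open>r_lam\<close>, and the change of \<open>1 / S\<close> from \<open>k - 1\<close> to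
  \<open>k\<close>. They contribute 1 and 3 to the constant 4.\<close>

lemma err_le: assumes k: "k \<le> n" shows "cmod (err k) \<le> 4 * (\<sigma> k)^2 / \<theta> k"
proof -
 define c where "c = complex_of_real (real k / (4 * real N))"
 have fac: "c / r k - r k + S k = - (r k - lam k) * (1 + c / (r k * lam k))"
 proof -
  have "S k = 2 * lam k - z" by (simp add: lam_eq field_simps)
  also have "\<dots> = lam k - c / lam k" using lam_fixed[OF k] unfolding c_def by (metis diff_diff_eq2 add_diff_cancel_left' diff_add_cancel mult_2 add_diff_eq diff_add_eq)
  finally have S: "S k = lam k - c / lam k" .
  show ?thesis unfolding S using lam_nz[OF k] r_ge(5)[OF k] by (simp add: field_simps)
 qed
 have "err k = (c / r k - r k + S k) / S k + r k * (1 / S k - 1 / S (k - 1))"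
  using S_nz[OF k] r_ge(5,6)[OF k]
  by (simp add: err_def \<kappa>_def \<rho>_def c_def del: r.simps) (simp add: field_simps del: r.simps)
 hence "cmod (err k) \<le> cmod ((c / r k - r k + S k) / S k) + cmod (r k * (1 / S k - 1 / S (k - 1)))"
  by (simp add: norm_triangle_ineq)
 also have "cmod ((c / r k - r k + S k) / S k) \<le> (x * (\<sigma> k)^2 / 2 * 2) / (x * \<theta> k)"
  unfolding fac norm_divide norm_mult
 proof (intro frac_le mult_mono)
  have "cmod (1 + c / (r k * lam k)) \<le> 1 + cmod (c / (r k * lam k))" using norm_triangle_ineq[of 1 "c / (r k * lam k)"] by simp
  also have "cmod (c / (r k * lam k)) \<le> 1"
   using quarter[OF k r_ge(2)[OF k] lam_props(2)[OF k]] \<theta>_pos[OF k] by (simp add: c_def norm_divide norm_mult)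
  finally show "cmod (1 + c / (r k * lam k)) \<le> 2" by simp
 qed (use r_lam[OF k] S_props(3)[OF k] x0 \<theta>_pos[OF k] in \<open>auto simp: norm_minus_commute\<close>)
 also have "\<dots> = (\<sigma> k)^2 / \<theta> k" using x0 by simp
 also have "cmod (r k * (1 / S k - 1 / S (k - 1))) \<le> 3 * (\<sigma> k)^2 / \<theta> k"
 proof (cases k)
  \<comment> \<open>Truncated subtraction gives \<open>S (0 - 1) = S 0\<close>, so the difference is
    zero here.\<close>
  case 0 thus ?thesis using \<theta>_pos[OF k] by simp
 next
  case (Suc j)
  hence j: "j \<le> n" "j < k" using k by auto
  have "r k * (1 / S k - 1 / S j) = r k * (S j - S k) / (S k * S j)"
   using S_nz[OF k] S_nz[OF j(1)] by (simp add: field_simps)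
  hence "cmod (r k * (1 / S k - 1 / S j)) = cmod (r k) * cmod (S j - S k) / (cmod (S k) * cmod (S j))"
   by (simp add: norm_mult norm_divide)
  also have "\<dots> \<le> 3 * x * (1 / (real N * (x * \<theta> k))) / ((x * \<theta> k) * (x * \<theta> k))"
  proof (intro frac_le mult_mono)
   have "cmod (S j - S k) \<le> 1 / (real N * (x * \<theta> j))" using S_diff[OF j(2) k] Suc by simp
   also have "\<dots> \<le> 1 / (real N * (x * \<theta> k))"
    using \<theta>_antimono[of j k] j k \<theta>_pos[OF k] x0 Npos by (intro divide_left_mono mult_left_mono mult_pos_pos) auto
   finally show "cmod (S j - S k) \<le> 1 / (real N * (x * \<theta> k))" .
   have "x * \<theta> k \<le> x * \<theta> j" using \<theta>_antimono[of j k] j k x0 by simp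
   thus "x * \<theta> k \<le> cmod (S j)" using S_props(3)[OF j(1)] by linarith
  qed (use r_le[of k] k S_props(3)[OF k] x0 \<theta>_pos[OF k] in auto)
  also have "\<dots> = 3 * (\<sigma> k)^2 / \<theta> k"
   using Nx_\<sigma>\<theta>[OF k] x0 Npos \<theta>_pos[OF k] by (simp add: field_simps power2_eq_square)
  finally show ?thesis by (simp add: Suc)
 qed
 finally show ?thesis by (simp add: add_divide_distrib[symmetric])
qed
end

section \<open>The three-term recursions\<close>

definition tridiag :: "(nat \<Rightarrow> 'a :: comm_ring_1) \<Rightarrow> (nat \<Rightarrow> 'a) \<Rightarrow> nat \<Rightarrow> 'a mat" where
 "tridiag d e n = Matrix.mat n n (\<lambda>(i, j). if i = j then d i else if j = Suc i then e i else if i = Suc j then e j else 0)"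

lemma det_tridiag_Suc_Suc:
 "det (tridiag d e (Suc (Suc n))) = d (Suc n) * det (tridiag d e (Suc n)) - (e n)\<^sup>2 * det (tridiag d e n)"
proof -
 let ?A = "tridiag d e (Suc (Suc n))"
 have A: "?A \<in> carrier_mat (Suc (Suc n)) (Suc (Suc n))" by (simp add: tridiag_def)
 have "det ?A = (\<Sum>i<Suc (Suc n). ?A $$ (i, Suc n) * cofactor ?A i (Suc n))"
  by (rule laplace_expansion_column[OF A]) simp
 also have "\<dots> = (\<Sum>i\<in>{n, Suc n}. ?A $$ (i, Suc n) * cofactor ?A i (Suc n))"
  by (rule sum.mono_neutral_right) (auto simp: tridiag_def)
 also have "\<dots> = e n * cofactor ?A n (Suc n) + d (Suc n) * cofactor ?A (Suc n) (Suc n)"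
  by (simp add: tridiag_def)
 also have "cofactor ?A (Suc n) (Suc n) = det (tridiag d e (Suc n))"
 proof -
  have "mat_delete ?A (Suc n) (Suc n) = tridiag d e (Suc n)"
   by (rule eq_matI) (auto simp: mat_delete_def tridiag_def)
  thus ?thesis by (simp add: cofactor_def)
 qed
 also have "cofactor ?A n (Suc n) = - (e n * det (tridiag d e n))"
 proof -
  let ?B = "mat_delete ?A n (Suc n)"
  have B: "?B \<in> carrier_mat (Suc n) (Suc n)" using A by (auto simp: mat_delete_def)
  have "det ?B = (\<Sum>j<Suc n. ?B $$ (n, j) * cofactor ?B n j)"
   by (rule laplace_expansion_row[OF B]) simp
  also have "\<dots> = (\<Sum>j\<in>{n}. ?B $$ (n, j) * cofactor ?B n j)"
   by (rule sum.mono_neutral_right) (auto simp: tridiag_def mat_delete_def)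
  also have "\<dots> = e n * cofactor ?B n n" by (simp add: tridiag_def mat_delete_def)
  also have "mat_delete ?B n n = tridiag d e n"
   by (rule eq_matI) (auto simp: mat_delete_def tridiag_def)
  hence "cofactor ?B n n = det (tridiag d e n)" by (simp add: cofactor_def)
  finally show ?thesis by (simp add: cofactor_def)
 qed
 finally show ?thesis by (simp add: power2_eq_square algebra_simps)
qed

lemma Phi_tridiag:
 "Phi \<beta> N a b n z \<omega> = det (tridiag
   (\<lambda>i. z - of_real ((4 * real N * \<beta>) powr (- 1 / 2) * b (Suc i) \<omega>))
   (\<lambda>i. - of_real ((4 * real N * \<beta>) powr (- 1 / 2) * a (Suc i) \<omega>)) n)"
 unfolding Phi_def by (rule arg_cong[where f = det], rule eq_matI) (auto simp: tridiag_def A_entry_def)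

lemma Phi_0: "Phi \<beta> N a b 0 z \<omega> = 1"
 by (simp add: Phi_tridiag tridiag_def)

lemma Phi_1: "Phi \<beta> N a b (Suc 0) z \<omega> = z - of_real ((4 * real N * \<beta>) powr (- 1 / 2) * b 1 \<omega>)"
 by (simp add: Phi_tridiag tridiag_def det_single)

lemma Phi_Suc_Suc:
 assumes "0 < \<beta>" "1 \<le> N"
 shows "Phi \<beta> N a b (Suc (Suc n)) z \<omega> =
  (z - of_real (b (n + 2) \<omega> / sqrt (4 * real N * \<beta>))) * Phi \<beta> N a b (Suc n) z \<omega>
  - of_real ((a (Suc n) \<omega>)^2 / (4 * real N * \<beta>)) * Phi \<beta> N a b n z \<omega>"
proof -
 have s: "(4 * real N * \<beta>) powr (- 1 / 2) = 1 / sqrt (4 * real N * \<beta>)"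
 proof -
  have "(4 * real N * \<beta>) powr (- 1 / 2) = (4 * real N * \<beta>) powr (- (1 / 2))" by simp
  also have "\<dots> = inverse ((4 * real N * \<beta>) powr (1 / 2))" by (rule powr_minus)
  also have "(4 * real N * \<beta>) powr (1 / 2) = sqrt (4 * real N * \<beta>)" using assms by (intro powr_half_sqrt) simp
  finally show ?thesis by (simp only: inverse_eq_divide)
 qed
 have "(- complex_of_real (1 / sqrt (4 * real N * \<beta>) * y))^2 = of_real (y^2 / (4 * real N * \<beta>))" for y
  using assms by (simp only: power2_minus of_real_power[symmetric] power_mult_distrib power_divide) simp
 thus ?thesis unfolding Phi_tridiag det_tridiag_Suc_Suc s by (simp only: numeral_2_eq_2 add_Suc_right add_0_right times_divide_eq_left mult_1)
qed

section \<open>Monic Hermite polynomials for the weight \<open>exp (- 2 N x^2)\<close>\<close>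

lemma poly_linear_ext:
 fixes f g :: "real poly \<Rightarrow> real"
 assumes "\<And>p q. f (p + q) = f p + f q" "\<And>p q. g (p + q) = g p + g q" "\<And>c k. f (Polynomial.monom c k) = g (Polynomial.monom c k)"
 shows "f p = g p"
proof -
 have f0: "f 0 = 0" "g 0 = 0" using assms(1)[of 0 0] assms(2)[of 0 0] by auto
 have "f (\<Sum>i\<le>m. Polynomial.monom (Polynomial.coeff p i) i) = g (\<Sum>i\<le>m. Polynomial.monom (Polynomial.coeff p i) i)" for m
  by (induction m) (auto simp: assms)
 thus ?thesis using poly_as_sum_of_monoms[of p] by metis
qed

text \<open>The monic Hermite polynomials for a Gaussian of variance \<open>1 / (4 N)\<close>. They
  are introduced through the recurrence that the sequel needs, and orthogonality is derived from
  it.\<close>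

fun herm :: "nat \<Rightarrow> nat \<Rightarrow> real poly" where
 "herm N 0 = 1"
| "herm N (Suc 0) = [:0, 1:]"
| "herm N (Suc (Suc n)) = pCons 0 (herm N (Suc n)) - Polynomial.smult (real (Suc n) / (4 * real N)) (herm N n)"

lemma herm_degree: "Polynomial.degree (herm N n) = n \<and> lead_coeff (herm N n) = 1"
proof (induction N n rule: herm.induct)
 case (3 N n)
 have d: "Polynomial.degree (pCons 0 (herm N (Suc n))) = Suc (Suc n)" using 3 by (auto simp: degree_pCons_eq)
 let ?B = "Polynomial.smult (real (Suc n) / (4 * real N)) (herm N n)"
 have B: "Polynomial.degree ?B < Suc (Suc n)"
  using 3 by (auto intro: le_less_trans[OF degree_smult_le])
 have "Polynomial.degree (herm N (Suc (Suc n))) = Suc (Suc n)"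
  unfolding herm.simps(3) diff_conv_add_uminus using degree_add_eq_left[of "- ?B" "pCons 0 (herm N (Suc n))"] B d
  by (simp only: degree_minus)
 moreover have "Polynomial.coeff ?B (Suc (Suc n)) = 0" by (rule coeff_eq_0[OF B])
 moreover have "Polynomial.coeff (herm N (Suc n)) (Suc n) = 1" using 3 by auto
 ultimately show ?case by (simp only: herm.simps(3) coeff_diff coeff_pCons_Suc) simp
qed auto

lemma pderiv_herm: "pderiv (herm N (Suc n)) = Polynomial.smult (real (Suc n)) (herm N n)"
proof (induction N n rule: herm.induct)
 case (1 N) show ?case by (simp add: pderiv_pCons one_pCons)
next
 case (2 N) show ?case by (simp add: pderiv_pCons pderiv_smult pderiv_diff numeral_2_eq_2 one_pCons)
next
 case (3 N n)
 have "pderiv (herm N (Suc (Suc (Suc n)))) = herm N (Suc (Suc n)) + pCons 0 (pderiv (herm N (Suc (Suc n))))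
   - Polynomial.smult (real (Suc (Suc n)) / (4 * real N)) (pderiv (herm N (Suc n)))"
  by (subst herm.simps(3)) (simp only: pderiv_diff pderiv_pCons pderiv_smult)
 also have "\<dots> = herm N (Suc (Suc n)) + Polynomial.smult (real (Suc (Suc n))) (pCons 0 (herm N (Suc n)) - Polynomial.smult (real (Suc n) / (4 * real N)) (herm N n))"
  unfolding 3 by (simp add: smult_diff_right)
 also have "\<dots> = Polynomial.smult (real (Suc (Suc (Suc n)))) (herm N (Suc (Suc n)))"
  unfolding herm.simps(3)[symmetric] of_nat_Suc[of "Suc (Suc n)"] smult_add_left by (simp del: herm.simps of_nat_Suc)
 finally show ?case .
qed

text \<open>The creation operator. In the Gaussian inner product it is, up to the factor
  \<open>1 / (4 N)\<close>, the adjoint of the derivative.\<close>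

lemma herm_Suc: "herm N (Suc n) = pCons 0 (herm N n) - Polynomial.smult (1 / (4 * real N)) (pderiv (herm N n))"
 by (cases n) (simp_all add: one_pCons pderiv_herm del: of_nat_Suc)

context
 fixes N :: nat assumes N: "1 \<le> N"
begin

definition wt :: "real \<Rightarrow> real" where "wt x = exp (- 2 * real N * x^2)"

definition \<Lambda> :: "real poly \<Rightarrow> real" where
 "\<Lambda> p = (LINT x|lborel. Polynomial.poly p x * wt x)"

lemma gauss_weight: "wt x = sqrt (2 * pi / (4 * real N)) * normal_density 0 (1 / sqrt (4 * real N)) x"
 using N by (simp add: wt_def normal_density_def power_divide real_sqrt_divide real_sqrt_mult field_simps)

lemma integrable_monom: "integrable lborel (\<lambda>x. x^k * wt x)"
proof -
 have "integrable lborel (\<lambda>x. sqrt (2 * pi / (4 * real N)) * (normal_density 0 (1 / sqrt (4 * real N)) x * (x - 0)^k))"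
  using N by (intro integrable_mult_right integrable_normal_moment) auto
 thus ?thesis unfolding gauss_weight by (simp add: mult_ac)
qed

lemma integrable_poly_weight: "integrable lborel (\<lambda>x. Polynomial.poly p x * wt x)"
 unfolding poly_altdef sum_distrib_right mult.assoc
 by (intro Bochner_Integration.integrable_sum integrable_mult_right integrable_monom)

lemma \<Lambda>_add: "\<Lambda> (p + q) = \<Lambda> p + \<Lambda> q"
 unfolding \<Lambda>_def by (simp add: distrib_right integrable_poly_weight)

lemma \<Lambda>_smult: "\<Lambda> (Polynomial.smult c p) = c * \<Lambda> p"
 unfolding \<Lambda>_def by (simp add: mult.assoc)

lemma \<Lambda>_diff: "\<Lambda> (p - q) = \<Lambda> p - \<Lambda> q"
 unfolding \<Lambda>_def by (simp add: left_diff_distrib integrable_poly_weight)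

text \<open>Gaussian integration by parts. Both sides are additive in \<open>p\<close>, so it
  suffices to compare the explicit normal moments on monomials; no boundary terms have to be
  estimated.\<close>

lemma \<Lambda>_parts: "\<Lambda> (pCons 0 p) = \<Lambda> (pderiv p) / (4 * real N)"
proof (rule poly_linear_ext[where f = "\<lambda>p. \<Lambda> (pCons 0 p)" and g = "\<lambda>p. \<Lambda> (pderiv p) / (4 * real N)"])
 show "\<Lambda> (pCons 0 (p + q)) = \<Lambda> (pCons 0 p) + \<Lambda> (pCons 0 q)" for p q
  by (subst \<Lambda>_add[symmetric]) simp
 show "\<Lambda> (pderiv (p + q)) / (4 * real N) = \<Lambda> (pderiv p) / (4 * real N) + \<Lambda> (pderiv q) / (4 * real N)" for p q
  by (simp add: pderiv_add \<Lambda>_add add_divide_distrib)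
next
 fix c :: real and k
 define s where "s = 1 / sqrt (4 * real N)"
 have s: "s > 0" "s^2 = 1 / (4 * real N)" using N by (auto simp: s_def power_divide)
 define K where "K = sqrt (2 * pi / (4 * real N))"
 have mom: "\<Lambda> (Polynomial.monom c j) = c * K * (LINT x|lborel. normal_density 0 s x * (x - 0)^j)" for c j
  unfolding \<Lambda>_def gauss_weight s_def[symmetric] K_def[symmetric] poly_monom
  by (simp add: mult_ac)
 have L: "pCons 0 (Polynomial.monom c k) = Polynomial.monom c (Suc k)" by (simp add: monom_Suc)
 show "\<Lambda> (pCons 0 (Polynomial.monom c k)) = \<Lambda> (pderiv (Polynomial.monom c k)) / (4 * real N)"
 proof (cases "even k")
  case True
  hence "\<Lambda> (pCons 0 (Polynomial.monom c k)) = 0" unfolding L mom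
   using integral_normal_moment_odd[OF s(1), of 0 "k div 2"] by (auto elim!: evenE)
  moreover have "\<Lambda> (pderiv (Polynomial.monom c k)) = 0"
  proof (cases "k = 0")
   case True thus ?thesis by (simp add: \<Lambda>_def pderiv_monom)
  next
   case False
   with True obtain j where "k = 2 * Suc j" by (metis evenE not0_implies_Suc mult_0_right)
   thus ?thesis unfolding pderiv_monom mom using integral_normal_moment_odd[OF s(1), of 0 j] by simp
  qed
  ultimately show ?thesis by simp
 next
  case False
  then obtain j where k: "k = 2 * j + 1" by (auto elim: oddE)
  have E: "(LINT x|lborel. normal_density 0 s x * (x - 0)^(2 * i)) = fact (2 * i) / ((2 / s^2)^i * fact i)" for i
   using integral_normal_moment_even[OF s(1), of 0 i] by simp
  have "fact (2 * Suc j) / ((2 / s^2)^Suc j * fact (Suc j)) = real (2 * j + 1) * s^2 * (fact (2 * j) / ((2 / s^2)^j * fact j))"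
   using s(1) by (simp add: divide_simps)
  hence "(LINT x|lborel. normal_density 0 s x * (x - 0)^(2 * Suc j)) = real (2 * j + 1) * s^2 * (LINT x|lborel. normal_density 0 s x * (x - 0)^(2 * j))"
   unfolding E .
  moreover have "Suc (2 * j + 1) = 2 * Suc j" "2 * j + 1 - 1 = 2 * j" by auto
  ultimately show ?thesis unfolding L unfolding k pderiv_monom mom by (simp only: s(2)) simp
 qed
qed

text \<open>The Rodrigues formula in integrated form. Orthogonality to lower degrees follows because
  the \<open>n\<close>-th derivative annihilates them.\<close>

lemma \<Lambda>_herm: "\<Lambda> (herm N n * p) = (1 / (4 * real N))^n * \<Lambda> ((pderiv ^^ n) p)"
proof (induction n arbitrary: p)
 case (Suc n)
 have "herm N (Suc n) * p = pCons 0 (herm N n * p) - Polynomial.smult (1 / (4 * real N)) (pderiv (herm N n) * p)"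
  by (simp add: herm_Suc left_diff_distrib)
 hence "\<Lambda> (herm N (Suc n) * p) = \<Lambda> (pderiv (herm N n * p)) / (4 * real N) - \<Lambda> (pderiv (herm N n) * p) / (4 * real N)"
  by (simp add: \<Lambda>_diff \<Lambda>_smult \<Lambda>_parts)
 also have "\<dots> = \<Lambda> (herm N n * pderiv p) / (4 * real N)"
  by (simp add: pderiv_mult \<Lambda>_add mult.commute add_divide_distrib)
 also have "\<dots> = (1 / (4 * real N))^Suc n * \<Lambda> ((pderiv ^^ Suc n) p)"
  by (subst Suc.IH) (simp add: funpow_Suc_right del: funpow.simps)
 finally show ?case .
qed simp

lemma pderiv_funpow_0: "Polynomial.degree p < n \<Longrightarrow> (pderiv ^^ n) p = (0 :: real poly)"
proof (induction n arbitrary: p)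
 case (Suc n)
 show ?case
 proof (cases "Polynomial.degree p = 0")
  case True
  hence "pderiv p = 0" by (simp add: pderiv_eq_0_iff)
  moreover have "(pderiv ^^ n) (0 :: real poly) = 0" by (induction n) auto
  ultimately show ?thesis by (simp add: funpow_Suc_right del: funpow.simps)
 next
  case False
  hence "Polynomial.degree (pderiv p) < n" using Suc.prems by (simp add: degree_pderiv)
  thus ?thesis using Suc.IH by (simp add: funpow_Suc_right del: funpow.simps)
 qed
qed simp

lemma \<Lambda>_definite: assumes "\<Lambda> (p * p) = 0" shows "p = 0"
proof (rule ccontr)
 assume p: "p \<noteq> 0"
 have "AE x in lborel. Polynomial.poly (p * p) x * wt x = 0"
  using assms integrable_poly_weight[of "p * p"] unfolding \<Lambda>_def
  by (subst (asm) integral_nonneg_eq_0_iff_AE) (auto simp: wt_def)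
 hence ae: "AE x in lborel. Polynomial.poly p x = 0" by (simp add: wt_def)
 have "finite {x. Polynomial.poly p x = 0}" using p by (rule poly_roots_finite)
 hence "emeasure lborel {x. Polynomial.poly p x = 0} = 0" by (rule emeasure_lborel_countable[OF countable_finite])
 hence "AE x in lborel. Polynomial.poly p x \<noteq> 0"
  using \<open>finite {x. Polynomial.poly p x = 0}\<close>
  by (intro AE_I[where N = "{x. Polynomial.poly p x = 0}"]) (auto intro: finite_imp_closed borel_closed)
 with ae have "AE x in (lborel :: real measure). False" by eventually_elim simp
 thus False by (simp add: AE_iff_measurable[where N=UNIV])
qed

lemma orth_poly_eq: "orth_poly N n = herm N n"
 unfolding orth_poly_def
proof (rule the_equality)
 have orth: "(LINT x|lborel. Polynomial.poly (herm N n) x * Polynomial.poly q x * exp (- 2 * real N * x^2)) = 0" if "Polynomial.degree q < n" for q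
  using \<Lambda>_herm[of n q] pderiv_funpow_0[OF that] by (simp add: \<Lambda>_def wt_def)
 show "Polynomial.degree (herm N n) = n \<and> lead_coeff (herm N n) = 1 \<and> (\<forall>q. Polynomial.degree q < n \<longrightarrow>
      (LINT x|lborel. Polynomial.poly (herm N n) x * Polynomial.poly q x * exp (- 2 * real N * x^2)) = 0)"
  using herm_degree orth by blast
 fix p assume p: "Polynomial.degree p = n \<and> lead_coeff p = 1 \<and> (\<forall>q. Polynomial.degree q < n \<longrightarrow>
      (LINT x|lborel. Polynomial.poly p x * Polynomial.poly q x * exp (- 2 * real N * x^2)) = 0)"
 show "p = herm N n"
 proof (cases "n = 0")
  case True
  thus ?thesis using p by (auto elim!: degree_eq_zeroE simp: one_pCons)
 next
  case False
  \<comment> \<open>Two monic candidates differ by a polynomial of lower degree, which is orthogonal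
    to both of them, hence to itself.\<close>
  define d where "d = p - herm N n"
  have "Polynomial.degree d < n"
  proof -
   have "Polynomial.degree d \<le> n" unfolding d_def using p herm_degree[of N n] by (intro degree_diff_le) auto
   moreover have "Polynomial.coeff d n = 0" unfolding d_def using p herm_degree[of N n] by auto
   ultimately show ?thesis using False by (metis coeff_0_degree_minus_1 degree_0 eq_zero_or_degree_less le_neq_implies_less leading_coeff_0_iff neq0_conv)
  qed
  hence "\<Lambda> (p * d) = 0" "\<Lambda> (herm N n * d) = 0" using p orth by (auto simp: \<Lambda>_def wt_def)
  hence "\<Lambda> (d * d) = 0" by (simp add: d_def left_diff_distrib \<Lambda>_diff)
  hence "d = 0" by (rule \<Lambda>_definite)
  thus ?thesis by (simp add: d_def)
 qed
qed

lemma pi_poly_rec: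
 "pi_poly N 0 z = 1" "pi_poly N (Suc 0) z = z"
 "pi_poly N (Suc (Suc n)) z = z * pi_poly N (Suc n) z - of_real (real (Suc n) / (4 * real N)) * pi_poly N n z"
proof -
 define ev where "ev p = Polynomial.poly (map_poly complex_of_real p) z" for p
 have pc: "ev (pCons 0 p) = z * ev p" for p by (cases "p = 0") (auto simp: ev_def map_poly_pCons)
 have df: "ev (p - q) = ev p - ev q" for p q
  unfolding ev_def poly_diff[symmetric] by (rule arg_cong[where f = "\<lambda>p. Polynomial.poly p z"]) (rule poly_eqI, simp add: coeff_map_poly)
 have sm: "ev (Polynomial.smult c p) = of_real c * ev p" for c p
  unfolding ev_def poly_smult[symmetric] by (rule arg_cong[where f = "\<lambda>p. Polynomial.poly p z"]) (rule poly_eqI, simp add: coeff_map_poly)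
 have e: "pi_poly N n z = ev (herm N n)" for n by (simp add: pi_poly_def ev_def orth_poly_eq)
 show "pi_poly N 0 z = 1" "pi_poly N (Suc 0) z = z" by (auto simp: e ev_def map_poly_pCons)
 show "pi_poly N (Suc (Suc n)) z = z * pi_poly N (Suc n) z - of_real (real (Suc n) / (4 * real N)) * pi_poly N n z"
  unfolding e herm.simps df pc sm ..
qed
end

section \<open>One step of the perturbed recursion\<close>

lemma norm_exp_minus_Taylor: "cmod (exp w - (\<Sum>k\<le>n. w^k / fact k)) \<le> exp (cmod w) * cmod w^Suc n / fact n"
proof -
 have "cmod (exp w - (\<Sum>k\<le>n. w^k / fact k)) \<le> exp \<bar>Re w\<bar> * cmod w^Suc n / fact n"
  by (rule Taylor_exp)
 also have "\<dots> \<le> exp (cmod w) * cmod w^Suc n / fact n"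
  using abs_Re_le_cmod[of w] by (intro divide_right_mono mult_right_mono) auto
 finally show ?thesis .
qed

lemma norm_exp_minus_1: "cmod (exp w - 1) \<le> cmod w * exp (cmod w)"
 using norm_exp_minus_Taylor[of w 0] by (simp add: mult.commute)

lemma norm_exp_minus_2: "cmod (exp w - 1 - w) \<le> cmod w^2 * exp (cmod w)"
 using norm_exp_minus_Taylor[of w 1] by (simp add: mult.commute diff_diff_eq power2_eq_square)

lemma norm_exp_minus_3: "cmod (exp w - 1 - w - w\<^sup>2 / 2) \<le> cmod w^3 * exp (cmod w) / 2"
 using norm_exp_minus_Taylor[of w 2]
 by (simp add: mult.commute diff_diff_eq numeral_2_eq_2 numeral_3_eq_3 add.assoc mult_ac)

lemma cmod_add_sq: "(cmod (a + b))^2 = (cmod a)^2 + 2 * Re (cnj a * b) + (cmod b)^2"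
 unfolding cmod_power2 by (simp add: power2_eq_square algebra_simps)

lemma abs_Re_cnj_mult: "\<bar>Re (cnj a * b)\<bar> \<le> cmod a * cmod b"
 using abs_Re_le_cmod[of "cnj a * b"] by (simp add: norm_mult)

text \<open>The first-order terms of \<open>exp F\<close> and \<open>1 - F\<close> cancel. At second
  order \<open>d - F^2 / 2\<close> remains, which is centred once \<open>d\<close> is half of the
  mean of \<open>F^2\<close>. The noise size \<open>w\<close> may be arbitrarily large, hence the
  exponential factor in the bound and the two separate bounds on \<open>d\<close>.\<close>

lemma exp_times_one_minus:
 assumes F: "cmod F \<le> w" and Fh: "cmod (Fh - F) \<le> w^3" and d: "cmod d \<le> w" "cmod d \<le> w^2"
 shows "cmod (exp (F + d) * (1 - Fh) - 1 - (d - F\<^sup>2 / 2)) \<le> 4 * (w^3 * exp (4 * w))"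
proof -
 have w: "0 \<le> w" using F norm_ge_zero order_trans by blast
 have e1: "1 + w \<le> exp w" by (rule exp_ge_add_one_self)
 have eF: "exp (cmod F) \<le> exp w" "exp (cmod d) \<le> exp w" using F d by auto
 have e_mono: "w^3 * exp (a * w) \<le> w^3 * exp (4 * w)" if "a \<le> 4" for a
  using w that by (intro mult_left_mono) (auto intro: mult_right_mono)
 \<comment> \<open>\<open>exp (F + d) * (1 - F)\<close> is \<open>(1 + A) * (1 + B)\<close> with
   \<open>B\<close> defined below. The quantities \<open>R = A + F^2 / 2\<close>,
   \<open>B - d\<close> and \<open>A * B\<close> are all of third order, as is the contribution of
   \<open>Fh - F\<close>.\<close>
 define A where "A = (1 - F) * exp F - 1"
 define R where "R = A + F^2 / 2"
 define B where "B = exp d - 1"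
 have R_eq: "R = (1 - F) * (exp F - 1 - F - F\<^sup>2 / 2) - F^3 / 2"
  by (simp add: R_def A_def field_simps power2_eq_square power3_eq_cube)
 have F3: "cmod F^3 \<le> w^3" "cmod F^2 \<le> w^2" using F by (auto intro: power_mono)
 have "cmod R \<le> (1 + w) * (w^3 * exp w / 2) + w^3 / 2"
 proof -
  have "cmod R \<le> cmod (1 - F) * cmod (exp F - 1 - F - F\<^sup>2 / 2) + cmod (F^3 / 2)"
   unfolding R_eq norm_mult[symmetric] by (rule norm_triangle_ineq4)
  also have "\<dots> \<le> (1 + w) * (w^3 * exp w / 2) + w^3 / 2"
  proof (intro add_mono mult_mono)
   show "cmod (1 - F) \<le> 1 + w" using norm_triangle_ineq4[of 1 F] F by simp
   show "cmod (exp F - 1 - F - F\<^sup>2 / 2) \<le> w^3 * exp w / 2"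
    using norm_exp_minus_3[of F] mult_mono[OF F3(1) eF(1)] w by simp
   show "cmod (F^3 / 2) \<le> w^3 / 2" using F3 by (simp add: norm_divide norm_power)
  qed (use w in auto)
  finally show ?thesis .
 qed
 also have "\<dots> \<le> exp w * (w^3 * exp w / 2) + w^3 / 2" using e1 w by (intro add_mono mult_right_mono) auto
 also have "\<dots> \<le> w^3 * exp (2 * w)"
 proof -
  have "w^3 * 1 \<le> w^3 * (exp w * exp w)" using w by (intro mult_left_mono) (auto intro: mult_ge1_I)
  hence "w^3 \<le> w^3 * exp (2 * w)" by (simp add: mult_exp_exp)
  moreover have "exp w * (w^3 * exp w / 2) = w^3 * exp (2 * w) / 2" by (simp add: exp_double power2_eq_square)
  ultimately show ?thesis by linarith
 qed
 finally have R: "cmod R \<le> w^3 * exp (2 * w)" .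
 have Bd: "cmod (B - d) \<le> w^3 * exp w"
 proof -
  have "cmod (B - d) \<le> cmod d * cmod d * exp (cmod d)" using norm_exp_minus_2[of d] by (simp add: B_def power2_eq_square)
  also have "\<dots> \<le> w * w^2 * exp w" using d eF w by (intro mult_mono) auto
  finally show ?thesis by (simp add: power3_eq_cube power2_eq_square)
 qed
 have Bn: "cmod B \<le> w * exp w"
  unfolding B_def by (rule order_trans[OF norm_exp_minus_1]) (use d eF w in \<open>intro mult_mono; simp\<close>)
 have "cmod (A * B) \<le> (w^3 * exp (2 * w) + w^2 / 2) * (w * exp w)"
  unfolding norm_mult
 proof (intro mult_mono)
  have "cmod A \<le> cmod R + cmod (F^2 / 2)" using norm_triangle_ineq4[of R "F^2 / 2"] by (simp add: R_def)
  also have "\<dots> \<le> w^3 * exp (2 * w) + w^2 / 2" using R F3 by (intro add_mono) (auto simp: norm_divide norm_power)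
  finally show "cmod A \<le> w^3 * exp (2 * w) + w^2 / 2" .
 qed (use Bn w in auto)
 also have "\<dots> \<le> w^3 * exp (4 * w)"
 proof -
  have "(w^3 * exp (2 * w) + w^2 / 2) * (w * exp w) \<le> (w^3 * exp (2 * w) + w^2 * exp (2 * w)) * (w * exp w)"
  proof (intro mult_right_mono add_left_mono)
   have "w^2 * (1/2) \<le> w^2 * exp (2 * w)" using w one_le_exp_iff[of "2 * w"] by (intro mult_left_mono zero_le_power2) linarith
   thus "w^2 / 2 \<le> w^2 * exp (2 * w)" by simp
  qed (use w in auto)
  also have "\<dots> = w^3 * (exp (3 * w) * (1 + w))"
   by (simp add: algebra_simps power2_eq_square power3_eq_cube mult_exp_exp)
  also have "\<dots> \<le> w^3 * (exp (3 * w) * exp w)" using w e1 by (intro mult_left_mono) auto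
  finally show ?thesis by (simp add: mult_exp_exp)
 qed
 finally have AB: "cmod (A * B) \<le> w^3 * exp (4 * w)" .
 have "cmod (exp (F + d) * (Fh - F)) \<le> exp (2 * w) * w^3"
  unfolding norm_mult
 proof (intro mult_mono)
  show "cmod (exp (F + d)) \<le> exp (2 * w)"
   using norm_exp[of "F + d"] norm_triangle_ineq[of F d] F d by (auto intro: order_trans)
 qed (use Fh w in auto)
 moreover have "exp (F + d) * (1 - Fh) - 1 - (d - F\<^sup>2 / 2) = R + (B - d) + A * B - exp (F + d) * (Fh - F)"
  by (simp add: A_def R_def B_def exp_add field_simps)
 ultimately have "cmod (exp (F + d) * (1 - Fh) - 1 - (d - F\<^sup>2 / 2))
   \<le> w^3 * exp (2 * w) + w^3 * exp w + w^3 * exp (4 * w) + exp (2 * w) * w^3"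
  using norm_triangle_ineq4[of "R + (B - d) + A * B" "exp (F + d) * (Fh - F)"]
   norm_triangle_ineq[of "R + (B - d)" "A * B"] norm_triangle_ineq[of R "B - d"] R Bd AB
  by (elim ssubst) linarith
 also have "\<dots> \<le> 4 * (w^3 * exp (4 * w))"
  using e_mono[of 2] e_mono[of 1] by (simp add: mult.commute)
 finally show ?thesis .
qed

text \<open>\<open>D0\<close> gathers all terms that have mean zero when \<open>F\<close>,
  \<open>T\<close>, \<open>\<tau>\<close>, \<open>\<phi>\<close> are linear in centred noise and
  \<open>d\<close> is half of the mean of \<open>F^2\<close>. The rest is of second order and is
  bounded directly; \<open>D0\<close> itself needs a bound as well, because its square enters the
  second-order term of the \<open>m\<close>-th power.\<close>

lemma one_step_expansion:
 fixes F Fh d e T \<tau> \<phi> \<rho> Y p :: complex and w A :: real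
 assumes F: "cmod F \<le> w" and Fh: "cmod (Fh - F) \<le> w^3" and d: "cmod d \<le> w" "cmod d \<le> w^2"
  and e: "cmod e \<le> w^2" and lin: "cmod T \<le> w" "cmod \<tau> \<le> w" "cmod \<phi> \<le> w" and \<rho>: "cmod \<rho> \<le> 1" and A: "0 \<le> A"
 defines "s \<equiv> 1 + Y"
 defines "Y' \<equiv> exp (F + d) * (s * (1 - Fh) + (e + T) * p) - 1"
  and "P' \<equiv> exp (F + d) * ((\<rho> + \<tau>) * p - \<phi> * s)"
  and "D0 \<equiv> 2 * Re (cnj Y * (T * p + (d - F\<^sup>2 / 2) * s)) + A * (2 * Re (cnj (\<rho> * p) * ((\<tau> + \<rho> * F) * p - \<phi> * s)))"
 shows "\<bar>((cmod Y')^2 - (cmod Y)\<^sup>2) + A * ((cmod P')^2 - (cmod (\<rho> * p))\<^sup>2) - D0\<bar>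
   \<le> 320 * exp (10 * w) * (w^3 * cmod Y * cmod s + w^2 * cmod Y * cmod p + w^2 * (cmod p)^2 + w^4 * (cmod s)^2
     + A * (w^2 * (cmod p)^2 + w^2 * (cmod s)^2))"
  and "\<bar>D0\<bar> \<le> 4 * (w * cmod Y * cmod p + w^2 * cmod Y * cmod s + A * (w * (cmod p)^2 + w * cmod p * cmod s))"
proof -
 have w: "0 \<le> w" using F norm_ge_zero order_trans by blast
 define Eps where "Eps = exp (F + d)"
 define q2 where "q2 = d - F\<^sup>2 / 2"
 define y pp ss where "y = cmod Y" and "pp = cmod p" and "ss = cmod s"
 have nn: "0 \<le> y" "0 \<le> pp" "0 \<le> ss" by (auto simp: y_def pp_def ss_def)
 have Fd: "cmod (F + d) \<le> 2 * w" using norm_triangle_ineq[of F d] F d by simp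
 have Ex: "exp (cmod (F + d)) \<le> exp (2 * w)" using Fd by simp
 have Eps: "cmod Eps \<le> exp (2 * w)" unfolding Eps_def using norm_exp[of "F + d"] Ex by linarith
 have Eps1: "cmod (Eps - 1) \<le> 2 * w * exp (2 * w)"
  unfolding Eps_def by (rule order_trans[OF norm_exp_minus_1 mult_mono[OF Fd Ex]]) (use w in auto)
 have em: "1 \<le> exp (c * w)" if "0 \<le> c" for c using that w by simp
 have q2: "cmod q2 \<le> 2 * w^2"
 proof -
  have "cmod (F^2 / 2) \<le> w^2 / 2" using power_mono[OF F, of 2] by (simp add: norm_divide norm_power)
  thus ?thesis using norm_triangle_ineq4[of d "F^2 / 2"] d(2) zero_le_power2[of w] unfolding q2_def by linarith
 qed
 have Eps2: "cmod (Eps - 1 - F) \<le> 5 * w^2 * exp (2 * w)"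
 proof -
  have "cmod (Eps - 1 - F) \<le> cmod (Eps - 1 - (F + d)) + cmod d"
  proof -
   have "Eps - 1 - F = (Eps - 1 - (F + d)) + d" by simp
   thus ?thesis by (simp only: norm_triangle_ineq)
  qed
  also have "cmod (Eps - 1 - (F + d)) \<le> (2 * w)^2 * exp (2 * w)"
   unfolding Eps_def by (rule order_trans[OF norm_exp_minus_2 mult_mono[OF power_mono[OF Fd] Ex]]) (use w in auto)
  also have "cmod d \<le> w^2 * exp (2 * w)" using d(2) mult_left_mono[OF em[of 2], of "w^2"] by simp
  finally show ?thesis by (simp add: power_mult_distrib)
 qed
 define RY where "RY = (Eps * (1 - Fh) - 1 - q2) * s + (Eps * (e + T) - T) * p"
 have RY: "cmod RY \<le> 4 * (w^3 * exp (4 * w)) * ss + 3 * w^2 * exp (2 * w) * pp"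
 proof -
  have "cmod (Eps * (e + T) - T) \<le> cmod Eps * cmod e + cmod (Eps - 1) * cmod T"
  proof -
   have "Eps * (e + T) - T = Eps * e + (Eps - 1) * T" by (simp add: algebra_simps)
   thus ?thesis unfolding norm_mult[symmetric] by (simp only: norm_triangle_ineq)
  qed
  also have "\<dots> \<le> exp (2 * w) * w^2 + (2 * w * exp (2 * w)) * w"
   using Eps Eps1 e lin w by (intro add_mono mult_mono) auto
  finally have 1: "cmod (Eps * (e + T) - T) \<le> 3 * w^2 * exp (2 * w)" by (simp add: power2_eq_square algebra_simps)
  have "cmod RY \<le> cmod (Eps * (1 - Fh) - 1 - q2) * ss + cmod (Eps * (e + T) - T) * pp"
   unfolding RY_def ss_def pp_def norm_mult[symmetric] by (rule norm_triangle_ineq)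
  also have "\<dots> \<le> 4 * (w^3 * exp (4 * w)) * ss + 3 * w^2 * exp (2 * w) * pp"
   using exp_times_one_minus[OF F Fh d] 1 nn by (intro add_mono mult_right_mono) (auto simp: Eps_def q2_def)
  finally show ?thesis .
 qed
 have Y': "Y' = Y + ((T * p + q2 * s) + RY)"
  by (simp add: Y'_def RY_def Eps_def[symmetric] s_def algebra_simps)
 define Z where "Z = (T * p + q2 * s) + RY"
 have Z: "cmod Z \<le> 4 * exp (5 * w) * (w * pp + w^2 * ss)"
 proof -
  have "cmod Z \<le> w * pp + 2 * w^2 * ss + cmod RY"
   unfolding Z_def using norm_triangle_ineq[of "T * p + q2 * s" RY] norm_triangle_ineq[of "T * p" "q2 * s"]
    mult_right_mono[OF lin(1), of pp] mult_right_mono[OF q2, of ss] nn by (simp add: norm_mult pp_def ss_def)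
  also have "\<dots> \<le> (w * pp) * (1 + 3 * w * exp (2 * w)) + (w^2 * ss) * (2 + 4 * w * exp (4 * w))"
   using RY by (simp add: algebra_simps power2_eq_square power3_eq_cube)
  also have "\<dots> \<le> (w * pp) * (4 * exp (5 * w)) + (w^2 * ss) * (4 * exp (5 * w))"
  proof -
   have "1 + w \<le> exp w" by (rule exp_ge_add_one_self)
   hence *: "w * exp (4 * w) + exp (4 * w) \<le> exp w * exp (4 * w)"
    by (metis distrib_right mult_right_mono exp_ge_zero add.commute mult_1)
   have "w * exp (2 * w) \<le> w * exp (4 * w)" using w by (intro mult_left_mono) auto
   hence "1 + 3 * w * exp (2 * w) \<le> 4 * exp (5 * w)" "2 + 4 * w * exp (4 * w) \<le> 4 * exp (5 * w)"
   proof -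
    have e4: "1 \<le> exp (4 * w)" by (rule em) simp
    have "w * exp (4 * w) + exp (4 * w) \<le> exp (5 * w)" using * by (simp add: mult_exp_exp)
    thus "1 + 3 * w * exp (2 * w) \<le> 4 * exp (5 * w)" "2 + 4 * w * exp (4 * w) \<le> 4 * exp (5 * w)"
     using e4 w \<open>w * exp (2 * w) \<le> w * exp (4 * w)\<close> exp_ge_zero[of "5 * w"] by linarith+
   qed
   thus ?thesis using w nn by (intro add_mono mult_left_mono) auto
  qed
  finally show ?thesis by (simp add: algebra_simps)
 qed
 have Z2: "(cmod Z)^2 \<le> 32 * exp (10 * w) * (w^2 * pp^2 + w^4 * ss^2)"
 proof -
  have "(cmod Z)^2 \<le> (4 * exp (5 * w) * (w * pp + w^2 * ss))^2" using Z by (intro power_mono) auto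
  also have "\<dots> = 16 * exp (10 * w) * (w * pp + w^2 * ss)^2" by (simp add: power_mult_distrib exp_double[symmetric])
  also have "(w * pp + w^2 * ss)^2 \<le> 2 * ((w * pp)^2 + (w^2 * ss)^2)"
   using sum_squares_bound[of "w * pp" "w^2 * ss"] by (simp add: power2_sum)
  also have "2 * ((w * pp)^2 + (w^2 * ss)^2) = 2 * (w^2 * pp^2 + w^4 * ss^2)"
   by (simp add: power_mult_distrib flip: power_mult)
  finally show ?thesis by (simp only: mult.assoc mult.left_commute) simp
 qed
 define RP where "RP = (Eps * (\<rho> + \<tau>) - \<rho> - (\<tau> + \<rho> * F)) * p - (Eps - 1) * \<phi> * s"
 have RP: "cmod RP \<le> 7 * w^2 * exp (2 * w) * (pp + ss)"
 proof -
  have "Eps * (\<rho> + \<tau>) - \<rho> - (\<tau> + \<rho> * F) = \<rho> * (Eps - 1 - F) + (Eps - 1) * \<tau>" by (simp add: algebra_simps)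
  hence "cmod (Eps * (\<rho> + \<tau>) - \<rho> - (\<tau> + \<rho> * F)) \<le> cmod \<rho> * cmod (Eps - 1 - F) + cmod (Eps - 1) * cmod \<tau>"
   by (metis norm_mult norm_triangle_ineq)
  also have "\<dots> \<le> 1 * (5 * w^2 * exp (2 * w)) + (2 * w * exp (2 * w)) * w"
   using Eps2 Eps1 lin \<rho> w by (intro add_mono mult_mono) auto
  finally have 1: "cmod (Eps * (\<rho> + \<tau>) - \<rho> - (\<tau> + \<rho> * F)) \<le> 7 * w^2 * exp (2 * w)" by (simp add: power2_eq_square algebra_simps)
  have "cmod ((Eps - 1) * \<phi>) \<le> (2 * w * exp (2 * w)) * w" unfolding norm_mult using Eps1 lin w by (intro mult_mono) auto
  also have "\<dots> = 2 * (w^2 * exp (2 * w))" by (simp add: power2_eq_square algebra_simps)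
  also have "\<dots> \<le> 7 * w^2 * exp (2 * w)" using w by simp
  finally have 2: "cmod ((Eps - 1) * \<phi>) \<le> 7 * w^2 * exp (2 * w)" .
  have "cmod RP \<le> cmod (Eps * (\<rho> + \<tau>) - \<rho> - (\<tau> + \<rho> * F)) * pp + cmod ((Eps - 1) * \<phi>) * ss"
   unfolding RP_def ss_def pp_def norm_mult[symmetric] by (rule norm_triangle_ineq4)
  also have "\<dots> \<le> 7 * w^2 * exp (2 * w) * pp + 7 * w^2 * exp (2 * w) * ss"
   using 1 2 nn by (intro add_mono mult_right_mono) auto
  finally show ?thesis by (simp add: algebra_simps)
 qed
 define L where "L = (\<tau> + \<rho> * F) * p - \<phi> * s"
 have L: "cmod L \<le> 2 * w * pp + w * ss"
 proof -
  have "cmod (\<tau> + \<rho> * F) \<le> w + 1 * w"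
   using norm_triangle_ineq[of \<tau> "\<rho> * F"] lin mult_mono[OF \<rho> F] by (simp add: norm_mult)
  hence "cmod ((\<tau> + \<rho> * F) * p) \<le> 2 * w * pp" unfolding norm_mult pp_def by (intro mult_right_mono) auto
  moreover have "cmod (\<phi> * s) \<le> w * ss" unfolding norm_mult ss_def using lin by (intro mult_right_mono) auto
  ultimately show ?thesis unfolding L_def using norm_triangle_ineq4[of "(\<tau> + \<rho> * F) * p" "\<phi> * s"] by linarith
 qed
 have P': "P' = \<rho> * p + (L + RP)"
  by (simp add: P'_def RP_def L_def Eps_def[symmetric] algebra_simps)
 have LR: "cmod (L + RP) \<le> 7 * exp (3 * w) * w * (pp + ss)"
 proof -
  have "cmod (L + RP) \<le> 2 * w * (pp + ss) + 7 * w^2 * exp (2 * w) * (pp + ss)"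
  proof -
   have "2 * w * pp + w * ss \<le> 2 * w * (pp + ss)" using w nn by (simp add: algebra_simps)
   thus ?thesis using norm_triangle_ineq[of L RP] L RP by linarith
  qed
  also have "\<dots> = (2 + 7 * w * exp (2 * w)) * (w * (pp + ss))" by (simp add: algebra_simps power2_eq_square)
  also have "\<dots> \<le> (7 * exp (3 * w)) * (w * (pp + ss))"
  proof (intro mult_right_mono)
   have "1 + w \<le> exp w" by (rule exp_ge_add_one_self)
   hence "w * exp (2 * w) + exp (2 * w) \<le> exp w * exp (2 * w)"
    by (metis distrib_right mult_right_mono exp_ge_zero add.commute mult_1)
   hence "w * exp (2 * w) + exp (2 * w) \<le> exp (3 * w)" by (simp add: mult_exp_exp)
   thus "2 + 7 * w * exp (2 * w) \<le> 7 * exp (3 * w)" using em[of 2] by linarith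
  qed (use w nn in auto)
  finally show ?thesis by (simp add: mult_ac)
 qed
 have LR2: "(cmod (L + RP))^2 \<le> 98 * exp (10 * w) * (w^2 * pp^2 + w^2 * ss^2)"
 proof -
  have "(cmod (L + RP))^2 \<le> (7 * exp (3 * w) * w * (pp + ss))^2" using LR by (intro power_mono) auto
  also have "\<dots> = 49 * exp (6 * w) * (w^2 * (pp + ss)^2)" by (simp add: power_mult_distrib exp_double[symmetric])
  also have "\<dots> \<le> 49 * exp (6 * w) * (w^2 * (2 * (pp^2 + ss^2)))"
   using sum_squares_bound[of pp ss] by (intro mult_left_mono) (simp_all add: power2_sum)
  finally have "(cmod (L + RP))^2 \<le> exp (6 * w) * (98 * (w^2 * pp^2 + w^2 * ss^2))" by (simp add: algebra_simps)
  also have "\<dots> \<le> exp (10 * w) * (98 * (w^2 * pp^2 + w^2 * ss^2))" using w by (intro mult_right_mono) auto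
  finally show ?thesis by (simp add: algebra_simps)
 qed
 have D1: "((cmod Y')^2 - (cmod Y)\<^sup>2) + A * ((cmod P')^2 - (cmod (\<rho> * p))\<^sup>2) - D0
   = 2 * Re (cnj Y * RY) + (cmod Z)^2 + A * (2 * Re (cnj (\<rho> * p) * RP) + (cmod (L + RP))^2)"
  unfolding Y' P' cmod_add_sq D0_def q2_def[symmetric] L_def[symmetric] Z_def[symmetric]
  unfolding Z_def by (simp add: algebra_simps)
 have b1: "\<bar>2 * Re (cnj Y * RY)\<bar> \<le> exp (10 * w) * (8 * (w^3 * y * ss) + 6 * (w^2 * y * pp))"
 proof -
  have "\<bar>2 * Re (cnj Y * RY)\<bar> \<le> 2 * (y * cmod RY)" using abs_Re_cnj_mult[of Y RY] by (simp add: y_def)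
  also have "\<dots> \<le> 2 * (y * (4 * (w^3 * exp (4 * w)) * ss + 3 * w^2 * exp (2 * w) * pp))"
   using RY nn by (intro mult_left_mono) auto
  also have "\<dots> = exp (4 * w) * (8 * (w^3 * y * ss)) + exp (2 * w) * (6 * (w^2 * y * pp))" by (simp add: algebra_simps)
  also have "\<dots> \<le> exp (10 * w) * (8 * (w^3 * y * ss)) + exp (10 * w) * (6 * (w^2 * y * pp))"
   using w nn by (intro add_mono mult_right_mono) auto
  finally show ?thesis by (simp add: algebra_simps)
 qed
 have b2: "\<bar>2 * Re (cnj (\<rho> * p) * RP)\<bar> \<le> exp (10 * w) * (28 * (w^2 * pp^2 + w^2 * ss^2))"
 proof -
  have "\<bar>2 * Re (cnj (\<rho> * p) * RP)\<bar> \<le> 2 * (cmod (\<rho> * p) * cmod RP)" using abs_Re_cnj_mult[of "\<rho> * p" RP] by simp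
  also have "\<dots> \<le> 2 * (pp * (7 * w^2 * exp (2 * w) * (pp + ss)))"
   using RP nn w mult_right_mono[OF \<rho>, of pp] by (intro mult_left_mono mult_mono) (auto simp: norm_mult pp_def)
  also have "\<dots> = exp (2 * w) * (14 * w^2 * (pp^2 + pp * ss))" by (simp add: algebra_simps power2_eq_square)
  also have "\<dots> \<le> exp (10 * w) * (28 * w^2 * (pp^2 + ss^2))"
  proof -
   have "14 * (pp^2 + pp * ss) \<le> 28 * (pp^2 + ss^2)"
    using sum_squares_bound[of pp ss] zero_le_power2[of pp] zero_le_power2[of ss] by (simp only: distrib_left mult.assoc)
   from mult_left_mono[OF this zero_le_power2[of w]] have *: "14 * w^2 * (pp^2 + pp * ss) \<le> 28 * w^2 * (pp^2 + ss^2)" by (simp only: mult_ac)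
   show ?thesis by (rule mult_mono[OF _ *]) (use w nn in auto)
  qed
  finally show ?thesis by (simp add: algebra_simps)
 qed
 have "\<bar>((cmod Y')^2 - (cmod Y)\<^sup>2) + A * ((cmod P')^2 - (cmod (\<rho> * p))\<^sup>2) - D0\<bar>
  \<le> \<bar>2 * Re (cnj Y * RY)\<bar> + (cmod Z)^2 + A * (\<bar>2 * Re (cnj (\<rho> * p) * RP)\<bar> + (cmod (L + RP))^2)"
 proof -
  define a1 a2 where "a1 = 2 * Re (cnj Y * RY)" and "a2 = 2 * Re (cnj (\<rho> * p) * RP)"
  have "\<bar>A * (a2 + (cmod (L + RP))^2)\<bar> \<le> A * (\<bar>a2\<bar> + (cmod (L + RP))^2)"
   unfolding abs_mult using A abs_triangle_ineq[of a2 "(cmod (L + RP))^2"] by (intro mult_mono) auto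
  moreover have "\<bar>(cmod Z)^2\<bar> = (cmod Z)^2" by simp
  ultimately show ?thesis unfolding D1 a1_def[symmetric] a2_def[symmetric] by linarith
 qed
 also have "\<dots> \<le> exp (10 * w) * (8 * (w^3 * y * ss) + 6 * (w^2 * y * pp)) + 32 * exp (10 * w) * (w^2 * pp^2 + w^4 * ss^2)
   + A * (exp (10 * w) * (28 * (w^2 * pp^2 + w^2 * ss^2)) + 98 * exp (10 * w) * (w^2 * pp^2 + w^2 * ss^2))"
  by (intro add_mono mult_left_mono b1 b2 Z2 LR2 A)
 also have "\<dots> = exp (10 * w) * (8 * (w^3 * y * ss) + 6 * (w^2 * y * pp) + 32 * (w^2 * pp^2) + 32 * (w^4 * ss^2)
   + 126 * (A * (w^2 * pp^2 + w^2 * ss^2)))" by (simp add: algebra_simps)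
 also have "\<dots> \<le> exp (10 * w) * (320 * (w^3 * y * ss) + 320 * (w^2 * y * pp) + 320 * (w^2 * pp^2) + 320 * (w^4 * ss^2)
   + 320 * (A * (w^2 * pp^2 + w^2 * ss^2)))"
  using w nn A by (intro mult_left_mono add_mono mult_right_mono) auto
 finally show "\<bar>((cmod Y')^2 - (cmod Y)\<^sup>2) + A * ((cmod P')^2 - (cmod (\<rho> * p))\<^sup>2) - D0\<bar>
   \<le> 320 * exp (10 * w) * (w^3 * cmod Y * cmod s + w^2 * cmod Y * cmod p + w^2 * (cmod p)^2 + w^4 * (cmod s)^2
     + A * (w^2 * (cmod p)^2 + w^2 * (cmod s)^2))"
  by (simp add: y_def pp_def ss_def algebra_simps)
 have "\<bar>D0\<bar> \<le> 2 * (y * (w * pp + 2 * w^2 * ss)) + A * (2 * (pp * (2 * w * pp + w * ss)))"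
 proof -
  have "\<bar>D0\<bar> \<le> 2 * \<bar>Re (cnj Y * (T * p + q2 * s))\<bar> + A * (2 * \<bar>Re (cnj (\<rho> * p) * L)\<bar>)"
   unfolding D0_def q2_def[symmetric] L_def[symmetric] using A
   by (intro order_trans[OF abs_triangle_ineq]) (simp only: abs_mult abs_of_nonneg abs_numeral)
  moreover have "\<bar>Re (cnj Y * (T * p + q2 * s))\<bar> \<le> y * (w * pp + 2 * w^2 * ss)"
  proof -
   have "cmod (T * p + q2 * s) \<le> w * pp + 2 * w^2 * ss"
    using norm_triangle_ineq[of "T * p" "q2 * s"]
     mult_right_mono[OF lin(1), of pp] mult_right_mono[OF q2, of ss] nn by (simp add: norm_mult pp_def ss_def)
   thus ?thesis using abs_Re_cnj_mult[of Y "T * p + q2 * s"] mult_left_mono[OF _ nn(1)] by (fastforce simp: y_def)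
  qed
  moreover have "\<bar>Re (cnj (\<rho> * p) * L)\<bar> \<le> pp * (2 * w * pp + w * ss)"
  proof -
   have "\<bar>Re (cnj (\<rho> * p) * L)\<bar> \<le> cmod (\<rho> * p) * cmod L" by (rule abs_Re_cnj_mult)
   also have "\<dots> \<le> pp * (2 * w * pp + w * ss)"
    using L nn w mult_right_mono[OF \<rho>, of pp] by (intro mult_mono) (auto simp: norm_mult pp_def)
   finally show ?thesis .
  qed
  ultimately show ?thesis using A
   by (elim order_trans, intro add_mono mult_left_mono) auto
 qed
 also have "\<dots> = 2 * (w * y * pp) + 4 * (w^2 * y * ss) + A * (4 * (w * pp^2) + 2 * (w * pp * ss))"
  by (simp add: algebra_simps power2_eq_square)
 also have "\<dots> \<le> 4 * (w * y * pp) + 4 * (w^2 * y * ss) + A * (4 * (w * pp^2) + 4 * (w * pp * ss))"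
  using w nn A by (intro add_mono mult_left_mono mult_right_mono) auto
 finally show "\<bar>D0\<bar> \<le> 4 * (w * cmod Y * cmod p + w^2 * cmod Y * cmod s + A * (w * (cmod p)^2 + w * cmod p * cmod s))"
  by (simp add: y_def pp_def ss_def algebra_simps)
qed

section \<open>The \<open>m\<close>-th moment of the Lyapunov function after one random step\<close>

lemma power_one_plus_quadratic:
 fixes y :: real
 shows "\<bar>(1 + y)^m - 1\<bar> \<le> real m * \<bar>y\<bar> * (1 + \<bar>y\<bar>)^m"
  and "\<bar>(1 + y)^m - 1 - real m * y\<bar> \<le> (real m)^2 * y^2 * (1 + \<bar>y\<bar>)^m"
proof -
 have mono: "(1 + \<bar>y\<bar>)^m \<le> (1 + \<bar>y\<bar>)^Suc m" "1 \<le> (1 + \<bar>y\<bar>)^m" for m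
  by (auto intro: power_increasing)
 have 1: "\<bar>(1 + y)^m - 1\<bar> \<le> real m * \<bar>y\<bar> * (1 + \<bar>y\<bar>)^m" for m
 proof (induction m)
  case (Suc m)
  have "\<bar>(1 + y)^Suc m - 1\<bar> = \<bar>((1 + y)^m - 1) + y * (1 + y)^m\<bar>" by (simp add: algebra_simps)
  also have "\<dots> \<le> \<bar>(1 + y)^m - 1\<bar> + \<bar>y\<bar> * (1 + \<bar>y\<bar>)^m"
   by (intro order_trans[OF abs_triangle_ineq] add_left_mono) (auto simp: abs_mult power_abs intro!: mult_left_mono power_mono)
  also have "\<dots> \<le> real m * \<bar>y\<bar> * (1 + \<bar>y\<bar>)^Suc m + \<bar>y\<bar> * (1 + \<bar>y\<bar>)^Suc m"
   using mono(1)[of m] by (intro add_mono order_trans[OF Suc.IH] mult_left_mono) auto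
  finally show ?case by (simp add: algebra_simps)
 qed simp
 show "\<bar>(1 + y)^m - 1\<bar> \<le> real m * \<bar>y\<bar> * (1 + \<bar>y\<bar>)^m" by (rule 1)
 show "\<bar>(1 + y)^m - 1 - real m * y\<bar> \<le> (real m)^2 * y^2 * (1 + \<bar>y\<bar>)^m"
 proof (induction m)
  case (Suc m)
  have "\<bar>(1 + y)^Suc m - 1 - real (Suc m) * y\<bar> = \<bar>((1 + y)^m - 1 - real m * y) + y * ((1 + y)^m - 1)\<bar>"
   by (simp add: algebra_simps)
  also have "\<dots> \<le> \<bar>(1 + y)^m - 1 - real m * y\<bar> + \<bar>y\<bar> * \<bar>(1 + y)^m - 1\<bar>"
   by (intro order_trans[OF abs_triangle_ineq] add_left_mono) (auto simp: abs_mult)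
  also have "\<dots> \<le> (real m)^2 * y^2 * (1 + \<bar>y\<bar>)^m + \<bar>y\<bar> * (real m * \<bar>y\<bar> * (1 + \<bar>y\<bar>)^m)"
   by (intro add_mono Suc.IH mult_left_mono 1) auto
  also have "\<dots> = ((real m)^2 + real m) * (y^2 * (1 + \<bar>y\<bar>)^m)"
  proof -
   define a where "a = \<bar>y\<bar>"
   have "y^2 = a^2" by (simp add: a_def)
   thus ?thesis unfolding a_def[symmetric] by (simp add: algebra_simps power2_eq_square)
  qed
  also have "\<dots> \<le> (real (Suc m))^2 * (y^2 * (1 + \<bar>y\<bar>)^Suc m)"
  proof (intro mult_mono)
   show "(real m)^2 + real m \<le> (real (Suc m))^2" by (simp add: power2_eq_square algebra_simps)
   show "0 \<le> y^2 * (1 + \<bar>y\<bar>)^m" by (intro mult_nonneg_nonneg) auto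
  qed (use mono(1)[of m] in auto)
  finally show ?case by (simp add: mult.assoc)
 qed simp
qed

text \<open>Convexity of \<open>exp\<close>. It moves numerical factors and the order
  \<open>m\<close> into the exponent, where they are affordable, while the bound still vanishes for
  vanishing noise.\<close>

lemma bernoulli_exp: assumes "1 \<le> (K::real)" "0 \<le> t" shows "K * (exp t - 1) \<le> exp (K * t) - 1"
proof -
 have "convex_on UNIV (exp :: real \<Rightarrow> real)" by (rule convex_on_realI[where f' = exp]) (auto intro!: derivative_eq_intros)
 from convex_onD[OF this, of "1 / K" 0 "K * t"] assms
 have "exp t \<le> (1 - 1 / K) + 1 / K * exp (K * t)" by simp
 hence "K * exp t \<le> K * ((1 - 1 / K) + 1 / K * exp (K * t))" using assms by (intro mult_left_mono) auto
 also have "\<dots> = (K - 1) + exp (K * t)" using assms by (simp add: field_simps)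
 finally show ?thesis by (simp add: algebra_simps)
qed

lemma power_le_fact_exp: assumes "0 \<le> (t::real)" shows "t^j \<le> fact j * exp t"
proof -
 have "t^j /\<^sub>R fact j \<le> (\<Sum>n. t^n /\<^sub>R fact n)"
  using sum_le_suminf[OF summable_exp_generic[of t], of "{j}"] assms by simp
 hence "t^j / fact j \<le> exp t" by (simp add: exp_def divide_inverse mult.commute)
 thus ?thesis by (simp add: pos_divide_le_eq mult.commute)
qed

text \<open>The second noise is allowed a variance \<open>v\<close> below 1 because the first step
  has \<open>Y = 0\<close>; there \<open>v = 0\<close>, and later \<open>v = 1\<close>.\<close>

locale step_noise = prob_space M for M :: "'a measure" +
 fixes g1 g2 :: "'a \<Rightarrow> real" and v h C0 :: real
 assumes gm[measurable]: "random_variable borel g1" "random_variable borel g2"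
  and g_int: "integrable M g1" "integrable M g2" "integrable M (\<lambda>x. (g1 x)^2)" "integrable M (\<lambda>x. (g2 x)^2)"
   "integrable M (\<lambda>x. g1 x * g2 x)"
  and g_mom: "expectation g1 = 0" "expectation g2 = 0" "expectation (\<lambda>x. g1 x * g2 x) = 0"
   "expectation (\<lambda>x. (g1 x)^2) = 1" "expectation (\<lambda>x. (g2 x)^2) = v"
  and v: "0 \<le> v" "v \<le> 1" and h: "0 < h" "h \<le> 1" and C0: "0 \<le> C0"
  and g_exp: "(\<integral>\<^sup>+x. ennreal (exp (h * (\<bar>g1 x\<bar> + \<bar>g2 x\<bar>))) \<partial>M) \<le> ennreal C0"
begin

definition U :: "'a \<Rightarrow> real" where "U x = 1 + (\<bar>g1 x\<bar> + \<bar>g2 x\<bar>)"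
definition Bm :: real where "Bm = 24 * (4 / h)^4 * exp h * C0"

lemma U_ge1: "1 \<le> U x" by (simp add: U_def)
lemma U_meas[measurable]: "U \<in> borel_measurable M" unfolding U_def by measurable

text \<open>A quarter of the exponent \<open>h\<close> pays for \<open>U^4\<close>, which explains
  \<open>24 * (4 / h)^4\<close>, and another quarter pays for \<open>exp (a U)\<close>. The fourth
  power is the highest power of the noise in the expansion of one step.\<close>

lemma U_moment: assumes "a \<le> h / 4"
 shows "integrable M (\<lambda>x. U x^4 * exp (a * U x))" "expectation (\<lambda>x. U x^4 * exp (a * U x)) \<le> Bm"
proof -
 have int: "integrable M (\<lambda>x. exp (h * (\<bar>g1 x\<bar> + \<bar>g2 x\<bar>)))"
 proof (rule integrableI_nonneg)
  show "(\<integral>\<^sup>+x. ennreal (exp (h * (\<bar>g1 x\<bar> + \<bar>g2 x\<bar>))) \<partial>M) < \<infinity>"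
   using g_exp ennreal_less_top le_less_trans by (metis infinity_ennreal_def)
 qed auto
 have ex: "expectation (\<lambda>x. exp (h * (\<bar>g1 x\<bar> + \<bar>g2 x\<bar>))) \<le> C0"
  using g_exp C0 by (subst integral_eq_nn_integral) (auto intro!: enn2real_leI)
 have bd: "U x^4 * exp (a * U x) \<le> 24 * (4 / h)^4 * exp h * exp (h * (\<bar>g1 x\<bar> + \<bar>g2 x\<bar>))" for x
 proof -
  have "U x^4 = (4 / h)^4 * (h / 4 * U x)^4" using h by (simp add: power_mult_distrib power_divide)
  also have "\<dots> \<le> (4 / h)^4 * (fact 4 * exp (h / 4 * U x))"
   using h U_ge1[of x] by (intro mult_left_mono power_le_fact_exp) auto
  finally have "U x^4 * exp (a * U x) \<le> ((4 / h)^4 * (fact 4 * exp (h / 4 * U x))) * exp (h / 4 * U x)"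
   using assms U_ge1[of x] h by (intro mult_mono) auto
  also have "\<dots> = 24 * (4 / h)^4 * exp (h / 2 * U x)" by (simp add: fact_numeral mult_exp_exp algebra_simps)
  also have "\<dots> \<le> 24 * (4 / h)^4 * exp (h + h * (\<bar>g1 x\<bar> + \<bar>g2 x\<bar>))"
  proof -
   have "h / 2 * U x \<le> h * U x" using h U_ge1[of x] by (intro mult_right_mono) auto
   also have "\<dots> = h + h * (\<bar>g1 x\<bar> + \<bar>g2 x\<bar>)" by (simp add: U_def algebra_simps)
   finally show ?thesis using h by (intro mult_left_mono) auto
  qed
  finally show ?thesis by (simp add: exp_add mult.assoc)
 qed
 show I: "integrable M (\<lambda>x. U x^4 * exp (a * U x))"
 proof (rule Bochner_Integration.integrable_bound[OF integrable_mult_right[OF int, of "24 * (4 / h)^4 * exp h"]]; (intro AE_I2)?)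
  fix x
  have "0 \<le> U x^4 * exp (a * U x)" using U_ge1[of x] by simp
  thus "norm (U x^4 * exp (a * U x)) \<le> norm (24 * (4 / h)^4 * exp h * exp (h * (\<bar>g1 x\<bar> + \<bar>g2 x\<bar>)))"
   using bd[of x] by (simp only: real_norm_def)
 qed measurable
 have "expectation (\<lambda>x. U x^4 * exp (a * U x)) \<le> expectation (\<lambda>x. 24 * (4 / h)^4 * exp h * exp (h * (\<bar>g1 x\<bar> + \<bar>g2 x\<bar>)))"
  by (rule integral_mono[OF I integrable_mult_right[OF int]]) (rule bd)
 also have "\<dots> \<le> Bm" unfolding Bm_def integral_mult_right_zero using ex h by (intro mult_left_mono) auto
 finally show "expectation (\<lambda>x. U x^4 * exp (a * U x)) \<le> Bm" .
qed

definition lin :: "complex \<Rightarrow> complex \<Rightarrow> 'a \<Rightarrow> complex" where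
 "lin a b x = a * of_real (g1 x) + b * of_real (g2 x)"

lemma lin_meas[measurable]: "lin a b \<in> borel_measurable M" unfolding lin_def by measurable

lemma lin_bound: assumes "cmod a \<le> c" "cmod b \<le> c" shows "cmod (lin a b x) \<le> c * U x"
proof -
 have c: "0 \<le> c" using assms(1) norm_ge_zero order_trans by blast
 have "cmod (lin a b x) \<le> cmod a * \<bar>g1 x\<bar> + cmod b * \<bar>g2 x\<bar>"
  unfolding lin_def by (intro order_trans[OF norm_triangle_ineq]) (simp add: norm_mult)
 also have "\<dots> \<le> c * \<bar>g1 x\<bar> + c * \<bar>g2 x\<bar>" using assms by (intro add_mono mult_right_mono) auto
 also have "\<dots> \<le> c * U x" using c by (simp add: U_def algebra_simps)
 finally show ?thesis .
qed

lemma lin_expect: "integrable M (lin a b)" "(LINT x|M. lin a b x) = 0"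
 unfolding lin_def using g_int g_mom by auto

lemma lin_sq_expect: "integrable M (\<lambda>x. (lin a b x)^2)" "(LINT x|M. (lin a b x)^2) = a^2 + b^2 * of_real v"
proof -
 have e: "(lin a b x)^2 = a^2 * of_real ((g1 x)^2) + b^2 * of_real ((g2 x)^2) + 2 * a * b * of_real (g1 x * g2 x)" for x
  by (simp add: lin_def power2_eq_square algebra_simps)
 show "integrable M (\<lambda>x. (lin a b x)^2)" unfolding e using g_int by (auto simp del: of_real_power of_real_mult)
 show "(LINT x|M. (lin a b x)^2) = a^2 + b^2 * of_real v"
  unfolding e using g_int g_mom by (auto simp del: of_real_power of_real_mult)
qed

text \<open>The new value is at most \<open>V0 (1 + y)\<close> with
  \<open>y = (D0 + D1) / V0\<close>, and \<open>(1 + y)^m\<close> is expanded to second order. The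
  linear term in \<open>D0\<close> vanishes in the mean, so \<open>D1\<close> enters with the factor
  \<open>m\<close> and the square of \<open>D0\<close> with the factor \<open>m^2\<close>.
  \<open>A2\<close> is the weight after the step; half of the contraction of \<open>p\<close> is
  already spent in \<open>V0\<close>. The number \<open>\<nu>\<close> is the size of the noise
  relative to \<open>sqrt V\<close>.\<close>

lemma one_step_moment_raw:
 fixes f1 f2 fh2 t1 t2 \<tau>1 \<tau>2 \<phi>1 \<phi>2 \<rho> e Y p :: complex and c \<sigma> \<nu> A A2 \<epsilon> \<theta> :: real and m :: nat
 assumes c: "1 \<le> c" and \<sigma>: "0 < \<sigma>" "c * \<sigma> \<le> 1"
  and f: "cmod f1 \<le> c * \<sigma>" "cmod f2 \<le> c * \<sigma>" "cmod (fh2 - f2) \<le> c * \<sigma>^3"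
  and t: "cmod t1 \<le> c * \<sigma>" "cmod t2 \<le> c * \<sigma>" and \<tau>: "cmod \<tau>1 \<le> c * \<sigma>" "cmod \<tau>2 \<le> c * \<sigma>"
  and \<phi>: "cmod \<phi>1 \<le> c * \<sigma>" "cmod \<phi>2 \<le> c * \<sigma>" and e: "cmod e \<le> c * \<sigma>^2"
  and \<rho>: "cmod \<rho> \<le> 1" "A2 * (cmod \<rho>)^2 \<le> A * (1 - \<theta> / 2)" and A: "0 < A" "A \<le> 2" "0 \<le> A2" "A2 \<le> 2 * A"
  and \<epsilon>: "0 < \<epsilon>" "\<epsilon> \<le> 1" and \<theta>: "0 \<le> \<theta>" "\<theta> \<le> 1"
  and \<nu>: "0 < \<nu>" "\<sigma>^2 \<le> \<nu>^2 * A" "\<sigma>^2 \<le> \<nu>^2 * \<epsilon>" and m: "1 \<le> m" "6 * 10^6 * c * real m * \<nu> \<le> h / 4"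
 defines "s \<equiv> 1 + Y"
 defines "Ef \<equiv> \<lambda>x. exp (lin f1 f2 x + (f1^2 + f2^2 * of_real v) / 2)"
 defines "Y' \<equiv> \<lambda>x. Ef x * (s * (1 - lin f1 fh2 x) + (e + lin t1 t2 x) * p) - 1"
  and "P' \<equiv> \<lambda>x. Ef x * ((\<rho> + lin \<tau>1 \<tau>2 x) * p - lin \<phi>1 \<phi>2 x * s)"
  and "V0 \<equiv> (cmod Y)^2 + A * (1 - \<theta> / 2) * (cmod p)^2 + \<epsilon>"
  and "q1 \<equiv> \<sigma>^3 * cmod Y * cmod s + \<sigma>^2 * cmod Y * cmod p + \<sigma>^2 * (cmod p)^2 + \<sigma>^4 * (cmod s)^2
     + A * (\<sigma>^2 * (cmod p)^2 + \<sigma>^2 * (cmod s)^2)"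
  and "q0 \<equiv> \<sigma>^2 * (cmod Y)^2 * (cmod p)^2 + \<sigma>^4 * (cmod Y)^2 * (cmod s)^2
     + A^2 * (\<sigma>^2 * (cmod p)^4 + \<sigma>^2 * (cmod p)^2 * (cmod s)^2)"
 shows "(\<integral>\<^sup>+x. ennreal (((cmod (Y' x))^2 + A2 * (cmod (P' x))^2 + \<epsilon>)^m) \<partial>M)
  \<le> ennreal (V0^m * (1 + 1920 * c^4 * Bm * real m * q1 / V0 + 512 * c^4 * Bm * (real m)^2 * q0 / V0^2))"
proof -
 define y pp ss where "y = cmod Y" and "pp = cmod p" and "ss = cmod s"
 have nn: "0 \<le> y" "0 \<le> pp" "0 \<le> ss" by (auto simp: y_def pp_def ss_def)
 define V where "V = y^2 + A * pp^2 + \<epsilon>"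
 define D0c where "D0c x = 2 * (cnj Y * (lin t1 t2 x * p + ((f1^2 + f2^2 * of_real v) / 2 - (lin f1 f2 x)\<^sup>2 / 2) * s))
   + of_real A2 * (2 * (cnj (\<rho> * p) * ((lin \<tau>1 \<tau>2 x + \<rho> * lin f1 f2 x) * p - lin \<phi>1 \<phi>2 x * s)))" for x
 define D0 where "D0 x = Re (D0c x)" for x
 define D1 where "D1 x = ((cmod (Y' x))^2 - (cmod Y)\<^sup>2) + A2 * ((cmod (P' x))^2 - (cmod (\<rho> * p))\<^sup>2) - D0 x" for x
 have V0: "0 < V0" "V \<le> 2 * V0" "\<epsilon> \<le> V" "y^2 \<le> V" "A * pp^2 \<le> V" "0 < V"
 proof -
  have a: "0 \<le> A * pp^2" using A by simp
  have "A * pp^2 * (1/2) \<le> A * pp^2 * (1 - \<theta> / 2)" using \<theta> a by (intro mult_left_mono) auto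
  hence "A * pp^2 \<le> 2 * (A * (1 - \<theta> / 2) * pp^2)" by (simp add: mult_ac)
  thus "0 < V0" "V \<le> 2 * V0" "\<epsilon> \<le> V" "y^2 \<le> V" "A * pp^2 \<le> V" "0 < V"
   using a \<epsilon> zero_le_power2[of y] unfolding V0_def V_def y_def[symmetric] pp_def[symmetric] by (simp_all, linarith+)
 qed
 \<comment> \<open>\<open>w\<close>, defined next, is the absolute size of the noise and
   \<open>W\<close> its size relative to \<open>sqrt V\<close>: products such as
   \<open>w * pp\<close> are bounded by \<open>W * sqrt V\<close>.\<close>
 define W where "W x = c * \<nu> * U x" for x
 define w where "w x = c * \<sigma> * U x" for x
 have U0: "0 < U x" for x using U_ge1[of x] by simp
 have w0: "0 \<le> w x" for x unfolding w_def using U0[of x] c \<sigma> by simp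
 have \<sigma>\<nu>: "\<sigma> \<le> \<nu>"
 proof -
  have "\<sigma>^2 \<le> \<nu>^2" using \<nu>(3) \<epsilon> mult_left_mono[of \<epsilon> 1 "\<nu>^2"] by simp
  thus ?thesis using \<nu> \<sigma> by (simp add: power2_le_iff_abs_le)
 qed
 have wW: "w x \<le> W x" for x unfolding w_def W_def using \<sigma>\<nu> U0[of x] c by (intro mult_right_mono mult_left_mono) auto
 have \<sigma>w: "c * \<sigma> \<le> w x" for x unfolding w_def using U_ge1[of x] c \<sigma> by simp
 have cs: "c * \<sigma>^2 \<le> (w x)^2" "(c * \<sigma>)^2 \<le> (w x)^2" for x
 proof -
  show *: "(c * \<sigma>)^2 \<le> (w x)^2" using \<sigma>w[of x] c \<sigma> by (intro power_mono) auto
  have "c * \<sigma>^2 \<le> c * c * \<sigma>^2" using c by (intro mult_right_mono) auto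
  also have "\<dots> = (c * \<sigma>)^2" by (simp add: power2_eq_square)
  finally show "c * \<sigma>^2 \<le> (w x)^2" using * by linarith
 qed
 have lb: "cmod (lin a b x) \<le> w x" if "cmod a \<le> c * \<sigma>" "cmod b \<le> c * \<sigma>" for a b x
  using lin_bound[OF that] by (simp add: w_def)
 have Fh: "cmod (lin f1 fh2 x - lin f1 f2 x) \<le> w x^3" for x
 proof -
  have "lin f1 fh2 x - lin f1 f2 x = lin 0 (fh2 - f2) x" by (simp add: lin_def algebra_simps)
  hence "cmod (lin f1 fh2 x - lin f1 f2 x) \<le> (c * \<sigma>^3) * U x" using lin_bound[of 0 "c * \<sigma>^3" "fh2 - f2" x] f c \<sigma> by simp
  also have "\<dots> \<le> (c^3 * \<sigma>^3) * U x^3"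
   using c \<sigma> U_ge1[of x] power_increasing[of 1 3 c] power_increasing[of 1 3 "U x"] by (intro mult_mono) auto
  finally show ?thesis by (simp add: w_def power_mult_distrib)
 qed
 have d: "cmod ((f1^2 + f2^2 * of_real v) / 2) \<le> (c * \<sigma>)^2"
 proof -
  have "cmod (f1^2 + f2^2 * of_real v) \<le> (cmod f1)^2 + (cmod f2)^2 * v"
   using norm_triangle_ineq[of "f1^2" "f2^2 * of_real v"] v by (simp add: norm_mult norm_power)
  also have "\<dots> \<le> (c * \<sigma>)^2 + (c * \<sigma>)^2 * 1" using f v by (intro add_mono mult_mono power_mono) auto
  finally show ?thesis by (simp add: norm_divide)
 qed
 have d2: "(c * \<sigma>)^2 \<le> c * \<sigma>" using \<sigma> c mult_left_mono[of "c * \<sigma>" 1 "c * \<sigma>"] by (simp add: power2_eq_square)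
 have D0_eq: "D0 x = 2 * Re (cnj Y * (lin t1 t2 x * p + ((f1^2 + f2^2 * of_real v) / 2 - (lin f1 f2 x)\<^sup>2 / 2) * s))
   + A2 * (2 * Re (cnj (\<rho> * p) * ((lin \<tau>1 \<tau>2 x + \<rho> * lin f1 f2 x) * p - lin \<phi>1 \<phi>2 x * s)))" for x
  unfolding D0_def D0c_def by simp
 define D1m where "D1m x = 320 * exp (10 * w x) * (w x^3 * y * ss + (w x)^2 * y * pp + (w x)^2 * pp^2 + w x^4 * ss^2
     + A2 * ((w x)^2 * pp^2 + (w x)^2 * ss^2))" for x
 define D0m where "D0m x = 4 * (w x * y * pp + (w x)^2 * y * ss + A2 * (w x * pp^2 + w x * pp * ss))" for x
 have D1a: "\<bar>D1 x\<bar> \<le> D1m x" and D0a: "\<bar>D0 x\<bar> \<le> D0m x" for x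
 proof -
  note ex = one_step_expansion[where F = "lin f1 f2 x" and Fh = "lin f1 fh2 x" and d = "(f1^2 + f2^2 * of_real v) / 2"
   and e = e and T = "lin t1 t2 x" and \<tau> = "lin \<tau>1 \<tau>2 x" and \<phi> = "lin \<phi>1 \<phi>2 x" and \<rho> = \<rho> and Y = Y and p = p and w = "w x" and A = A2,
   OF lb[OF f(1,2)] Fh order_trans[OF d order_trans[OF d2 \<sigma>w]] order_trans[OF d cs(2)] order_trans[OF e cs(1)] lb[OF t] lb[OF \<tau>] lb[OF \<phi>] \<rho>(1) A(3)]
  show "\<bar>D1 x\<bar> \<le> D1m x" using ex(1) unfolding D1_def D1m_def D0_eq Y'_def P'_def Ef_def s_def y_def pp_def ss_def .
  show "\<bar>D0 x\<bar> \<le> D0m x" using ex(2) unfolding D0_eq D0m_def s_def y_def pp_def ss_def .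
 qed
 \<comment> \<open>Here the additive \<open>\<epsilon>\<close> is indispensable:
   \<open>s = 1 + Y\<close> does not vanish with \<open>Y\<close>, but 1 is at most
   \<open>V / \<epsilon>\<close>.\<close>
 have s_le: "ss \<le> 2 * sqrt (V / \<epsilon>)"
 proof -
  have "ss \<le> 1 + y" using norm_triangle_ineq[of 1 Y] by (simp add: ss_def s_def y_def)
  hence "ss^2 \<le> (1 + y)^2" using nn by (intro power_mono) auto
  also have "\<dots> \<le> 2 * (1 + y^2)" using sum_squares_bound[of 1 y] by (simp add: power2_sum)
  also have "\<dots> \<le> 2 * (V / \<epsilon> + V / \<epsilon>)"
  proof (intro mult_left_mono add_mono)
   show "1 \<le> V / \<epsilon>" using V0 \<epsilon> by simp
   have "V \<le> V / \<epsilon>" using V0 \<epsilon> mult_left_mono[of \<epsilon> 1 V] by (simp add: field_simps)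
   thus "y^2 \<le> V / \<epsilon>" using V0 by linarith
  qed simp
  also have "\<dots> = (2 * sqrt (V / \<epsilon>))^2" using V0 \<epsilon> by (simp add: power_mult_distrib)
  finally show ?thesis by (rule power2_le_imp_le) (use V0 \<epsilon> in auto)
 qed
 have b_y: "y \<le> sqrt V" using V0 nn by (intro real_le_rsqrt) auto
 have b_p: "\<sigma> * pp \<le> \<nu> * sqrt V"
 proof -
  have "(\<sigma> * pp)^2 \<le> \<nu>^2 * A * pp^2" using \<nu> by (simp add: power_mult_distrib mult_right_mono)
  also have "\<dots> \<le> \<nu>^2 * V" using V0 by (simp add: mult.assoc mult_left_mono)
  also have "\<dots> = (\<nu> * sqrt V)^2" using V0 by (simp add: power_mult_distrib)
  finally show ?thesis by (rule power2_le_imp_le) (use V0 \<nu> in auto)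
 qed
 have b_s: "\<sigma> * ss \<le> 2 * \<nu> * sqrt V"
 proof -
  have "\<sigma> \<le> \<nu> * sqrt \<epsilon>"
   by (rule power2_le_imp_le) (use \<nu> \<epsilon> in \<open>auto simp: power_mult_distrib\<close>)
  hence "\<sigma> * ss \<le> (\<nu> * sqrt \<epsilon>) * (2 * sqrt (V / \<epsilon>))" using s_le \<nu> \<epsilon> nn by (intro mult_mono) auto
  also have "\<dots> = 2 * \<nu> * sqrt V" using \<epsilon> by (simp add: real_sqrt_divide)
  finally show ?thesis .
 qed
 have sV: "sqrt V * sqrt V = V" "0 \<le> sqrt V" using V0 by auto
 have c\<nu>: "w x * r \<le> W x * k * sqrt V" if "\<sigma> * r \<le> \<nu> * k * sqrt V" for x r k
  using mult_left_mono[OF that, of "c * U x"] c U0[of x] by (simp add: w_def W_def mult_ac)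
 have wp: "w x * pp \<le> W x * sqrt V" and ws: "w x * ss \<le> 2 * W x * sqrt V" for x
  using c\<nu>[of pp 1 x] c\<nu>[of ss 2 x] b_p b_s by (auto simp: mult_ac)
 have W0: "0 < W x" for x unfolding W_def using U0[of x] c \<nu> by simp
 have rel: "w x * y * pp \<le> W x * V" "(w x)^2 * y * ss \<le> 2 * (W x)^2 * V" "A2 * (w x * pp^2) \<le> 2 * W x * V"
  "A2 * (w x * pp * ss) \<le> 8 * W x * V" "w x^3 * y * ss \<le> 2 * W x^3 * V" "(w x)^2 * y * pp \<le> (W x)^2 * V"
  "(w x)^2 * pp^2 \<le> (W x)^2 * V" "w x^4 * ss^2 \<le> 4 * W x^4 * V" "A2 * ((w x)^2 * pp^2) \<le> 4 * (W x)^2 * V"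
  "A2 * ((w x)^2 * ss^2) \<le> 16 * (W x)^2 * V" for x
 proof -
  let ?w = "w x" and ?W = "W x"
  have n0: "0 \<le> ?w * pp" "0 \<le> ?w * ss" "0 \<le> ?W * sqrt V" "0 \<le> 2 * ?W * sqrt V"
   using nn w0[of x] W0[of x] V0 by auto
  have "y * (?w * pp) \<le> sqrt V * (?W * sqrt V)" by (rule mult_mono[OF b_y wp sV(2) n0(1)])
  also have "\<dots> = ?W * (sqrt V * sqrt V)" by (simp only: mult_ac)
  finally have 1: "?w * y * pp \<le> ?W * V" unfolding sV by (simp only: mult_ac)
  have "y * (?w * ss) \<le> sqrt V * (2 * ?W * sqrt V)" by (rule mult_mono[OF b_y ws sV(2) n0(2)])
  also have "\<dots> = 2 * ?W * (sqrt V * sqrt V)" by (simp only: mult_ac)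
  finally have 2: "?w * y * ss \<le> 2 * ?W * V" unfolding sV by (simp only: mult_ac)
  have "(?w * pp) * (?w * pp) \<le> (?W * sqrt V) * (?W * sqrt V)" by (rule mult_mono[OF wp wp n0(3) n0(1)])
  also have "\<dots> = ?W * ?W * (sqrt V * sqrt V)" by (simp only: mult_ac)
  finally have 3: "(?w * pp) * (?w * pp) \<le> ?W * ?W * V" unfolding sV .
  have "(?w * ss) * (?w * ss) \<le> (2 * ?W * sqrt V) * (2 * ?W * sqrt V)" by (rule mult_mono[OF ws ws n0(4) n0(2)])
  also have "\<dots> = 4 * (?W * ?W) * (sqrt V * sqrt V)" by (simp add: mult_ac)
  finally have 4: "(?w * ss) * (?w * ss) \<le> 4 * (?W * ?W) * V" unfolding sV .
  have wW': "?w \<le> ?W" "?w^2 \<le> ?W^2" "0 \<le> ?w" using wW w0 by (auto intro: power_mono)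
  show "?w * y * pp \<le> ?W * V" by (rule 1)
  show "?w^2 * y * ss \<le> 2 * ?W^2 * V"
   using mult_mono[OF wW'(1) 2] wW' nn W0[of x] by (simp add: power2_eq_square mult_ac)
  show "?w^2 * y * pp \<le> ?W^2 * V"
   using mult_mono[OF wW'(1) 1] wW' nn W0[of x] by (simp add: power2_eq_square mult_ac)
  show "?w^3 * y * ss \<le> 2 * ?W^3 * V"
   using mult_mono[OF wW'(2) 2] wW' nn W0[of x] by (simp add: power3_eq_cube power2_eq_square mult_ac)
  show p2: "?w^2 * pp^2 \<le> ?W^2 * V" using 3 by (simp add: power2_eq_square mult_ac)
  have s2: "?w^2 * ss^2 \<le> 4 * (?W^2 * V)" using 4 by (simp add: power2_eq_square mult_ac)
  show "?w^4 * ss^2 \<le> 4 * ?W^4 * V"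
   using mult_mono[OF wW'(2) s2] wW' nn W0[of x] by (simp add: power4_eq_xxxx power2_eq_square mult_ac)
  have A4: "A2 \<le> 4" using A by linarith
  show "A2 * (?w^2 * pp^2) \<le> 4 * ?W^2 * V"
   using mult_mono[OF A4 p2] by (simp add: mult_ac)
  show "A2 * (?w^2 * ss^2) \<le> 16 * ?W^2 * V"
   using mult_mono[OF A4 s2] by (simp add: mult_ac)
  have Ap: "A2 * pp^2 \<le> 2 * V" using V0(5) A mult_right_mono[OF A(4), of "pp^2"] by simp
  show "A2 * (?w * pp^2) \<le> 2 * ?W * V"
   using mult_mono[OF wW'(1) Ap] wW' W0[of x] A by (simp add: mult_ac)
  have App: "A2 * pp \<le> 4 * sqrt V"
  proof (rule power2_le_imp_le)
   have "(A2 * pp)^2 = A2 * (A2 * pp^2)" by (simp add: power2_eq_square mult_ac)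
   also have "\<dots> \<le> 4 * (2 * V)" by (rule mult_mono[OF A4 Ap]) (use A in auto)
   also have "\<dots> \<le> (4 * sqrt V)^2" using V0 by (simp add: power_mult_distrib)
   finally show "(A2 * pp)^2 \<le> (4 * sqrt V)^2" .
  qed (use V0 in auto)
  have "(A2 * pp) * (?w * ss) \<le> (4 * sqrt V) * (2 * ?W * sqrt V)"
   by (rule mult_mono[OF App ws]) (use n0 sV in auto)
  also have "\<dots> = 8 * ?W * (sqrt V * sqrt V)" by (simp add: mult_ac)
  finally show "A2 * (?w * pp * ss) \<le> 8 * ?W * V" unfolding sV by (simp only: mult_ac)
 qed
 \<comment> \<open>The estimate below produces \<open>97400 * 11\<close>, rounded up to
   \<open>2 * 10^6\<close>. A bound of the form \<open>exp T - 1\<close> covers large noise and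
   gives at once that \<open>(1 + |y|)^m\<close> is at most \<open>exp (m T)\<close>.\<close>
 define T where "T x = 2 * 10^6 * W x" for x
 have T0: "0 \<le> T x" for x using W0[of x] by (simp add: T_def)
 have small: "D0m x + D1m x \<le> V0 * (exp (T x) - 1)" for x
 proof -
  let ?W = "W x" and ?w = "w x"
  define E where "E = exp ?W - 1"
  have Ej: "?W^Suc j \<le> fact (Suc j) * E" for j
  proof -
   have "1 + ?W^Suc j / fact (Suc j) = (\<Sum>i\<in>{0, Suc j}. ?W^i /\<^sub>R fact i)"
    by (simp add: divide_inverse mult.commute)
   also have "\<dots> \<le> (\<Sum>i. ?W^i /\<^sub>R fact i)"
    by (rule sum_le_suminf[OF summable_exp_generic[of ?W]]) (use W0[of x] in auto)
   finally have "?W^Suc j / fact (Suc j) \<le> E" by (simp add: exp_def E_def)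
   thus ?thesis by (simp add: pos_divide_le_eq mult.commute del: power_Suc fact_Suc)
  qed
  have E: "?W \<le> E" "?W^2 \<le> 2 * E" "?W^3 \<le> 6 * E" "?W^4 \<le> 24 * E"
   using Ej[of 0] Ej[of 1] Ej[of 2] Ej[of 3] by (simp_all add: numeral_eq_Suc fact_numeral)
  have "D0m x \<le> 4 * (?W * V + 2 * ?W^2 * V + (2 * ?W * V + 8 * ?W * V))"
   unfolding D0m_def distrib_left[of A2] using rel[of x] by (intro mult_left_mono add_mono) auto
  also have "\<dots> = V * (44 * ?W + 8 * ?W^2)" by (simp add: algebra_simps)
  also have "\<dots> \<le> V * (60 * E)" using E V0 by (intro mult_left_mono) linarith+
  finally have a: "D0m x \<le> V * (60 * E)" .
  have "D1m x \<le> 320 * exp (10 * ?W) * (2 * ?W^3 * V + ?W^2 * V + ?W^2 * V + 4 * ?W^4 * V + (4 * ?W^2 * V + 16 * ?W^2 * V))"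
   unfolding D1m_def distrib_left[of A2]
  proof (rule mult_mono)
   show "w x^3 * y * ss + (w x)^2 * y * pp + (w x)^2 * pp^2 + w x^4 * ss^2 + (A2 * ((w x)^2 * pp^2) + A2 * ((w x)^2 * ss^2))
     \<le> 2 * ?W^3 * V + ?W^2 * V + ?W^2 * V + 4 * ?W^4 * V + (4 * ?W^2 * V + 16 * ?W^2 * V)"
    using rel[of x] by linarith
   show "0 \<le> w x^3 * y * ss + (w x)^2 * y * pp + (w x)^2 * pp^2 + w x^4 * ss^2 + (A2 * ((w x)^2 * pp^2) + A2 * ((w x)^2 * ss^2))"
    using nn w0[of x] A by (intro add_nonneg_nonneg mult_nonneg_nonneg) auto
  qed (use wW[of x] in auto)
  also have "\<dots> = 320 * exp (10 * ?W) * (V * (2 * ?W^3 + 22 * ?W^2 + 4 * ?W^4))" by (simp add: algebra_simps)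
  also have "\<dots> \<le> 320 * exp (10 * ?W) * (V * (152 * E))" using E V0 by (intro mult_left_mono) auto
  finally have b: "D1m x \<le> exp (10 * ?W) * (V * (48640 * E))" by simp
  have E0: "0 \<le> E" using E W0[of x] by linarith
  have "V * (60 * E) \<le> exp (10 * ?W) * (V * (60 * E))"
   using W0[of x] V0 E0 mult_right_mono[of 1 "exp (10 * ?W)" "V * (60 * E)"] by simp
  hence "D0m x + D1m x \<le> exp (10 * ?W) * (V * (48700 * E))" using a b by (simp add: algebra_simps)
  also have "\<dots> \<le> exp (10 * ?W) * ((2 * V0) * (48700 * E))" using V0 E0 by (intro mult_left_mono mult_right_mono) auto
  also have "\<dots> = V0 * (97400 * (exp (11 * ?W) - exp (10 * ?W)))" by (simp add: E_def algebra_simps mult_exp_exp)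
  also have "\<dots> \<le> V0 * (exp (T x) - 1)"
  proof (intro mult_left_mono)
   have "97400 * (exp (11 * ?W) - exp (10 * ?W)) \<le> 97400 * (exp (11 * ?W) - 1)"
    using W0[of x] by (intro mult_left_mono diff_left_mono) auto
   also have "\<dots> \<le> exp (97400 * (11 * ?W)) - 1" by (rule bernoulli_exp) (use W0[of x] in auto)
   also have "\<dots> \<le> exp (T x) - 1" using W0[of x] by (simp add: T_def)
   finally show "97400 * (exp (11 * ?W) - exp (10 * ?W)) \<le> exp (T x) - 1" .
  qed (use V0 in auto)
  finally show ?thesis .
 qed
 have m0: "1 \<le> real m" using m by simp
 define a where "a = 6 * 10^6 * c * real m * \<nu>"
 have aU: "3 * (real m * T x) = a * U x" for x by (simp add: a_def T_def W_def)
 have wj: "w x^j \<le> c^4 * U x^4 * \<sigma>^j" if "j \<le> 4" for j x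
  unfolding w_def power_mult_distrib using c \<sigma> U_ge1[of x] power_increasing[OF that c] power_increasing[OF that U_ge1[of x]]
  by (subst mult.assoc[of "c^4"], subst (2) mult.commute, subst mult.assoc) (intro mult_mono, auto)
 have D1m: "D1m x \<le> 640 * c^4 * q1 * (U x^4 * exp (T x))" for x
 proof -
  let ?c = "c^4 * U x^4"
  have 0: "w x \<le> ?c * \<sigma>" using wj[of 1 x] by simp
  have c0: "0 \<le> ?c" using c U0[of x] by simp
  have "D1m x \<le> 320 * exp (10 * w x) * ((?c * \<sigma>^3) * y * ss + (?c * \<sigma>^2) * y * pp + (?c * \<sigma>^2) * pp^2 + (?c * \<sigma>^4) * ss^2
     + (2 * A) * ((?c * \<sigma>^2) * pp^2 + (?c * \<sigma>^2) * ss^2))"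
   unfolding D1m_def using nn A w0[of x] c0 \<sigma>
   by (intro mult_left_mono add_mono mult_mono mult_right_mono wj) auto
  also have "\<dots> \<le> 320 * exp (10 * w x) * (2 * ?c * q1)"
  proof (intro mult_left_mono)
   have "0 \<le> ?c * (\<sigma>^3 * y * ss + \<sigma>^2 * y * pp + \<sigma>^2 * pp^2 + \<sigma>^4 * ss^2)"
    using nn c0 \<sigma> by (intro mult_nonneg_nonneg add_nonneg_nonneg) auto
   thus "(?c * \<sigma>^3) * y * ss + (?c * \<sigma>^2) * y * pp + (?c * \<sigma>^2) * pp^2 + (?c * \<sigma>^4) * ss^2
     + (2 * A) * ((?c * \<sigma>^2) * pp^2 + (?c * \<sigma>^2) * ss^2) \<le> 2 * ?c * q1"
    unfolding q1_def y_def[symmetric] pp_def[symmetric] ss_def[symmetric] by (simp add: algebra_simps)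
  qed auto
  also have "\<dots> = 640 * c^4 * q1 * (U x^4 * exp (10 * w x))" by (simp add: algebra_simps)
  also have "\<dots> \<le> 640 * c^4 * q1 * (U x^4 * exp (T x))"
  proof (intro mult_left_mono)
   show "exp (10 * w x) \<le> exp (T x)" using wW[of x] W0[of x] by (simp add: T_def)
   show "0 \<le> 640 * c^4 * q1" unfolding q1_def using c \<sigma> A by (intro mult_nonneg_nonneg add_nonneg_nonneg) auto
  qed auto
  finally show ?thesis .
 qed
 have D0m: "(D0m x)^2 \<le> 256 * c^4 * q0 * U x^4" for x
 proof -
  let ?c = "c^4 * U x^4"
  have c0: "0 \<le> ?c" using c U0[of x] by simp
  define z1 z2 z3 z4 where "z1 = w x * y * pp" and "z2 = (w x)^2 * y * ss" and "z3 = A2 * (w x * pp^2)" and "z4 = A2 * (w x * pp * ss)"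
  have "D0m x = 4 * (z1 + z2 + z3 + z4)" by (simp add: D0m_def z1_def z2_def z3_def z4_def algebra_simps)
  hence "(D0m x)^2 = 16 * (z1 + z2 + z3 + z4)^2" by (simp only: power_mult_distrib) simp
  also have "(z1 + z2 + z3 + z4)^2 \<le> 4 * (z1^2 + z2^2 + z3^2 + z4^2)"
  proof -
   have "4 * (z1^2 + z2^2 + z3^2 + z4^2) - (z1 + z2 + z3 + z4)\<^sup>2
     = (z1 - z2)^2 + (z1 - z3)^2 + (z1 - z4)^2 + (z2 - z3)^2 + (z2 - z4)^2 + (z3 - z4)^2"
    by (simp add: power2_eq_square algebra_simps)
   thus ?thesis by (smt (verit) zero_le_power2)
  qed
  also have "z1^2 \<le> ?c * (\<sigma>^2 * y^2 * pp^2)"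
   using mult_right_mono[OF wj[of 2 x], of "y^2 * pp^2"] by (simp add: z1_def power_mult_distrib mult.assoc)
  also have "z2^2 \<le> ?c * (\<sigma>^4 * y^2 * ss^2)"
   using mult_right_mono[OF wj[of 4 x], of "y^2 * ss^2"] by (simp add: z2_def power_mult_distrib mult.assoc flip: power_mult)
  also have "z3^2 \<le> 4 * ?c * (A^2 * (\<sigma>^2 * pp^4))"
  proof -
   have "z3^2 = A2^2 * ((w x)^2 * pp^4)" by (simp add: z3_def power_mult_distrib flip: power_mult)
   also have "\<dots> \<le> (2 * A)^2 * ((?c * \<sigma>^2) * pp^4)" using A nn by (intro mult_mono power_mono wj) auto
   finally show ?thesis by (simp add: power_mult_distrib mult_ac)
  qed
  also have "z4^2 \<le> 4 * ?c * (A^2 * (\<sigma>^2 * pp^2 * ss^2))"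
  proof -
   have "z4^2 = A2^2 * ((w x)^2 * (pp^2 * ss^2))" by (simp add: z4_def power_mult_distrib mult.assoc)
   also have "\<dots> \<le> (2 * A)^2 * ((?c * \<sigma>^2) * (pp^2 * ss^2))" using A nn by (intro mult_mono power_mono wj) auto
   finally show ?thesis by (simp add: power_mult_distrib mult_ac)
  qed
  also have "16 * (4 * (?c * (\<sigma>^2 * y^2 * pp^2) + ?c * (\<sigma>^4 * y^2 * ss^2) + 4 * ?c * (A^2 * (\<sigma>^2 * pp^4)) + 4 * ?c * (A^2 * (\<sigma>^2 * pp^2 * ss^2))))
    \<le> 256 * (?c * q0)"
  proof -
   have "0 \<le> ?c * (\<sigma>^2 * y^2 * pp^2)" "0 \<le> ?c * (\<sigma>^4 * y^2 * ss^2)" using c0 by auto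
   thus ?thesis unfolding q0_def y_def[symmetric] pp_def[symmetric] ss_def[symmetric] by (simp add: algebra_simps)
  qed
  finally show ?thesis by (simp add: mult_ac)
 qed
 \<comment> \<open>The term with \<open>D0\<close> is kept apart because its mean is zero;
   everything else is a constant times \<open>U^4 * exp (a U)\<close>. The exponent \<open>a\<close>
   collects up to three factors \<open>exp (m T)\<close>.\<close>
 define RHS where "RHS x = V0^m * (1 + real m * D0 x / V0
   + (1920 * c^4 * real m * q1 / V0 + 512 * c^4 * (real m)^2 * q0 / V0^2) * (U x^4 * exp (a * U x)))" for x
 have q_nn: "0 \<le> q1" "0 \<le> q0" unfolding q1_def q0_def using \<sigma> A by (intro add_nonneg_nonneg mult_nonneg_nonneg; simp)+
 have pw: "((cmod (Y' x))^2 + A2 * (cmod (P' x))^2 + \<epsilon>)^m \<le> RHS x" for x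
 proof -
  define yv where "yv = (D0 x + D1 x) / V0"
  let ?e = "exp (real m * T x)"
  have e1: "1 \<le> ?e" using T0[of x] by simp
  have yv_le: "\<bar>yv\<bar> \<le> exp (T x) - 1"
  proof -
   have "\<bar>D0 x + D1 x\<bar> \<le> V0 * (exp (T x) - 1)" using D0a[of x] D1a[of x] small[of x] by linarith
   thus ?thesis using V0 by (simp add: yv_def pos_divide_le_eq mult.commute)
  qed
  \<comment> \<open>This turns the quadratic contribution of \<open>D1m\<close>, which carries
    \<open>m^2\<close>, into a linear one with the factor \<open>m\<close>, at the price of one more
    factor \<open>?e\<close>.\<close>
  have D1s: "real m * (D1m x / V0) \<le> ?e"
  proof -
   have "D1m x \<le> V0 * (exp (T x) - 1)" using small[of x] D0a[of x] by linarith
   hence "real m * (D1m x / V0) \<le> real m * (exp (T x) - 1)"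
    using V0 by (intro mult_left_mono) (auto simp: pos_divide_le_eq mult.commute)
   also have "\<dots> \<le> exp (real m * T x) - 1" using bernoulli_exp[OF m0 T0] .
   finally show ?thesis by linarith
  qed
  have "(cmod (Y' x))^2 + A2 * (cmod (P' x))^2 + \<epsilon> = y^2 + A2 * (cmod \<rho>)^2 * pp^2 + \<epsilon> + (D0 x + D1 x)"
   by (simp add: D1_def y_def pp_def norm_mult power_mult_distrib algebra_simps)
  also have "\<dots> \<le> V0 + (D0 x + D1 x)"
   using mult_right_mono[OF \<rho>(2), of "pp^2"] by (simp add: V0_def y_def pp_def)
  also have "\<dots> = V0 * (1 + yv)" using V0 by (simp add: yv_def field_simps)
  finally have "((cmod (Y' x))^2 + A2 * (cmod (P' x))^2 + \<epsilon>)^m \<le> (V0 * (1 + yv))^m"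
   using A \<epsilon> by (intro power_mono) auto
  also have "\<dots> = V0^m * (1 + yv)^m" by (simp add: power_mult_distrib)
  also have "\<dots> \<le> V0^m * (1 + real m * D0 x / V0 + real m * (D1m x / V0) + (real m)^2 * (2 * (D0m x)^2 / V0^2 + 2 * (D1m x / V0)^2) * ?e)"
  proof (intro mult_left_mono)
   have "(1 + yv)^m \<le> 1 + real m * yv + (real m)^2 * yv^2 * (1 + \<bar>yv\<bar>)^m"
    using power_one_plus_quadratic(2)[of yv m] by linarith
   also have "real m * yv \<le> real m * D0 x / V0 + real m * (D1m x / V0)"
   proof -
    have "real m * yv = real m * D0 x / V0 + real m * (D1 x / V0)" by (simp add: yv_def add_divide_distrib distrib_left)
    moreover have "real m * (D1 x / V0) \<le> real m * (D1m x / V0)" using D1a[of x] V0 by (intro mult_left_mono divide_right_mono) auto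
    ultimately show ?thesis by linarith
   qed
   also have "(real m)^2 * yv^2 * (1 + \<bar>yv\<bar>)^m \<le> (real m)^2 * (2 * (D0m x)^2 / V0^2 + 2 * (D1m x / V0)^2) * ?e"
   proof (intro mult_mono)
    have "(D0 x + D1 x)^2 \<le> 2 * ((D0 x)^2 + (D1 x)^2)" using sum_squares_bound[of "D0 x" "D1 x"] by (simp add: power2_sum)
    also have "\<dots> \<le> 2 * ((D0m x)^2 + (D1m x)^2)" using D0a[of x] D1a[of x] by (intro mult_left_mono add_mono) (auto simp: abs_le_square_iff[symmetric])
    finally have "yv^2 \<le> 2 * ((D0m x)^2 + (D1m x)^2) / V0^2" unfolding yv_def power_divide by (intro divide_right_mono) auto
    thus "yv^2 \<le> 2 * (D0m x)^2 / V0^2 + 2 * (D1m x / V0)^2" by (simp add: power_divide add_divide_distrib)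
    have "(1 + \<bar>yv\<bar>)^m \<le> exp (T x)^m" using yv_le by (intro power_mono) auto
    thus "(1 + \<bar>yv\<bar>)^m \<le> ?e" by (simp add: exp_of_nat_mult[symmetric])
   qed auto
   finally show "(1 + yv)^m \<le> 1 + real m * D0 x / V0 + real m * (D1m x / V0) + (real m)^2 * (2 * (D0m x)^2 / V0^2 + 2 * (D1m x / V0)^2) * ?e"
    by simp
  qed (use V0 in auto)
  also have "\<dots> \<le> RHS x"
   unfolding RHS_def
  proof (intro mult_left_mono)
   define X where "X = D1m x / V0"
   have X0: "0 \<le> X" using D1a[of x] V0 by (simp add: X_def)
   have X2: "(real m)^2 * (2 * X^2) * ?e \<le> 2 * real m * X * ?e * ?e"
    using mult_right_mono[OF D1s[folded X_def], of "2 * real m * X * ?e"] X0 by (simp add: power2_eq_square mult_ac)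
   have X1: "real m * X \<le> real m * X * ?e * ?e"
    using e1 X0 mult_left_mono[OF mult_mono[OF e1 e1], of "real m * X"] by (simp add: mult.assoc)
   have "X \<le> 640 * c^4 * q1 / V0 * (U x^4 * exp (T x))"
    using divide_right_mono[OF D1m[of x], of V0] V0 by (simp add: X_def mult_ac)
   hence "3 * real m * ?e * ?e * X \<le> 3 * real m * ?e * ?e * (640 * c^4 * q1 / V0 * (U x^4 * exp (T x)))"
    by (intro mult_left_mono) auto
   also have "\<dots> = 1920 * c^4 * real m * q1 / V0 * (U x^4 * exp (T x + 2 * (real m * T x)))"
   proof -
    have "exp (T x + 2 * (real m * T x)) = exp (T x) * (?e * ?e)" by (simp only: exp_add mult_2)
    thus ?thesis by (simp only: mult_ac times_divide_eq_right times_divide_eq_left) simp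
   qed
   also have "\<dots> \<le> 1920 * c^4 * real m * q1 / V0 * (U x^4 * exp (a * U x))"
   proof (intro mult_left_mono)
    have "T x \<le> real m * T x" using m0 T0[of x] mult_right_mono[OF m0 T0[of x]] by simp
    thus "exp (T x + 2 * (real m * T x)) \<le> exp (a * U x)" unfolding aU[symmetric] by simp
   qed (use c q_nn V0 in auto)
   finally have P1: "3 * real m * ?e * ?e * X \<le> 1920 * c^4 * real m * q1 / V0 * (U x^4 * exp (a * U x))" .
   have "(real m)^2 * (2 * (D0m x)^2 / V0^2) * ?e \<le> (real m)^2 * (2 * (256 * c^4 * q0 * U x^4) / V0^2) * ?e"
    using D0m[of x] by (intro mult_right_mono mult_left_mono divide_right_mono) auto
   also have "\<dots> = 512 * c^4 * (real m)^2 * q0 / V0^2 * (U x^4 * ?e)" by (simp add: mult_ac)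
   also have "\<dots> \<le> 512 * c^4 * (real m)^2 * q0 / V0^2 * (U x^4 * exp (a * U x))"
    using aU[of x] T0[of x] c q_nn V0 by (intro mult_left_mono) (auto simp flip: aU)
   finally have P2: "(real m)^2 * (2 * (D0m x)^2 / V0^2) * ?e \<le> 512 * c^4 * (real m)^2 * q0 / V0^2 * (U x^4 * exp (a * U x))" .
   have "(real m)^2 * (2 * (D0m x)^2 / V0^2 + 2 * X^2) * ?e = (real m)^2 * (2 * (D0m x)^2 / V0^2) * ?e + (real m)^2 * (2 * X^2) * ?e"
    by (simp add: algebra_simps)
   moreover have "3 * real m * ?e * ?e * X = real m * X * ?e * ?e + 2 * real m * X * ?e * ?e" by (simp add: algebra_simps)
   ultimately show "1 + real m * D0 x / V0 + real m * (D1m x / V0) + (real m)^2 * (2 * (D0m x)^2 / V0^2 + 2 * (D1m x / V0)^2) * ?e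
     \<le> 1 + real m * D0 x / V0 + (1920 * c^4 * real m * q1 / V0 + 512 * c^4 * (real m)^2 * q0 / V0^2) * (U x^4 * exp (a * U x))"
    unfolding X_def[symmetric] distrib_right using X1 X2 P1 P2 by linarith
  qed (use V0 in auto)
  finally show ?thesis .
 qed
 \<comment> \<open>The linear terms are centred, and the quadratic one is centred because the mean
   of \<open>lin f1 f2\<close> squared (the complex square) is
   \<open>f1^2 + f2^2 * v\<close>.\<close>
 have D0_int: "integrable M D0" "expectation D0 = 0"
 proof -
  have I: "integrable M (\<lambda>x. 2 * (cnj Y * (lin t1 t2 x * p + ((f1^2 + f2^2 * of_real v) / 2 - (lin f1 f2 x)\<^sup>2 / 2) * s)))"
     "integrable M (\<lambda>x. of_real A2 * (2 * (cnj (\<rho> * p) * ((lin \<tau>1 \<tau>2 x + \<rho> * lin f1 f2 x) * p - lin \<phi>1 \<phi>2 x * s))))"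
   using lin_expect(1) lin_sq_expect(1) by (auto simp del: of_real_power)
  have "integrable M D0c" "(LINT x|M. D0c x) = 0"
   unfolding D0c_def using I lin_expect lin_sq_expect by (auto simp: prob_space simp del: of_real_power)
  thus "integrable M D0" "expectation D0 = 0" unfolding D0_def by (auto simp: integral_Re)
 qed
 note UM = U_moment[OF m(2)[folded a_def]]
 have RHS_int: "integrable M RHS" unfolding RHS_def using D0_int UM by auto
 have "(\<integral>\<^sup>+x. ennreal (((cmod (Y' x))^2 + A2 * (cmod (P' x))^2 + \<epsilon>)^m) \<partial>M) \<le> (\<integral>\<^sup>+x. ennreal (RHS x) \<partial>M)"
  by (intro nn_integral_mono ennreal_leI pw)
 also have "\<dots> = ennreal (expectation RHS)"
 proof (rule nn_integral_eq_integral[OF RHS_int], intro AE_I2)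
  fix x show "0 \<le> RHS x" by (rule order_trans[OF _ pw]) (use A \<epsilon> in auto)
 qed
 also have "expectation RHS = V0^m * (1 + (1920 * c^4 * real m * q1 / V0 + 512 * c^4 * (real m)^2 * q0 / V0^2) * expectation (\<lambda>x. U x^4 * exp (a * U x)))"
  unfolding RHS_def using D0_int UM by (simp add: prob_space)
 also have "\<dots> \<le> V0^m * (1 + (1920 * c^4 * real m * q1 / V0 + 512 * c^4 * (real m)^2 * q0 / V0^2) * Bm)"
  using UM V0 c q_nn by (intro mult_left_mono add_left_mono) auto
 finally show ?thesis by (simp add: algebra_simps ennreal_leI)
qed

end

text \<open>The step gains \<open>B / 2\<close> from the contraction, that is a factor
  \<open>exp (- m B / (2 V))\<close>. Every error term containing \<open>p\<close> is bounded by a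
  small multiple of \<open>B / V\<close> plus a term of \<open>cost\<close>; the multiples of
  \<open>B / V\<close> together stay below that gain. Conditions \<open>c1\<close> to
  \<open>c3\<close> say that the noise is weak compared with the contraction by the factor
  \<open>K\<close>.\<close>

lemma lyapunov_algebra:
 fixes y p s A \<epsilon> \<theta> \<sigma> G K :: real and m :: nat
 assumes nn: "0 \<le> y" "0 \<le> p" "0 \<le> s" "s \<le> 1 + y" and A: "0 < A" "A \<le> 2" and \<epsilon>: "0 < \<epsilon>" "\<epsilon> \<le> 1"
  and \<theta>: "0 < \<theta>" "\<theta> \<le> 1" and \<sigma>: "0 < \<sigma>" "\<sigma>^2 \<le> A" and m: "1 \<le> m" and G: "1 \<le> G" and K: "400 * G \<le> K"
  and c1: "K * real m * \<sigma>^2 \<le> \<theta> * A" and c2: "K * real m * \<sigma>^2 \<le> \<theta>" and c3: "K * real m * \<sigma>^2 * A \<le> 2 * \<theta> * \<epsilon>"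
 defines "V \<equiv> y^2 + A * p^2 + \<epsilon>" and "V0 \<equiv> y^2 + A * (1 - \<theta> / 2) * p^2 + \<epsilon>"
  and "q1 \<equiv> \<sigma>^3 * y * s + \<sigma>^2 * y * p + \<sigma>^2 * p^2 + \<sigma>^4 * s^2 + A * (\<sigma>^2 * p^2 + \<sigma>^2 * s^2)"
  and "q0 \<equiv> \<sigma>^2 * y^2 * p^2 + \<sigma>^4 * y^2 * s^2 + A^2 * (\<sigma>^2 * p^4 + \<sigma>^2 * p^2 * s^2)"
  and "cost \<equiv> \<sigma>^3 / sqrt \<epsilon> + \<sigma>^4 / (\<theta> * A) + A * \<sigma>^2 / \<epsilon> + real m * \<sigma>^4 / \<epsilon>"
 shows "V0^m * (1 + G * real m * q1 / V0 + G * (real m)^2 * q0 / V0^2) \<le> V^m * exp (16 * G^2 * real m * cost)"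
proof -
 define r1 r2 r3 r4 where "r1 = \<sigma>^3 / sqrt \<epsilon>" and "r2 = \<sigma>^4 / (\<theta> * A)" and "r3 = A * \<sigma>^2 / \<epsilon>" and "r4 = real m * \<sigma>^4 / \<epsilon>"
 \<comment> \<open>Twice the gain by contraction: \<open>V0 = V - B / 2\<close>.\<close>
 define B where "B = \<theta> * A * p^2"
 have K0: "0 < K" using G K by linarith
 have m0: "1 \<le> real m" using m by simp
 have B0: "0 \<le> B" using \<theta> A by (simp add: B_def)
 have V: "0 < V" "y^2 \<le> V" "\<epsilon> \<le> V" "A * p^2 \<le> V"
  using \<epsilon> A unfolding V_def by (simp_all add: add_nonneg_pos)
 have BV: "B \<le> V"
 proof -
  have "B \<le> 1 * (A * p^2)" unfolding B_def mult.assoc using \<theta> A by (intro mult_right_mono) auto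
  thus ?thesis using V by linarith
 qed
 have V0: "V0 = V - B / 2" by (simp add: V0_def V_def B_def algebra_simps)
 have V0p: "0 < V0" "V \<le> 2 * V0" using V0 BV V B0 by linarith+
 have s2: "s^2 \<le> 4 * V / \<epsilon>"
 proof -
  have "s^2 \<le> (1 + y)^2" using nn by (intro power_mono) auto
  also have "\<dots> \<le> 2 * (1 + y^2)" using sum_squares_bound[of 1 y] by (simp add: power2_sum)
  also have "\<dots> \<le> 2 * (V / \<epsilon> + V / \<epsilon>)"
  proof (intro mult_left_mono add_mono)
   show "1 \<le> V / \<epsilon>" using V \<epsilon> by simp
   have "V \<le> V / \<epsilon>" using V \<epsilon> mult_left_mono[of \<epsilon> 1 V] by (simp add: field_simps)
   thus "y^2 \<le> V / \<epsilon>" using V by linarith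
  qed simp
  finally show ?thesis by simp
 qed
 have sp: "K * real m * (\<sigma>^2 * p^2) \<le> B" using mult_right_mono[OF c1, of "p^2"] by (simp add: B_def mult.assoc)
 have sp1: "K * (\<sigma>^2 * p^2) \<le> B"
 proof -
  have "K * (\<sigma>^2 * p^2) \<le> real m * (K * (\<sigma>^2 * p^2))" using m0 K0 mult_right_mono[OF m0, of "K * (\<sigma>^2 * p^2)"] by simp
  thus ?thesis using sp by (simp add: mult_ac)
 qed
 have t1: "\<sigma>^3 * y * s \<le> 2 * (\<sigma>^3 / sqrt \<epsilon>) * V"
 proof -
  have se: "0 < sqrt \<epsilon>" "sqrt \<epsilon> \<le> 1" "sqrt \<epsilon> * sqrt \<epsilon> = \<epsilon>" using \<epsilon> by auto
  have "2 * (y * sqrt \<epsilon>) \<le> y^2 + \<epsilon>" using sum_squares_bound[of y "sqrt \<epsilon>"] \<epsilon> by simp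
  also have "\<dots> \<le> V" using A by (simp add: V_def)
  finally have a: "y * sqrt \<epsilon> \<le> V" using mult_nonneg_nonneg[OF nn(1) less_imp_le[OF se(1)]] by linarith
  have "y^2 * sqrt \<epsilon> \<le> V * 1" using V se by (intro mult_mono) auto
  hence "(y * s) * sqrt \<epsilon> \<le> 2 * V"
   using a mult_right_mono[OF mult_left_mono[OF nn(4) nn(1)], of "sqrt \<epsilon>"] se by (simp add: algebra_simps power2_eq_square)
  hence "y * s \<le> 2 * V / sqrt \<epsilon>" using se by (simp add: field_simps)
  from mult_left_mono[OF this, of "\<sigma>^3"] show ?thesis using \<sigma> by (simp add: mult_ac)
 qed
 \<comment> \<open>The only cross term of \<open>y\<close> and \<open>p\<close> that is linear in
   \<open>p\<close>. The weight in \<open>2 a b \<le> a^2 + b^2\<close> is tuned so that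
   \<open>p\<close> costs \<open>B / (32 G)\<close>; the part with \<open>y\<close> becomes the
   second term of \<open>cost\<close>.\<close>
 have t2: "\<sigma>^2 * y * p \<le> B / (32 * G) + 8 * G * (\<sigma>^4 / (\<theta> * A)) * V"
 proof -
  define a b where "a = sqrt (\<theta> * A / (32 * G)) * p" and "b = \<sigma>^2 * y / (2 * sqrt (\<theta> * A / (32 * G)))"
  have g: "0 < \<theta> * A / (32 * G)" using \<theta> A G by simp
  have "\<sigma>^2 * y * p = 2 * a * b"
  proof -
   define rr where "rr = sqrt (\<theta> * A / (32 * G))"
   have "0 < rr" unfolding rr_def by (rule real_sqrt_gt_zero[OF g])
   thus ?thesis unfolding a_def b_def rr_def[symmetric] by simp
  qed
  also have "\<dots> \<le> a^2 + b^2" by (rule sum_squares_bound)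
  also have "a^2 = B / (32 * G)" using g by (simp add: a_def B_def power_mult_distrib)
  also have "b^2 = 8 * G * (\<sigma>^4 / (\<theta> * A)) * y^2"
   using g \<theta> A G by (simp add: b_def power_mult_distrib power_divide field_simps flip: power_mult)
  also have "\<dots> \<le> 8 * G * (\<sigma>^4 / (\<theta> * A)) * V" using V G \<theta> A by (intro mult_left_mono) auto
  finally show ?thesis by simp
 qed
 have t3: "\<sigma>^2 * p^2 \<le> B / K" using sp1 K0 by (simp add: field_simps)
 have t5: "A * (\<sigma>^2 * s^2) \<le> 4 * (A * \<sigma>^2 / \<epsilon>) * V"
  using mult_left_mono[OF s2, of "A * \<sigma>^2"] A by (simp add: mult_ac)
 have t4: "\<sigma>^4 * s^2 \<le> 4 * (A * \<sigma>^2 / \<epsilon>) * V"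
 proof -
  have "\<sigma>^4 * s^2 = \<sigma>^2 * (\<sigma>^2 * s^2)" by (simp add: mult.assoc flip: power_add)
  also have "\<dots> \<le> A * (\<sigma>^2 * s^2)" using \<sigma> by (intro mult_right_mono) auto
  finally show ?thesis using t5 by linarith
 qed
 have t6: "A * (\<sigma>^2 * p^2) \<le> 2 * (B / K)"
  using mult_mono[OF A(2) t3] A by simp
 have q1: "q1 \<le> (2 * (\<sigma>^3 / sqrt \<epsilon>) + 8 * G * (\<sigma>^4 / (\<theta> * A)) + 8 * (A * \<sigma>^2 / \<epsilon>)) * V + B / (32 * G) + 3 * (B / K)"
 proof -
  have "q1 \<le> 2 * r1 * V + (B / (32 * G) + 8 * G * r2 * V) + B / K + 4 * r3 * V + (2 * (B / K) + 4 * r3 * V)"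
   unfolding q1_def distrib_left r1_def r2_def r3_def by (intro add_mono t1 t2 t3 t4 t5 t6)
  also have "\<dots> = (2 * r1 + 8 * G * r2 + 8 * r3) * V + B / (32 * G) + 3 * (B / K)" by (simp add: algebra_simps)
  finally show ?thesis by (simp only: r1_def r2_def r3_def)
 qed
 have u1: "real m * (\<sigma>^2 * y^2 * p^2) \<le> (B / K) * V"
 proof -
  have "real m * (\<sigma>^2 * p^2) \<le> B / K" using sp K0 by (simp add: field_simps)
  from mult_mono[OF this V(2)] show ?thesis using B0 K0 by (simp add: mult_ac)
 qed
 have u2: "real m * (\<sigma>^4 * y^2 * s^2) \<le> 4 * (real m * \<sigma>^4 / \<epsilon>) * V * V"
  using mult_left_mono[OF mult_mono[OF V(2) s2], of "real m * \<sigma>^4"] V by (simp add: mult_ac)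
 have u3: "real m * (A^2 * (\<sigma>^2 * p^4)) \<le> (B / K) * V"
 proof -
  have "K * (real m * (A * (\<sigma>^2 * p^2))) \<le> B"
   using mult_right_mono[OF c2, of "A * p^2"] A by (simp add: B_def mult_ac)
  hence "real m * (A * (\<sigma>^2 * p^2)) \<le> B / K" using K0 by (simp add: field_simps)
  from mult_mono[OF this V(4)] show ?thesis using B0 K0 A by (simp add: mult_ac power2_eq_square power4_eq_xxxx)
 qed
 have u4: "real m * (A^2 * (\<sigma>^2 * p^2 * s^2)) \<le> 8 * (B / K) * V"
 proof -
  have "K * (real m * \<sigma>^2 * A) * (A * p^2) \<le> 2 * \<theta> * \<epsilon> * (A * p^2)"
   using mult_right_mono[OF c3, of "A * p^2"] A by (simp add: mult_ac)
  hence "real m * (A^2 * (\<sigma>^2 * p^2)) \<le> 2 * \<epsilon> * (B / K)" using K0 by (simp add: B_def field_simps power2_eq_square)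
  from mult_mono[OF this s2] have "real m * (A^2 * (\<sigma>^2 * p^2)) * s^2 \<le> 2 * \<epsilon> * (B / K) * (4 * V / \<epsilon>)" using B0 K0 \<epsilon> by simp
  also have "\<dots> = 8 * (B / K) * V" using \<epsilon> by simp
  finally show ?thesis by (simp add: mult_ac)
 qed
 have q0: "real m * q0 \<le> 4 * (real m * \<sigma>^4 / \<epsilon>) * V * V + 10 * (B / K) * V"
  unfolding q0_def distrib_left using u1 u2 u3 u4 by linarith
 have q_nn: "0 \<le> q1" "0 \<le> q0" unfolding q1_def q0_def using nn \<sigma> A by auto
 define BV where "BV = B / V"
 have BV0: "0 \<le> BV" using B0 V by (simp add: BV_def)
 have r_nn: "0 \<le> r1" "0 \<le> r2" "0 \<le> r3" "0 \<le> r4" using \<sigma> A \<theta> \<epsilon> by (auto simp: r1_def r2_def r3_def r4_def)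
 have e1: "q1 / V0 \<le> 2 * (2 * r1 + 8 * G * r2 + 8 * r3 + BV / (32 * G) + 3 * (BV / K))"
 proof -
  have "q1 / V0 \<le> q1 / (V / 2)" using V V0p q_nn by (intro divide_left_mono) auto
  hence "q1 / V0 \<le> 2 * (q1 / V)" by (simp add: mult.commute)
  also have "q1 / V \<le> ((2 * r1 + 8 * G * r2 + 8 * r3) * V + B / (32 * G) + 3 * (B / K)) / V"
   using q1 V by (intro divide_right_mono) (auto simp: r1_def r2_def r3_def)
  also have "\<dots> = 2 * r1 + 8 * G * r2 + 8 * r3 + BV / (32 * G) + 3 * (BV / K)"
   using V by (simp add: add_divide_distrib BV_def mult.commute)
  finally show ?thesis by simp
 qed
 have e2: "real m * q0 / V0^2 \<le> 4 * (4 * r4 + 10 * (BV / K))"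
 proof -
  have "V^2 \<le> (2 * V0)^2" using V V0p by (intro power_mono) auto
  hence "real m * q0 / V0^2 \<le> 4 * (real m * q0 / V^2)" using V V0p q_nn by (simp add: field_simps mult_left_mono power_mult_distrib)
  also have "real m * q0 / V^2 \<le> (4 * r4 * V * V + 10 * (B / K) * V) / V^2"
   using q0 V by (intro divide_right_mono) (auto simp: r4_def)
  also have "\<dots> = 4 * r4 + 10 * (BV / K)" using V by (simp add: add_divide_distrib BV_def power2_eq_square)
  finally show ?thesis by simp
 qed
 \<comment> \<open>In total \<open>BV\<close> appears with \<open>1/16 + 46/400\<close>, which is
   below the available \<open>1/2\<close>.\<close>
 have GK: "G * (BV / K) \<le> BV / 400"
 proof -
  have "G / K \<le> 1 / 400" using K K0 by (simp add: field_simps)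
  from mult_right_mono[OF this BV0] show ?thesis by (simp add: mult_ac)
 qed
 have "G * real m * q1 / V0 + G * (real m)^2 * q0 / V0^2 = real m * (G * (q1 / V0) + G * (real m * q0 / V0^2))"
  by (simp add: algebra_simps power2_eq_square)
 also have "\<dots> \<le> real m * (16 * G^2 * cost + BV / 2)"
 proof (intro mult_left_mono)
  have "G * (q1 / V0) \<le> G * (2 * (2 * r1 + 8 * G * r2 + 8 * r3 + BV / (32 * G) + 3 * (BV / K)))"
   using e1 G by (intro mult_left_mono) auto
  also have "\<dots> = 4 * (G * r1) + 16 * (G^2 * r2) + 16 * (G * r3) + BV / 16 + 6 * (G * (BV / K))"
   using G by (simp add: algebra_simps power2_eq_square)
  finally have a: "G * (q1 / V0) \<le> 4 * (G * r1) + 16 * (G^2 * r2) + 16 * (G * r3) + BV / 16 + 6 * (G * (BV / K))" .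
  have "G * (real m * q0 / V0^2) \<le> G * (4 * (4 * r4 + 10 * (BV / K)))"
   using e2 G by (intro mult_left_mono) auto
  also have "\<dots> = 16 * (G * r4) + 40 * (G * (BV / K))" by (simp add: algebra_simps)
  finally have b: "G * (real m * q0 / V0^2) \<le> 16 * (G * r4) + 40 * (G * (BV / K))" .
  have GG: "G \<le> G^2" using G mult_left_mono[of 1 G G] by (simp add: power2_eq_square)
  have "G * r1 \<le> G^2 * r1" "G * r3 \<le> G^2 * r3" "G * r4 \<le> G^2 * r4" "0 \<le> G^2 * r1"
   using GG r_nn by (auto intro: mult_right_mono)
  moreover have "16 * G^2 * cost = 16 * (G^2 * r1) + 16 * (G^2 * r2) + 16 * (G^2 * r3) + 16 * (G^2 * r4)"
   by (simp add: cost_def r1_def r2_def r3_def r4_def distrib_left)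
  moreover define z1 z2 z3 z4 where "z1 = G * (q1 / V0)" and "z2 = G * (real m * q0 / V0^2)" and "z3 = 16 * G^2 * cost" and "z4 = G * (BV / K)"
  ultimately have "z1 + z2 \<le> z3 + BV / 2" using a b GK BV0 unfolding z1_def[symmetric] z2_def[symmetric] z4_def[symmetric] by linarith
  thus "G * (q1 / V0) + G * (real m * q0 / V0^2) \<le> 16 * G^2 * cost + BV / 2" unfolding z1_def z2_def z3_def .
 qed simp
 finally have x: "1 + G * real m * q1 / V0 + G * (real m)^2 * q0 / V0^2 \<le> exp (real m * (16 * G^2 * cost + BV / 2))"
  using exp_ge_add_one_self[of "real m * (16 * G^2 * cost + BV / 2)"] by linarith
 have "V0 \<le> V * exp (- BV / 2)"
 proof -
  have "V0 = V * (1 + (- BV / 2))" using V by (simp add: V0 BV_def field_simps)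
  also have "\<dots> \<le> V * exp (- BV / 2)" using V by (intro mult_left_mono exp_ge_add_one_self) auto
  finally show ?thesis .
 qed
 hence "V0^m \<le> (V * exp (- BV / 2))^m" using V0p by (intro power_mono) auto
 also have "\<dots> = V^m * exp (- (real m * (BV / 2)))" by (simp add: power_mult_distrib exp_of_nat_mult[symmetric])
 finally have "V0^m * (1 + G * real m * q1 / V0 + G * (real m)^2 * q0 / V0^2)
   \<le> (V^m * exp (- (real m * (BV / 2)))) * exp (real m * (16 * G^2 * cost + BV / 2))"
  using x V V0p q_nn G by (intro mult_mono) auto
 also have "\<dots> = V^m * exp (16 * G^2 * real m * cost)" by (simp add: mult.assoc mult_exp_exp algebra_simps)
 finally show ?thesis .
qed

context step_noise begin

lemma one_step_moment:
 fixes f1 f2 fh2 t1 t2 \<tau>1 \<tau>2 \<phi>1 \<phi>2 \<rho> e Y p :: complex and c \<sigma> \<nu> A A2 \<epsilon> \<theta> K G :: real and m :: nat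
 assumes c: "1 \<le> c" and \<sigma>: "0 < \<sigma>" "c * \<sigma> \<le> 1"
  and f: "cmod f1 \<le> c * \<sigma>" "cmod f2 \<le> c * \<sigma>" "cmod (fh2 - f2) \<le> c * \<sigma>^3"
  and t: "cmod t1 \<le> c * \<sigma>" "cmod t2 \<le> c * \<sigma>" and \<tau>: "cmod \<tau>1 \<le> c * \<sigma>" "cmod \<tau>2 \<le> c * \<sigma>"
  and \<phi>: "cmod \<phi>1 \<le> c * \<sigma>" "cmod \<phi>2 \<le> c * \<sigma>" and e: "cmod e \<le> c * \<sigma>^2"
  and \<rho>: "cmod \<rho> \<le> 1" "A2 * (cmod \<rho>)^2 \<le> A * (1 - \<theta> / 2)" and A: "0 < A" "A \<le> 2" "0 \<le> A2" "A2 \<le> 2 * A"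
  and \<epsilon>: "0 < \<epsilon>" "\<epsilon> \<le> 1" and \<theta>: "0 < \<theta>" "\<theta> \<le> 1"
  and \<nu>: "0 < \<nu>" "\<sigma>^2 \<le> \<nu>^2 * A" "\<sigma>^2 \<le> \<nu>^2 * \<epsilon>" and m: "1 \<le> m" "6 * 10^6 * c * real m * \<nu> \<le> h / 4"
  and G: "1 \<le> G" "1920 * c^4 * Bm \<le> G" and K: "400 * G \<le> K" and \<sigma>A: "\<sigma>^2 \<le> A"
  and c1: "K * real m * \<sigma>^2 \<le> \<theta> * A" and c2: "K * real m * \<sigma>^2 \<le> \<theta>" and c3: "K * real m * \<sigma>^2 * A \<le> 2 * \<theta> * \<epsilon>"
 shows "(\<integral>\<^sup>+\<omega>. ennreal (((cmod (exp (lin f1 f2 \<omega> + (f1^2 + f2^2 * of_real v) / 2) * ((1 + Y) * (1 - lin f1 fh2 \<omega>) + (e + lin t1 t2 \<omega>) * p) - 1))^2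
    + A2 * (cmod (exp (lin f1 f2 \<omega> + (f1^2 + f2^2 * of_real v) / 2) * ((\<rho> + lin \<tau>1 \<tau>2 \<omega>) * p - lin \<phi>1 \<phi>2 \<omega> * (1 + Y))))^2 + \<epsilon>)^m) \<partial>M)
  \<le> ennreal (((cmod Y)^2 + A * (cmod p)^2 + \<epsilon>)^m * exp (16 * G^2 * real m *
    (\<sigma>^3 / sqrt \<epsilon> + \<sigma>^4 / (\<theta> * A) + A * \<sigma>^2 / \<epsilon> + real m * \<sigma>^4 / \<epsilon>)))"
proof -
 define V0 where "V0 = (cmod Y)^2 + A * (1 - \<theta> / 2) * (cmod p)^2 + \<epsilon>"
 define q1 where "q1 = \<sigma>^3 * cmod Y * cmod (1 + Y) + \<sigma>^2 * cmod Y * cmod p + \<sigma>^2 * (cmod p)^2 + \<sigma>^4 * (cmod (1 + Y))^2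
     + A * (\<sigma>^2 * (cmod p)^2 + \<sigma>^2 * (cmod (1 + Y))^2)"
 define q0 where "q0 = \<sigma>^2 * (cmod Y)^2 * (cmod p)^2 + \<sigma>^4 * (cmod Y)^2 * (cmod (1 + Y))^2
     + A^2 * (\<sigma>^2 * (cmod p)^4 + \<sigma>^2 * (cmod p)^2 * (cmod (1 + Y))^2)"
 have V0: "0 < V0" using A \<epsilon> \<theta> by (simp add: V0_def add_nonneg_pos)
 have q: "0 \<le> q1" "0 \<le> q0" using \<sigma> A by (auto simp: q1_def q0_def)
 have B: "0 \<le> Bm" using h C0 by (simp add: Bm_def)
 have "V0^m * (1 + 1920 * c^4 * Bm * real m * q1 / V0 + 512 * c^4 * Bm * (real m)^2 * q0 / V0^2)
   \<le> V0^m * (1 + G * real m * q1 / V0 + G * (real m)^2 * q0 / V0^2)"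
 proof (intro mult_left_mono add_mono divide_right_mono mult_right_mono)
  have "512 * c^4 * Bm \<le> 1920 * c^4 * Bm" using B c by (intro mult_right_mono) auto
  thus "512 * c^4 * Bm \<le> G" using G by linarith
 qed (use V0 q G in auto)
 also have "\<dots> \<le> ((cmod Y)^2 + A * (cmod p)^2 + \<epsilon>)^m * exp (16 * G^2 * real m *
    (\<sigma>^3 / sqrt \<epsilon> + \<sigma>^4 / (\<theta> * A) + A * \<sigma>^2 / \<epsilon> + real m * \<sigma>^4 / \<epsilon>))"
  unfolding V0_def q1_def q0_def
  by (rule lyapunov_algebra) (use assms norm_triangle_ineq[of 1 Y] in auto)
 finally have *: "V0^m * (1 + 1920 * c^4 * Bm * real m * q1 / V0 + 512 * c^4 * Bm * (real m)^2 * q0 / V0^2) \<le> \<dots>" .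
 show ?thesis
  by (rule order_trans[OF one_step_moment_raw ennreal_leI[OF *[unfolded V0_def q1_def q0_def]]]) (use assms in auto)
qed
end

section \<open>The normalized recursion\<close>

locale hyperbolic_beta = hyperbolic +
 fixes \<beta> :: real assumes \<beta>: "0 < \<beta>"
begin

definition bb :: real where "bb = sqrt (2 / \<beta>)"

abbreviation yc :: "nat \<Rightarrow> real" where "yc k \<equiv> sqrt (2 * \<beta> * real k) / (4 * real N * \<beta>)"

definition \<phi>1 :: "nat \<Rightarrow> complex" where "\<phi>1 k = 1 / (of_real (sqrt (2 * real N * \<beta>)) * r (Suc k))"
definition \<phi>2 :: "nat \<Rightarrow> complex" where "\<phi>2 k = of_real (yc k) / (r k * r (Suc k))"
definition \<tau>1 :: "nat \<Rightarrow> complex" where "\<tau>1 k = \<phi>1 k * \<kappa> k"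
definition \<tau>2 :: "nat \<Rightarrow> complex" where "\<tau>2 k = \<phi>2 k * (\<kappa> k + 1)"
text \<open>The recursion of \<open>s\<close> produces the coefficients \<open>f1\<close> and
  \<open>fh2\<close>. In \<open>f2\<close> the ratio \<open>r\<close> is replaced by
  \<open>lam\<close>, which makes \<open>f1\<close> and \<open>f2\<close> multiples of the grid
  values of the two integrands of the field.\<close>

definition f1 :: "nat \<Rightarrow> complex" where "f1 k = 1 / (of_real (sqrt (2 * real N * \<beta>)) * S k)"
definition f2 :: "nat \<Rightarrow> complex" where "f2 k = of_real (yc k) / (lam k * S k)"
definition fh2 :: "nat \<Rightarrow> complex" where "fh2 k = of_real (yc k) / (r k * S k)"

lemma bb0: "0 < bb" using \<beta> by (simp add: bb_def)

lemma sq1: "k \<le> n \<Longrightarrow> 1 / (sqrt (2 * real N * \<beta>) * (x / 2)) = bb * (\<sigma> k * \<theta> k)"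
 using x0 Npos \<beta> unfolding \<sigma>\<theta> sqrtP bb_def
 by (simp add: real_sqrt_mult real_sqrt_divide field_simps)

lemma sq2: assumes "k \<le> n" shows "yc k \<le> bb * (\<sigma> k * \<theta> k) * (x / 2)^2"
proof -
 have "real k \<le> P" using \<Delta>_pos[OF assms] by (simp add: \<Delta>_def)
 hence "sqrt (2 * \<beta> * real k) \<le> sqrt (2 * \<beta> * P)" using \<beta> by simp
 hence "yc k \<le> sqrt (2 * \<beta> * P) / (4 * real N * \<beta>)" using Npos \<beta> by (intro divide_right_mono) auto
 also have "sqrt (2 * \<beta> * P) = bb * \<beta> * sqrt P"
 proof -
  have "sqrt (2 * \<beta>) = sqrt (2 / \<beta> * (\<beta> * \<beta>))" using \<beta> by simp
  also have "\<dots> = bb * \<beta>" using \<beta> unfolding bb_def real_sqrt_mult by simp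
  finally have "sqrt (2 * \<beta>) = bb * \<beta>" .
  thus ?thesis by (simp add: real_sqrt_mult[of "2 * \<beta>"])
 qed
 also have "bb * \<beta> * sqrt P / (4 * real N * \<beta>) = bb * (1 / sqrt P) * (x / 2)^2"
 proof -
  have "sqrt P * sqrt P = real N * x^2" using Ppos by (simp add: P_def)
  thus ?thesis using \<beta> Npos Ppos x0 by (simp add: field_simps power2_eq_square)
 qed
 finally show ?thesis by (simp add: \<sigma>\<theta>[OF assms])
qed

context fixes k assumes k: "k \<le> n" begin

lemma \<phi>1_le: "cmod (\<phi>1 k) \<le> bb * (\<sigma> k * \<theta> k)"
proof -
 have "cmod (\<phi>1 k) = 1 / (sqrt (2 * real N * \<beta>) * cmod (r (Suc k)))"
  using Npos \<beta> by (simp add: \<phi>1_def norm_divide norm_mult del: r.simps)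
 also have "\<dots> \<le> 1 / (sqrt (2 * real N * \<beta>) * (x / 2))"
  using r_ge(3,6)[OF k] x0 Npos \<beta> by (intro divide_left_mono mult_left_mono mult_pos_pos) auto
 finally show ?thesis unfolding sq1[OF k] .
qed

lemma prod_le: assumes "x / 2 \<le> cmod A" "x / 2 * B \<le> cmod C" "0 < B" "0 \<le> D" "D \<le> E * (x / 2)^2"
 shows "D / (cmod A * cmod C) \<le> E / B"
proof -
 have "D / (cmod A * cmod C) \<le> (E * (x / 2)^2) / ((x / 2) * (x / 2 * B))"
  using assms x0 by (intro frac_le mult_mono mult_pos_pos) auto
 also have "\<dots> = E / B" using x0 assms by (simp add: field_simps power2_eq_square)
 finally show ?thesis .
qed

lemma \<phi>2_le: "cmod (\<phi>2 k) \<le> bb * (\<sigma> k * \<theta> k)"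
 using prod_le[of "r k" 1 "r (Suc k)", OF _ _ _ _ sq2[OF k]] r_ge(3,4)[OF k] Npos \<beta>
 by (simp add: \<phi>2_def norm_divide norm_mult del: r.simps)

lemma S_half: "x / 2 * \<theta> k \<le> cmod (S k)" using S_props(3)[OF k] mult_pos_pos[OF x0 \<theta>_pos[OF k]] by simp

lemma f1_le: "cmod (f1 k) \<le> bb * \<sigma> k"
proof -
 have "cmod (f1 k) = 1 / (sqrt (2 * real N * \<beta>) * cmod (S k))"
  using Npos \<beta> by (simp add: f1_def norm_divide norm_mult)
 also have "\<dots> \<le> 1 / (sqrt (2 * real N * \<beta>) * (x / 2 * \<theta> k))"
  using S_half S_nz[OF k] x0 Npos \<beta> \<theta>_pos[OF k] by (intro divide_left_mono mult_left_mono mult_pos_pos) auto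
 also have "\<dots> = 1 / (sqrt (2 * real N * \<beta>) * (x / 2)) / \<theta> k" by simp
 finally show ?thesis unfolding sq1[OF k] using \<theta>_pos[OF k] by simp
qed

lemma lam_half: "x / 2 \<le> cmod (lam k)" using lam_props(2)[OF k] x0 \<theta>_pos[OF k] by (simp add: algebra_simps) (smt (verit) mult_pos_pos)

lemma f2_le: "cmod (f2 k) \<le> bb * \<sigma> k"
 using prod_le[of "lam k" "\<theta> k" "S k", OF lam_half S_half _ _ sq2[OF k]] Npos \<beta> \<theta>_pos[OF k]
 by (simp add: f2_def norm_divide norm_mult)

text \<open>Third order in \<open>\<sigma>\<close> is exactly what
  \<open>exp_times_one_minus\<close> tolerates between the true and the idealized noise; it comes
  from the second-order accuracy of \<open>r_lam\<close>.\<close>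

lemma fh2_f2: "cmod (fh2 k - f2 k) \<le> 4 * bb * \<sigma> k^3"
proof -
 have "fh2 k - f2 k = f2 k * ((lam k - r k) / r k)"
 proof -
  define q where "q = complex_of_real (yc k)"
  show ?thesis unfolding fh2_def f2_def q_def[symmetric] using lam_nz[OF k] r_ge(5)[OF k] S_nz[OF k] by (simp add: field_simps)
 qed
 hence "cmod (fh2 k - f2 k) = cmod (f2 k) * (cmod (r k - lam k) / cmod (r k))"
  by (simp add: norm_mult norm_divide norm_minus_commute)
 also have "\<dots> \<le> bb * \<sigma> k * (x * (\<sigma> k)^2 / 2 / (x / 2))"
  using f2_le r_lam[OF k] r_ge(4)[OF k] x0 bb0 \<sigma>_pos[OF k] by (intro mult_mono frac_le) auto
 also have "\<dots> = bb * \<sigma> k^3" using x0 by (simp add: power2_eq_square power3_eq_cube)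
 also have "\<dots> \<le> 4 * bb * \<sigma> k^3" using bb0 \<sigma>_pos[OF k] by simp
 finally show ?thesis .
qed

lemma \<tau>1_le: "cmod (\<tau>1 k) \<le> 4 * bb * \<sigma> k"
proof -
 have "cmod (\<tau>1 k) \<le> bb * (\<sigma> k * \<theta> k) * (4 / \<theta> k)"
  unfolding \<tau>1_def norm_mult using \<phi>1_le \<kappa>_le[OF k] bb0 \<sigma>_pos[OF k] \<theta>_pos[OF k] by (intro mult_mono) auto
 thus ?thesis using \<theta>_pos[OF k] by simp
qed

lemma \<tau>2_le: "cmod (\<tau>2 k) \<le> 5 * bb * \<sigma> k"
proof -
 have "cmod (\<kappa> k + 1) \<le> 4 / \<theta> k + 1 / \<theta> k"
  using norm_triangle_ineq[of "\<kappa> k" 1] \<kappa>_le[OF k] \<theta>_le1[of k] \<theta>_pos[OF k]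
  by (intro order_trans[OF norm_triangle_ineq] add_mono) auto
 hence "cmod (\<tau>2 k) \<le> bb * (\<sigma> k * \<theta> k) * (5 / \<theta> k)"
  unfolding \<tau>2_def norm_mult using \<phi>2_le bb0 \<sigma>_pos[OF k] \<theta>_pos[OF k]
  by (intro mult_mono) (auto simp: add_divide_distrib[symmetric])
 thus ?thesis using \<theta>_pos[OF k] by simp
qed

end

text \<open>One constant for all coefficients: 15 is the product of 3 from
  \<open>\<kappa>_Suc\<close> and 5 from \<open>\<tau>2_le\<close>, and 4 is the constant of
  \<open>err_le\<close>.\<close>

definition cc :: real where "cc = 15 * bb + 4"

lemma cc: "1 \<le> cc" "bb \<le> cc" using bb0 by (auto simp: cc_def)

lemma coeff_bounds: assumes k: "k \<le> n" shows
 "cmod (f1 k) \<le> cc * \<sigma> k" "cmod (f2 k) \<le> cc * \<sigma> k" "cmod (fh2 k - f2 k) \<le> cc * \<sigma> k^3"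
 "cmod (\<tau>1 k) \<le> cc * \<sigma> k" "cmod (\<tau>2 k) \<le> cc * \<sigma> k"
 "cmod (\<phi>1 k / of_real (\<theta> k)) \<le> cc * \<sigma> k" "cmod (\<phi>2 k / of_real (\<theta> k)) \<le> cc * \<sigma> k"
 "cmod (of_real (\<theta> k) * ((1 + \<kappa> (Suc k)) * \<tau>1 k)) \<le> cc * \<sigma> k" "cmod (of_real (\<theta> k) * ((1 + \<kappa> (Suc k)) * \<tau>2 k)) \<le> cc * \<sigma> k"
 "cmod (of_real (\<theta> k) * err k) \<le> cc * (\<sigma> k)^2"
proof -
 note p = \<theta>_pos[OF k] \<sigma>_pos[OF k] bb0
 have le: "a * bb * \<sigma> k \<le> cc * \<sigma> k" if "a \<le> 15" for a
  using p that by (intro mult_right_mono) (auto simp: cc_def intro!: add_increasing2 mult_right_mono)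
 show "cmod (f1 k) \<le> cc * \<sigma> k" "cmod (f2 k) \<le> cc * \<sigma> k" using f1_le[OF k] f2_le[OF k] le[of 1] by auto
 have "4 * bb * \<sigma> k^3 \<le> cc * \<sigma> k^3" using p by (intro mult_right_mono) (auto simp: cc_def)
 thus "cmod (fh2 k - f2 k) \<le> cc * \<sigma> k^3" using fh2_f2[OF k] by linarith
 show t: "cmod (\<tau>1 k) \<le> cc * \<sigma> k" "cmod (\<tau>2 k) \<le> cc * \<sigma> k" using \<tau>1_le[OF k] \<tau>2_le[OF k] le[of 4] le[of 5] by auto
 have "cmod (\<phi>1 k / of_real (\<theta> k)) \<le> bb * \<sigma> k" "cmod (\<phi>2 k / of_real (\<theta> k)) \<le> bb * \<sigma> k"
  using \<phi>1_le[OF k] \<phi>2_le[OF k] p by (simp_all add: norm_divide pos_divide_le_eq mult.assoc)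
 thus "cmod (\<phi>1 k / of_real (\<theta> k)) \<le> cc * \<sigma> k" "cmod (\<phi>2 k / of_real (\<theta> k)) \<le> cc * \<sigma> k" using le[of 1] by auto
 have *: "cmod (of_real (\<theta> k) * ((1 + \<kappa> (Suc k)) * t)) \<le> cc * \<sigma> k" if "cmod t \<le> 5 * bb * \<sigma> k" for t
 proof -
  have "cmod (of_real (\<theta> k) * ((1 + \<kappa> (Suc k)) * t)) \<le> \<theta> k * (3 / \<theta> k * (5 * bb * \<sigma> k))"
   unfolding norm_mult using that \<kappa>_Suc[OF k] p by (intro mult_mono) auto
  also have "\<dots> = 15 * bb * \<sigma> k" using p by simp
  finally show ?thesis using le[of 15] by simp
 qed
 show "cmod (of_real (\<theta> k) * ((1 + \<kappa> (Suc k)) * \<tau>2 k)) \<le> cc * \<sigma> k" by (rule *[OF \<tau>2_le[OF k]])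
 show "cmod (of_real (\<theta> k) * ((1 + \<kappa> (Suc k)) * \<tau>1 k)) \<le> cc * \<sigma> k"
  by (rule *) (use \<tau>1_le[OF k] p in \<open>auto elim!: order_trans intro!: mult_right_mono\<close>)
 have "cmod (of_real (\<theta> k) * err k) \<le> 4 * (\<sigma> k)^2"
  using mult_left_mono[OF err_le[OF k], of "\<theta> k"] p by (simp add: norm_mult)
 also have "\<dots> \<le> cc * (\<sigma> k)^2" using p by (intro mult_right_mono) (auto simp: cc_def)
 finally show "cmod (of_real (\<theta> k) * err k) \<le> cc * (\<sigma> k)^2" .
qed

text \<open>\<open>\<Phi>\<close> and the noise \<open>X, Y\<close> (indexed from \<open>1\<close>) at a fixed sample point.\<close>

context
 fixes \<Phi> :: "nat \<Rightarrow> complex" and X Y :: "nat \<Rightarrow> real"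
 assumes \<Phi>0: "\<Phi> 0 = 1"
  and \<Phi>_rec: "\<And>k. \<Phi> (Suc k) = (z - of_real (X (Suc k) / sqrt (2 * real N * \<beta>))) * \<Phi> k
    - of_real (real k / (4 * real N) + yc k * Y (Suc k)) * \<Phi> (k - 1)"
begin

definition u :: "nat \<Rightarrow> complex" where "u k = \<Phi> k / pi_poly N k z"
definition v :: "nat \<Rightarrow> complex" where "v k = (if k = 0 then 0 else u k - u (k - 1))"
definition s :: "nat \<Rightarrow> complex" where "s k = u k + \<kappa> k * v k"
definition \<phi> :: "nat \<Rightarrow> complex" where "\<phi> k = \<phi>1 k * of_real (X (Suc k)) + \<phi>2 k * of_real (Y (Suc k))"
definition \<tau> :: "nat \<Rightarrow> complex" where "\<tau> k = \<tau>1 k * of_real (X (Suc k)) + \<tau>2 k * of_real (Y (Suc k))"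

lemma pi_poly_Suc: "k \<le> n \<Longrightarrow> pi_poly N (Suc k) z = r (Suc k) * pi_poly N k z \<and> pi_poly N k z \<noteq> 0"
proof (induction k)
 case 0 thus ?case using N by (simp add: pi_poly_rec)
next
 case (Suc k)
 hence IH: "pi_poly N (Suc k) z = r (Suc k) * pi_poly N k z" "pi_poly N k z \<noteq> 0" and k: "k \<le> n" by auto
 have r: "r (Suc k) \<noteq> 0" by (rule r_ge(6)[OF k])
 have "pi_poly N (Suc (Suc k)) z = z * pi_poly N (Suc k) z - of_real (real (Suc k) / (4 * real N)) * pi_poly N k z"
  by (rule pi_poly_rec(3)[OF N])
 also have "pi_poly N k z = pi_poly N (Suc k) z / r (Suc k)" using IH r by simp
 finally have "pi_poly N (Suc (Suc k)) z = r (Suc (Suc k)) * pi_poly N (Suc k) z" by (simp add: algebra_simps)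
 thus ?case using IH r by simp
qed

text \<open>Division by the recursion of the orthogonal polynomials cancels the deterministic part
  acting on \<open>u\<close>; what is left of it acts on \<open>v\<close> alone and is
  \<open>\<rho>\<close>.\<close>

lemma v_rec: assumes k: "k \<le> n"
 shows "v (Suc k) = (\<rho> k + \<phi>2 k * of_real (Y (Suc k))) * v k - \<phi> k * u k"
proof -
 \<comment> \<open>\<open>w\<close> stands for \<open>u (k - 1)\<close>. For \<open>k = 0\<close>
   the value 1 gives \<open>u 0 - w = 0 = v 0\<close>, and the coefficients that multiply
   \<open>\<Phi> (0 - 1)\<close> are zero.\<close>
 define w where "w = (if k = 0 then 1 else \<Phi> (k - 1) / pi_poly N k z * r k)"
 have nz: "r (Suc k) \<noteq> 0" "r k \<noteq> 0" "pi_poly N k z \<noteq> 0" using r_ge(5,6)[OF k] pi_poly_Suc[OF k] by auto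
 have w: "k \<noteq> 0 \<Longrightarrow> w = u (k - 1)"
 proof -
  assume k0: "k \<noteq> 0"
  hence "pi_poly N k z = r k * pi_poly N (k - 1) z" using pi_poly_Suc[of "k - 1"] k by simp
  thus ?thesis using nz k0 by (simp add: w_def u_def)
 qed
 have uw: "u k - w = v k"
  using w \<Phi>0 pi_poly_rec(1)[OF N] by (cases "k = 0") (auto simp: v_def u_def w_def)
 have rr: "z - r (Suc k) = of_real (real k / (4 * real N)) / r k" by simp
 have qr: "(of_real (real k / (4 * real N)) :: complex) * \<Phi> (k - 1) / pi_poly N k z = of_real (real k / (4 * real N)) * w / r k"
  "(of_real (yc k) :: complex) * \<Phi> (k - 1) / pi_poly N k z = of_real (yc k) * w / r k"
  using nz by (auto simp: w_def)
 define q1 q2 q3 where "q1 = complex_of_real (real k / (4 * real N))" and "q2 = complex_of_real (yc k)"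
  and "q3 = complex_of_real (X (Suc k) / sqrt (2 * real N * \<beta>))"
 have "\<Phi> (Suc k) / pi_poly N k z = (z - q3) * u k - (q1 + q2 * of_real (Y (Suc k))) * w / r k"
  using qr unfolding \<Phi>_rec[of k] q1_def[symmetric] q2_def[symmetric] q3_def[symmetric] of_real_add of_real_mult
  by (simp add: u_def diff_divide_distrib add_divide_distrib distrib_right) (metis (no_types, lifting) mult.assoc mult.commute times_divide_eq_left)
 hence us: "u (Suc k) = ((z - q3) * u k - (q1 + q2 * of_real (Y (Suc k))) * w / r k) / r (Suc k)"
 proof -
  assume a: "\<Phi> (Suc k) / pi_poly N k z = ((z - q3) * u k - (q1 + q2 * of_real (Y (Suc k))) * w / r k)"
  have "u (Suc k) = \<Phi> (Suc k) / pi_poly N k z / r (Suc k)"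
   using pi_poly_Suc[OF k] by (simp add: u_def mult.commute del: r.simps)
  thus ?thesis unfolding a .
 qed
 have "v (Suc k) = u (Suc k) - u k" by (simp add: v_def)
 also have "\<dots> = (((z - r (Suc k)) - q3) * u k - (q1 + q2 * of_real (Y (Suc k))) * w / r k) / r (Suc k)"
  unfolding us using nz by (simp add: field_simps del: r.simps)
 also have "\<dots> = (q1 * (u k - w) / r k - q3 * u k - q2 * of_real (Y (Suc k)) * w / r k) / r (Suc k)"
  unfolding rr q1_def[symmetric] using nz by (simp add: field_simps del: r.simps)
 also have "w = u k - v k" using uw by (simp add: algebra_simps)
 also have "(q1 * (u k - (u k - v k)) / r k - q3 * u k - q2 * of_real (Y (Suc k)) * (u k - v k) / r k) / r (Suc k)
   = (q1 / (r k * r (Suc k)) + q2 / (r k * r (Suc k)) * of_real (Y (Suc k))) * v k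
    - (q3 / r (Suc k) + q2 / (r k * r (Suc k)) * of_real (Y (Suc k))) * u k"
  using nz by (simp add: field_simps del: r.simps)
 finally show ?thesis by (simp add: \<rho>_def \<phi>_def \<phi>1_def \<phi>2_def q1_def q2_def q3_def del: r.simps)
qed

lemma v_rec': assumes k: "k \<le> n" shows "v (Suc k) = (\<rho> k + \<tau> k) * v k - \<phi> k * s k"
 unfolding v_rec[OF k] \<tau>_def s_def \<phi>_def \<tau>1_def \<tau>2_def by (simp add: algebra_simps)

text \<open>\<open>1 + \<kappa> (Suc k) = r (Suc k) / S k\<close> cancels the denominator
  \<open>r (Suc k)\<close> of the noise \<open>\<phi>\<close> and leaves \<open>1 / S k\<close>; the
  deterministic effect of \<open>v\<close> on \<open>s\<close> reduces to
  \<open>err\<close>.\<close>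

lemma s_rec: assumes k: "k \<le> n"
 shows "s (Suc k) = s k * (1 - (f1 k * of_real (X (Suc k)) + fh2 k * of_real (Y (Suc k)))) + (err k + (1 + \<kappa> (Suc k)) * \<tau> k) * v k"
proof -
 have nz: "r (Suc k) \<noteq> 0" "r k \<noteq> 0" "S k \<noteq> 0" using r_ge(5,6)[OF k] S_nz[OF k] by auto
 have F: "(1 + \<kappa> (Suc k)) * \<phi> k = f1 k * of_real (X (Suc k)) + fh2 k * of_real (Y (Suc k))"
  using nz by (simp add: \<kappa>_def \<phi>_def \<phi>1_def \<phi>2_def f1_def fh2_def field_simps del: r.simps)
 have "s (Suc k) = u k + (1 + \<kappa> (Suc k)) * v (Suc k)" by (simp add: s_def v_def algebra_simps)
 also have "\<dots> = s k - \<kappa> k * v k + (1 + \<kappa> (Suc k)) * ((\<rho> k + \<tau> k) * v k - \<phi> k * s k)"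
  unfolding v_rec'[OF k] by (simp add: s_def)
 also have "\<dots> = s k * (1 - (1 + \<kappa> (Suc k)) * \<phi> k) + (err k + (1 + \<kappa> (Suc k)) * \<tau> k) * v k"
  by (simp add: err_def algebra_simps)
 finally show ?thesis unfolding F .
qed

lemma s_0: "s 0 = 1" "v 0 = 0"
 using \<Phi>0 pi_poly_rec(1)[OF N] by (auto simp: s_def v_def u_def)

end
end

section \<open>Moment bound along the recursion\<close>

lemma (in prob_space) indep_nn_integral:
 assumes ind: "indep_var S Z T W" and f: "f \<in> borel_measurable (S \<Otimes>\<^sub>M T)"
 shows "(\<integral>\<^sup>+w. f (Z w, W w) \<partial>M) = (\<integral>\<^sup>+w. \<integral>\<^sup>+w'. f (Z w, W w') \<partial>M \<partial>M)"
proof -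
 have rv[measurable]: "random_variable S Z" "random_variable T W" and
  eq: "distr M S Z \<Otimes>\<^sub>M distr M T W = distr M (S \<Otimes>\<^sub>M T) (\<lambda>x. (Z x, W x))"
  using ind unfolding indep_var_distribution_eq by auto
 interpret W: prob_space "distr M T W" by (rule prob_space_distr) simp
 note f[measurable]
 have fm: "f \<in> borel_measurable (distr M S Z \<Otimes>\<^sub>M distr M T W)"
  using f by (subst measurable_cong_sets[OF sets_pair_measure_cong[OF sets_distr sets_distr] refl])
 have "(\<integral>\<^sup>+w. f (Z w, W w) \<partial>M) = (\<integral>\<^sup>+x. f x \<partial>(distr M (S \<Otimes>\<^sub>M T) (\<lambda>x. (Z x, W x))))"
  by (subst nn_integral_distr) auto
 also have "\<dots> = (\<integral>\<^sup>+z. \<integral>\<^sup>+w. f (z, w) \<partial>distr M T W \<partial>distr M S Z)"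
  unfolding eq[symmetric] by (rule W.nn_integral_fst[OF fm, symmetric])
 also have "\<dots> = (\<integral>\<^sup>+z. \<integral>\<^sup>+w'. f (z, W w') \<partial>M \<partial>distr M S Z)"
  by (intro nn_integral_cong, subst nn_integral_distr) auto
 also have "\<dots> = (\<integral>\<^sup>+w. \<integral>\<^sup>+w'. f (Z w, W w') \<partial>M \<partial>M)"
  by (subst nn_integral_distr) (auto simp: measurable_distr_eq1)
 finally show ?thesis .
qed

text \<open>The state before step \<open>k\<close> is a measurable function of the inputs with index
  below \<open>k\<close>, which is constructed along the induction.\<close>

lemma (in prob_space) chain_indep:
 fixes W :: "nat \<Rightarrow> 'a \<Rightarrow> complex \<times> complex" and Z :: "nat \<Rightarrow> 'a \<Rightarrow> complex \<times> complex"
 assumes ind: "indep_vars (\<lambda>_. borel) W UNIV" and Z0: "\<And>w. Z 0 w = z0"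
  and Zs: "\<And>k w. Z (Suc k) w = step k (Z k w, W k w)"
  and step[measurable]: "\<And>k. step k \<in> borel_measurable (borel \<Otimes>\<^sub>M borel)"
 shows "indep_var borel (Z k) borel (W k)"
proof -
 have "\<exists>F. F \<in> borel_measurable (PiM {..<k} (\<lambda>_. borel)) \<and> (\<forall>w. Z k w = F (\<lambda>i\<in>{..<k}. W i w))" for k
 proof (induction k)
  case 0
  show ?case by (intro exI[of _ "\<lambda>_. z0"]) (auto simp: Z0)
 next
  case (Suc k)
  then obtain F where F[measurable]: "F \<in> borel_measurable (PiM {..<k} (\<lambda>_. borel))" "\<And>w. Z k w = F (\<lambda>i\<in>{..<k}. W i w)" by auto
  define F' where "F' f = step k (F (restrict f {..<k}), f k)" for f
  have r: "(\<lambda>f. restrict f {..<k}) \<in> measurable (PiM {..<Suc k} (\<lambda>_. borel)) (PiM {..<k} (\<lambda>_. borel))"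
   by (rule measurable_restrict_subset) auto
  have c: "(\<lambda>f. f k) \<in> measurable (PiM {..<Suc k} (\<lambda>_. borel)) borel"
   by (rule measurable_component_singleton) auto
  have "F' \<in> borel_measurable (PiM {..<Suc k} (\<lambda>_. borel))"
   unfolding F'_def by (intro measurable_compose[OF measurable_Pair[OF measurable_compose[OF r F(1)] c] step])
  moreover have "restrict (\<lambda>i\<in>{..<Suc k}. W i w) {..<k} = (\<lambda>i\<in>{..<k}. W i w)" for w by (auto simp: fun_eq_iff)
  hence "\<forall>w. Z (Suc k) w = F' (\<lambda>i\<in>{..<Suc k}. W i w)" by (simp add: Zs F'_def F(2))
  ultimately show ?case by blast
 qed
 then obtain F where F: "F \<in> borel_measurable (PiM {..<k} (\<lambda>_. borel))" "\<And>w. Z k w = F (\<lambda>i\<in>{..<k}. W i w)" by blast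
 have "indep_var (PiM {..<k} (\<lambda>_. borel)) (\<lambda>w. restrict (\<lambda>i. W i w) {..<k}) (PiM {k} (\<lambda>_. borel)) (\<lambda>w. restrict (\<lambda>i. W i w) {k})"
  by (rule indep_var_restrict[OF ind]) auto
 hence "indep_var borel (F \<circ> (\<lambda>w. restrict (\<lambda>i. W i w) {..<k})) borel ((\<lambda>f. f k) \<circ> (\<lambda>w. restrict (\<lambda>i. W i w) {k}))"
  by (rule indep_var_compose) (use F in \<open>auto intro: measurable_component_singleton\<close>)
 thus ?thesis by (simp add: comp_def F(2)[symmetric])
qed

text \<open>Conditioning on the past in the form of Fubini's theorem: since the next input is
  independent of the state, a bound for every frozen state is enough.\<close>

lemma (in prob_space) chain_moment:
 fixes W :: "nat \<Rightarrow> 'a \<Rightarrow> complex \<times> complex" and Z :: "nat \<Rightarrow> 'a \<Rightarrow> complex \<times> complex" and H :: "nat \<Rightarrow> complex \<times> complex \<Rightarrow> real"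
 assumes ind: "indep_vars (\<lambda>_. borel) W UNIV" and Z0: "\<And>w. Z 0 w = z0"
  and Zs: "\<And>k w. Z (Suc k) w = step k (Z k w, W k w)"
  and step[measurable]: "\<And>k. step k \<in> borel_measurable (borel \<Otimes>\<^sub>M borel)"
  and H[measurable]: "\<And>k. H k \<in> borel_measurable borel"
  and one: "\<And>k z. k < n \<Longrightarrow> (\<integral>\<^sup>+w. ennreal (H (Suc k) (step k (z, W k w))) \<partial>M) \<le> ennreal (H k z * exp (cost k))"
 shows "(\<integral>\<^sup>+w. ennreal (H n (Z n w)) \<partial>M) \<le> ennreal (H 0 z0 * exp (\<Sum>k<n. cost k))"
 using one
proof (induction n)
 case 0
 have "(\<integral>\<^sup>+w. ennreal (H 0 (Z 0 w)) \<partial>M) = ennreal (H 0 z0)" by (simp add: Z0 emeasure_space_1)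
 thus ?case by simp
next
 case (Suc n)
 note ci = chain_indep[OF ind Z0 Zs step, of n]
 have rv[measurable]: "random_variable borel (Z n)" "random_variable borel (W n)"
  using ci by (auto dest: indep_var_rv1 indep_var_rv2)
 have "(\<integral>\<^sup>+w. ennreal (H (Suc n) (Z (Suc n) w)) \<partial>M) = (\<integral>\<^sup>+w. (\<lambda>zw. ennreal (H (Suc n) (step n zw))) (Z n w, W n w) \<partial>M)"
  by (simp add: Zs)
 also have "\<dots> = (\<integral>\<^sup>+w. \<integral>\<^sup>+w'. (\<lambda>zw. ennreal (H (Suc n) (step n zw))) (Z n w, W n w') \<partial>M \<partial>M)"
  by (rule indep_nn_integral[OF ci]) measurable
 also have "\<dots> \<le> (\<integral>\<^sup>+w. ennreal (H n (Z n w) * exp (cost n)) \<partial>M)"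
  by (intro nn_integral_mono) (use Suc.prems[of n] in auto)
 also have "\<dots> = (\<integral>\<^sup>+w. ennreal (exp (cost n)) * ennreal (H n (Z n w)) \<partial>M)"
  by (intro nn_integral_cong) (simp add: ennreal_mult'[symmetric] mult.commute)
 also have "\<dots> = ennreal (exp (cost n)) * (\<integral>\<^sup>+w. ennreal (H n (Z n w)) \<partial>M)"
  by (rule nn_integral_cmult) measurable
 also have "\<dots> \<le> ennreal (exp (cost n)) * ennreal (H 0 z0 * exp (\<Sum>k<n. cost k))"
  by (intro mult_left_mono Suc.IH Suc.prems) auto
 also have "\<dots> = ennreal (H 0 z0 * exp (\<Sum>k<Suc n. cost k))"
  by (simp add: ennreal_mult'[symmetric] exp_add mult_ac)
 finally show ?case .
qed

lemma (in prob_space) normal_exp_moment: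
 assumes X: "distributed M lborel X (\<lambda>x. ennreal (normal_density 0 s x))" and s: "0 < s"
 shows "(\<integral>\<^sup>+w. ennreal (exp (t * X w)) \<partial>M) = ennreal (exp (t^2 * s^2 / 2))"
proof -
 have "(\<integral>\<^sup>+w. ennreal (exp (t * X w)) \<partial>M) = (\<integral>\<^sup>+x. ennreal (normal_density 0 s x) * ennreal (exp (t * x)) \<partial>lborel)"
  by (rule distributed_nn_integral[OF X, symmetric]) simp
 also have "\<dots> = (\<integral>\<^sup>+x. ennreal (normal_density 0 s x * exp (t * x)) \<partial>lborel)" by (simp add: ennreal_mult)
 also have "\<dots> = ennreal (LINT x|lborel. normal_density 0 s x * exp (t * x))"
 proof (rule nn_integral_eq_integral)
  have "integrable lborel (\<lambda>x. Re (normal_density 0 s x *\<^sub>R exp (of_real t * of_real x)))"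
   by (rule integrable_Re[OF gaussian_mgf_complex(1)[OF s]])
  thus "integrable lborel (\<lambda>x. normal_density 0 s x * exp (t * x))"
   by (simp add: exp_of_real flip: of_real_mult)
 qed auto
 also have "(LINT x|lborel. normal_density 0 s x * exp (t * x)) = exp (t^2 * s^2 / 2)"
 proof -
  have "complex_of_real (LINT x|lborel. normal_density 0 s x * exp (t * x)) = (LINT x|lborel. normal_density 0 s x *\<^sub>R exp (of_real t * of_real x))"
   by (simp add: scaleR_conv_of_real exp_of_real flip: of_real_mult integral_complex_of_real)
  also have "\<dots> = of_real (exp (t^2 * s^2 / 2))" unfolding gaussian_mgf_complex(2)[OF s] by (simp add: exp_of_real[symmetric])
  finally show ?thesis by (simp only: of_real_eq_iff)
 qed
 finally show ?thesis .
qed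

section \<open>Moments and independence of the noise\<close>

context beta_coupling begin

abbreviation X where "X \<equiv> X_var b"
abbreviation Y where "Y \<equiv> Y_var \<beta> a"

lemma ab_meas: "1 \<le> k \<Longrightarrow> a k \<in> borel_measurable M" "1 \<le> k \<Longrightarrow> b k \<in> borel_measurable M"
 using b_normal[of k] a_chi[of k] unfolding chi_distributed_def by (auto dest: distributed_measurable)

lemma XY_meas: "1 \<le> k \<Longrightarrow> X k \<in> borel_measurable M" "Y k \<in> borel_measurable M"
proof -
 show "X k \<in> borel_measurable M" if "1 \<le> k" using ab_meas(2)[OF that] unfolding X_var_def by measurable
 show "Y k \<in> borel_measurable M"
 proof (cases "k \<le> 1")
  case True thus ?thesis by (simp add: Y_var_def[abs_def])
 next
  case False
  hence [measurable]: "a (k - 1) \<in> borel_measurable M" by (intro ab_meas) auto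
  show ?thesis unfolding Y_var_def by measurable
 qed
qed

lemma X_mgf: assumes "1 \<le> k" shows "(\<integral>\<^sup>+w. ennreal (exp (t * X k w)) \<partial>M) = ennreal (exp (t^2 / 2))"
 using normal_exp_moment[OF b_normal[OF assms], of "t / sqrt 2"] by (simp add: X_var_def power_divide)

lemma X_moments: assumes "1 \<le> k"
 shows "integrable M (X k)" "expectation (X k) = 0" "integrable M (\<lambda>w. (X k w)^2)" "expectation (\<lambda>w. (X k w)^2) = 1"
proof -
 have 1: "((\<lambda>t. (exp (t^2 / 2) - 1) / t) \<longlongrightarrow> 0) (at_right (0::real))" by real_asymp
 have 2: "((\<lambda>t. (exp (t^2 / 2) + exp ((- t)^2 / 2) - 2) / t^2) \<longlongrightarrow> 1) (at_right (0::real))" by real_asymp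
 note * = moments_of_mgf[of "X k" 1, OF XY_meas(1)[OF assms] _ X_mgf[OF assms] _ 1 2]
 show "integrable M (X k)" "expectation (X k) = 0" "integrable M (\<lambda>w. (X k w)^2)" "expectation (\<lambda>w. (X k w)^2) = 1"
  by (rule *; simp)+
qed

lemma Y_moments: assumes \<beta>: "0 < \<beta>" and k: "1 \<le> k"
 shows "integrable M (Y (Suc k))" "expectation (Y (Suc k)) = 0" "integrable M (\<lambda>w. (Y (Suc k) w)^2)" "expectation (\<lambda>w. (Y (Suc k) w)^2) = 1"
proof -
 define p where "p = \<beta> * real k"
 have p: "0 < p" using \<beta> k by (simp add: p_def)
 note m = chi_square_moments[OF a_chi[OF k, folded p_def]]
 have Y: "Y (Suc k) = (\<lambda>w. ((a k w)^2 - p) / sqrt (2 * p))" using k by (simp add: Y_var_def fun_eq_iff p_def)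
 show "integrable M (Y (Suc k))" "expectation (Y (Suc k)) = 0" unfolding Y using m by (simp_all add: prob_space)
 have Y2: "(\<lambda>w. (Y (Suc k) w)^2) = (\<lambda>w. (((a k w)^2)^2 - 2 * p * (a k w)^2 + p^2) / (2 * p))"
  unfolding Y using p by (simp add: fun_eq_iff power_divide power2_diff algebra_simps)
 show "integrable M (\<lambda>w. (Y (Suc k) w)^2)" unfolding Y2 using m by simp
 show "expectation (\<lambda>w. (Y (Suc k) w)^2) = 1" unfolding Y2 using m p by (simp add: prob_space field_simps power2_eq_square)
qed

text \<open>The outer factor \<open>1/2\<close> is there because the joint exponential moment of
  \<open>X\<close> and \<open>Y\<close> is reduced to separate moments with exponent
  \<open>2 * hh\<close>; the bound \<open>sqrt (2 * \<beta>) / 4\<close> is the range of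
  \<open>chi_square_exp_moment\<close> for the smallest parameter
  \<open>p = \<beta>\<close>.\<close>

definition hh :: real where "hh = min 1 (sqrt (2 * \<beta>) / 4) / 2"

lemma hh: assumes "0 < \<beta>" shows "0 < hh" "hh \<le> 1" "2 * hh \<le> 1" "2 * hh \<le> sqrt (2 * \<beta>) / 4"
 using assms by (auto simp: hh_def)

lemma noise_exp: assumes \<beta>: "0 < \<beta>"
 shows "(\<integral>\<^sup>+w. ennreal (exp (hh * (\<bar>X (Suc k) w\<bar> + \<bar>Y (Suc k) w\<bar>))) \<partial>M) \<le> ennreal (2 * exp 2)"
proof -
 note h = hh[OF \<beta>]
 have [measurable]: "X (Suc k) \<in> borel_measurable M" "Y (Suc k) \<in> borel_measurable M" using XY_meas by auto
 have "(\<integral>\<^sup>+w. ennreal (exp (2 * hh * \<bar>X (Suc k) w\<bar>)) \<partial>M) \<le> (\<integral>\<^sup>+w. ennreal (exp (2 * hh * X (Suc k) w)) + ennreal (exp (- 2 * hh * X (Suc k) w)) \<partial>M)"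
  by (intro nn_integral_mono) (auto simp: abs_if ennreal_plus[symmetric] simp del: ennreal_plus intro!: ennreal_leI)
 also have "\<dots> = ennreal (2 * exp ((2 * hh)^2 / 2))"
  using X_mgf[of "Suc k" "2 * hh"] X_mgf[of "Suc k" "- 2 * hh"] by (subst nn_integral_add) (auto simp: ennreal_plus[symmetric] simp del: ennreal_plus)
 also have "\<dots> \<le> ennreal (2 * exp 2)"
  using power_mono[OF h(3), of 2] h by (intro ennreal_leI) simp
 finally have X: "(\<integral>\<^sup>+w. ennreal (exp (2 * hh * \<bar>X (Suc k) w\<bar>)) \<partial>M) \<le> ennreal (2 * exp 2)" .
 have Y: "(\<integral>\<^sup>+w. ennreal (exp (2 * hh * \<bar>Y (Suc k) w\<bar>)) \<partial>M) \<le> ennreal (2 * exp 2)"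
 proof (cases "k = 0")
  case True
  have "(1::real) \<le> 2 * exp 2" using exp_ge_add_one_self[of "2::real"] by simp
  thus ?thesis using True by (simp add: Y_var_def emeasure_space_1)
 next
  case False
  define p where "p = \<beta> * real k"
  have p: "0 < p" using \<beta> False by (simp add: p_def)
  have "sqrt (2 * \<beta>) \<le> sqrt (2 * p)" using \<beta> False by (simp add: p_def)
  hence hp: "2 * hh \<le> sqrt (2 * p) / 4" using h by linarith
  have Y: "Y (Suc k) = (\<lambda>w. ((a k w)^2 - p) / sqrt (2 * p))" using False by (simp add: Y_var_def fun_eq_iff p_def)
  have "(\<integral>\<^sup>+w. ennreal (exp (2 * hh * \<bar>Y (Suc k) w\<bar>)) \<partial>M) \<le> ennreal (2 * exp (2 * (2 * hh)^2))"
   unfolding Y using h hp p False by (intro chi_square_exp_moment) (auto simp: p_def intro: a_chi)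
  also have "\<dots> \<le> ennreal (2 * exp 2)" using power_mono[OF h(3), of 2] h by (intro ennreal_leI) simp
  finally show ?thesis .
 qed
 have "(\<integral>\<^sup>+w. ennreal (exp (hh * (\<bar>X (Suc k) w\<bar> + \<bar>Y (Suc k) w\<bar>))) \<partial>M)
   \<le> (\<integral>\<^sup>+w. ennreal (1/2) * ennreal (exp (2 * hh * \<bar>X (Suc k) w\<bar>)) + ennreal (1/2) * ennreal (exp (2 * hh * \<bar>Y (Suc k) w\<bar>)) \<partial>M)"
 proof (intro nn_integral_mono)
  fix w
  \<comment> \<open>The inequality \<open>2 p q \<le> p^2 + q^2\<close> separates the two noises
    without an appeal to their independence.\<close>
  define p q where "p = exp (hh * \<bar>X (Suc k) w\<bar>)" and "q = exp (hh * \<bar>Y (Suc k) w\<bar>)"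
  have "2 * p * q \<le> p^2 + q^2" by (rule sum_squares_bound)
  hence "exp (hh * (\<bar>X (Suc k) w\<bar> + \<bar>Y (Suc k) w\<bar>)) \<le> 1/2 * exp (2 * hh * \<bar>X (Suc k) w\<bar>) + 1/2 * exp (2 * hh * \<bar>Y (Suc k) w\<bar>)"
   by (simp add: p_def q_def exp_double[symmetric] distrib_left exp_add mult.assoc)
  thus "ennreal (exp (hh * (\<bar>X (Suc k) w\<bar> + \<bar>Y (Suc k) w\<bar>))) \<le> ennreal (1/2) * ennreal (exp (2 * hh * \<bar>X (Suc k) w\<bar>)) + ennreal (1/2) * ennreal (exp (2 * hh * \<bar>Y (Suc k) w\<bar>))"
   by (simp only: ennreal_mult[symmetric] ennreal_plus[symmetric] exp_ge_zero zero_le_divide_1_iff zero_le_numeral mult_nonneg_nonneg ennreal_leI)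
 qed
 also have "\<dots> = ennreal (1/2) * (\<integral>\<^sup>+w. ennreal (exp (2 * hh * \<bar>X (Suc k) w\<bar>)) \<partial>M) + ennreal (1/2) * (\<integral>\<^sup>+w. ennreal (exp (2 * hh * \<bar>Y (Suc k) w\<bar>)) \<partial>M)"
  by (subst nn_integral_add) (simp_all add: nn_integral_cmult)
 also have "\<dots> \<le> ennreal (1/2) * ennreal (2 * exp 2) + ennreal (1/2) * ennreal (2 * exp 2)"
  by (intro add_mono mult_left_mono X Y) auto
 also have "\<dots> = ennreal (2 * exp 2)"
  by (simp only: ennreal_mult[symmetric] ennreal_plus[symmetric] exp_ge_zero zero_le_divide_1_iff zero_le_numeral mult_nonneg_nonneg) simp
 finally show ?thesis .
qed

lemma W_indep: "indep_vars (\<lambda>_. borel) (\<lambda>k w. (complex_of_real (X (Suc k) w), complex_of_real (Y (Suc k) w))) (UNIV :: nat set)"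
proof -
 \<comment> \<open>Step \<open>k\<close> uses \<open>b (Suc k)\<close> and \<open>a k\<close>, since
   \<open>Y (Suc k)\<close> is built from \<open>a k\<close>. In step 0 there is no
   \<open>a\<close>, because \<open>Y 1 = 0\<close>.\<close>
 define K :: "nat \<Rightarrow> (nat + nat) set" where "K k = (if k = 0 then {Inr 1} else {Inl k, Inr (Suc k)})" for k
 have "disjoint_family_on K UNIV" by (auto simp: disjoint_family_on_def K_def)
 hence 1: "indep_vars (\<lambda>j. PiM (K j) (\<lambda>_. borel)) (\<lambda>j w. restrict (\<lambda>i. case_sum a b i w) (K j)) UNIV"
  by (rule indep_vars_restrict[OF indep_ab, rotated]) (auto simp: K_def)
 define h where "h k f = (complex_of_real (f (Inr (Suc k)) / sqrt 2), complex_of_real (if k = 0 then 0 else ((f (Inl k))^2 - \<beta> * real k) / sqrt (2 * \<beta> * real k)))" for k and f :: "nat + nat \<Rightarrow> real"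
 have "h k \<in> borel_measurable (PiM (K k) (\<lambda>_. borel))" for k
 proof -
  have [measurable]: "(\<lambda>f. f (Inr (Suc k))) \<in> borel_measurable (PiM (K k) (\<lambda>_. borel))"
   by (rule measurable_component_singleton) (simp add: K_def)
  show ?thesis
  proof (cases "k = 0")
   case True
   have "h k = (\<lambda>f. (complex_of_real (f (Inr (Suc k)) / sqrt 2), 0))" using True by (simp add: h_def fun_eq_iff)
   thus ?thesis by simp
  next
   case False
   have [measurable]: "(\<lambda>f. f (Inl k)) \<in> borel_measurable (PiM (K k) (\<lambda>_. borel))"
    by (rule measurable_component_singleton) (simp add: K_def False)
   have "h k = (\<lambda>f. (complex_of_real (f (Inr (Suc k)) / sqrt 2), complex_of_real (((f (Inl k))^2 - \<beta> * real k) / sqrt (2 * \<beta> * real k))))"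
    using False by (simp add: h_def fun_eq_iff)
   thus ?thesis by simp
  qed
 qed
 from indep_vars_compose2[OF 1 this]
 have "indep_vars (\<lambda>_. borel) (\<lambda>k w. h k (restrict (\<lambda>i. case_sum a b i w) (K k))) UNIV" .
 moreover have "h k (restrict (\<lambda>i. case_sum a b i w) (K k)) = (complex_of_real (X (Suc k) w), complex_of_real (Y (Suc k) w))" for k w
  by (simp add: h_def K_def X_var_def Y_var_def)
 ultimately show ?thesis by (simp only:)
qed

lemma XY_product: assumes \<beta>: "0 < \<beta>"
 shows "integrable M (\<lambda>w. X (Suc k) w * Y (Suc k) w)" "expectation (\<lambda>w. X (Suc k) w * Y (Suc k) w) = 0"
proof -
 have *: "integrable M (\<lambda>w. X (Suc k) w * Y (Suc k) w) \<and> expectation (\<lambda>w. X (Suc k) w * Y (Suc k) w) = 0"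
 proof (cases "k = 0")
  case True thus ?thesis by (simp add: Y_var_def)
 next
  case False
  have "indep_var (PiM {Inr (Suc k)} (\<lambda>_. borel)) (\<lambda>w. restrict (\<lambda>i. case_sum a b i w) {Inr (Suc k)})
     (PiM {Inl k} (\<lambda>_. borel)) (\<lambda>w. restrict (\<lambda>i. case_sum a b i w) {Inl k})"
   using False by (intro indep_var_restrict[OF indep_ab]) auto
  hence "indep_var borel ((\<lambda>f. f (Inr (Suc k)) / sqrt 2) \<circ> (\<lambda>w. restrict (\<lambda>i. case_sum a b i w) {Inr (Suc k)}))
    borel ((\<lambda>f. ((f (Inl k))^2 - \<beta> * real k) / sqrt (2 * \<beta> * real k)) \<circ> (\<lambda>w. restrict (\<lambda>i. case_sum a b i w) {Inl k}))"
   by (rule indep_var_compose) measurable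
  hence ind: "indep_var borel (X (Suc k)) borel (Y (Suc k))"
   using False by (simp add: comp_def X_var_def[abs_def] Y_var_def[abs_def])
  have k: "1 \<le> k" using False by simp
  show ?thesis
   using indep_var_integrable[OF ind] indep_var_lebesgue_integral[OF ind] X_moments[of "Suc k"] Y_moments[OF \<beta> k] by simp
 qed
 thus "integrable M (\<lambda>w. X (Suc k) w * Y (Suc k) w)" "expectation (\<lambda>w. X (Suc k) w * Y (Suc k) w) = 0" by auto
qed

lemma step_noise: assumes \<beta>: "0 < \<beta>"
 shows "step_noise M (X (Suc k)) (Y (Suc k)) (if k = 0 then 0 else 1) hh (2 * exp 2)"
proof
 show "integrable M (Y (Suc k))" "expectation (Y (Suc k)) = 0" "integrable M (\<lambda>w. (Y (Suc k) w)^2)"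
  "expectation (\<lambda>w. (Y (Suc k) w)^2) = (if k = 0 then 0 else 1)"
 proof -
  have "integrable M (Y (Suc k)) \<and> expectation (Y (Suc k)) = 0 \<and> integrable M (\<lambda>w. (Y (Suc k) w)^2)
   \<and> expectation (\<lambda>w. (Y (Suc k) w)^2) = (if k = 0 then 0 else 1)"
  proof (cases "k = 0")
   case True thus ?thesis by (simp add: Y_var_def[abs_def])
  next
   case False
   hence "1 \<le> k" by simp
   thus ?thesis using Y_moments[OF \<beta>, of k] False by simp
  qed
  thus "integrable M (Y (Suc k))" "expectation (Y (Suc k)) = 0" "integrable M (\<lambda>w. (Y (Suc k) w)^2)"
   "expectation (\<lambda>w. (Y (Suc k) w)^2) = (if k = 0 then 0 else 1)" by blast+
 qed
 show "(\<integral>\<^sup>+w. ennreal (exp (hh * (\<bar>X (Suc k) w\<bar> + \<bar>Y (Suc k) w\<bar>))) \<partial>M) \<le> ennreal (2 * exp 2)"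
  by (rule noise_exp[OF \<beta>])
 show "X (Suc k) \<in> borel_measurable M" "Y (Suc k) \<in> borel_measurable M" using XY_meas by auto
 show "integrable M (X (Suc k))" "integrable M (\<lambda>w. (X (Suc k) w)^2)" "expectation (X (Suc k)) = 0" "expectation (\<lambda>w. (X (Suc k) w)^2) = 1"
  by (rule X_moments; simp)+
 show "integrable M (\<lambda>w. X (Suc k) w * Y (Suc k) w)" "expectation (\<lambda>w. X (Suc k) w * Y (Suc k) w) = 0"
  by (rule XY_product[OF \<beta>])+
 show "0 < hh" "hh \<le> 1" by (rule hh[OF \<beta>])+
qed auto

end

text \<open>Comparison with the telescoping sum of \<open>2 / sqrt (P - k)\<close>. The sum is
  dominated by the indices near the turning point, hence the order
  \<open>1 / sqrt \<omega>\<close>.\<close>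

lemma sum_power_three_halves:
 fixes P \<omega> :: real assumes \<omega>: "0 < \<omega>" and n: "real n + \<omega> \<le> P"
 shows "(\<Sum>k<n. 1 / ((P - real k) * sqrt (P - real k))) \<le> 2 / sqrt \<omega>"
proof -
 define g where "g k = 2 / sqrt (P - real k)" for k
 have step: "1 / ((P - real k) * sqrt (P - real k)) \<le> g (Suc k) - g k" if "k < n" for k
 proof -
  define a b where "a = sqrt (P - real k)" and "b = sqrt (P - real (Suc k))"
  have pos: "0 < P - real (Suc k)" "0 < P - real k" using that n \<omega> by auto
  have ab: "0 < b" "0 < a" "b \<le> a" "a^2 = P - real k" "b^2 = P - real (Suc k)" using pos by (auto simp: a_def b_def)
  have d: "(a - b) * (a + b) = 1" using ab by (simp add: algebra_simps power2_eq_square)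
  have "1 / (a^2 * a) = (a - b) * (a + b) / (a^2 * a)" by (simp add: d)
  also have "\<dots> \<le> (a - b) * (2 * a) / (a^2 * a)" using ab by (intro divide_right_mono mult_left_mono mult_nonneg_nonneg zero_le_power2) auto
  also have "\<dots> = 2 * (a - b) / (a * a)" using ab by (simp add: field_simps power2_eq_square)
  also have "\<dots> \<le> 2 * (a - b) / (a * b)" using ab by (intro divide_left_mono mult_left_mono mult_pos_pos) auto
  also have "\<dots> = 2 / b - 2 / a" using ab by (simp add: field_simps)
  finally show ?thesis using ab(4) by (simp add: g_def a_def b_def)
 qed
 have "(\<Sum>k<n. 1 / ((P - real k) * sqrt (P - real k))) \<le> (\<Sum>k<n. g (Suc k) - g k)" by (intro sum_mono step) auto
 also have "\<dots> = g n - g 0" by (rule sum_lessThan_telescope)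
 also have "\<dots> \<le> g n" using n \<omega> by (simp add: g_def)
 also have "\<dots> \<le> 2 / sqrt \<omega>" unfolding g_def using n \<omega> by (intro divide_left_mono) auto
 finally show ?thesis .
qed

lemma sum_geometric_decay:
 fixes t :: real assumes t: "0 < t"
 shows "(\<Sum>k<n. inverse ((1 + t)^(n - k))) \<le> 1 / t"
proof (induction n)
 case 0 show ?case using t by simp
next
 case (Suc n)
 have "(\<Sum>k<Suc n. inverse ((1 + t)^(Suc n - k))) = inverse (1 + t) * (\<Sum>k<n. inverse ((1 + t)^(n - k))) + inverse (1 + t)"
  by (simp add: sum_distrib_left Suc_diff_le)
 also have "\<dots> \<le> inverse (1 + t) * (1 / t) + inverse (1 + t)" using Suc t by (intro add_right_mono mult_left_mono) auto
 also have "\<dots> = inverse (1 + t) * ((1 + t) / t)" using t by (simp add: add_divide_distrib distrib_left)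
 also have "\<dots> = 1 / t" using t by (simp add: divide_inverse)
 finally show ?case .
qed

section \<open>The recursion driven by the coupled noise\<close>

locale coupled = beta_coupling M \<beta> C a b BX BY + hyperbolic_beta N n z \<omega> \<beta>
 for M :: "'a measure" and \<beta> C a b BX BY N n z \<omega>
begin

definition Ph :: "'a \<Rightarrow> nat \<Rightarrow> complex" where "Ph w k = Phi \<beta> N a b k z w"

lemma Ph_0: "Ph w 0 = 1" by (simp add: Ph_def Phi_0)

lemma Ph_rec: "Ph w (Suc k) = (z - of_real (X (Suc k) w / sqrt (2 * real N * \<beta>))) * Ph w k
    - of_real (real k / (4 * real N) + yc k * Y (Suc k) w) * Ph w (k - 1)"
proof -
 have bX: "b j w / sqrt (4 * real N * \<beta>) = X j w / sqrt (2 * real N * \<beta>)" for j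
 proof -
  have "sqrt (4 * real N * \<beta>) = sqrt 2 * sqrt (2 * real N * \<beta>)" by (simp add: real_sqrt_mult[symmetric])
  thus ?thesis by (simp add: X_var_def)
 qed
 show ?thesis
 proof (cases k)
  case 0
  have "(4 * real N * \<beta>) powr (- 1 / 2) = 1 / sqrt (4 * real N * \<beta>)"
  proof -
   have "(4 * real N * \<beta>) powr (- 1 / 2) = (4 * real N * \<beta>) powr (- (1 / 2))" by simp
   also have "\<dots> = inverse ((4 * real N * \<beta>) powr (1 / 2))" by (rule powr_minus)
   also have "(4 * real N * \<beta>) powr (1 / 2) = sqrt (4 * real N * \<beta>)" using \<beta> by (intro powr_half_sqrt) simp
   finally show ?thesis by (simp only: inverse_eq_divide)
  qed
  hence "(4 * real N * \<beta>) powr (- 1 / 2) * b 1 w = X 1 w / sqrt (2 * real N * \<beta>)" using bX[of 1] by (simp only: times_divide_eq_left mult_1)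
  thus ?thesis using 0 by (simp only: Ph_def Phi_1 Phi_0) simp
 next
  case (Suc j)
  have "(a (Suc j) w)^2 / (4 * real N * \<beta>) = real k / (4 * real N) + yc k * Y (Suc k) w"
  proof -
   have "sqrt (2 * \<beta> * real k) \<noteq> 0" using \<beta> Suc by simp
   hence "sqrt (2 * \<beta> * real k) * Y (Suc k) w = (a (Suc j) w)^2 - \<beta> * real k" using Suc by (simp add: Y_var_def)
   hence "(a (Suc j) w)^2 = \<beta> * real k + sqrt (2 * \<beta> * real k) * Y (Suc k) w" by simp
   thus ?thesis using \<beta> Npos by (simp add: add_divide_distrib)
  qed
  hence "complex_of_real ((a (Suc j) w)^2 / (4 * real N * \<beta>)) = of_real (real k / (4 * real N) + yc k * Y (Suc k) w)"
   by (simp only:)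
  moreover have "complex_of_real (b (j + 2) w / sqrt (4 * real N * \<beta>)) = of_real (X (Suc k) w / sqrt (2 * real N * \<beta>))"
   using bX[of "j + 2"] Suc by (simp only: add_2_eq_Suc')
  ultimately show ?thesis using Phi_Suc_Suc[OF \<beta> N, of a b j z w] unfolding Ph_def Suc diff_Suc_1 by (simp only:)
 qed
qed

definition vv :: "nat \<Rightarrow> real" where "vv k = (if k = 0 then 0 else 1)"
text \<open>Half of the mean of \<open>(FF k)^2\<close>, with the complex square and not the squared
  modulus; \<open>vv\<close> is the variance of \<open>Y (Suc k)\<close>.\<close>

definition dd :: "nat \<Rightarrow> complex" where "dd k = ((f1 k)^2 + (f2 k)^2 * of_real (vv k)) / 2"
definition FF :: "nat \<Rightarrow> 'a \<Rightarrow> complex" where "FF k w = f1 k * of_real (X (Suc k) w) + f2 k * of_real (Y (Suc k) w)"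
definition EE :: "nat \<Rightarrow> 'a \<Rightarrow> complex" where "EE k w = exp (- (\<Sum>j<k. FF j w + dd j))"
definition ss :: "nat \<Rightarrow> 'a \<Rightarrow> complex" where "ss k w = s (Ph w) k"
definition vs :: "nat \<Rightarrow> 'a \<Rightarrow> complex" where "vs k w = v (Ph w) k"

text \<open>One step of the pair \<open>(s / E - 1, v / (E \<theta>))\<close> as a function of the
  pair and the fresh noise. The factor \<open>\<theta> k / \<theta> (Suc k)\<close> accounts for the
  change of the scale of \<open>v\<close>, and both components carry \<open>exp (F + d)\<close> from
  the division by \<open>E\<close>.\<close>

definition step :: "nat \<Rightarrow> (complex \<times> complex) \<times> (complex \<times> complex) \<Rightarrow> complex \<times> complex" where
 "step k q =
  (exp (f1 k * fst (snd q) + f2 k * snd (snd q) + dd k) * ((1 + fst (fst q)) * (1 - (f1 k * fst (snd q) + fh2 k * snd (snd q)))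
    + (of_real (\<theta> k) * err k + (of_real (\<theta> k) * ((1 + \<kappa> (Suc k)) * \<tau>1 k) * fst (snd q) + of_real (\<theta> k) * ((1 + \<kappa> (Suc k)) * \<tau>2 k) * snd (snd q))) * snd (fst q)) - 1,
   of_real (\<theta> k / \<theta> (Suc k)) * (exp (f1 k * fst (snd q) + f2 k * snd (snd q) + dd k)
    * ((\<rho> k + (\<tau>1 k * fst (snd q) + \<tau>2 k * snd (snd q))) * snd (fst q)
      - (\<phi>1 k / of_real (\<theta> k) * fst (snd q) + \<phi>2 k / of_real (\<theta> k) * snd (snd q)) * (1 + fst (fst q)))))"

lemma step_meas: "step k \<in> borel_measurable (borel \<Otimes>\<^sub>M borel)"
 unfolding step_def[abs_def] borel_prod[symmetric] by measurable

primrec chain :: "nat \<Rightarrow> 'a \<Rightarrow> complex \<times> complex" where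
 "chain 0 w = (0, 0)"
| "chain (Suc k) w = step k (chain k w, (of_real (X (Suc k) w), of_real (Y (Suc k) w)))"

lemma chain_eq: "k \<le> n \<Longrightarrow> chain k w = (ss k w / EE k w - 1, vs k w / (EE k w * of_real (\<theta> k)))"
proof (induction k)
 case 0 show ?case using s_0[of "Ph w" "\<lambda>k. X k w" "\<lambda>k. Y k w", OF Ph_0 Ph_rec] by (simp add: ss_def vs_def EE_def)
next
 case (Suc k)
 hence k: "k \<le> n" by simp
 note nz = \<theta>_pos[OF k] \<theta>_pos[OF Suc.prems]
 have E: "EE (Suc k) w * exp (FF k w + dd k) = EE k w" "EE k w \<noteq> 0" "EE (Suc k) w \<noteq> 0"
  by (auto simp: EE_def exp_add[symmetric])
 define ex where "ex = exp (FF k w + dd k)"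
 have ex: "exp (f1 k * of_real (X (Suc k) w) + f2 k * of_real (Y (Suc k) w) + dd k) = ex" by (simp add: ex_def FF_def)
 have ee: "EE k w = EE (Suc k) w * ex" "ex \<noteq> 0" using E by (auto simp: ex_def)
 have a: "ss (Suc k) w = ss k w * (1 - (f1 k * of_real (X (Suc k) w) + fh2 k * of_real (Y (Suc k) w))) + (err k + (1 + \<kappa> (Suc k)) * (\<tau>1 k * of_real (X (Suc k) w) + \<tau>2 k * of_real (Y (Suc k) w))) * vs k w"
  unfolding ss_def vs_def using s_rec[of "Ph w" "\<lambda>k. X k w" "\<lambda>k. Y k w", OF Ph_0 Ph_rec k] by (simp add: \<tau>_def[OF Ph_0 Ph_rec])
 have b: "vs (Suc k) w = (\<rho> k + (\<tau>1 k * of_real (X (Suc k) w) + \<tau>2 k * of_real (Y (Suc k) w))) * vs k w - (\<phi>1 k * of_real (X (Suc k) w) + \<phi>2 k * of_real (Y (Suc k) w)) * ss k w"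
  unfolding ss_def vs_def using v_rec'[of "Ph w" "\<lambda>k. X k w" "\<lambda>k. Y k w", OF Ph_0 Ph_rec k] by (simp add: \<tau>_def[OF Ph_0 Ph_rec] \<phi>_def[OF Ph_0 Ph_rec])
 show ?case
  unfolding chain.simps Suc.IH[OF k] step_def fst_conv snd_conv ex prod.inject
 proof
  show "ex * ((1 + (ss k w / EE k w - 1)) * (1 - (f1 k * of_real (X (Suc k) w) + fh2 k * of_real (Y (Suc k) w))) +
    (of_real (\<theta> k) * err k + (of_real (\<theta> k) * ((1 + \<kappa> (Suc k)) * \<tau>1 k) * of_real (X (Suc k) w) + of_real (\<theta> k) * ((1 + \<kappa> (Suc k)) * \<tau>2 k) * of_real (Y (Suc k) w))) *
    (vs k w / (EE k w * of_real (\<theta> k)))) - 1 = ss (Suc k) w / EE (Suc k) w - 1"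
   unfolding a ee(1) using nz E(3) ee(2) by (simp add: field_simps)
  show "of_real (\<theta> k / \<theta> (Suc k)) * (ex * ((\<rho> k + (\<tau>1 k * of_real (X (Suc k) w) + \<tau>2 k * of_real (Y (Suc k) w))) * (vs k w / (EE k w * of_real (\<theta> k))) -
    (\<phi>1 k / of_real (\<theta> k) * of_real (X (Suc k) w) + \<phi>2 k / of_real (\<theta> k) * of_real (Y (Suc k) w)) * (1 + (ss k w / EE k w - 1))))
   = vs (Suc k) w / (EE (Suc k) w * of_real (\<theta> (Suc k)))"
   unfolding b ee(1) using nz E(3) ee(2) by (simp add: field_simps)
 qed
qed

definition LL :: real where "LL = \<omega> * sqrt (\<omega> / P)"
text \<open>The constant \<open>1920 * cc^4 * Bm\<close> of \<open>one_step_moment\<close> with the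
  noise parameters \<open>hh\<close> and \<open>2 * exp 2\<close> inserted; it depends on
  \<open>\<beta>\<close> alone.\<close>

definition GG :: real where "GG = max 1 (1920 * cc^4 * (24 * (4 / hh)^4 * exp hh * (2 * exp 2)))"
definition KK :: real where "KK = 400 * GG"

lemma GK: "1 \<le> GG" "400 \<le> KK" "400 * GG \<le> KK" by (auto simp: GG_def KK_def)

text \<open>The choice of the parameters. The first part of \<open>A\<close> has the size required
  by \<open>c1\<close>, because \<open>sqrt (\<omega> / P)\<close> is a lower bound of every
  \<open>\<theta> k\<close>. The second part grows geometrically to 1 at \<open>k = n\<close>, at a
  rate slower than the contraction. The value of \<open>\<epsilon>\<close> makes one
  \<open>\<nu>\<close> serve both conditions on the relative noise.\<close>

lemma one_step_coupled:
 fixes m :: nat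
 assumes k: "k < n" and m: "1 \<le> m" "KK * real m \<le> LL" and \<omega>: "cc^2 \<le> \<omega>" and LL: "64 \<le> LL"
  and small: "6 * 10^6 * cc * (\<omega> / sqrt P) \<le> hh / 4"
 defines "tw \<equiv> sqrt (\<omega> / P)" and "\<epsilon> \<equiv> KK * real m / LL"
 defines "A \<equiv> \<lambda>k. KK * real m / (sqrt (\<omega> / P) * \<Delta> k) + inverse ((1 + sqrt (\<omega> / P) / 8)^(n - k))"
 shows "(\<integral>\<^sup>+w. ennreal (((cmod (fst (step k (yp, (of_real (X (Suc k) w), of_real (Y (Suc k) w))))))^2
   + A (Suc k) * (cmod (snd (step k (yp, (of_real (X (Suc k) w), of_real (Y (Suc k) w))))))^2 + \<epsilon>)^m) \<partial>M)
  \<le> ennreal (((cmod (fst yp))^2 + A k * (cmod (snd yp))^2 + \<epsilon>)^m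
    * exp (16 * GG^2 * real m * (4 * (sqrt \<omega> * (1 / (\<Delta> k * sqrt (\<Delta> k)))) + tw * inverse ((1 + tw / 8)^(n - k)))))"
proof -
 have kn: "k \<le> n" "Suc k \<le> n" using k by auto
 have m0: "1 \<le> real m" using m by simp
 have K0: "0 < KK" "1 \<le> KK" using GK by auto
 have Km: "1 \<le> KK * real m" using K0 m0 mult_mono[of 1 KK 1 "real m"] by simp
 have w0: "0 < \<omega>" using \<omega>1 by simp
 have \<Delta>s: "\<omega> \<le> \<Delta> (Suc k)" "\<Delta> (Suc k) = \<Delta> k - 1" "\<omega> \<le> \<Delta> k" "0 < \<Delta> k" "0 < \<Delta> (Suc k)"
  using \<Delta>_ge[OF kn(1)] \<Delta>_ge[OF kn(2)] \<Delta>_pos[OF kn(1)] \<Delta>_pos[OF kn(2)] by (auto simp: \<Delta>_def)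
 have \<omega>P: "\<omega> \<le> P" using \<Delta>s(3) \<Delta>_le[of k] by linarith
 have tw: "0 < tw" "tw \<le> 1" "tw \<le> \<theta> k" "LL = \<omega> * tw"
  using w0 Ppos \<omega>P \<Delta>s by (auto simp: tw_def \<theta>_def LL_def divide_right_mono)
 note th = \<theta>_pos[OF kn(1)] \<theta>_le1[of k]
 have L0: "0 < LL" using LL by simp
 have LDel: "LL \<le> \<Delta> k * \<theta> k" "LL \<le> \<Delta> (Suc k) * \<theta> k"
  unfolding tw(4) using \<Delta>s tw w0 th by (auto intro!: mult_mono)
 have Lom: "LL \<le> \<omega>" unfolding tw(4) using tw w0 by (simp add: mult_left_le)
 have \<epsilon>: "0 < \<epsilon>" "\<epsilon> \<le> 1" using Km L0 m by (auto simp: \<epsilon>_def)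
 define B where "B j = inverse ((1 + tw / 8)^(n - j))" for j
 have B: "0 < B j" "B j \<le> 1" for j using tw by (auto simp: B_def intro!: inverse_le_1_iff[THEN iffD2])
 have BS: "B (Suc k) = (1 + tw / 8) * B k"
 proof -
  have "n - k = Suc (n - Suc k)" using k by simp
  thus ?thesis using tw by (simp add: B_def)
 qed
 have A_eq: "A j = KK * real m / (tw * \<Delta> j) + B j" for j by (simp add: A_def tw_def B_def)
 have Km\<Delta>: "KK * real m / (tw * \<Delta> k) \<le> 1"
 proof -
  have "LL \<le> tw * \<Delta> k" unfolding tw(4) using \<Delta>s tw by (simp add: mult.commute)
  hence "KK * real m \<le> tw * \<Delta> k" using m by linarith
  thus ?thesis using tw \<Delta>s by simp
 qed
 have A: "0 < A k" "A k \<le> 2" "KK * real m / (tw * \<Delta> k) \<le> A k"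
 proof -
  have "0 \<le> KK * real m / (tw * \<Delta> k)" using K0 m0 tw \<Delta>s by simp
  thus "0 < A k" "A k \<le> 2" "KK * real m / (tw * \<Delta> k) \<le> A k" using B[of k] Km\<Delta> unfolding A_eq by linarith+
 qed
 define \<mu> where "\<mu> = \<theta> k"
 have r\<Delta>: "\<Delta> k / \<Delta> (Suc k) = 1 + 1 / \<Delta> (Suc k)" using \<Delta>s by (simp add: field_simps)
 have i\<Delta>: "1 / \<Delta> (Suc k) \<le> \<mu> / 64"
 proof -
  have "64 \<le> \<Delta> (Suc k) * \<theta> k" using LDel(2) LL by linarith
  hence "1 * 64 \<le> \<mu> * \<Delta> (Suc k)" by (simp add: \<mu>_def mult.commute)
  hence "1 * 64 / (\<Delta> (Suc k) * 64) \<le> \<mu> * \<Delta> (Suc k) / (\<Delta> (Suc k) * 64)" using \<Delta>s(5) by (intro divide_right_mono) auto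
  thus ?thesis using \<Delta>s(5) by simp
 qed
 have A': "A (Suc k) \<le> A k * (1 + \<mu> / 8)" "0 \<le> A (Suc k)"
 proof -
  have "KK * real m / (tw * \<Delta> (Suc k)) = KK * real m / (tw * \<Delta> k) * (\<Delta> k / \<Delta> (Suc k))" using \<Delta>s by simp
  also have "\<dots> \<le> KK * real m / (tw * \<Delta> k) * (1 + \<mu> / 8)"
   using i\<Delta> K0 m0 tw \<Delta>s th unfolding r\<Delta> by (intro mult_left_mono) (auto simp: \<mu>_def)
  finally have 1: "KK * real m / (tw * \<Delta> (Suc k)) \<le> KK * real m / (tw * \<Delta> k) * (1 + \<mu> / 8)" .
  have 2: "B (Suc k) \<le> B k * (1 + \<mu> / 8)" unfolding BS using tw B(1)[of k] by (simp add: mult.commute \<mu>_def)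
  show "A (Suc k) \<le> A k * (1 + \<mu> / 8)" unfolding A_eq distrib_right using 1 2 by linarith
  show "0 \<le> A (Suc k)" unfolding A_eq using K0 m0 tw \<Delta>s B(1)[of "Suc k"] by (intro add_nonneg_nonneg) auto
 qed
 \<comment> \<open>The rescaling of \<open>v\<close> multiplies the new weight by
   \<open>1 + 1 / \<Delta> (Suc k)\<close>. The assumption \<open>64 \<le> LL\<close> keeps
   \<open>1 / \<Delta> (Suc k)\<close> below \<open>\<theta> k / 64\<close>.\<close>
 define A2 where "A2 = A (Suc k) * (\<theta> k / \<theta> (Suc k))^2"
 have \<theta>r: "(\<theta> k / \<theta> (Suc k))^2 = 1 + 1 / \<Delta> (Suc k)"
  unfolding power_divide \<theta>_sq[OF kn(1)] \<theta>_sq[OF kn(2)] r\<Delta>[symmetric] using Ppos by simp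
 have A2: "0 \<le> A2" "A2 \<le> A k * (1 + \<mu> / 4)"
 proof -
  show "0 \<le> A2" using A' by (simp add: A2_def)
  have "A2 \<le> (A k * (1 + \<mu> / 8)) * (1 + \<mu> / 64)"
   unfolding A2_def \<theta>r using A' i\<Delta> \<Delta>s A th by (intro mult_mono) (auto simp: \<mu>_def)
  also have "\<dots> = A k * ((1 + \<mu> / 8) * (1 + \<mu> / 64))" by simp
  also have "\<dots> \<le> A k * (1 + \<mu> / 4)"
  proof (intro mult_left_mono)
   have "\<mu> * \<mu> \<le> \<mu> * 1" using th by (intro mult_left_mono) (auto simp: \<mu>_def)
   moreover have "(1 + \<mu> / 8) * (1 + \<mu> / 64) = 1 + \<mu> / 8 + \<mu> / 64 + \<mu> * \<mu> / 512" by (simp add: field_simps)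
   ultimately show "(1 + \<mu> / 8) * (1 + \<mu> / 64) \<le> 1 + \<mu> / 4" using th(1) unfolding \<mu>_def[symmetric] by linarith
  qed (use A in auto)
  finally show "A2 \<le> A k * (1 + \<mu> / 4)" .
 qed
 \<comment> \<open>The growth of the weight, at most \<open>1 + \<mu> / 4\<close>, is paid by one of
   the two factors \<open>1 - \<mu>\<close>; the other one leaves the contraction needed by
   \<open>one_step_moment\<close>.\<close>
 have A2\<rho>: "A2 * (cmod (\<rho> k))^2 \<le> A k * (1 - \<mu> / 2)"
 proof -
  have "A2 * (cmod (\<rho> k))^2 \<le> (A k * (1 + \<mu> / 4)) * (1 - \<mu>)^2"
   using A2 \<rho>_le[OF kn(1)] A th by (intro mult_mono power_mono) (auto simp: \<mu>_def)
  also have "\<dots> = A k * ((1 + \<mu> / 4) * (1 - \<mu>)^2)" by simp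
  also have "\<dots> \<le> A k * (1 - \<mu> / 2)"
  proof (intro mult_left_mono)
   have "(1 + \<mu> / 4) * (1 - \<mu>) \<le> 1" using th zero_le_square[of \<mu>] by (simp add: algebra_simps \<mu>_def)
   hence "(1 + \<mu> / 4) * (1 - \<mu>) * (1 - \<mu>) \<le> 1 * (1 - \<mu>)" using th by (intro mult_right_mono) (auto simp: \<mu>_def)
   thus "(1 + \<mu> / 4) * (1 - \<mu>)^2 \<le> 1 - \<mu> / 2" using th by (simp add: power2_eq_square \<mu>_def mult.assoc)
  qed (use A in auto)
  finally show ?thesis .
 qed
 have A22: "A2 \<le> 2 * A k"
 proof -
  have "A k * (1 + \<mu> / 4) \<le> A k * 2" using A th by (intro mult_left_mono) (auto simp: \<mu>_def)
  thus ?thesis using A2 by simp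
 qed
 note s = \<sigma>_pos[OF kn(1)] \<sigma>_sq[OF kn(1)]
 have cs: "cc * \<sigma> k \<le> 1"
 proof (rule power2_le_imp_le)
  have "(cc * \<sigma> k)^2 = cc^2 / \<Delta> k" using s by (simp add: power_mult_distrib)
  also have "\<dots> \<le> 1^2" using \<omega> \<Delta>s by simp
  finally show "(cc * \<sigma> k)^2 \<le> 1^2" .
 qed simp
 \<comment> \<open>The smallest value with
   \<open>\<sigma>^2 \<le> \<nu>^2 * (KK m / (tw \<Delta>))\<close>. With the chosen
   \<open>\<epsilon>\<close> it also gives \<open>\<nu>^2 * \<epsilon> = 1 / \<omega>\<close>, which
   dominates \<open>\<sigma>^2\<close>.\<close>
 define \<nu> where "\<nu> = sqrt (tw / (KK * real m))"
 have \<nu>0: "0 < \<nu>" using tw K0 m0 by (simp add: \<nu>_def)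
 have \<nu>sq: "\<nu>^2 = tw / (KK * real m)" using tw K0 m0 by (simp add: \<nu>_def)
 have \<nu>A: "(\<sigma> k)^2 \<le> \<nu>^2 * A k"
 proof -
  have "(\<sigma> k)^2 = \<nu>^2 * (KK * real m / (tw * \<Delta> k))" unfolding s(2) \<nu>sq using tw K0 m0 by simp
  also have "\<dots> \<le> \<nu>^2 * A k" using A by (intro mult_left_mono) auto
  finally show ?thesis .
 qed
 have \<nu>\<epsilon>: "(\<sigma> k)^2 \<le> \<nu>^2 * \<epsilon>"
 proof -
  have "\<nu>^2 * \<epsilon> = 1 / \<omega>" unfolding \<nu>sq \<epsilon>_def tw(4) using tw K0 m0 by simp
  thus ?thesis unfolding s(2) using \<Delta>s w0 by (simp add: frac_le)
 qed
 \<comment> \<open>Since \<open>KK * m \<le> LL\<close>, the product \<open>m * \<nu>\<close> is at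
   most \<open>\<omega> / sqrt P\<close>, which tends to zero in the regime considered; this is the
   purpose of the assumption \<open>small\<close>.\<close>
 have m\<nu>: "6 * 10^6 * cc * real m * \<nu> \<le> hh / 4"
 proof -
  have "real m * \<nu> \<le> \<omega> / sqrt P"
  proof (rule power2_le_imp_le)
   have "(real m * \<nu>)^2 = real m * tw / KK" unfolding power_mult_distrib \<nu>sq using K0 m0 by (simp add: power2_eq_square)
   also have "\<dots> \<le> real m * tw * KK"
   proof -
    have p: "0 \<le> real m * tw" using m0 tw by simp
    have "real m * tw / KK \<le> real m * tw / 1" using K0 p by (intro divide_left_mono) auto
    also have "\<dots> \<le> real m * tw * KK" using mult_left_mono[OF K0(2) p] by simp
    finally show ?thesis .
   qed
   also have "\<dots> \<le> LL * tw" using mult_right_mono[OF m(2), of tw] tw by (simp add: mult_ac)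
   also have "\<dots> = \<omega> * (tw * tw)" by (simp add: tw(4))
   also have "tw * tw = \<omega> / P" using w0 Ppos by (simp add: tw_def)
   also have "\<omega> * (\<omega> / P) = (\<omega> / sqrt P)^2" using Ppos by (simp add: power_divide power2_eq_square)
   finally show "(real m * \<nu>)^2 \<le> (\<omega> / sqrt P)^2" .
  qed (use w0 Ppos in auto)
  hence "6 * 10^6 * cc * (real m * \<nu>) \<le> 6 * 10^6 * cc * (\<omega> / sqrt P)" using cc by (intro mult_left_mono) auto
  thus ?thesis using small by (simp add: mult.assoc)
 qed
 have \<sigma>A: "(\<sigma> k)^2 \<le> A k"
 proof -
  have "1 / \<Delta> k \<le> KK * real m / (tw * \<Delta> k)" using Km tw \<Delta>s by (simp add: field_simps)
  thus ?thesis using A s by simp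
 qed
 have c1: "KK * real m * (\<sigma> k)^2 \<le> \<theta> k * A k"
 proof -
  have "KK * real m * (\<sigma> k)^2 = tw * (KK * real m / (tw * \<Delta> k))" using s tw by simp
  also have "\<dots> \<le> \<theta> k * A k" using tw A th K0 m0 \<Delta>s by (intro mult_mono) auto
  finally show ?thesis .
 qed
 have c2: "KK * real m * (\<sigma> k)^2 \<le> \<theta> k"
 proof -
  have "KK * real m \<le> \<theta> k * \<Delta> k" using m(2) LDel(1) by (simp add: mult.commute)
  thus ?thesis unfolding s(2) using \<Delta>s by (simp add: pos_divide_le_eq)
 qed
 have c3: "KK * real m * (\<sigma> k)^2 * A k \<le> 2 * \<theta> k * \<epsilon>"
 proof -
  have "KK * real m * (\<sigma> k)^2 * A k \<le> KK * real m * (\<sigma> k)^2 * 2" using A K0 m0 by (intro mult_left_mono) auto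
  also have "\<dots> = 2 * (KK * real m) * (1 / \<Delta> k)" using s by simp
  also have "\<dots> \<le> 2 * (KK * real m) * (\<theta> k / LL)" using LDel(1) \<Delta>s L0 K0 m0 by (intro mult_left_mono) (auto simp: field_simps)
  finally show ?thesis by (simp add: \<epsilon>_def mult_ac)
 qed
 \<comment> \<open>Each of the four terms is at most
   \<open>q = sqrt \<omega> * \<Delta>^(-3/2)\<close>, whose sum over \<open>k\<close> is bounded by
   a constant; only the geometric part of \<open>A\<close> adds \<open>tw * B k\<close>, whose sum
   is bounded as well.\<close>
 define cost where "cost = \<sigma> k^3 / sqrt \<epsilon> + \<sigma> k^4 / (\<theta> k * A k) + A k * (\<sigma> k)^2 / \<epsilon> + real m * \<sigma> k^4 / \<epsilon>"
 define q where "q = sqrt \<omega> * (1 / (\<Delta> k * sqrt (\<Delta> k)))"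
 have cost: "cost \<le> 4 * q + tw * B k"
 proof -
  have q\<omega>: "\<omega> / (\<Delta> k)^2 \<le> q"
  proof -
   have "sqrt \<omega> / sqrt (\<Delta> k) \<le> 1" using \<Delta>s w0 by simp
   hence "q * (sqrt \<omega> / sqrt (\<Delta> k)) \<le> q * 1" using w0 \<Delta>s by (intro mult_left_mono) (auto simp: q_def)
   moreover have "q * (sqrt \<omega> / sqrt (\<Delta> k)) = (sqrt \<omega> * sqrt \<omega>) / (\<Delta> k * (sqrt (\<Delta> k) * sqrt (\<Delta> k)))" by (simp add: q_def)
   ultimately show ?thesis using w0 \<Delta>s by (simp add: power2_eq_square)
  qed
  have s3: "\<sigma> k^3 = 1 / (\<Delta> k * sqrt (\<Delta> k))" using \<Delta>s by (simp add: \<sigma>_def power3_eq_cube)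
  have s4: "\<sigma> k^4 = 1 / (\<Delta> k)^2"
  proof -
   have "\<sigma> k^4 = ((\<sigma> k)^2)^2" by (simp flip: power_mult)
   thus ?thesis unfolding s(2) by (simp add: power_divide)
  qed
  have k1: "\<sigma> k^3 / sqrt \<epsilon> \<le> q"
  proof -
   have "1 / sqrt \<epsilon> = sqrt (LL / (KK * real m))" by (simp add: \<epsilon>_def real_sqrt_divide)
   also have "\<dots> \<le> sqrt \<omega>"
   proof -
    have "LL / (KK * real m) \<le> LL / 1" using Km L0 by (intro divide_left_mono) auto
    thus ?thesis using Lom by (intro real_sqrt_le_mono) linarith
   qed
   finally have "\<sigma> k^3 * (1 / sqrt \<epsilon>) \<le> \<sigma> k^3 * sqrt \<omega>" using s by (intro mult_left_mono) auto
   thus ?thesis by (simp add: q_def s3)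
  qed
  have k2: "\<sigma> k^4 / (\<theta> k * A k) \<le> q"
  proof -
   have "\<sigma> k^4 / (\<theta> k * A k) \<le> (1 / (\<Delta> k)^2) / (\<theta> k * (1 / (tw * \<Delta> k)))"
    unfolding s4
   proof (intro divide_left_mono mult_left_mono)
    have "1 / (tw * \<Delta> k) \<le> KK * real m / (tw * \<Delta> k)" using Km tw \<Delta>s by (intro divide_right_mono) auto
    thus "1 / (tw * \<Delta> k) \<le> A k" using A by linarith
   qed (use th A tw \<Delta>s in auto)
   also have "\<dots> = (tw / \<theta> k) * (1 / \<Delta> k)" using \<Delta>s tw th by (simp add: field_simps power2_eq_square)
   also have "tw / \<theta> k = sqrt \<omega> / sqrt (\<Delta> k)" using Ppos w0 \<Delta>s by (simp add: tw_def \<theta>_def real_sqrt_divide)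
   finally show ?thesis by (simp add: q_def mult_ac)
  qed
  have k3: "A k * (\<sigma> k)^2 / \<epsilon> \<le> q + tw * B k"
  proof -
   have "A k * (\<sigma> k)^2 / \<epsilon> = (KK * real m / (tw * \<Delta> k)) * (1 / \<Delta> k) / \<epsilon> + B k * (1 / \<Delta> k) / \<epsilon>"
    unfolding A_eq s(2) by (simp add: add_divide_distrib distrib_right)
   also have "(KK * real m / (tw * \<Delta> k)) * (1 / \<Delta> k) / \<epsilon> = \<omega> / (\<Delta> k)^2"
    unfolding \<epsilon>_def tw(4) using tw K0 m0 \<Delta>s by (simp add: power2_eq_square)
   also have "B k * (1 / \<Delta> k) / \<epsilon> = B k * ((LL / \<Delta> k) / (KK * real m))" by (simp add: \<epsilon>_def)
   also have "\<dots> \<le> B k * (tw / 1)"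
   proof (intro mult_left_mono frac_le)
    have "LL \<le> tw * \<Delta> k" unfolding tw(4) using \<Delta>s tw by (simp add: mult.commute)
    thus "LL / \<Delta> k \<le> tw" using \<Delta>s by (simp add: field_simps)
   qed (use Km tw B(1)[of k] in auto)
   finally show ?thesis using q\<omega> by (simp add: mult.commute)
  qed
  have k4: "real m * \<sigma> k^4 / \<epsilon> \<le> q"
  proof -
   have "real m * \<sigma> k^4 / \<epsilon> = (LL / KK) / (\<Delta> k)^2" unfolding s4 \<epsilon>_def using m0 by simp
   also have "\<dots> \<le> \<omega> / (\<Delta> k)^2"
   proof (intro divide_right_mono)
    have "LL / KK \<le> LL / 1" using K0 L0 by (intro divide_left_mono) auto
    thus "LL / KK \<le> \<omega>" using Lom by linarith
   qed simp
   finally show ?thesis using q\<omega> by linarith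
  qed
  show ?thesis unfolding cost_def using k1 k2 k3 k4 by linarith
 qed
 interpret sn: step_noise M "X (Suc k)" "Y (Suc k)" "vv k" hh "2 * exp 2"
  using step_noise[OF \<beta>, of k] by (simp add: vv_def)
 have GB: "1920 * cc^4 * sn.Bm \<le> GG" by (simp add: GG_def sn.Bm_def)
 note cb = coeff_bounds[OF kn(1)]
 have \<rho>1: "cmod (\<rho> k) \<le> 1" using \<rho>_le[OF kn(1)] th by linarith
 note os = sn.one_step_moment[of cc "\<sigma> k" "f1 k" "f2 k" "fh2 k" "of_real (\<theta> k) * ((1 + \<kappa> (Suc k)) * \<tau>1 k)" "of_real (\<theta> k) * ((1 + \<kappa> (Suc k)) * \<tau>2 k)"
   "\<tau>1 k" "\<tau>2 k" "\<phi>1 k / of_real (\<theta> k)" "\<phi>2 k / of_real (\<theta> k)" "of_real (\<theta> k) * err k" "\<rho> k" A2 "A k" "\<theta> k" \<epsilon> \<nu> m GG KK "fst yp" "snd yp",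
   OF cc(1) s(1) cs cb(1,2,3,8,9,4,5,6,7,10) \<rho>1 A2\<rho>[unfolded \<mu>_def] A(1,2) A2(1) A22 \<epsilon> th \<nu>0 \<nu>A \<nu>\<epsilon> m(1) m\<nu> GK(1) GB GK(3) \<sigma>A c1 c2 c3]
 have eq: "(cmod (fst (step k (yp, (of_real (X (Suc k) w), of_real (Y (Suc k) w))))))^2
   + A (Suc k) * (cmod (snd (step k (yp, (of_real (X (Suc k) w), of_real (Y (Suc k) w))))))^2 + \<epsilon>
  = (cmod (exp (sn.lin (f1 k) (f2 k) w + ((f1 k)^2 + (f2 k)^2 * of_real (vv k)) / 2) * ((1 + fst yp) * (1 - sn.lin (f1 k) (fh2 k) w)
     + (of_real (\<theta> k) * err k + sn.lin (of_real (\<theta> k) * ((1 + \<kappa> (Suc k)) * \<tau>1 k)) (of_real (\<theta> k) * ((1 + \<kappa> (Suc k)) * \<tau>2 k)) w) * snd yp) - 1))^2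
    + A2 * (cmod (exp (sn.lin (f1 k) (f2 k) w + ((f1 k)^2 + (f2 k)^2 * of_real (vv k)) / 2) * ((\<rho> k + sn.lin (\<tau>1 k) (\<tau>2 k) w) * snd yp
     - sn.lin (\<phi>1 k / of_real (\<theta> k)) (\<phi>2 k / of_real (\<theta> k)) w * (1 + fst yp))))^2 + \<epsilon>" for w
  by (cases yp) (simp add: step_def sn.lin_def dd_def A2_def norm_mult norm_divide power_mult_distrib power_divide)
 show ?thesis
  unfolding eq
 proof (rule order_trans[OF os], intro ennreal_leI mult_left_mono)
  show "exp (16 * GG^2 * real m * (\<sigma> k^3 / sqrt \<epsilon> + \<sigma> k^4 / (\<theta> k * A k) + A k * (\<sigma> k)^2 / \<epsilon> + real m * \<sigma> k^4 / \<epsilon>))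
   \<le> exp (16 * GG^2 * real m * (4 * (sqrt \<omega> * (1 / (\<Delta> k * sqrt (\<Delta> k)))) + tw * inverse ((1 + tw / 8)^(n - k))))"
   unfolding exp_le_cancel_iff using cost unfolding cost_def q_def B_def by (intro mult_left_mono) auto
 qed (use A \<epsilon> in auto)
qed

text \<open>The chain starts at \<open>(0, 0)\<close>, so the initial value of \<open>V\<close> is
  \<open>\<epsilon>\<close>. The sums give \<open>4 * 2\<close> from the powers of
  \<open>\<Delta>\<close> and 8 from the geometric weights, and 16 times 16 is the constant
  256.\<close>

lemma moment_bound:
 fixes m :: nat
 assumes m: "1 \<le> m" "KK * real m \<le> LL" and \<omega>: "cc^2 \<le> \<omega>" and LL: "64 \<le> LL"
  and small: "6 * 10^6 * cc * (\<omega> / sqrt P) \<le> hh / 4"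
 shows "(\<integral>\<^sup>+w. ennreal (((cmod (fst (chain n w)))^2 + (cmod (snd (chain n w)))^2)^m) \<partial>M)
  \<le> ennreal ((KK * exp (256 * GG^2) * real m / LL)^m)"
proof -
 define tw where "tw = sqrt (\<omega> / P)"
 define \<epsilon> where "\<epsilon> = KK * real m / LL"
 define A where "A k = KK * real m / (sqrt (\<omega> / P) * \<Delta> k) + inverse ((1 + sqrt (\<omega> / P) / 8)^(n - k))" for k
 define cost where "cost k = 16 * GG^2 * real m * (4 * (sqrt \<omega> * (1 / (\<Delta> k * sqrt (\<Delta> k)))) + tw * inverse ((1 + tw / 8)^(n - k)))" for k
 define H where "H k yp = ((cmod (fst yp))^2 + A k * (cmod (snd yp))^2 + \<epsilon>)^m" for k and yp :: "complex \<times> complex"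
 have K0: "0 < KK" using GK by auto
 have w0: "0 < \<omega>" using \<omega>1 by simp
 have tw0: "0 < tw" using w0 Ppos by (simp add: tw_def)
 have \<epsilon>0: "0 \<le> \<epsilon>" using K0 LL by (simp add: \<epsilon>_def)
 have "(\<integral>\<^sup>+w. ennreal (H n (chain n w)) \<partial>M) \<le> ennreal (H 0 (0, 0) * exp (\<Sum>k<n. cost k))"
 proof (rule chain_moment[OF W_indep, where step = step])
  show "H k \<in> borel_measurable borel" for k unfolding H_def borel_prod[symmetric] by measurable
  show "(\<integral>\<^sup>+w. ennreal (H (Suc k) (step k (yp, (of_real (X (Suc k) w), of_real (Y (Suc k) w))))) \<partial>M) \<le> ennreal (H k yp * exp (cost k))" if "k < n" for k yp
   unfolding H_def cost_def A_def \<epsilon>_def tw_def by (rule one_step_coupled[OF that m \<omega> LL small])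
 qed (auto simp: step_meas)
 also have "H 0 (0, 0) * exp (\<Sum>k<n. cost k) \<le> \<epsilon>^m * exp (256 * GG^2 * real m)"
 proof (intro mult_mono)
  have "(\<Sum>k<n. cost k) = 16 * GG^2 * real m * (4 * (sqrt \<omega> * (\<Sum>k<n. 1 / (\<Delta> k * sqrt (\<Delta> k)))) + tw * (\<Sum>k<n. inverse ((1 + tw / 8)^(n - k))))"
   unfolding cost_def sum_distrib_left[symmetric] sum.distrib ..
  also have "\<dots> \<le> 16 * GG^2 * real m * (4 * (sqrt \<omega> * (2 / sqrt \<omega>)) + tw * (1 / (tw / 8)))"
  proof (intro mult_left_mono add_mono)
   show "(\<Sum>k<n. 1 / (\<Delta> k * sqrt (\<Delta> k))) \<le> 2 / sqrt \<omega>"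
    unfolding \<Delta>_def by (rule sum_power_three_halves[OF w0]) (use gap in \<open>simp add: P_def x_def\<close>)
   show "(\<Sum>k<n. inverse ((1 + tw / 8)^(n - k))) \<le> 1 / (tw / 8)" by (rule sum_geometric_decay) (use tw0 in simp)
  qed (use w0 tw0 in auto)
  also have "\<dots> = 256 * GG^2 * real m" using w0 tw0 by simp
  finally show "exp (\<Sum>k<n. cost k) \<le> exp (256 * GG^2 * real m)" by simp
 qed (use \<epsilon>0 in \<open>auto simp: H_def\<close>)
 also have "\<epsilon>^m * exp (256 * GG^2 * real m) = (KK * exp (256 * GG^2) * real m / LL)^m"
 proof -
  have "exp (256 * GG^2 * real m) = exp (256 * GG^2)^m" by (simp add: exp_of_nat_mult[symmetric] mult.commute)
  thus ?thesis by (simp add: \<epsilon>_def power_mult_distrib[symmetric] mult_ac)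
 qed
 finally have *: "(\<integral>\<^sup>+w. ennreal (H n (chain n w)) \<partial>M) \<le> ennreal ((KK * exp (256 * GG^2) * real m / LL)^m)"
  by (simp add: ennreal_leI)
 have "(\<integral>\<^sup>+w. ennreal (((cmod (fst (chain n w)))^2 + (cmod (snd (chain n w)))^2)^m) \<partial>M) \<le> (\<integral>\<^sup>+w. ennreal (H n (chain n w)) \<partial>M)"
 proof (intro nn_integral_mono ennreal_leI)
  fix w
  \<comment> \<open>At \<open>k = n\<close> the geometric part of the weight equals 1.\<close>
  have "1 \<le> A n" using K0 tw0 \<Delta>_pos[of n] unfolding A_def tw_def[symmetric] by simp
  hence "(cmod (snd (chain n w)))^2 \<le> A n * (cmod (snd (chain n w)))^2" using mult_right_mono[of 1 "A n" "(cmod (snd (chain n w)))^2"] by simp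
  thus "((cmod (fst (chain n w)))^2 + (cmod (snd (chain n w)))^2)^m \<le> H n (chain n w)"
   unfolding H_def using \<epsilon>0 by (intro power_mono) auto
 qed
 thus ?thesis using * by (rule order_trans)
qed

end

section \<open>Wiener integrals of deterministic functions\<close>

abbreviation steps_nonneg :: "(real \<times> real \<times> complex) list \<Rightarrow> bool" where
 "steps_nonneg \<phi> \<equiv> \<forall>(s, t, c) \<in> set \<phi>. 0 \<le> s \<and> s \<le> t"

abbreviation steps_within :: "real \<Rightarrow> (real \<times> real \<times> complex) list \<Rightarrow> bool" where
 "steps_within T \<phi> \<equiv> \<forall>(s, t, c) \<in> set \<phi>. 0 \<le> s \<and> s \<le> t \<and> t \<le> T"

abbreviation l2dist :: "'a measure \<Rightarrow> ('a \<Rightarrow> complex) \<Rightarrow> ('a \<Rightarrow> complex) \<Rightarrow> ennreal" where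
 "l2dist M f g \<equiv> \<integral>\<^sup>+w. ennreal ((cmod (f w - g w))^2) \<partial>M"

lemma sum_list_prod_cong_sum:
 fixes f :: "'b \<Rightarrow> nat \<Rightarrow> complex"
 shows "(\<Sum>x\<leftarrow>xs. \<Sum>k<n. f x k) = (\<Sum>k<n. \<Sum>x\<leftarrow>xs. f x k)"
 by (induction xs) (auto simp: sum.distrib)

text \<open>A list of overlapping steps is rewritten on a common refinement of all end points.\<close>

lemma step_grid:
 fixes \<phi> :: "(real \<times> real \<times> complex) list"
 assumes \<phi>: "steps_nonneg \<phi>"
 obtains t :: "nat \<Rightarrow> real" and n :: nat and c :: "nat \<Rightarrow> complex" where
  "0 \<le> t 0" "incseq t" "\<And>k. k < n \<Longrightarrow> t k < t (Suc k)"
  "\<And>W w. step_integral W \<phi> w = (\<Sum>k<n. c k * of_real (W (t (Suc k)) w - W (t k) w))"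
  "\<And>u. step_fun \<phi> u = (\<Sum>k<n. c k * indicator {t k<..t (Suc k)} u)"
proof -
 define D where "D = insert 0 (\<Union>(s, t, c) \<in> set \<phi>. {s, t})"
 have fin: "finite D" by (auto simp: D_def)
 define p where "p = sorted_list_of_set D"
 have p: "sorted p" "distinct p" "set p = D" using fin by (auto simp: p_def)
 have pne: "p \<noteq> []" using p(3) by (auto simp: D_def)
 define n where "n = length p - 1"
 \<comment> \<open>The grid is continued as a constant beyond \<open>n\<close>, because the
   independence of increments is stated for increasing sequences on all natural numbers.\<close>
 define t where "t i = p ! (min i n)" for i
 have tmono: "i \<le> j \<Longrightarrow> t i \<le> t j" for i j
 proof -
  assume "i \<le> j"
  moreover have "min j n < length p" using pne by (cases p) (auto simp: n_def)
  ultimately show "t i \<le> t j" unfolding t_def using p(1) by (intro sorted_nth_mono) auto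
 qed
 have tstrict: "i < j \<Longrightarrow> j \<le> n \<Longrightarrow> t i < t j" for i j
 proof -
  assume ij: "i < j" "j \<le> n"
  have "t i \<noteq> t j" unfolding t_def using ij p(2) pne by (auto simp: n_def nth_eq_iff_index_eq)
  thus ?thesis using tmono[of i j] ij by simp
 qed
 have tD: "\<exists>i\<le>n. s = t i" if "s \<in> D" for s
 proof -
  from that p(3) obtain i where "i < length p" "p ! i = s" by (auto simp: in_set_conv_nth)
  thus ?thesis by (intro exI[of _ i]) (auto simp: t_def n_def)
 qed
 have D0: "0 \<le> s" if "s \<in> D" for s using that \<phi> by (fastforce simp: D_def)
 have t0: "0 \<le> t 0" using p(3) pne D0[of "p ! 0"] by (auto simp: t_def)
 define c where "c k = (\<Sum>(a, b, c)\<leftarrow>\<phi>. if a \<le> t k \<and> t (Suc k) \<le> b then c else 0)" for k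
 \<comment> \<open>The identity holds for an arbitrary \<open>g\<close>. Taking for \<open>g\<close>
   a path yields the step integral, and taking the indicators of half lines yields the step
   function, so both are refined by the same coefficients \<open>c\<close>.\<close>
 have tele: "(\<Sum>k<n. if a \<le> t k \<and> t (Suc k) \<le> b then g (t (Suc k)) - g (t k) else 0) = g b - g a"
  if ab: "a \<in> D" "b \<in> D" "a \<le> b" for a b and g :: "real \<Rightarrow> complex"
 proof -
  obtain i where i: "i \<le> n" "a = t i" using tD[OF ab(1)] by blast
  obtain j where j: "j \<le> n" "b = t j" using tD[OF ab(2)] by blast
  have ij: "i \<le> j" using ab(3) tstrict[of j i] i j by (metis leD le_less_linear)
  have eq: "(t i \<le> t k \<and> t (Suc k) \<le> t j) = (i \<le> k \<and> k < j)" if "k < n" for k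
   using that i j tmono tstrict[of k i] tstrict[of j "Suc k"] by (metis Suc_leI leD le_less_linear less_Suc_eq_le nat_le_linear)
  have "(\<Sum>k<n. if a \<le> t k \<and> t (Suc k) \<le> b then g (t (Suc k)) - g (t k) else 0)
    = (\<Sum>k<n. if k \<in> {i..<j} then g (t (Suc k)) - g (t k) else 0)"
   by (intro sum.cong) (auto simp: i j eq)
  also have "\<dots> = (\<Sum>k\<in>{i..<j}. g (t (Suc k)) - g (t k))"
   using j by (subst sum.If_cases) (auto intro!: sum.cong)
  also have "\<dots> = g (t j) - g (t i)" using ij by (rule sum_Suc_diff')
  finally show ?thesis by (simp add: i j)
 qed
 have lin: "(\<Sum>(a, b, c)\<leftarrow>\<phi>. c * (g b - g a)) = (\<Sum>k<n. c k * (g (t (Suc k)) - g (t k)))" for g :: "real \<Rightarrow> complex"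
 proof -
  have "(\<Sum>(a, b, c)\<leftarrow>\<phi>. c * (g b - g a)) = (\<Sum>x\<leftarrow>\<phi>. \<Sum>k<n. (case x of (a, b, c) \<Rightarrow> (if a \<le> t k \<and> t (Suc k) \<le> b then c else 0) * (g (t (Suc k)) - g (t k))))"
  proof (intro arg_cong[where f = sum_list] map_cong refl)
   fix x assume x: "x \<in> set \<phi>"
   obtain a b d where abd: "x = (a, b, d)" by (cases x)
   have "a \<in> D" "b \<in> D" "a \<le> b" using x abd \<phi> by (force simp: D_def)+
   from tele[OF this, of g] have "d * (g b - g a) = (\<Sum>k<n. d * (if a \<le> t k \<and> t (Suc k) \<le> b then g (t (Suc k)) - g (t k) else 0))"
    unfolding sum_distrib_left[symmetric] by (simp only:)
   also have "\<dots> = (\<Sum>k<n. (if a \<le> t k \<and> t (Suc k) \<le> b then d else 0) * (g (t (Suc k)) - g (t k)))"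
    by (intro sum.cong) auto
   finally show "(case x of (a, b, c) \<Rightarrow> c * (g b - g a)) = (\<Sum>k<n. (case x of (a, b, c) \<Rightarrow> (if a \<le> t k \<and> t (Suc k) \<le> b then c else 0) * (g (t (Suc k)) - g (t k))))"
    by (simp add: abd)
  qed
  also have "\<dots> = (\<Sum>k<n. \<Sum>x\<leftarrow>\<phi>. (case x of (a, b, c) \<Rightarrow> (if a \<le> t k \<and> t (Suc k) \<le> b then c else 0) * (g (t (Suc k)) - g (t k))))"
   by (rule sum_list_prod_cong_sum)
  also have "\<dots> = (\<Sum>k<n. c k * (g (t (Suc k)) - g (t k)))"
   unfolding c_def by (simp add: sum_list_mult_const[symmetric] case_prod_unfold)
  finally show ?thesis .
 qed
 have ind: "indicator {a<..b} u = indicator {..b} u - (indicator {..a} u :: complex)" if "a \<le> b" for a b u :: real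
  using that by (auto simp: indicator_def)
 show thesis
 proof (rule that[of t n c])
  show "0 \<le> t 0" by (rule t0)
  show "incseq t" by (rule monoI) (rule tmono)
  show "t k < t (Suc k)" if "k < n" for k using that by (intro tstrict) auto
  show "step_integral W \<phi> w = (\<Sum>k<n. c k * of_real (W (t (Suc k)) w - W (t k) w))" for W and w :: 'a
   unfolding step_integral_def of_real_diff by (rule lin)
  show "step_fun \<phi> u = (\<Sum>k<n. c k * indicator {t k<..t (Suc k)} u)" for u
  proof -
   have "step_fun \<phi> u = (\<Sum>(a, b, c)\<leftarrow>\<phi>. c * (indicator {..b} u - indicator {..a} u))"
    unfolding step_fun_def
    by (intro arg_cong[where f = sum_list] map_cong refl) (use \<phi> in \<open>fastforce simp: ind\<close>)
   also have "\<dots> = (\<Sum>k<n. c k * (indicator {..t (Suc k)} u - indicator {..t k} u))" by (rule lin)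
   also have "\<dots> = (\<Sum>k<n. c k * indicator {t k<..t (Suc k)} u)"
    by (intro sum.cong) (auto simp: ind tmono)
   finally show ?thesis .
  qed
 qed
qed

lemma step_fun_meas[measurable]: "step_fun \<phi> \<in> borel_measurable borel"
proof -
 have "(\<lambda>u. step_fun \<phi> u) \<in> borel_measurable borel"
  by (induction \<phi>) (auto simp: step_fun_def case_prod_unfold)
 thus ?thesis by simp
qed

lemma step_list_simps:
 "step_fun [] u = 0" "step_integral W [] w = 0"
 "step_fun (\<phi> @ \<psi>) u = step_fun \<phi> u + step_fun \<psi> u" "step_integral W (\<phi> @ \<psi>) w = step_integral W \<phi> w + step_integral W \<psi> w"
 "step_fun (map (\<lambda>(s, t, c). (s, t, g c)) \<phi>) u = (\<Sum>(s, t, c)\<leftarrow>\<phi>. g c * indicator {s<..t} u)"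
 "step_integral W (map (\<lambda>(s, t, c). (s, t, g c)) \<phi>) w = (\<Sum>(s, t, c)\<leftarrow>\<phi>. g c * of_real (W t w - W s w))"
 by (simp_all add: step_fun_def step_integral_def o_def case_prod_unfold)

definition step_scale :: "complex \<Rightarrow> (real \<times> real \<times> complex) list \<Rightarrow> (real \<times> real \<times> complex) list" where
 "step_scale a \<phi> = map (\<lambda>(s, t, c). (s, t, a * c)) \<phi>"

lemma step_scale:
 "step_fun (step_scale a \<phi>) u = a * step_fun \<phi> u" "step_integral W (step_scale a \<phi>) w = a * step_integral W \<phi> w"
 "\<forall>(s, t, c) \<in> set \<phi>. Q s t \<Longrightarrow> \<forall>(s, t, c) \<in> set (step_scale a \<phi>). Q s t"
 unfolding step_scale_def step_list_simps
 by (auto simp: step_fun_def step_integral_def case_prod_unfold sum_list_const_mult[symmetric] mult.assoc)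

definition step_re :: "(real \<times> real \<times> complex) list \<Rightarrow> (real \<times> real \<times> complex) list" where
 "step_re \<phi> = map (\<lambda>(s, t, c). (s, t, of_real (Re c))) \<phi>"

lemma step_re:
 "step_fun (step_re \<phi>) u = of_real (Re (step_fun \<phi> u))" "step_integral W (step_re \<phi>) w = of_real (Re (step_integral W \<phi> w))"
 "\<forall>(s, t, c) \<in> set \<phi>. Q s t \<Longrightarrow> \<forall>(s, t, c) \<in> set (step_re \<phi>). Q s t"
proof -
 have ind: "(indicator {s<..t} u :: complex) = of_real (indicator {s<..t} u)" for s t :: real by (simp add: indicator_def)
 show "step_fun (step_re \<phi>) u = of_real (Re (step_fun \<phi> u))" "step_integral W (step_re \<phi>) w = of_real (Re (step_integral W \<phi> w))"
  unfolding step_re_def by (induction \<phi>) (auto simp: step_fun_def step_integral_def ind)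
 show "\<forall>(s, t, c) \<in> set \<phi>. Q s t \<Longrightarrow> \<forall>(s, t, c) \<in> set (step_re \<phi>). Q s t" by (auto simp: step_re_def)
qed

text \<open>The square is the complex one, since it is the exponent of the complex Laplace
  transform. No mixed terms appear because the cells of the grid are disjoint.\<close>

lemma step_fun_sq_integral:
 assumes \<phi>: "steps_nonneg \<phi>" and t: "incseq t" "\<And>u. step_fun \<phi> u = (\<Sum>k<n. c k * indicator {t k<..t (Suc k)} u)"
 shows "integrable lborel (\<lambda>u. (step_fun \<phi> u)^2)" "(LINT u|lborel. (step_fun \<phi> u)^2) = (\<Sum>k<n. (c k)^2 * of_real (t (Suc k) - t k))"
proof -
 have sq: "(step_fun \<phi> u)^2 = (\<Sum>k<n. (c k)^2 * indicator {t k<..t (Suc k)} u)" for u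
 proof -
  have uniq: "j = k" if "u \<in> {t k<..t (Suc k)}" "u \<in> {t j<..t (Suc j)}" for j k
  proof (rule ccontr)
   assume "j \<noteq> k"
   hence "Suc j \<le> k \<or> Suc k \<le> j" by auto
   hence "t (Suc j) \<le> t k \<or> t (Suc k) \<le> t j" using t(1) by (auto dest: incseqD)
   thus False using that by auto
  qed
  show ?thesis
  proof (cases "\<exists>k<n. u \<in> {t k<..t (Suc k)}")
   case False
   hence "d j * indicator {t j<..t (Suc j)} u = 0" if "j < n" for j and d :: "nat \<Rightarrow> complex"
    using that by (auto simp: indicator_def)
   hence "(\<Sum>j<n. d j * indicator {t j<..t (Suc j)} u) = 0" for d :: "nat \<Rightarrow> complex"
    by (intro sum.neutral) auto
   thus ?thesis unfolding t(2) by (simp only: zero_power2)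
  next
   case True
   then obtain k where k: "k < n" "u \<in> {t k<..t (Suc k)}" by blast
   have "d j * indicator {t j<..t (Suc j)} u = (if j = k then d k else 0)" for j and d :: "nat \<Rightarrow> complex"
   proof (cases "j = k")
    case False
    hence "u \<notin> {t j<..t (Suc j)}" using uniq[OF k(2)] by blast
    hence "indicator {t j<..t (Suc j)} u = (0 :: complex)" by (rule indicator_simps(2))
    thus ?thesis using False by (simp only: mult_zero_right if_False)
   qed (use k(2) in simp)
   hence "(\<Sum>j<n. d j * indicator {t j<..t (Suc j)} u) = d k" for d :: "nat \<Rightarrow> complex"
    using k(1) by (simp only: sum.delta finite_lessThan) simp
   thus ?thesis unfolding t(2) by (simp only:)
  qed
 qed
 have le: "t k \<le> t (Suc k)" for k using t(1) by (simp add: incseq_SucD)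
 have hb: "has_bochner_integral lborel (\<lambda>u. (c k)^2 * indicator {t k<..t (Suc k)} u) ((c k)^2 * of_real (t (Suc k) - t k))" for k
 proof -
  have "has_bochner_integral lborel (\<lambda>u. indicator {t k<..t (Suc k)} u *\<^sub>R (c k)^2) (measure lborel {t k<..t (Suc k)} *\<^sub>R (c k)^2)"
   using le by (intro has_bochner_integral_indicator) auto
  moreover have "(\<lambda>u. indicator {t k<..t (Suc k)} u *\<^sub>R (c k)^2) = (\<lambda>u. (c k)^2 * indicator {t k<..t (Suc k)} u)"
   by (auto simp: fun_eq_iff indicator_def)
  moreover have "measure lborel {t k<..t (Suc k)} *\<^sub>R (c k)^2 = (c k)^2 * of_real (t (Suc k) - t k)"
   using le[of k] by (simp add: scaleR_conv_of_real)
  ultimately show ?thesis by (simp only:)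
 qed
 have "has_bochner_integral lborel (\<lambda>u. (step_fun \<phi> u)^2) (\<Sum>k<n. (c k)^2 * of_real (t (Suc k) - t k))"
  unfolding sq by (intro has_bochner_integral_sum hb)
 thus "integrable lborel (\<lambda>u. (step_fun \<phi> u)^2)" "(LINT u|lborel. (step_fun \<phi> u)^2) = (\<Sum>k<n. (c k)^2 * of_real (t (Suc k) - t k))"
  by (auto simp: has_bochner_integral_iff)
qed

lemma distributed_complex:
 fixes g :: "real \<Rightarrow> complex"
 assumes D: "distributed M lborel X (\<lambda>x. ennreal (f x))" and f: "\<And>x. 0 \<le> f x" "f \<in> borel_measurable borel"
  and g: "g \<in> borel_measurable borel"
 shows "integrable lborel (\<lambda>x. f x *\<^sub>R g x) \<Longrightarrow> integrable M (\<lambda>w. g (X w))"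
  "(LINT w|M. g (X w)) = (LINT x|lborel. f x *\<^sub>R g x)"
proof -
 have X: "X \<in> measurable M lborel" and eq: "distr M lborel X = density lborel (\<lambda>x. ennreal (f x))"
  using D by (auto simp: distributed_def)
 have "integrable M (\<lambda>w. g (X w)) \<longleftrightarrow> integrable (density lborel (\<lambda>x. ennreal (f x))) g"
  unfolding eq[symmetric] using X g by (subst integrable_distr_eq) auto
 also have "\<dots> \<longleftrightarrow> integrable lborel (\<lambda>x. f x *\<^sub>R g x)" using f g by (subst integrable_density) auto
 finally show "integrable lborel (\<lambda>x. f x *\<^sub>R g x) \<Longrightarrow> integrable M (\<lambda>w. g (X w))" by simp
 have "(LINT w|M. g (X w)) = integral\<^sup>L (density lborel (\<lambda>x. ennreal (f x))) g"
  unfolding eq[symmetric] using X g by (subst integral_distr) auto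
 also have "\<dots> = (LINT x|lborel. f x *\<^sub>R g x)" using f g by (subst integral_density) auto
 finally show "(LINT w|M. g (X w)) = (LINT x|lborel. f x *\<^sub>R g x)" .
qed

section \<open>Laplace transforms of step integrals\<close>

context brownian_motion begin

lemma step_integral_meas: assumes "steps_nonneg \<phi>"
 shows "step_integral W \<phi> \<in> borel_measurable M"
proof -
 have "(\<lambda>w. step_integral W \<phi> w) \<in> borel_measurable M"
  using assms
 proof (induction \<phi>)
  case Nil show ?case by (simp add: step_integral_def)
 next
  case (Cons a \<phi>)
  obtain s t c where a: "a = (s, t, c)" by (cases a)
  have [measurable]: "W s \<in> borel_measurable M" "W t \<in> borel_measurable M" using Cons.prems by (auto simp: a intro!: measurable_W)
  have [measurable]: "(\<lambda>w. step_integral W \<phi> w) \<in> borel_measurable M" using Cons by auto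
  have "(\<lambda>w. step_integral W (a # \<phi>) w) = (\<lambda>w. c * of_real (W t w - W s w) + step_integral W \<phi> w)"
   by (simp add: step_integral_def a)
  thus ?case by simp
 qed
 thus ?thesis by simp
qed

lemma step_integral_mgf:
 assumes \<phi>: "steps_nonneg \<phi>"
 shows "integrable M (\<lambda>w. exp (step_integral W \<phi> w))"
  "(LINT w|M. exp (step_integral W \<phi> w)) = exp ((LINT u|lborel. (step_fun \<phi> u)^2) / 2)"
proof -
 obtain t n c where t: "0 \<le> t 0" "incseq t" "\<And>k. k < n \<Longrightarrow> t k < t (Suc k)"
  "\<And>(V :: real \<Rightarrow> 'a \<Rightarrow> real) w. step_integral V \<phi> w = (\<Sum>k<n. c k * of_real (V (t (Suc k)) w - V (t k) w))"
  "\<And>u. step_fun \<phi> u = (\<Sum>k<n. c k * indicator {t k<..t (Suc k)} u)"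
  by (rule step_grid[OF \<phi>]) (rule that)
 define G where "G k w = exp (c k * of_real (W (t (Suc k)) w - W (t k) w))" for k w
 have tk: "0 \<le> t k" for k using t(1) incseqD[OF t(2), of 0 k] by simp
 have ind: "indep_vars (\<lambda>_. borel) G {..<n}"
  unfolding G_def
  by (rule indep_vars_compose2[OF indep_increments[OF t(1,2), of n], where Y = "\<lambda>k y. exp (c k * of_real y)" and N = "\<lambda>_. borel"]) measurable
 have G: "integrable M (G k) \<and> (LINT w|M. G k w) = exp ((c k)^2 * of_real (t (Suc k) - t k) / 2)" if k: "k < n" for k
 proof -
  define q where "q = sqrt (t (Suc k) - t k)"
  have q: "0 < q" "q^2 = t (Suc k) - t k" using t(3)[OF k] by (auto simp: q_def)
  have D: "distributed M lborel (\<lambda>w. W (t (Suc k)) w - W (t k) w) (\<lambda>x. ennreal (normal_density 0 q x))"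
   unfolding q_def by (rule normal_increments[OF tk t(3)[OF k]])
  have "integrable M (\<lambda>w. exp (c k * of_real (W (t (Suc k)) w - W (t k) w)))"
   using gaussian_mgf_complex(1)[OF q(1), of "c k"] by (intro distributed_complex(1)[OF D]) auto
  moreover have "(LINT w|M. exp (c k * of_real (W (t (Suc k)) w - W (t k) w))) = exp ((c k)^2 * of_real (q^2) / 2)"
   by (subst distributed_complex(2)[OF D, where g = "\<lambda>x. exp (c k * of_real x)"]) (auto simp: gaussian_mgf_complex(2)[OF q(1)])
  ultimately show ?thesis unfolding G_def[abs_def] q(2) by blast
 qed
 have e: "exp (step_integral W \<phi> w) = (\<Prod>k<n. G k w)" for w
  unfolding t(4) G_def by (simp add: exp_sum)
 show "integrable M (\<lambda>w. exp (step_integral W \<phi> w))"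
  unfolding e using G by (intro indep_vars_integrable ind) auto
 have "(LINT w|M. exp (step_integral W \<phi> w)) = (\<Prod>k<n. exp ((c k)^2 * of_real (t (Suc k) - t k) / 2))"
  unfolding e using G by (subst indep_vars_lebesgue_integral[OF _ ind]) auto
 also have "\<dots> = exp ((LINT u|lborel. (step_fun \<phi> u)^2) / 2)"
  unfolding step_fun_sq_integral(2)[OF \<phi> t(2,5)] by (simp add: exp_sum[symmetric] sum_divide_distrib)
 finally show "(LINT w|M. exp (step_integral W \<phi> w)) = exp ((LINT u|lborel. (step_fun \<phi> u)^2) / 2)" .
qed

end

section \<open>Exponentials along limits in \<open>L^2\<close>\<close>

lemma norm_exp_diff: "cmod (exp a - exp b) \<le> cmod (a - b) * (exp (Re a) + exp (Re b))"
proof -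
 have "norm (exp a - exp b) \<le> (exp (Re a) + exp (Re b)) * norm (a - b)"
 proof (rule field_differentiable_bound[where S = "closed_segment a b" and f' = exp])
  fix w assume "w \<in> closed_segment a b"
  then obtain u where u: "0 \<le> u" "u \<le> 1" "w = (1 - u) *\<^sub>R a + u *\<^sub>R b" by (auto simp: closed_segment_def)
  have "Re w \<le> max (Re a) (Re b)"
   using u convex_bound_le[of "Re a" "max (Re a) (Re b)" "Re b" "1 - u" u] by simp
  hence "exp (Re w) \<le> exp (max (Re a) (Re b))" by simp
  also have "\<dots> \<le> exp (Re a) + exp (Re b)" by (auto simp: max_def)
  finally show "norm (exp w) \<le> exp (Re a) + exp (Re b)" by simp
  show "(exp has_field_derivative exp w) (at w within closed_segment a b)" by (auto intro!: derivative_eq_intros)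
 qed auto
 thus ?thesis by (simp add: mult.commute)
qed

definition nsq :: "real \<Rightarrow> (real \<Rightarrow> complex) \<Rightarrow> ennreal" where
 "nsq T h = (\<integral>\<^sup>+u. ennreal ((cmod (h u))^2) * indicator {0..T} u \<partial>lborel)"

lemma cmod_sq_le: "(cmod a)^2 \<le> 2 * (cmod (a - b))^2 + 2 * (cmod b)^2"
proof -
 have "cmod a \<le> cmod (a - b) + cmod b" using norm_triangle_ineq[of "a - b" b] by simp
 hence "(cmod a)^2 \<le> (cmod (a - b) + cmod b)^2" by (intro power_mono) auto
 also have "\<dots> \<le> 2 * (cmod (a - b))^2 + 2 * (cmod b)^2"
  using sum_squares_bound[of "cmod (a - b)" "cmod b"] by (simp add: power2_sum)
 finally show ?thesis .
qed

lemma (in prob_space) L2_AE_subseq: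
 fixes S :: "nat \<Rightarrow> 'a \<Rightarrow> complex"
 assumes m[measurable]: "\<And>n. S n \<in> borel_measurable M" "J \<in> borel_measurable M"
  and lim: "(\<lambda>n. l2dist M (S n) J) \<longlonglongrightarrow> 0"
 obtains r where "strict_mono r" "AE w in M. (\<lambda>n. S (r n) w) \<longlonglongrightarrow> J w"
proof -
 \<comment> \<open>Initial terms may have infinite distance to the limit and are discarded, so that
   integrability is available.\<close>
 obtain N0 where N0: "\<And>n. n \<ge> N0 \<Longrightarrow> l2dist M (S n) J < 1"
  using order_tendstoD(2)[OF lim, of 1] by (auto simp: eventually_sequentially)
 define u where "u n w = (cmod (S (n + N0) w - J w))^2" for n w
 have int: "integrable M (u n)" for n
  unfolding u_def by (rule integrableI_nonneg) (use N0[of "n + N0"] in \<open>auto intro: less_trans\<close>)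
 have "(\<lambda>n. \<integral>w. norm (u n w) \<partial>M) \<longlonglongrightarrow> 0"
 proof -
  have "(\<lambda>n. \<integral>\<^sup>+w. ennreal (u n w) \<partial>M) \<longlonglongrightarrow> 0" unfolding u_def using LIMSEQ_ignore_initial_segment[OF lim, of N0] .
  moreover have "(\<integral>\<^sup>+w. ennreal (u n w) \<partial>M) = ennreal (\<integral>w. norm (u n w) \<partial>M)" for n
   using nn_integral_eq_integral[OF int[of n]] by (simp add: u_def[abs_def])
  ultimately have "(\<lambda>n. ennreal (\<integral>w. norm (u n w) \<partial>M)) \<longlonglongrightarrow> ennreal 0" by simp
  thus ?thesis by (subst (asm) tendsto_ennreal_iff) (auto intro!: always_eventually)
 qed
 from tendsto_L1_AE_subseq[OF int this] obtain r where r: "strict_mono r" "AE w in M. (\<lambda>n. u (r n) w) \<longlonglongrightarrow> 0" by blast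
 show thesis
 proof (rule that[of "\<lambda>n. r n + N0"])
  show "strict_mono (\<lambda>n. r n + N0)" using r(1) by (auto simp: strict_mono_def)
  show "AE w in M. (\<lambda>n. S (r n + N0) w) \<longlonglongrightarrow> J w"
   using r(2)
  proof eventually_elim
   case (elim w)
   hence "(\<lambda>n. sqrt (u (r n) w)) \<longlonglongrightarrow> sqrt 0" by (rule tendsto_real_sqrt)
   hence "(\<lambda>n. cmod (S (r n + N0) w - J w)) \<longlonglongrightarrow> 0" by (simp add: u_def)
   thus ?case by (simp add: tendsto_norm_zero_iff LIM_zero_iff)
  qed
 qed
qed

text \<open>Fatou's lemma along an almost surely convergent subsequence.\<close>

lemma (in prob_space) L2_limit_exp_bound:
 fixes S :: "nat \<Rightarrow> 'a \<Rightarrow> complex"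
 assumes m[measurable]: "\<And>n. S n \<in> borel_measurable M" "J \<in> borel_measurable M"
  and lim: "(\<lambda>n. l2dist M (S n) J) \<longlonglongrightarrow> 0"
  and B: "eventually (\<lambda>n. (\<integral>\<^sup>+w. ennreal (exp (a * Re (S n w))) \<partial>M) \<le> B) sequentially"
 shows "(\<integral>\<^sup>+w. ennreal (exp (a * Re (J w))) \<partial>M) \<le> B"
proof -
 obtain r where r: "strict_mono r" "AE w in M. (\<lambda>n. S (r n) w) \<longlonglongrightarrow> J w" using L2_AE_subseq[OF m lim] by blast
 have "(\<integral>\<^sup>+w. ennreal (exp (a * Re (J w))) \<partial>M) = (\<integral>\<^sup>+w. liminf (\<lambda>n. ennreal (exp (a * Re (S (r n) w)))) \<partial>M)"
 proof (rule nn_integral_cong_AE)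
  show "AE w in M. ennreal (exp (a * Re (J w))) = liminf (\<lambda>n. ennreal (exp (a * Re (S (r n) w))))"
   using r(2)
  proof eventually_elim
   case (elim w)
   hence "(\<lambda>n. ennreal (exp (a * Re (S (r n) w)))) \<longlonglongrightarrow> ennreal (exp (a * Re (J w)))"
    by (intro tendsto_ennrealI tendsto_intros)
   thus ?case by (rule lim_imp_Liminf[OF trivial_limit_sequentially, symmetric])
  qed
 qed
 also have "\<dots> \<le> liminf (\<lambda>n. \<integral>\<^sup>+w. ennreal (exp (a * Re (S (r n) w))) \<partial>M)"
  by (rule nn_integral_liminf) measurable
 also have "\<dots> \<le> B"
 proof (rule Liminf_le)
  show "eventually (\<lambda>n. (\<integral>\<^sup>+w. ennreal (exp (a * Re (S (r n) w))) \<partial>M) \<le> B) sequentially"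
   using eventually_subseq[OF r(1) B] .
 qed simp
 finally show ?thesis .
qed

text \<open>The exponentials converge in \<open>L^1\<close>: the difference is at most
  \<open>|S - J|\<close> times a sum of exponentials, a weighted inequality between arithmetic and
  geometric mean separates the two factors, and the exponentials have uniformly bounded second
  moments.\<close>

lemma (in prob_space) L2_limit_mgf:
 fixes S :: "nat \<Rightarrow> 'a \<Rightarrow> complex"
 assumes m[measurable]: "\<And>n. S n \<in> borel_measurable M" "J \<in> borel_measurable M"
  and lim: "(\<lambda>n. l2dist M (S n) J) \<longlonglongrightarrow> 0"
  and B: "eventually (\<lambda>n. (\<integral>\<^sup>+w. ennreal (exp (2 * Re (S n w))) \<partial>M) \<le> ennreal B) sequentially" "0 \<le> B"
  and q: "\<And>n. integrable M (\<lambda>w. exp (S n w))" "(\<lambda>n. LINT w|M. exp (S n w)) \<longlonglongrightarrow> q"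
 shows "integrable M (\<lambda>w. exp (J w))" "(LINT w|M. exp (J w)) = q"
proof -
 have BJ: "(\<integral>\<^sup>+w. ennreal (exp (2 * Re (J w))) \<partial>M) \<le> ennreal B" by (rule L2_limit_exp_bound[OF m lim B(1)])
 have "(\<integral>\<^sup>+w. ennreal (norm (exp (J w))) \<partial>M) \<le> (\<integral>\<^sup>+w. ennreal 1 + ennreal (exp (2 * Re (J w))) \<partial>M)"
 proof (intro nn_integral_mono)
  fix w
  have "exp (Re (J w)) \<le> 1 + exp (2 * Re (J w))"
   using sum_squares_bound[of 1 "exp (Re (J w))"] by (simp add: exp_double) (smt (verit) exp_ge_zero)
  hence "ennreal (norm (exp (J w))) \<le> ennreal (1 + exp (2 * Re (J w)))" by (intro ennreal_leI) simp
  also have "\<dots> = ennreal 1 + ennreal (exp (2 * Re (J w)))" by (rule ennreal_plus) auto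
  finally show "ennreal (norm (exp (J w))) \<le> ennreal 1 + ennreal (exp (2 * Re (J w)))" .
 qed
 also have "\<dots> \<le> ennreal 1 + ennreal B" by (subst nn_integral_add) (use BJ in \<open>auto simp: emeasure_space_1\<close>)
 also have "\<dots> < \<infinity>" by (simp add: ennreal_add_eq_top less_top[symmetric])
 finally show int: "integrable M (\<lambda>w. exp (J w))" by (intro integrableI_bounded) auto
 have "(\<lambda>n. LINT w|M. exp (S n w)) \<longlonglongrightarrow> (LINT w|M. exp (J w))"
 proof (rule LIMSEQ_I)
  fix e :: real assume e: "0 < e"
  \<comment> \<open>The weight of the separation. The exponentials then cost
    \<open>2 \<delta> B \<le> e / 4\<close>, and the distance in \<open>L^2\<close> is made so small
    that it costs \<open>e / 2\<close>.\<close>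
  define \<delta> where "\<delta> = e / (8 * (B + 1))"
  have \<delta>: "0 < \<delta>" using e B by (simp add: \<delta>_def)
  have ev: "eventually (\<lambda>n. l2dist M (S n) J < ennreal (e * \<delta>)) sequentially"
   using order_tendstoD(2)[OF lim, of "ennreal (e * \<delta>)"] e \<delta> by simp
  have "eventually (\<lambda>n. norm ((LINT w|M. exp (S n w)) - (LINT w|M. exp (J w))) < e) sequentially"
   using ev B(1)
  proof eventually_elim
   case (elim n)
   have "ennreal (norm ((LINT w|M. exp (S n w)) - (LINT w|M. exp (J w)))) = ennreal (norm (LINT w|M. exp (S n w) - exp (J w)))"
    using q(1)[of n] int by simp
   also have "\<dots> \<le> (\<integral>\<^sup>+w. ennreal (norm (exp (S n w) - exp (J w))) \<partial>M)"
    using q(1)[of n] int by (intro integral_norm_bound_ennreal) auto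
   also have "\<dots> \<le> (\<integral>\<^sup>+w. ennreal (1 / (2 * \<delta>)) * ennreal ((cmod (S n w - J w))^2) + (ennreal \<delta> * ennreal (exp (2 * Re (S n w))) + ennreal \<delta> * ennreal (exp (2 * Re (J w)))) \<partial>M)"
   proof (intro nn_integral_mono)
    fix w
    define x y b1 b2 where "x = cmod (S n w - J w)" and "y = exp (Re (S n w)) + exp (Re (J w))"
     and "b1 = exp (2 * Re (S n w))" and "b2 = exp (2 * Re (J w))"
    have y2: "y^2 \<le> 2 * (b1 + b2)"
     using sum_squares_bound[of "exp (Re (S n w))" "exp (Re (J w))"] by (simp add: y_def b1_def b2_def exp_double power2_sum)
    have "x * y \<le> 1 / (2 * \<delta>) * x^2 + \<delta> / 2 * y^2"
    proof -
     have "2 * (x / sqrt \<delta>) * (y * sqrt \<delta>) \<le> (x / sqrt \<delta>)^2 + (y * sqrt \<delta>)^2" by (rule sum_squares_bound)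
     thus ?thesis using \<delta> by (simp add: power_divide power_mult_distrib field_simps)
    qed
    also have "\<delta> / 2 * y^2 \<le> \<delta> / 2 * (2 * (b1 + b2))" using y2 \<delta> by (intro mult_left_mono) auto
    finally have "norm (exp (S n w) - exp (J w)) \<le> 1 / (2 * \<delta>) * x^2 + (\<delta> * b1 + \<delta> * b2)"
     using norm_exp_diff[of "S n w" "J w"] by (simp add: x_def y_def algebra_simps)
    hence "ennreal (norm (exp (S n w) - exp (J w))) \<le> ennreal (1 / (2 * \<delta>) * x^2 + (\<delta> * b1 + \<delta> * b2))" by (rule ennreal_leI)
    also have "\<dots> = ennreal (1 / (2 * \<delta>)) * ennreal (x^2) + (ennreal \<delta> * ennreal b1 + ennreal \<delta> * ennreal b2)"
    proof -
     have nn: "0 \<le> 1 / (2 * \<delta>)" "0 \<le> x^2" "0 \<le> \<delta>" "0 \<le> b1" "0 \<le> b2" using \<delta> by (auto simp: b1_def b2_def)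
     show ?thesis using nn by (simp only: ennreal_plus ennreal_mult mult_nonneg_nonneg add_nonneg_nonneg)
    qed
    finally show "ennreal (norm (exp (S n w) - exp (J w))) \<le> ennreal (1 / (2 * \<delta>)) * ennreal ((cmod (S n w - J w))^2) + (ennreal \<delta> * ennreal (exp (2 * Re (S n w))) + ennreal \<delta> * ennreal (exp (2 * Re (J w))))"
     by (simp add: x_def b1_def b2_def)
   qed
   also have "\<dots> = ennreal (1 / (2 * \<delta>)) * (l2dist M (S n) J)
      + (ennreal \<delta> * (\<integral>\<^sup>+w. ennreal (exp (2 * Re (S n w))) \<partial>M) + ennreal \<delta> * (\<integral>\<^sup>+w. ennreal (exp (2 * Re (J w))) \<partial>M))"
    by (simp add: nn_integral_add nn_integral_cmult)
   also have "\<dots> \<le> ennreal (1 / (2 * \<delta>)) * ennreal (e * \<delta>) + (ennreal \<delta> * ennreal B + ennreal \<delta> * ennreal B)"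
    using elim BJ by (intro add_mono mult_left_mono) auto
   also have "\<dots> = ennreal (e / 2 + 2 * \<delta> * B)"
    using \<delta> e B by (simp add: ennreal_mult[symmetric] ennreal_plus[symmetric] algebra_simps del: ennreal_plus)
   also have "\<dots> < ennreal e"
   proof (rule ennreal_lessI[OF e])
    have "2 * \<delta> * B \<le> e / 4" using e B by (simp add: \<delta>_def field_simps)
    thus "e / 2 + 2 * \<delta> * B < e" using e by linarith
   qed
   finally show ?case by (simp add: ennreal_less_iff)
  qed
  thus "\<exists>no. \<forall>n\<ge>no. norm ((LINT w|M. exp (S n w)) - (LINT w|M. exp (J w))) < e" by (simp add: eventually_sequentially)
 qed
 thus "(LINT w|M. exp (J w)) = q" using q(2) LIMSEQ_unique by blast
qed

lemma nsq_step:
 assumes \<phi>: "steps_within T \<phi>"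
 shows "integrable lborel (\<lambda>u. (cmod (step_fun \<phi> u))^2)" "nsq T (step_fun \<phi>) = ennreal (LINT u|lborel. (cmod (step_fun \<phi> u))^2)"
  "u \<notin> {0..T} \<Longrightarrow> step_fun \<phi> u = 0"
proof -
 have \<phi>': "steps_nonneg \<phi>" using \<phi> by auto
 have int: "integrable lborel (\<lambda>u. (Re (step_fun \<phi> u))^2)" if "steps_nonneg \<phi>" for \<phi>
 proof -
  have r: "steps_nonneg (step_re \<phi>)" by (rule step_re(3)[OF that])
  obtain t n c where t: "incseq t" "\<And>u. step_fun (step_re \<phi>) u = (\<Sum>k<n. c k * indicator {t k<..t (Suc k)} u)"
   by (rule step_grid[OF r]) blast
  have "integrable lborel (\<lambda>u. (step_fun (step_re \<phi>) u)^2)"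
   by (rule step_fun_sq_integral(1)[OF r t])
  hence "integrable lborel (\<lambda>u. Re ((step_fun (step_re \<phi>) u)^2))" by (rule integrable_Re)
  thus ?thesis by (simp add: step_re(1) flip: of_real_power)
 qed
 \<comment> \<open>Multiplication by \<open>-\<i>\<close> turns the imaginary part into a real part,
   so the real case is used twice.\<close>
 have "integrable lborel (\<lambda>u. (Re (step_fun \<phi> u))^2 + (Re (step_fun (step_scale (-\<i>) \<phi>) u))^2)"
  by (intro Bochner_Integration.integrable_add int \<phi>' step_scale(3))
 thus I: "integrable lborel (\<lambda>u. (cmod (step_fun \<phi> u))^2)" by (simp add: step_scale cmod_power2)
 show out: "step_fun \<phi> u = 0" if "u \<notin> {0..T}" for u
  using that \<phi> unfolding step_fun_def
 proof (induction \<phi>)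
  case (Cons x \<phi>)
  obtain s t c where x: "x = (s, t, c)" by (cases x)
  have "u \<notin> {s<..t}" using Cons.prems by (auto simp: x)
  hence "indicator {s<..t} u = (0 :: complex)" by (rule indicator_simps(2))
  thus ?case using Cons by (simp add: x)
 qed simp
 have "nsq T (step_fun \<phi>) = (\<integral>\<^sup>+u. ennreal ((cmod (step_fun \<phi> u))^2) \<partial>lborel)"
  unfolding nsq_def by (intro nn_integral_cong) (use out in \<open>auto simp: indicator_def\<close>)
 also have "\<dots> = ennreal (LINT u|lborel. (cmod (step_fun \<phi> u))^2)" by (rule nn_integral_eq_integral[OF I]) auto
 finally show "nsq T (step_fun \<phi>) = ennreal (LINT u|lborel. (cmod (step_fun \<phi> u))^2)" .
qed

context brownian_motion begin

lemma step_integral_real_mgf: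
 assumes \<phi>: "steps_nonneg \<phi>"
 shows "(\<integral>\<^sup>+w. ennreal (exp (a * Re (step_integral W \<phi> w))) \<partial>M) = ennreal (exp (a^2 / 2 * (LINT u|lborel. (Re (step_fun \<phi> u))^2)))"
proof -
 define \<psi> where "\<psi> = step_scale (of_real a) (step_re \<phi>)"
 have \<psi>: "steps_nonneg \<psi>" unfolding \<psi>_def by (intro step_scale(3) step_re(3) \<phi>)
 have e: "exp (step_integral W \<psi> w) = of_real (exp (a * Re (step_integral W \<phi> w)))" for w
  by (simp add: \<psi>_def step_scale step_re exp_of_real flip: of_real_mult)
 note mg = step_integral_mgf[OF \<psi>, unfolded e]
 have int: "integrable M (\<lambda>w. exp (a * Re (step_integral W \<phi> w)))"
  using integrable_Re[OF mg(1)] by simp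
 have "(LINT u|lborel. (step_fun \<psi> u)^2) = of_real (a^2 * (LINT u|lborel. (Re (step_fun \<phi> u))^2))"
  unfolding \<psi>_def step_scale step_re of_real_mult[symmetric] of_real_power[symmetric] power_mult_distrib integral_complex_of_real
  by simp
 hence "complex_of_real (expectation (\<lambda>w. exp (a * Re (step_integral W \<phi> w)))) = exp (of_real (a^2 * (LINT u|lborel. (Re (step_fun \<phi> u))^2) / 2))"
  using mg(2) by simp
 also have "\<dots> = of_real (exp (a^2 / 2 * (LINT u|lborel. (Re (step_fun \<phi> u))^2)))" by (simp only: exp_of_real) simp
 finally have "expectation (\<lambda>w. exp (a * Re (step_integral W \<phi> w))) = exp (a^2 / 2 * (LINT u|lborel. (Re (step_fun \<phi> u))^2))"
  by (simp only: of_real_eq_iff)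
 thus ?thesis using int by (subst nn_integral_eq_integral) auto
qed

lemma step_integral_exp_bound:
 assumes \<phi>: "steps_within T \<phi>" and v: "nsq T (step_fun \<phi>) \<le> ennreal v" "0 \<le> v"
 shows "(\<integral>\<^sup>+w. ennreal (exp (a * Re (step_integral W \<phi> w))) \<partial>M) \<le> ennreal (exp (a^2 / 2 * v))"
proof -
 have \<phi>': "steps_nonneg \<phi>" using \<phi> by auto
 have "(LINT u|lborel. (Re (step_fun \<phi> u))^2) \<le> (LINT u|lborel. (cmod (step_fun \<phi> u))^2)"
 proof (rule integral_mono')
  show "integrable lborel (\<lambda>u. (cmod (step_fun \<phi> u))^2)" by (rule nsq_step(1)[OF \<phi>])
 qed (auto simp: cmod_power2)
 also have "\<dots> \<le> v" using v unfolding nsq_step(2)[OF \<phi>] by (simp add: ennreal_le_iff)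
 finally show ?thesis unfolding step_integral_real_mgf[OF \<phi>'] by (intro ennreal_leI) (simp add: mult_left_mono)
qed

text \<open>The Ito isometry, read off the second-order behaviour of the Laplace transform at 0 by
  \<open>moments_of_mgf\<close>.\<close>

lemma step_integral_L2:
 assumes \<phi>: "steps_within T \<phi>"
 shows "(\<integral>\<^sup>+w. ennreal ((cmod (step_integral W \<phi> w))^2) \<partial>M) = nsq T (step_fun \<phi>)"
proof -
 have \<phi>': "steps_nonneg \<phi>" using \<phi> by auto
 have sq: "integrable M (\<lambda>w. (Re (step_integral W \<phi> w))^2) \<and> expectation (\<lambda>w. (Re (step_integral W \<phi> w))^2) = (LINT u|lborel. (Re (step_fun \<phi> u))^2)"
  if \<phi>': "steps_nonneg \<phi>" for \<phi>
 proof -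
  define v where "v = (LINT u|lborel. (Re (step_fun \<phi> u))^2)"
  have [measurable]: "step_integral W \<phi> \<in> borel_measurable M" by (rule step_integral_meas[OF \<phi>'])
  have 1: "((\<lambda>t. (exp (t^2 / 2 * v) - 1) / t) \<longlongrightarrow> 0) (at_right (0::real))" by real_asymp
  have 2: "((\<lambda>t. (exp (t^2 / 2 * v) + exp ((- t)^2 / 2 * v) - 2) / t^2) \<longlongrightarrow> v) (at_right (0::real))" by real_asymp
  note * = moments_of_mgf[of "\<lambda>w. Re (step_integral W \<phi> w)" 1, OF _ _ step_integral_real_mgf[OF \<phi>', folded v_def] _ 1 2]
  show ?thesis unfolding v_def[symmetric] by (intro conjI *) auto
 qed
 have \<phi>'': "steps_nonneg (step_scale (-\<i>) \<phi>)" by (rule step_scale(3)[OF \<phi>'])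
 have c: "(cmod (step_integral W \<phi> w))^2 = (Re (step_integral W \<phi> w))^2 + (Re (step_integral W (step_scale (-\<i>) \<phi>) w))^2"
  "(cmod (step_fun \<phi> u))^2 = (Re (step_fun \<phi> u))^2 + (Re (step_fun (step_scale (-\<i>) \<phi>) u))^2" for w u
  by (simp_all add: step_scale cmod_power2)
 have \<phi>T: "steps_within T (step_scale (-\<i>) \<phi>)" by (rule step_scale(3)[OF \<phi>])
 have int_re: "integrable lborel (\<lambda>u. (Re (step_fun \<phi> u))^2)" if "steps_within T \<phi>" for \<phi>
  by (rule Bochner_Integration.integrable_bound[OF nsq_step(1)[OF that]]) (auto simp: cmod_power2)
 have "(\<integral>\<^sup>+w. ennreal ((cmod (step_integral W \<phi> w))^2) \<partial>M) = ennreal (expectation (\<lambda>w. (cmod (step_integral W \<phi> w))^2))"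
  unfolding c using sq[OF \<phi>'] sq[OF \<phi>''] by (intro nn_integral_eq_integral) auto
 also have "expectation (\<lambda>w. (cmod (step_integral W \<phi> w))^2) = (LINT u|lborel. (cmod (step_fun \<phi> u))^2)"
  unfolding c using sq[OF \<phi>'] sq[OF \<phi>''] int_re[OF \<phi>] int_re[OF \<phi>T] by simp
 finally show ?thesis unfolding nsq_step(2)[OF \<phi>] .
qed

end

section \<open>Equidistant grids and mean square norms\<close>

definition grid_steps :: "real \<Rightarrow> (nat \<Rightarrow> complex) \<Rightarrow> nat \<Rightarrow> (real \<times> real \<times> complex) list" where
 "grid_steps h g n = map (\<lambda>k. (h * real k, h * real (Suc k), g k)) [0..<n]"

lemma grid_steps_integral: "step_integral W (grid_steps h g n) w = (\<Sum>k<n. g k * of_real (W (h * real (Suc k)) w - W (h * real k) w))"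
 by (simp add: step_integral_def grid_steps_def o_def interv_sum_list_conv_sum_set_nat atLeast0LessThan)

lemma grid_steps_bounds: "0 \<le> h \<Longrightarrow> h * real n \<le> T \<Longrightarrow> steps_within T (grid_steps h g n)"
proof -
 assume h: "0 \<le> h" "h * real n \<le> T"
 have "h * real (Suc k) \<le> T" if "k < n" for k
  using that h(1) by (intro order_trans[OF mult_left_mono h(2)]) auto
 thus ?thesis using h by (auto simp: grid_steps_def intro!: mult_left_mono simp del: of_nat_Suc)
qed

lemma grid_steps_eq:
 assumes "k < n" "h * real k < u" "u \<le> h * real (Suc k)" "0 < h"
 shows "step_fun (grid_steps h g n) u = g k"
proof -
 have ind: "indicator {h * real i<..h * real (Suc i)} u = (if i = k then 1 else 0 :: complex)" for i
 proof (cases "i = k")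
  case False
  hence "Suc i \<le> k \<or> Suc k \<le> i" by auto
  hence "h * real (Suc i) \<le> h * real k \<or> h * real (Suc k) \<le> h * real i" using assms(4) by (auto simp del: of_nat_Suc)
  hence "u \<notin> {h * real i<..h * real (Suc i)}" using assms unfolding greaterThanAtMost_iff by linarith
  hence "indicator {h * real i<..h * real (Suc i)} u = (0 :: complex)" by (rule indicator_simps(2))
  thus ?thesis using False by (simp only: if_False)
 qed (use assms in simp)
 have "step_fun (grid_steps h g n) u = (\<Sum>i<n. g i * indicator {h * real i<..h * real (Suc i)} u)"
  by (simp add: step_fun_def grid_steps_def o_def interv_sum_list_conv_sum_set_nat atLeast0LessThan)
 also have "\<dots> = (\<Sum>i<n. if i = k then g i else 0)" unfolding ind by (intro sum.cong) auto
 also have "\<dots> = g k" using assms by simp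
 finally show ?thesis .
qed

lemma grid_cell:
 assumes "0 < u" "u \<le> h * real n" "0 < h"
 obtains k where "k < n" "h * real k < u" "u \<le> h * real (Suc k)"
proof -
 define k where "k = nat \<lceil>u / h\<rceil> - 1"
 have "0 < u / h" using assms by simp
 hence c: "1 \<le> \<lceil>u / h\<rceil>" by linarith
 hence Sk: "real (Suc k) = of_int \<lceil>u / h\<rceil>" unfolding k_def by (simp add: of_nat_diff)
 have 1: "u / h \<le> real (Suc k)" unfolding Sk by (rule le_of_int_ceiling)
 have 2: "real k < u / h" using Sk of_int_ceiling_le_add_one[of "u / h"] ceiling_correct[of "u / h"] by simp
 have "u / h \<le> real n" using assms by (simp add: field_simps)
 hence "real k < real n" using 2 by linarith
 hence "k < n" by simp
 thus thesis using 1 2 assms(3) by (intro that[of k]) (auto simp: field_simps)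
qed

lemma nsq_le:
 assumes "\<And>u. 0 < u \<Longrightarrow> u \<le> T \<Longrightarrow> cmod (h u) \<le> e" "0 \<le> T" "0 \<le> e"
 shows "nsq T h \<le> ennreal (e^2 * T)"
proof -
 have "nsq T h \<le> (\<integral>\<^sup>+u. ennreal (e^2) * indicator {0..T} u \<partial>lborel)"
  unfolding nsq_def
 proof (intro nn_integral_mono_AE)
  have "AE u in lborel. u \<noteq> (0 :: real)" by (rule AE_lborel_singleton)
  thus "AE u in lborel. ennreal ((cmod (h u))^2) * indicator {0..T} u \<le> ennreal (e^2) * indicator {0..T} u"
  proof eventually_elim
   case (elim u)
   show ?case
   proof (cases "u \<in> {0..T}")
    case True
    hence "cmod (h u) \<le> e" using elim assms by auto
    thus ?thesis using True by (auto intro!: ennreal_leI power_mono)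
   qed auto
  qed
 qed
 also have "\<dots> = ennreal (e^2 * T)" using assms by (simp add: nn_integral_cmult_indicator ennreal_mult)
 finally show ?thesis .
qed

lemma nsq_triangle:
 assumes [measurable]: "f \<in> borel_measurable borel" "g \<in> borel_measurable borel"
 shows "nsq T f \<le> 2 * nsq T (\<lambda>u. f u - g u) + 2 * nsq T g"
proof -
 have "nsq T f \<le> (\<integral>\<^sup>+u. 2 * (ennreal ((cmod (f u - g u))^2) * indicator {0..T} u) + 2 * (ennreal ((cmod (g u))^2) * indicator {0..T} u) \<partial>lborel)"
  unfolding nsq_def
 proof (intro nn_integral_mono)
  fix u
  have "ennreal ((cmod (f u))^2) \<le> ennreal (2 * (cmod (f u - g u))^2 + 2 * (cmod (g u))^2)" by (intro ennreal_leI cmod_sq_le)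
  also have "\<dots> = 2 * ennreal ((cmod (f u - g u))^2) + 2 * ennreal ((cmod (g u))^2)"
   by (simp add: ennreal_mult)
  finally show "ennreal ((cmod (f u))^2) * indicator {0..T} u
   \<le> 2 * (ennreal ((cmod (f u - g u))^2) * indicator {0..T} u) + 2 * (ennreal ((cmod (g u))^2) * indicator {0..T} u)"
   by (auto simp: indicator_def)
 qed
 also have "\<dots> = 2 * nsq T (\<lambda>u. f u - g u) + 2 * nsq T g"
  unfolding nsq_def by (simp add: nn_integral_add nn_integral_cmult)
 finally show ?thesis .
qed

lemma is_wiener_integralE:
 assumes "is_wiener_integral M W T f J"
 obtains \<phi> where "J \<in> borel_measurable M" "\<And>n. steps_within T (\<phi> n)"
  "(\<lambda>n. nsq T (\<lambda>u. step_fun (\<phi> n) u - f u)) \<longlonglongrightarrow> 0"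
  "(\<lambda>n. l2dist M (step_integral W (\<phi> n)) J) \<longlonglongrightarrow> 0"
 using assms unfolding is_wiener_integral_def nsq_def by blast

text \<open>A discretization error is again a Wiener integral. The unimodular factor
  \<open>a\<close> allows each direction of the plane to be treated as a real part.\<close>

lemma wiener_diff_step:
 assumes I: "is_wiener_integral M W T f I" and \<psi>: "steps_within T \<psi>"
  and m: "step_integral W \<psi> \<in> borel_measurable M" and a: "cmod a = 1"
 shows "is_wiener_integral M W T (\<lambda>u. a * (f u - step_fun \<psi> u)) (\<lambda>w. a * (I w - step_integral W \<psi> w))"
proof -
 from I obtain \<phi> where \<phi>: "I \<in> borel_measurable M" "\<And>n. steps_within T (\<phi> n)"
  "(\<lambda>n. nsq T (\<lambda>u. step_fun (\<phi> n) u - f u)) \<longlonglongrightarrow> 0"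
  "(\<lambda>n. l2dist M (step_integral W (\<phi> n)) I) \<longlonglongrightarrow> 0" by (rule is_wiener_integralE) blast
 define \<phi>' where "\<phi>' n = step_scale a (\<phi> n @ step_scale (-1) \<psi>)" for n
 have b: "steps_within T (\<phi>' n)" for n
  unfolding \<phi>'_def using \<phi>(2)[of n] step_scale(3)[OF \<psi>, of "-1"] by (intro step_scale(3)) (auto simp: ball_Un)
 have e: "step_fun (\<phi>' n) u - a * (f u - step_fun \<psi> u) = a * (step_fun (\<phi> n) u - f u)"
  "step_integral W (\<phi>' n) w - a * (I w - step_integral W \<psi> w) = a * (step_integral W (\<phi> n) w - I w)" for n u w
  unfolding \<phi>'_def by (simp_all add: step_scale step_list_simps algebra_simps)
 have "(\<lambda>w. a * (I w - step_integral W \<psi> w)) \<in> borel_measurable M" using \<phi>(1) m by measurable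
 thus ?thesis
  unfolding is_wiener_integral_def
  by (intro conjI exI[of _ \<phi>'] allI b) (use \<phi>(3,4) in \<open>auto simp: e norm_mult a nsq_def\<close>)
qed

context brownian_motion begin

text \<open>The exponent \<open>a^2 * v\<close>, twice that of a Gaussian of variance
  \<open>v\<close>, pays for the factor 2 in \<open>nsq_triangle\<close> when \<open>f\<close> is
  replaced by an approximating step function.\<close>

lemma wiener_exp_bound:
 assumes I: "is_wiener_integral M W T f J" and f: "f \<in> borel_measurable borel" and v: "nsq T f < ennreal v"
 shows "(\<integral>\<^sup>+w. ennreal (exp (a * Re (J w))) \<partial>M) \<le> ennreal (exp (a^2 * v))"
proof -
 from I obtain \<phi> where \<phi>: "J \<in> borel_measurable M" "\<And>n. steps_within T (\<phi> n)"
  "(\<lambda>n. nsq T (\<lambda>u. step_fun (\<phi> n) u - f u)) \<longlonglongrightarrow> 0"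
  "(\<lambda>n. l2dist M (step_integral W (\<phi> n)) J) \<longlonglongrightarrow> 0" by (rule is_wiener_integralE) blast
 have v0: "0 < v" using v by (metis ennreal_neg not_gr_zero not_less_zero linorder_not_less)
 show ?thesis
 proof (rule L2_limit_exp_bound[OF _ \<phi>(1) \<phi>(4)])
  show "step_integral W (\<phi> n) \<in> borel_measurable M" for n using \<phi>(2)[of n] by (intro step_integral_meas) auto
  have "(\<lambda>n. 2 * nsq T (\<lambda>u. step_fun (\<phi> n) u - f u) + 2 * nsq T f) \<longlonglongrightarrow> 2 * 0 + 2 * nsq T f"
   by (intro tendsto_intros ennreal_tendsto_cmult \<phi>(3)) auto
  moreover have "2 * 0 + 2 * nsq T f < ennreal (2 * v)"
  proof -
   obtain y where y: "nsq T f = ennreal y" "0 \<le> y" using v by (cases "nsq T f") auto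
   hence "y < v" using v v0 by (simp add: ennreal_less_iff)
   have "2 * ennreal y = ennreal (2 * y)" using y(2) by (simp add: ennreal_mult)
   thus ?thesis using y \<open>y < v\<close> v0 by (simp add: ennreal_less_iff)
  qed
  ultimately have "eventually (\<lambda>n. 2 * nsq T (\<lambda>u. step_fun (\<phi> n) u - f u) + 2 * nsq T f < ennreal (2 * v)) sequentially"
   by (rule order_tendstoD(2))
  thus "eventually (\<lambda>n. (\<integral>\<^sup>+w. ennreal (exp (a * Re (step_integral W (\<phi> n) w))) \<partial>M) \<le> ennreal (exp (a^2 * v))) sequentially"
  proof eventually_elim
   case (elim n)
   have "nsq T (step_fun (\<phi> n)) \<le> ennreal (2 * v)"
    using nsq_triangle[OF step_fun_meas f, of T "\<phi> n"] elim by (auto intro: order_trans less_imp_le)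
   from step_integral_exp_bound[OF \<phi>(2) this, of a] v0 show ?case by simp
  qed
 qed
qed

lemma wiener_Re_tail:
 assumes I: "is_wiener_integral M W T f J" and f: "f \<in> borel_measurable borel" and v: "nsq T f < ennreal v" and s: "0 \<le> s"
 shows "prob {w \<in> space M. s \<le> Re (J w)} \<le> exp (- s\<^sup>2 / (4 * v))"
proof -
 have v0: "0 < v" using v by (metis ennreal_neg not_gr_zero not_less_zero linorder_not_less)
 have [measurable]: "J \<in> borel_measurable M" using I by (simp add: is_wiener_integral_def)
 define a where "a = s / (2 * v)"
 have a0: "0 \<le> a" using s v0 by (simp add: a_def)
 have "emeasure M {w \<in> space M. s \<le> Re (J w)} \<le> emeasure M {w \<in> space M. 1 \<le> ennreal (exp (- a * s)) * ennreal (exp (a * Re (J w)))}"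
 proof (intro emeasure_mono)
  show "{w \<in> space M. s \<le> Re (J w)} \<subseteq> {w \<in> space M. 1 \<le> ennreal (exp (- a * s)) * ennreal (exp (a * Re (J w)))}"
   using mult_left_mono[OF _ a0] by (auto simp: ennreal_mult[symmetric] exp_add[symmetric])
 qed measurable
 also have "\<dots> \<le> ennreal (exp (- a * s)) * (\<integral>\<^sup>+w. ennreal (exp (a * Re (J w))) * indicator (space M) w \<partial>M)"
  by (rule nn_integral_Markov_inequality) auto
 also have "\<dots> = ennreal (exp (- a * s)) * (\<integral>\<^sup>+w. ennreal (exp (a * Re (J w))) \<partial>M)"
  by (intro arg_cong2[where f = "(*)"] nn_integral_cong refl) auto
 also have "\<dots> \<le> ennreal (exp (- a * s)) * ennreal (exp (a^2 * v))"
  by (intro mult_left_mono wiener_exp_bound[OF I f v]) auto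
 also have "\<dots> = ennreal (exp (- s\<^sup>2 / (4 * v)))"
  using v0 by (simp add: ennreal_mult[symmetric] exp_add[symmetric] a_def power2_eq_square field_simps)
 finally show ?thesis by (simp add: emeasure_eq_measure)
qed

text \<open>If the modulus is at least \<open>s\<close>, then the real part in one of the directions
  \<open>1\<close>, \<open>-1\<close>, \<open>\<i>\<close>, \<open>-\<i>\<close> is at least
  \<open>s / sqrt 2\<close>.\<close>

lemma wiener_tail:
 assumes I: "is_wiener_integral M W T f J" and f: "f \<in> borel_measurable borel" and \<psi>: "steps_within T \<psi>"
  and v: "nsq T (\<lambda>u. f u - step_fun \<psi> u) < ennreal v" and s: "0 \<le> s"
 shows "prob {w \<in> space M. s \<le> cmod (J w - step_integral W \<psi> w)} \<le> 4 * exp (- s\<^sup>2 / (8 * v))"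
proof -
 have \<psi>m[measurable]: "step_integral W \<psi> \<in> borel_measurable M" using \<psi> by (intro step_integral_meas) auto
 have [measurable]: "J \<in> borel_measurable M" using I by (simp add: is_wiener_integral_def)
 have [measurable]: "f \<in> borel_measurable borel" by fact
 define D where "D w = J w - step_integral W \<psi> w" for w
 have [measurable]: "D \<in> borel_measurable M" unfolding D_def by measurable
 define B where "B a = {w \<in> space M. s / sqrt 2 \<le> Re (a * D w)}" for a
 have [measurable]: "B a \<in> sets M" for a unfolding B_def by measurable
 have PB: "prob (B a) \<le> exp (- s\<^sup>2 / (8 * v))" if a: "cmod a = 1" for a
 proof -
  have "prob (B a) \<le> exp (- (s / sqrt 2)\<^sup>2 / (4 * v))" unfolding B_def D_def
  proof (rule wiener_Re_tail[OF wiener_diff_step[OF I \<psi> \<psi>m a]])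
   show "(\<lambda>u. a * (f u - step_fun \<psi> u)) \<in> borel_measurable borel" by measurable
   show "nsq T (\<lambda>u. a * (f u - step_fun \<psi> u)) < ennreal v" using v by (simp add: nsq_def norm_mult a)
  qed (use s in simp)
  thus ?thesis by (simp add: power_divide)
 qed
 have "{w \<in> space M. s \<le> cmod (D w)} \<subseteq> B 1 \<union> B (-1) \<union> (B \<i> \<union> B (-\<i>))"
 proof (rule ccontr)
  assume "\<not> ?thesis"
  then obtain w where "w \<in> space M" "s \<le> cmod (D w)" "w \<notin> B 1" "w \<notin> B (-1)" "w \<notin> B \<i>" "w \<notin> B (-\<i>)" by blast
  hence w: "s \<le> cmod (D w)" "\<bar>Re (D w)\<bar> < s / sqrt 2" "\<bar>Im (D w)\<bar> < s / sqrt 2" by (auto simp: B_def abs_less_iff)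
  have "\<bar>Re (D w)\<bar>^2 < (s / sqrt 2)^2" "\<bar>Im (D w)\<bar>^2 < (s / sqrt 2)^2" by (rule power_strict_mono[OF w(2)] power_strict_mono[OF w(3)]; simp)+
  hence "(Re (D w))^2 < (s / sqrt 2)^2" "(Im (D w))^2 < (s / sqrt 2)^2" by simp_all
  hence "(cmod (D w))^2 < s^2" by (simp add: cmod_power2 power_divide)
  thus False using power_mono[OF w(1) s, of 2] by simp
 qed
 hence "prob {w \<in> space M. s \<le> cmod (D w)} \<le> prob (B 1 \<union> B (-1) \<union> (B \<i> \<union> B (-\<i>)))" by (intro finite_measure_mono) auto
 also have "\<dots> \<le> (prob (B 1) + prob (B (-1))) + (prob (B \<i>) + prob (B (-\<i>)))"
  by (intro order_trans[OF measure_Un_le] add_mono) auto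
 also have "\<dots> \<le> (exp (- s\<^sup>2 / (8 * v)) + exp (- s\<^sup>2 / (8 * v))) + (exp (- s\<^sup>2 / (8 * v)) + exp (- s\<^sup>2 / (8 * v)))"
  by (intro add_mono PB) auto
 finally show ?thesis by (simp add: D_def)
qed

text \<open>Needed to know that the choice in \<open>wiener_integral\<close> yields an integral at
  all. The integral is built as an almost sure limit of step integrals of uniform
  approximations.\<close>

lemma wiener_integral_exists:
 assumes f: "continuous_on {0..T} f" and T: "0 < T"
 shows "\<exists>I. is_wiener_integral M W T f I"
proof -
 have unif: "\<exists>\<psi>. (steps_within T \<psi>) \<and> (\<forall>u. 0 < u \<longrightarrow> u \<le> T \<longrightarrow> cmod (step_fun \<psi> u - f u) \<le> e)"
  if e: "0 < e" for e
 proof -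
  have "uniformly_continuous_on {0..T} f" using f by (intro compact_uniformly_continuous) auto
  then obtain d where d: "0 < d" "\<And>x y. x \<in> {0..T} \<Longrightarrow> y \<in> {0..T} \<Longrightarrow> dist y x < d \<Longrightarrow> dist (f y) (f x) < e"
   using e unfolding uniformly_continuous_on_def by metis
  obtain m :: nat where m: "T / d < real m" using reals_Archimedean2 by blast
  have m0: "0 < real m" using m T d(1) by (smt (verit) divide_pos_pos)
  define h where "h = T / real m"
  have h: "0 < h" "h < d" "h * real m = T" using m m0 T d(1) by (auto simp: h_def field_simps)
  define \<psi> where "\<psi> = grid_steps h (\<lambda>k. f (h * real k)) m"
  have "cmod (step_fun \<psi> u - f u) \<le> e" if u: "0 < u" "u \<le> T" for u
  proof -
   obtain k where k: "k < m" "h * real k < u" "u \<le> h * real (Suc k)" using grid_cell[of u h m] u h by auto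
   have "step_fun \<psi> u = f (h * real k)" unfolding \<psi>_def using grid_steps_eq[OF k h(1)] by simp
   moreover have "dist (f (h * real k)) (f u) < e"
    using k u h by (intro d(2)) (auto simp: dist_real_def algebra_simps)
   ultimately show ?thesis by (simp add: dist_norm)
  qed
  moreover have "steps_within T \<psi>" unfolding \<psi>_def using h by (intro grid_steps_bounds) auto
  ultimately show ?thesis by blast
 qed
 \<comment> \<open>The rate \<open>(1/4)^n\<close> is fast enough that the mean squares of
   successive differences, multiplied by \<open>2^n\<close>, are still summable. This gives almost
   sure convergence of the whole sequence.\<close>
 have "\<exists>\<phi>. \<forall>n. (steps_within T (\<phi> n)) \<and> (\<forall>u. 0 < u \<longrightarrow> u \<le> T \<longrightarrow> cmod (step_fun (\<phi> n) u - f u) \<le> (1/4)^n)"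
  by (intro choice allI unif) auto
 then obtain \<phi> where \<phi>: "\<And>n. steps_within T (\<phi> n)"
  "\<And>n u. 0 < u \<Longrightarrow> u \<le> T \<Longrightarrow> cmod (step_fun (\<phi> n) u - f u) \<le> (1/4)^n" by blast
 define S where "S n = step_integral W (\<phi> n)" for n
 have [measurable]: "S n \<in> borel_measurable M" for n unfolding S_def using \<phi>(1)[of n] by (intro step_integral_meas) auto
 have SS: "l2dist M (S n) (S m) \<le> ennreal ((2 * (1/4)^n)^2 * T)" if nm: "n \<le> m" for n m
 proof -
  define \<psi> where "\<psi> = \<phi> n @ step_scale (-1) (\<phi> m)"
  have \<psi>: "steps_within T \<psi>"
   unfolding \<psi>_def using \<phi>(1)[of n] step_scale(3)[OF \<phi>(1)[of m], of "-1"] by (auto simp: ball_Un)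
  have "S n w - S m w = step_integral W \<psi> w" for w by (simp add: S_def \<psi>_def step_list_simps step_scale)
  hence "l2dist M (S n) (S m) = nsq T (step_fun \<psi>)" using step_integral_L2[OF \<psi>] by simp
  also have "\<dots> \<le> ennreal ((2 * (1/4)^n)^2 * T)"
  proof (intro nsq_le)
   fix u assume u: "0 < u" "u \<le> T"
   have "step_fun \<psi> u = (step_fun (\<phi> n) u - f u) - (step_fun (\<phi> m) u - f u)" by (simp add: \<psi>_def step_list_simps step_scale)
   also have "cmod \<dots> \<le> (1/4)^n + (1/4)^m" by (intro order_trans[OF norm_triangle_ineq4] add_mono \<phi>(2) u)
   also have "\<dots> \<le> 2 * (1/4)^n" using power_decreasing[OF nm, of "1/4 :: real"] by simp
   finally show "cmod (step_fun \<psi> u) \<le> 2 * (1/4)^n" .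
  qed (use T in auto)
  finally show ?thesis .
 qed
 define D where "D n w = S (Suc n) w - S n w" for n w
 have [measurable]: "D n \<in> borel_measurable M" for n unfolding D_def by measurable
 have "(\<integral>\<^sup>+w. (\<Sum>n. ennreal (cmod (D n w))) \<partial>M) \<le> (\<Sum>n. ennreal ((1 + 4 * T) * (1/2)^n))"
 proof -
  have "(\<integral>\<^sup>+w. ennreal (cmod (D n w)) \<partial>M) \<le> ennreal ((1 + 4 * T) * (1/2)^n)" for n
  proof -
   have "(\<integral>\<^sup>+w. ennreal (cmod (D n w)) \<partial>M) \<le> (\<integral>\<^sup>+w. ennreal ((1/2)^n) + ennreal (2^n) * ennreal ((cmod (S n w - S (Suc n) w))^2) \<partial>M)"
   proof (intro nn_integral_mono)
    fix w
    define y where "y = cmod (D n w)"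
    have y: "y = cmod (S n w - S (Suc n) w)" by (simp add: y_def D_def norm_minus_commute)
    have "2 * y \<le> (1/2)^n + 2^n * y^2"
    proof -
     have "0 \<le> (1/2)^n * (2^n * y - 1)^2" by simp
     also have "\<dots> = (1/2)^n * (2^n)^2 * y^2 - 2 * ((1/2)^n * 2^n) * y + (1/2)^n"
      by (simp add: power2_eq_square algebra_simps)
     also have "(1/2 :: real)^n * (2^n)^2 = 2^n" by (simp add: power2_eq_square power_divide)
     also have "(1/2 :: real)^n * 2^n = 1" by (simp add: power_divide)
     finally show ?thesis by simp
    qed
    hence "y \<le> (1/2)^n + 2^n * y^2" by (smt (verit) norm_ge_zero y_def)
    hence "ennreal y \<le> ennreal ((1/2)^n + 2^n * y^2)" by (rule ennreal_leI)
    also have "\<dots> = ennreal ((1/2)^n) + ennreal (2^n) * ennreal (y^2)" by (simp add: ennreal_mult)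
    finally show "ennreal (cmod (D n w)) \<le> ennreal ((1/2)^n) + ennreal (2^n) * ennreal ((cmod (S n w - S (Suc n) w))^2)"
     unfolding y[symmetric] y_def .
   qed
   also have "\<dots> = ennreal ((1/2)^n) + ennreal (2^n) * (l2dist M (S n) (S (Suc n)))"
    by (simp add: nn_integral_add nn_integral_cmult emeasure_space_1)
   also have "\<dots> \<le> ennreal ((1/2)^n) + ennreal (2^n) * ennreal ((2 * (1/4)^n)^2 * T)"
    by (intro add_left_mono mult_left_mono SS) auto
   also have "\<dots> = ennreal ((1/2)^n + 2^n * ((2 * (1/4)^n)^2 * T))" using T by (simp add: ennreal_mult)
   also have "\<dots> \<le> ennreal ((1 + 4 * T) * (1/2)^n)"
   proof (rule ennreal_leI)
    have "(1/4 :: real)^n = (1/2)^n * (1/2)^n" by (simp add: power_mult_distrib[symmetric])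
    hence "2^n * ((2 * (1/4)^n)^2 * T) = 4 * T * (2 * (1/2))^n * ((1/2)^n * (1/2)^n) * (1/2)^n"
    proof -
     have "x * ((2 * (q * q))^2 * T) = 4 * T * (x * q) * (q * q) * q" for x q :: real
      by (simp add: power2_eq_square)
     thus ?thesis unfolding \<open>(1/4 :: real)^n = (1/2)^n * (1/2)^n\<close> power_mult_distrib[of 2 "1/2"] .
    qed
    also have "\<dots> \<le> 4 * T * 1 * (1 * 1) * (1/2)^n" using T by (intro mult_mono mult_nonneg_nonneg power_le_one) auto
    finally show "(1/2)^n + 2^n * ((2 * (1/4)^n)^2 * T) \<le> (1 + 4 * T) * (1/2)^n" by (simp add: algebra_simps)
   qed
   finally show ?thesis .
  qed
  thus ?thesis by (subst nn_integral_suminf) (auto intro!: suminf_le)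
 qed
 also have "\<dots> = ennreal (\<Sum>n. (1 + 4 * T) * (1/2)^n)" using T by (intro suminf_ennreal2 summable_mult) auto
 also have "\<dots> < \<infinity>" by simp
 finally have "AE w in M. (\<Sum>n. ennreal (cmod (D n w))) \<noteq> \<infinity>" by (intro nn_integral_PInf_AE) auto
 hence conv: "AE w in M. convergent (\<lambda>n. S n w)"
 proof eventually_elim
  case (elim w)
  hence "summable (\<lambda>n. cmod (D n w))" by (intro summable_suminf_not_top) auto
  hence "summable (\<lambda>n. D n w)" by (rule summable_norm_cancel)
  hence "convergent (\<lambda>m. \<Sum>n<m. D n w)" by (simp add: summable_iff_convergent)
  moreover have "(\<Sum>n<m. D n w) = S m w - S 0 w" for m unfolding D_def by (rule sum_lessThan_telescope)
  ultimately have "convergent (\<lambda>m. S m w - S 0 w + S 0 w)" by (intro convergent_add convergent_const) simp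
  thus ?case by simp
 qed
 define I where "I w = lim (\<lambda>n. S n w)" for w
 have [measurable]: "I \<in> borel_measurable M" unfolding I_def by measurable
 have bound: "l2dist M (S n) I \<le> ennreal ((2 * (1/4)^n)^2 * T)" for n
 proof -
  have "l2dist M (S n) I = (\<integral>\<^sup>+w. liminf (\<lambda>m. ennreal ((cmod (S n w - S m w))^2)) \<partial>M)"
  proof (rule nn_integral_cong_AE)
   show "AE w in M. ennreal ((cmod (S n w - I w))^2) = liminf (\<lambda>m. ennreal ((cmod (S n w - S m w))^2))"
    using conv
   proof eventually_elim
    case (elim w)
    hence "(\<lambda>m. S m w) \<longlonglongrightarrow> I w" unfolding I_def by (simp add: convergent_LIMSEQ_iff)
    hence "(\<lambda>m. ennreal ((cmod (S n w - S m w))^2)) \<longlonglongrightarrow> ennreal ((cmod (S n w - I w))^2)"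
     by (intro tendsto_ennrealI tendsto_intros)
    thus ?case by (rule lim_imp_Liminf[OF trivial_limit_sequentially, symmetric])
   qed
  qed
  also have "\<dots> \<le> liminf (\<lambda>m. l2dist M (S n) (S m))" by (rule nn_integral_liminf) measurable
  also have "\<dots> \<le> ennreal ((2 * (1/4)^n)^2 * T)"
   by (rule Liminf_le) (use SS[of n] in \<open>auto simp: eventually_sequentially\<close>)
  finally show ?thesis .
 qed
 have lim0: "(\<lambda>n. ennreal ((K * (1/4)^n)^2 * T)) \<longlonglongrightarrow> 0" for K
 proof -
  have "(\<lambda>n. ennreal ((K * (1/4)^n)^2 * T)) \<longlonglongrightarrow> ennreal ((K * 0)^2 * T)"
   by (intro tendsto_ennrealI tendsto_intros LIMSEQ_power_zero) auto
  thus ?thesis by simp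
 qed
 have "is_wiener_integral M W T f I"
  unfolding is_wiener_integral_def
 proof (intro conjI exI[of _ \<phi>] allI \<phi>(1))
  have "nsq T (\<lambda>u. step_fun (\<phi> n) u - f u) \<le> ennreal ((1 * (1/4)^n)^2 * T)" for n
   using \<phi>(2) T by (intro nsq_le) auto
  thus "(\<lambda>n. \<integral>\<^sup>+u. ennreal ((cmod (step_fun (\<phi> n) u - f u))^2) * indicator {0..T} u \<partial>lborel) \<longlonglongrightarrow> 0"
   unfolding nsq_def by (intro tendsto_sandwich[OF _ _ tendsto_const lim0[of 1]]) auto
  show "(\<lambda>n. l2dist M (step_integral W (\<phi> n)) I) \<longlonglongrightarrow> 0"
   using bound unfolding S_def by (intro tendsto_sandwich[OF _ _ tendsto_const lim0[of 2]]) auto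
 qed measurable
 thus ?thesis by blast
qed

end

text \<open>The complex squares converge because \<open>|a^2 - b^2|\<close> is at most
  \<open>(1 + 1/\<epsilon>) |a - b|^2 + \<epsilon> |b|^2\<close>; the second part is made small by
  \<open>\<epsilon>\<close>, the first by the approximation.\<close>

lemma step_sq_limit:
 assumes [measurable]: "f \<in> borel_measurable borel" and F: "nsq T f < \<infinity>"
  and \<phi>: "\<And>n. steps_within T (\<phi> n)"
  and lim: "(\<lambda>n. nsq T (\<lambda>u. step_fun (\<phi> n) u - f u)) \<longlonglongrightarrow> 0"
 shows "(\<lambda>n. LINT u|lborel. (step_fun (\<phi> n) u)^2) \<longlonglongrightarrow> (LINT u:{0..T}|lborel. (f u)^2)"
proof (rule LIMSEQ_I)
 fix e :: real assume e: "0 < e"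
 obtain F' where F': "nsq T f = ennreal F'" "0 \<le> F'" using F by (cases "nsq T f") auto
 define \<epsilon> where "\<epsilon> = e / (2 * (F' + 1))"
 have \<epsilon>: "0 < \<epsilon>" "\<epsilon> * F' \<le> e / 2" using e F' by (auto simp: \<epsilon>_def field_simps)
 define d where "d = e / 4 / (1 + 1 / \<epsilon>)"
 have \<epsilon>': "0 < 1 + 1 / \<epsilon>" using \<epsilon>(1) by (simp add: add_pos_pos)
 have d: "0 < d" "(1 + 1 / \<epsilon>) * d = e / 4"
 proof -
  have "y * (e / 4 / y) = e / 4" if "0 < y" for y :: real using that by simp
  thus "(1 + 1 / \<epsilon>) * d = e / 4" unfolding d_def using \<epsilon>' by blast
  show "0 < d" unfolding d_def using e \<epsilon>' by (intro divide_pos_pos) auto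
 qed
 have intf: "integrable lborel (\<lambda>u. indicator {0..T} u *\<^sub>R (f u)^2)"
 proof (rule integrableI_bounded)
  have "(\<integral>\<^sup>+u. ennreal (norm (indicator {0..T} u *\<^sub>R (f u)^2)) \<partial>lborel) = nsq T f"
   unfolding nsq_def by (intro nn_integral_cong) (auto simp: indicator_def norm_power)
  thus "(\<integral>\<^sup>+u. ennreal (norm (indicator {0..T} u *\<^sub>R (f u)^2)) \<partial>lborel) < \<infinity>" using F by simp
 qed measurable
 have ints: "integrable lborel (\<lambda>u. (step_fun (\<phi> n) u)^2)" for n
 proof (rule Bochner_Integration.integrable_bound[OF nsq_step(1)[OF \<phi>[of n]]])
  have [measurable]: "step_fun (\<phi> n) \<in> borel_measurable borel" by (rule step_fun_meas)
  show "(\<lambda>u. (step_fun (\<phi> n) u)^2) \<in> borel_measurable lborel" by measurable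
 qed (simp add: norm_power)
 have "eventually (\<lambda>n. nsq T (\<lambda>u. step_fun (\<phi> n) u - f u) < ennreal d) sequentially"
  using order_tendstoD(2)[OF lim, of "ennreal d"] d by simp
 hence "eventually (\<lambda>n. norm ((LINT u|lborel. (step_fun (\<phi> n) u)^2) - (LINT u:{0..T}|lborel. (f u)^2)) < e) sequentially"
 proof eventually_elim
  case (elim n)
  have [measurable]: "step_fun (\<phi> n) \<in> borel_measurable borel" by (rule step_fun_meas)
  have "ennreal (norm ((LINT u|lborel. (step_fun (\<phi> n) u)^2) - (LINT u:{0..T}|lborel. (f u)^2)))
    = ennreal (norm (LINT u|lborel. (step_fun (\<phi> n) u)^2 - indicator {0..T} u *\<^sub>R (f u)^2))"
   unfolding set_lebesgue_integral_def using ints intf by simp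
  also have "\<dots> \<le> (\<integral>\<^sup>+u. ennreal (norm ((step_fun (\<phi> n) u)^2 - indicator {0..T} u *\<^sub>R (f u)^2)) \<partial>lborel)"
   using ints intf by (intro integral_norm_bound_ennreal) auto
  also have "\<dots> \<le> (\<integral>\<^sup>+u. ennreal (1 + 1 / \<epsilon>) * (ennreal ((cmod (step_fun (\<phi> n) u - f u))^2) * indicator {0..T} u)
    + ennreal \<epsilon> * (ennreal ((cmod (f u))^2) * indicator {0..T} u) \<partial>lborel)"
  proof (intro nn_integral_mono)
   fix u
   show "ennreal (norm ((step_fun (\<phi> n) u)^2 - indicator {0..T} u *\<^sub>R (f u)^2))
    \<le> ennreal (1 + 1 / \<epsilon>) * (ennreal ((cmod (step_fun (\<phi> n) u - f u))^2) * indicator {0..T} u)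
    + ennreal \<epsilon> * (ennreal ((cmod (f u))^2) * indicator {0..T} u)"
   proof (cases "u \<in> {0..T}")
    case False
    thus ?thesis using nsq_step(3)[OF \<phi>[of n] False] by simp
   next
    case True
    define x y where "x = cmod (step_fun (\<phi> n) u - f u)" and "y = cmod (f u)"
    have "(step_fun (\<phi> n) u)^2 - (f u)\<^sup>2 = (step_fun (\<phi> n) u - f u)^2 + 2 * f u * (step_fun (\<phi> n) u - f u)"
     by (simp add: power2_eq_square algebra_simps)
    hence "norm ((step_fun (\<phi> n) u)^2 - (f u)\<^sup>2) \<le> x^2 + 2 * y * x"
     using norm_triangle_ineq[of "(step_fun (\<phi> n) u - f u)^2" "2 * f u * (step_fun (\<phi> n) u - f u)"]
     by (simp add: x_def y_def norm_mult norm_power)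
    also have "2 * y * x \<le> \<epsilon> * y^2 + 1 / \<epsilon> * x^2"
    proof -
     have "2 * (y * sqrt \<epsilon>) * (x / sqrt \<epsilon>) \<le> (y * sqrt \<epsilon>)^2 + (x / sqrt \<epsilon>)^2" by (rule sum_squares_bound)
     thus ?thesis using \<epsilon>(1) by (simp add: power_divide power_mult_distrib mult.commute)
    qed
    finally have "ennreal (norm ((step_fun (\<phi> n) u)^2 - (f u)\<^sup>2)) \<le> ennreal ((1 + 1 / \<epsilon>) * x^2 + \<epsilon> * y^2)"
     by (intro ennreal_leI) (simp add: algebra_simps)
    also have "\<dots> = ennreal (1 + 1 / \<epsilon>) * ennreal (x^2) + ennreal \<epsilon> * ennreal (y^2)"
    proof -
     have nn: "0 \<le> 1 + 1 / \<epsilon>" "0 \<le> x^2" "0 \<le> \<epsilon>" "0 \<le> y^2" using \<epsilon>(1) by auto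
     show ?thesis by (simp only: ennreal_plus[OF mult_nonneg_nonneg[OF nn(1,2)] mult_nonneg_nonneg[OF nn(3,4)]] ennreal_mult[OF nn(1,2)] ennreal_mult[OF nn(3,4)])
    qed
    finally show ?thesis using True by (simp add: x_def y_def)
   qed
  qed
  also have "\<dots> = ennreal (1 + 1 / \<epsilon>) * nsq T (\<lambda>u. step_fun (\<phi> n) u - f u) + ennreal \<epsilon> * nsq T f"
   unfolding nsq_def by (simp add: nn_integral_add nn_integral_cmult)
  also have "\<dots> \<le> ennreal (1 + 1 / \<epsilon>) * ennreal d + ennreal \<epsilon> * ennreal F'"
   using elim F' by (intro add_mono mult_left_mono) auto
  also have "\<dots> = ennreal ((1 + 1 / \<epsilon>) * d + \<epsilon> * F')"
  proof -
   have nn: "0 \<le> 1 + 1 / \<epsilon>" "0 \<le> d" "0 \<le> \<epsilon>" "0 \<le> F'" using \<epsilon>(1) d F' by auto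
   show ?thesis by (simp only: ennreal_plus[OF mult_nonneg_nonneg[OF nn(1,2)] mult_nonneg_nonneg[OF nn(3,4)]] ennreal_mult[OF nn(1,2)] ennreal_mult[OF nn(3,4)])
  qed
  also have "\<dots> < ennreal e" using d \<epsilon> e by (intro ennreal_lessI) auto
  finally show ?case by (simp add: ennreal_less_iff)
 qed
 thus "\<exists>no. \<forall>n\<ge>no. norm ((LINT u|lborel. (step_fun (\<phi> n) u)^2) - (LINT u:{0..T}|lborel. (f u)^2)) < e"
  by (simp add: eventually_sequentially)
qed

text \<open>Independence is used for the step integrals, where the transform factorizes; the formula
  for the sum then passes to the limit in \<open>L^2\<close>.\<close>

lemma wiener_pair_mgf:
 assumes W: "brownian_motion M W" "brownian_motion M V"
  and ind: "\<And>\<phi> \<psi>. steps_nonneg \<phi> \<Longrightarrow> steps_nonneg \<psi> \<Longrightarrow>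
   prob_space.indep_var M borel (step_integral W \<phi>) borel (step_integral V \<psi>)"
  and f: "f \<in> borel_measurable borel" "nsq T f < \<infinity>" "is_wiener_integral M W T f I"
  and g: "g \<in> borel_measurable borel" "nsq T g < \<infinity>" "is_wiener_integral M V T g J"
 shows "(LINT w|M. exp (of_real a * (I w + J w))) = exp (of_real (a^2 / 2) * ((LINT u:{0..T}|lborel. (f u)^2) + (LINT u:{0..T}|lborel. (g u)^2)))"
proof -
 interpret W: brownian_motion M W by fact
 interpret V: brownian_motion M V by fact
 from f(3) obtain \<phi> where \<phi>: "I \<in> borel_measurable M" "\<And>n. steps_within T (\<phi> n)"
  "(\<lambda>n. nsq T (\<lambda>u. step_fun (\<phi> n) u - f u)) \<longlonglongrightarrow> 0"
  "(\<lambda>n. l2dist M (step_integral W (\<phi> n)) I) \<longlonglongrightarrow> 0" by (rule is_wiener_integralE) blast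
 from g(3) obtain \<psi> where \<psi>: "J \<in> borel_measurable M" "\<And>n. steps_within T (\<psi> n)"
  "(\<lambda>n. nsq T (\<lambda>u. step_fun (\<psi> n) u - g u)) \<longlonglongrightarrow> 0"
  "(\<lambda>n. l2dist M (step_integral V (\<psi> n)) J) \<longlonglongrightarrow> 0" by (rule is_wiener_integralE) blast
 note [measurable] = \<phi>(1) \<psi>(1)
 define S R where "S n = step_integral W (\<phi> n)" and "R n = step_integral V (\<psi> n)" for n
 have \<phi>0: "steps_nonneg (\<phi> n)" and \<psi>0: "steps_nonneg (\<psi> n)" for n
  using \<phi>(2)[of n] \<psi>(2)[of n] by auto
 have [measurable]: "S n \<in> borel_measurable M" "R n \<in> borel_measurable M" for n
  unfolding S_def R_def by (rule W.step_integral_meas[OF \<phi>0] V.step_integral_meas[OF \<psi>0])+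
 have vbound: "\<exists>v. 0 \<le> v \<and> eventually (\<lambda>n. nsq T (step_fun (\<phi> n)) \<le> ennreal v) sequentially"
  if f: "f \<in> borel_measurable borel" "nsq T f < \<infinity>" and lim: "(\<lambda>n. nsq T (\<lambda>u. step_fun (\<phi> n) u - f u)) \<longlonglongrightarrow> 0"
  for f :: "real \<Rightarrow> complex" and \<phi>
 proof -
  obtain F where F: "nsq T f = ennreal F" "0 \<le> F" using f(2) by (cases "nsq T f") auto
  have "eventually (\<lambda>n. nsq T (\<lambda>u. step_fun (\<phi> n) u - f u) < ennreal 1) sequentially"
   using order_tendstoD(2)[OF lim, of 1] by simp
  hence "eventually (\<lambda>n. nsq T (step_fun (\<phi> n)) \<le> ennreal (2 + 2 * F)) sequentially"
  proof eventually_elim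
   case (elim n)
   have "nsq T (step_fun (\<phi> n)) \<le> 2 * nsq T (\<lambda>u. step_fun (\<phi> n) u - f u) + 2 * nsq T f"
    by (rule nsq_triangle[OF step_fun_meas f(1)])
   also have "\<dots> \<le> 2 * ennreal 1 + 2 * ennreal F" using elim F by (intro add_mono mult_left_mono) auto
   also have "\<dots> = ennreal (2 + 2 * F)" using F(2) by (simp add: ennreal_mult)
   finally show ?case .
  qed
  thus ?thesis using F(2) by (intro exI[of _ "2 + 2 * F"]) auto
 qed
 obtain v1 where v1: "0 \<le> v1" "eventually (\<lambda>n. nsq T (step_fun (\<phi> n)) \<le> ennreal v1) sequentially" using vbound[OF f(1,2) \<phi>(3)] by blast
 obtain v2 where v2: "0 \<le> v2" "eventually (\<lambda>n. nsq T (step_fun (\<psi> n)) \<le> ennreal v2) sequentially" using vbound[OF g(1,2) \<psi>(3)] by blast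
 \<comment> \<open>The exponent \<open>a\<close> is doubled twice: once because
   \<open>L2_limit_mgf\<close> asks for second moments, once to separate the two integrals by
   \<open>x y \<le> x^2 + y^2\<close>.\<close>
 define B where "B = exp ((4 * a)^2 / 2 * v1) + exp ((4 * a)^2 / 2 * v2)"
 have mgfW: "integrable M (\<lambda>w. exp (of_real a * S n w)) \<and>
   (LINT w|M. exp (of_real a * S n w)) = exp (of_real (a^2 / 2) * (LINT u|lborel. (step_fun (\<phi> n) u)^2))" for n
  using W.step_integral_mgf[OF step_scale(3)[OF \<phi>0[of n], of "of_real a"]]
  by (simp add: step_scale S_def power_mult_distrib)
 have mgfV: "integrable M (\<lambda>w. exp (of_real a * R n w)) \<and>
   (LINT w|M. exp (of_real a * R n w)) = exp (of_real (a^2 / 2) * (LINT u|lborel. (step_fun (\<psi> n) u)^2))" for n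
  using V.step_integral_mgf[OF step_scale(3)[OF \<psi>0[of n], of "of_real a"]]
  by (simp add: step_scale R_def power_mult_distrib)
 have prod: "integrable M (\<lambda>w. exp (of_real a * (S n w + R n w)))"
  "(LINT w|M. exp (of_real a * (S n w + R n w))) = exp (of_real (a^2 / 2) * ((LINT u|lborel. (step_fun (\<phi> n) u)^2) + (LINT u|lborel. (step_fun (\<psi> n) u)^2)))" for n
 proof -
  have iv: "W.indep_var borel (\<lambda>w. exp (of_real a * S n w)) borel (\<lambda>w. exp (of_real a * R n w))"
   using W.indep_var_compose[OF ind[OF \<phi>0[of n] \<psi>0[of n]], of "\<lambda>z. exp (of_real a * z)" borel "\<lambda>z. exp (of_real a * z)" borel]
   by (simp add: o_def S_def R_def)
  have e: "exp (of_real a * (S n w + R n w)) = exp (of_real a * S n w) * exp (of_real a * R n w)" for w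
   by (simp add: distrib_left exp_add)
  show "integrable M (\<lambda>w. exp (of_real a * (S n w + R n w)))"
   unfolding e by (rule W.indep_var_integrable[OF iv]) (use mgfW mgfV in blast)+
  show "(LINT w|M. exp (of_real a * (S n w + R n w))) = exp (of_real (a^2 / 2) * ((LINT u|lborel. (step_fun (\<phi> n) u)^2) + (LINT u|lborel. (step_fun (\<psi> n) u)^2)))"
   unfolding e using W.indep_var_lebesgue_integral[OF iv] mgfW[of n] mgfV[of n] by (simp add: exp_add distrib_left)
 qed
 show ?thesis
 proof (rule W.L2_limit_mgf(2)[where S = "\<lambda>n w. of_real a * (S n w + R n w)" and B = B])
  show "(\<lambda>w. of_real a * (S n w + R n w)) \<in> borel_measurable M" for n by measurable
  show "(\<lambda>w. of_real a * (I w + J w)) \<in> borel_measurable M" by measurable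
  show "integrable M (\<lambda>w. exp (of_real a * (S n w + R n w)))" for n by (rule prod)
  show "0 \<le> B" by (simp add: B_def)
  show "(\<lambda>n. LINT w|M. exp (of_real a * (S n w + R n w))) \<longlonglongrightarrow> exp (of_real (a^2 / 2) * ((LINT u:{0..T}|lborel. (f u)^2) + (LINT u:{0..T}|lborel. (g u)^2)))"
   unfolding prod(2) by (intro tendsto_intros step_sq_limit f g \<phi> \<psi>)
  show "(\<lambda>n. \<integral>\<^sup>+w. ennreal ((cmod (of_real a * (S n w + R n w) - of_real a * (I w + J w)))^2) \<partial>M) \<longlonglongrightarrow> 0"
  proof (rule tendsto_sandwich[OF _ _ tendsto_const])
   let ?u = "\<lambda>n. ennreal (2 * a^2) * (l2dist M (S n) I + (l2dist M (R n) J))"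
   have "?u \<longlonglongrightarrow> ennreal (2 * a^2) * (0 + 0)"
    by (intro tendsto_intros ennreal_tendsto_cmult) (use \<phi>(4) \<psi>(4) in \<open>auto simp: S_def R_def\<close>)
   thus "?u \<longlonglongrightarrow> 0" by simp
   show "eventually (\<lambda>n. (\<integral>\<^sup>+w. ennreal ((cmod (of_real a * (S n w + R n w) - of_real a * (I w + J w)))^2) \<partial>M) \<le> ?u n) sequentially"
   proof (intro always_eventually allI)
    fix n
    have "(\<integral>\<^sup>+w. ennreal ((cmod (of_real a * (S n w + R n w) - of_real a * (I w + J w)))^2) \<partial>M)
     \<le> (\<integral>\<^sup>+w. ennreal (2 * a^2) * (ennreal ((cmod (S n w - I w))^2) + ennreal ((cmod (R n w - J w))^2)) \<partial>M)"
    proof (intro nn_integral_mono)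
     fix w
     have "of_real a * (S n w + R n w) - of_real a * (I w + J w) = of_real a * ((S n w - I w) + (R n w - J w))" by (simp add: algebra_simps)
     hence "(cmod (of_real a * (S n w + R n w) - of_real a * (I w + J w)))^2 = a^2 * (cmod ((S n w - I w) + (R n w - J w)))^2"
      by (simp add: norm_mult power_mult_distrib)
     also have "\<dots> \<le> a^2 * (2 * (cmod (S n w - I w))^2 + 2 * (cmod (R n w - J w))^2)"
      using cmod_sq_le[of "(S n w - I w) + (R n w - J w)" "R n w - J w"] by (intro mult_left_mono) auto
     also have "\<dots> = 2 * a^2 * ((cmod (S n w - I w))^2 + (cmod (R n w - J w))^2)" by (simp add: algebra_simps)
     finally have "ennreal ((cmod (of_real a * (S n w + R n w) - of_real a * (I w + J w)))^2) \<le> ennreal (2 * a^2 * ((cmod (S n w - I w))^2 + (cmod (R n w - J w))^2))"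
      by (rule ennreal_leI)
     also have "\<dots> = ennreal (2 * a^2) * (ennreal ((cmod (S n w - I w))^2) + ennreal ((cmod (R n w - J w))^2))"
      by (subst ennreal_mult) (auto simp: ennreal_plus)
     finally show "ennreal ((cmod (of_real a * (S n w + R n w) - of_real a * (I w + J w)))^2) \<le> ennreal (2 * a^2) * (ennreal ((cmod (S n w - I w))^2) + ennreal ((cmod (R n w - J w))^2))" .
    qed
    also have "\<dots> = ?u n" by (simp add: nn_integral_cmult nn_integral_add)
    finally show "(\<integral>\<^sup>+w. ennreal ((cmod (of_real a * (S n w + R n w) - of_real a * (I w + J w)))^2) \<partial>M) \<le> ?u n" .
   qed
  qed auto
  show "eventually (\<lambda>n. (\<integral>\<^sup>+w. ennreal (exp (2 * Re (of_real a * (S n w + R n w)))) \<partial>M) \<le> ennreal B) sequentially"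
   using v1(2) v2(2)
  proof eventually_elim
   case (elim n)
   have "(\<integral>\<^sup>+w. ennreal (exp (2 * Re (of_real a * (S n w + R n w)))) \<partial>M)
     \<le> (\<integral>\<^sup>+w. ennreal (exp (4 * a * Re (S n w))) + ennreal (exp (4 * a * Re (R n w))) \<partial>M)"
   proof (intro nn_integral_mono)
    fix w
    define x y where "x = exp (2 * a * Re (S n w))" and "y = exp (2 * a * Re (R n w))"
    have "exp (2 * Re (of_real a * (S n w + R n w))) = x * y" by (simp add: x_def y_def exp_add[symmetric] algebra_simps)
    also have "\<dots> \<le> x^2 + y^2"         proof -
     have "0 \<le> x * y" by (simp add: x_def y_def)
     thus ?thesis using sum_squares_bound[of x y] by linarith
    qed
    also have "\<dots> = exp (4 * a * Re (S n w)) + exp (4 * a * Re (R n w))" by (simp add: x_def y_def exp_double[symmetric] mult.assoc)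
    finally have "ennreal (exp (2 * Re (of_real a * (S n w + R n w)))) \<le> ennreal (exp (4 * a * Re (S n w)) + exp (4 * a * Re (R n w)))" by (rule ennreal_leI)
    thus "ennreal (exp (2 * Re (of_real a * (S n w + R n w)))) \<le> ennreal (exp (4 * a * Re (S n w))) + ennreal (exp (4 * a * Re (R n w)))"
     by simp
   qed
   also have "\<dots> = (\<integral>\<^sup>+w. ennreal (exp (4 * a * Re (S n w))) \<partial>M) + (\<integral>\<^sup>+w. ennreal (exp (4 * a * Re (R n w))) \<partial>M)"
    by (intro nn_integral_add) auto
   also have "\<dots> \<le> ennreal (exp ((4 * a)^2 / 2 * v1)) + ennreal (exp ((4 * a)^2 / 2 * v2))"
    unfolding S_def R_def
    by (rule add_mono[OF W.step_integral_exp_bound[OF \<phi>(2) elim(1) v1(1)] V.step_integral_exp_bound[OF \<psi>(2) elim(2) v2(1)]])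
   also have "\<dots> = ennreal B" by (simp add: B_def)
   finally show ?case .
  qed
 qed
qed

section \<open>Brownian scaling\<close>

lemma (in brownian_motion) scaled_brownian:
 assumes N: "1 \<le> N"
 shows "brownian_motion M (scaled N W)"
proof
 have N0: "0 < real N" using N by simp
 have [measurable]: "W t \<in> borel_measurable M" if "0 \<le> t" for t using measurable_W[OF that] .
 show "random_variable borel (scaled N W t)" if "0 \<le> t" for t
 proof -
  have "W (t * real N) \<in> borel_measurable M" using that by (intro measurable_W) auto
  hence "(\<lambda>w. W (t * real N) w / sqrt (real N)) \<in> borel_measurable M" by measurable
  thus ?thesis by (simp add: scaled_def[abs_def])
 qed
 show "AE w in M. scaled N W 0 w = 0" using start_zero by eventually_elim (simp add: scaled_def)
 show "AE w in M. continuous_on {0..} (\<lambda>t. scaled N W t w)"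
  using continuous_paths
 proof eventually_elim
  case (elim w)
  have "continuous_on {0..} (\<lambda>t. W (t * real N) w)"
   by (rule continuous_on_compose2[OF elim, of _ "\<lambda>t. t * real N"]) (auto intro!: continuous_intros)
  thus ?case unfolding scaled_def using N0 by (intro continuous_intros) auto
 qed
 show "distributed M lborel (\<lambda>w. scaled N W t w - scaled N W s w) (\<lambda>x. ennreal (normal_density 0 (sqrt (t - s)) x))"
  if st: "0 \<le> s" "s < t" for s t
 proof -
  have D: "distributed M lborel (\<lambda>w. W (t * real N) w - W (s * real N) w) (\<lambda>x. ennreal (normal_density 0 (sqrt (t * real N - s * real N)) x))"
   using st N0 by (intro normal_increments) auto
  have "distributed M lborel (\<lambda>w. 0 + (1 / sqrt (real N)) * (W (t * real N) w - W (s * real N) w))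
    (\<lambda>x. ennreal (normal_density (0 + (1 / sqrt (real N)) * 0) (\<bar>1 / sqrt (real N)\<bar> * sqrt (t * real N - s * real N)) x))"
   by (rule normal_density_affine[OF D]) (use st N0 in auto)
  moreover have "\<bar>1 / sqrt (real N)\<bar> * sqrt (t * real N - s * real N) = sqrt (t - s)"
  proof -
   have "\<bar>1 / sqrt (real N)\<bar> * sqrt (t * real N - s * real N) = sqrt ((t * real N - s * real N) / real N)"
    by (simp add: real_sqrt_divide)
   also have "(t * real N - s * real N) / real N = t - s" using N0 by (simp add: field_simps)
   finally show ?thesis .
  qed
  ultimately show ?thesis by (simp add: scaled_def diff_divide_distrib)
 qed
 show "indep_vars (\<lambda>_. borel) (\<lambda>i w. scaled N W (t (Suc i)) w - scaled N W (t i) w) {..<n}"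
  if t: "0 \<le> t 0" "incseq t" for t :: "nat \<Rightarrow> real" and n
 proof -
  have "indep_vars (\<lambda>_. borel) (\<lambda>i w. W (t (Suc i) * real N) w - W (t i * real N) w) {..<n}"
   using indep_increments[of "\<lambda>i. t i * real N" n] t by (auto simp: incseq_def mult_right_mono)
  from indep_vars_compose2[OF this, where Y = "\<lambda>_ y. y / sqrt (real N)" and N = "\<lambda>_. borel"]
  show ?thesis by (simp add: scaled_def diff_divide_distrib)
 qed
qed

lemma (in beta_coupling) scaled_indep:
 assumes \<phi>: "steps_nonneg \<phi>" and \<psi>: "steps_nonneg \<psi>"
 shows "indep_var borel (step_integral (scaled N BX) \<phi>) borel (step_integral (scaled N BY) \<psi>)"
proof -
 let ?P = "Pi\<^sub>M {0..} (\<lambda>_. borel) :: (real \<Rightarrow> real) measure"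
 \<comment> \<open>The step integral is written as a function of the path by letting the path
   \<open>p\<close> itself be the sample point; independence of the two paths then transfers by
   composition.\<close>
 have F: "(\<lambda>p. step_integral (scaled N (\<lambda>t p. p t)) \<phi> p) \<in> borel_measurable ?P" if \<phi>: "steps_nonneg \<phi>" for \<phi>
  using \<phi>
 proof (induction \<phi>)
  case Nil show ?case by (simp add: step_integral_def)
 next
  case (Cons x \<phi>)
  obtain s t c where x: "x = (s, t, c)" by (cases x)
  have [measurable]: "(\<lambda>p. p (s * real N)) \<in> borel_measurable ?P" "(\<lambda>p. p (t * real N)) \<in> borel_measurable ?P"
   using Cons.prems by (auto simp: x intro!: measurable_component_singleton)
  have [measurable]: "(\<lambda>p. step_integral (scaled N (\<lambda>t p. p t)) \<phi> p) \<in> borel_measurable ?P" using Cons by auto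
  have "(\<lambda>p. step_integral (scaled N (\<lambda>t p. p t)) (x # \<phi>) p) =
   (\<lambda>p. c * of_real (p (t * real N) / sqrt (real N) - p (s * real N) / sqrt (real N)) + step_integral (scaled N (\<lambda>t p. p t)) \<phi> p)"
   by (simp add: step_integral_def x scaled_def)
  thus ?case by simp
 qed
 have eq: "step_integral (scaled N (\<lambda>t p. p t)) \<phi> (\<lambda>t\<in>{0..}. B t w) = step_integral (scaled N B) \<phi> w"
  if "steps_nonneg \<phi>" for \<phi> B and w :: 'a
  unfolding step_integral_def
  by (intro arg_cong[where f = sum_list] map_cong refl) (use that in \<open>fastforce simp: scaled_def\<close>)
 show ?thesis
  using indep_var_compose[OF indep_BX_BY F[OF \<phi>] F[OF \<psi>]] by (simp add: o_def eq[OF \<phi>] eq[OF \<psi>])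
qed

section \<open>Comparison with the limiting field\<close>

lemma nn_integral_cells_le:
 fixes h :: "real \<Rightarrow> complex"
 assumes h: "\<And>k u. k < n \<Longrightarrow> d * real k < u \<Longrightarrow> u \<le> d * real (Suc k) \<Longrightarrow> cmod (h u) \<le> c k"
  and d: "0 < d" and c: "\<And>k. k < n \<Longrightarrow> 0 \<le> c k"
 shows "(\<integral>\<^sup>+u. ennreal (cmod (h u)) * indicator {0..d * real n} u \<partial>lborel) \<le> ennreal (d * (\<Sum>k<n. c k))"
proof -
 have "(\<integral>\<^sup>+u. ennreal (cmod (h u)) * indicator {0..d * real n} u \<partial>lborel)
   \<le> (\<integral>\<^sup>+u. (\<Sum>k<n. ennreal (c k) * indicator {d * real k<..d * real (Suc k)} u) \<partial>lborel)"
 proof (intro nn_integral_mono_AE)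
  have "AE u in lborel. u \<noteq> (0 :: real)" by (rule AE_lborel_singleton)
  thus "AE u in lborel. ennreal (cmod (h u)) * indicator {0..d * real n} u
    \<le> (\<Sum>k<n. ennreal (c k) * indicator {d * real k<..d * real (Suc k)} u)"
  proof eventually_elim
   case (elim u)
   show ?case
   proof (cases "u \<in> {0..d * real n}")
    case True
    then obtain k where k: "k < n" "d * real k < u" "u \<le> d * real (Suc k)" using grid_cell[of u d n] elim d by auto
    have i: "indicator {d * real k<..d * real (Suc k)} u = (1 :: ennreal)" by (rule indicator_simps(1)) (use k in simp)
    have "ennreal (cmod (h u)) \<le> ennreal (c k) * indicator {d * real k<..d * real (Suc k)} u"
     unfolding i using h[OF k] by (simp add: ennreal_leI)
    also have "\<dots> \<le> (\<Sum>k<n. ennreal (c k) * indicator {d * real k<..d * real (Suc k)} u)"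
     using k(1) by (intro member_le_sum) auto
    finally show ?thesis using True by simp
   qed simp
  qed
 qed
 also have "\<dots> = (\<Sum>k<n. ennreal (c k) * ennreal d)"
 proof (subst nn_integral_sum)
  have "(\<integral>\<^sup>+u. ennreal (c k) * indicator {d * real k<..d * real (Suc k)} u \<partial>lborel) = ennreal (c k) * ennreal d" for k
   using d by (simp add: nn_integral_cmult_indicator algebra_simps)
  thus "(\<Sum>k<n. \<integral>\<^sup>+u. ennreal (c k) * indicator {d * real k<..d * real (Suc k)} u \<partial>lborel) = (\<Sum>k<n. ennreal (c k) * ennreal d)" by (simp only:)
 qed auto
 also have "\<dots> = ennreal (d * (\<Sum>k<n. c k))"
 proof -
  have "(\<Sum>k<n. ennreal (c k) * ennreal d) = (\<Sum>k<n. ennreal (d * c k))"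
   using c d by (intro sum.cong refl) (simp add: ennreal_mult[symmetric] mult.commute)
  also have "\<dots> = ennreal (\<Sum>k<n. d * c k)" using c d by (intro sum_ennreal) auto
  finally show ?thesis by (simp add: sum_distrib_left)
 qed
 finally show ?thesis .
qed

lemma grid_steps_sq:
 assumes "0 \<le> d"
 shows "(LINT u|lborel. (step_fun (grid_steps d g n) u)^2) = of_real d * (\<Sum>k<n. (g k)^2)"
proof -
 have inc: "incseq (\<lambda>k. d * real k)" using assms by (auto simp: incseq_def intro: mult_left_mono)
 have "step_fun (grid_steps d g n) u = (\<Sum>k<n. g k * indicator {d * real k<..d * real (Suc k)} u)" for u
  by (simp add: step_fun_def grid_steps_def o_def interv_sum_list_conv_sum_set_nat atLeast0LessThan)
 moreover have "steps_nonneg (grid_steps d g n)" using grid_steps_bounds[OF assms order_refl, of g n] by auto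
 ultimately have "(LINT u|lborel. (step_fun (grid_steps d g n) u)^2) = (\<Sum>k<n. (g k)^2 * of_real (d * real (Suc k) - d * real k))"
  by (intro step_fun_sq_integral(2)[OF _ inc])
 also have "\<dots> = of_real d * (\<Sum>k<n. (g k)^2)"
  by (simp add: sum_distrib_left algebra_simps)
 finally show ?thesis .
qed

section \<open>Regularity of the two integrands of the field\<close>

context hyperbolic begin

definition T :: real where "T = real n / real N"
definition gX :: "real \<Rightarrow> complex" where "gX u = 1 / sqrt_branch u z"
definition gY :: "real \<Rightarrow> complex" where "gY u = J_map (z / of_real (sqrt u)) / sqrt_branch u z"
definition D :: "real \<Rightarrow> real" where "D u = P - u * real N"

lemma gap_props: assumes "u \<le> T"
 shows "\<omega> \<le> D u" "0 < D u" "x^2 - u = D u / real N" "u < x^2"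
proof -
 have "u * real N \<le> real n" using assms Npos by (simp add: T_def field_simps)
 thus 1: "\<omega> \<le> D u" using gap by (simp add: D_def P_def x_def)
 thus 2: "0 < D u" using \<omega>1 by linarith
 show 3: "x^2 - u = D u / real N" using Npos by (simp add: D_def P_def field_simps)
 have "0 < D u / real N" using 2 Npos by simp
 thus "u < x^2" unfolding 3[symmetric] by simp
qed

lemma branch_props: assumes "0 \<le> u" "u \<le> T"
 shows "sqrt (D u / real N) \<le> Re (sqrt_branch u z)" "0 \<le> Im (sqrt_branch u z)" "sqrt (D u / real N) \<le> cmod (sqrt_branch u z)" "sqrt_branch u z \<noteq> 0"
  "x / 2 \<le> cmod (lambda_plus u z)" "0 < sqrt (D u / real N)" "sqrt (D u / real N) \<le> x" "lambda_plus u z \<noteq> 0" "z \<noteq> 0"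
proof -
 note g = gap_props[OF assms(2)]
 note * = sqrt_branch_first_quadrant[OF xpos y0 assms(1) g(4)[unfolded x_def], folded x_def, unfolded g(3)]
 show 1: "sqrt (D u / real N) \<le> Re (sqrt_branch u z)" "0 \<le> Im (sqrt_branch u z)" by (fact *)+
 show 2: "sqrt (D u / real N) \<le> cmod (sqrt_branch u z)" using 1(1) complex_Re_le_cmod order_trans by blast
 show 3: "0 < sqrt (D u / real N)" using g(2) Npos by simp
 show 4: "sqrt_branch u z \<noteq> 0" using 2 3 by auto
 show "sqrt (D u / real N) \<le> x" unfolding g(3)[symmetric] using x0 assms(1) by (intro real_le_lsqrt) auto
 have "0 \<le> Re (sqrt_branch u z)" using 1(1) 3 by linarith
 hence "x / 2 \<le> Re (lambda_plus u z)" by (simp add: lambda_plus_def x_def)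
 thus 5: "x / 2 \<le> cmod (lambda_plus u z)" using complex_Re_le_cmod order_trans by blast
 show "lambda_plus u z \<noteq> 0" using 5 x0 by auto
 show "z \<noteq> 0" using xpos by auto
qed

text \<open>\<open>J (z / sqrt u) = (z - S) / sqrt u\<close>, and
  \<open>(z - S) (z + S) = u\<close>. The resulting form has no singularity at \<open>u = 0\<close>,
  where the default \<open>z / 0 = 0\<close> gives \<open>gY 0 = 0\<close> as well.\<close>

lemma gY_eq: assumes "0 \<le> u" "u \<le> T"
 shows "gY u = of_real (sqrt u) / (2 * lambda_plus u z * sqrt_branch u z)"
proof (cases "u = 0")
 case True thus ?thesis by (simp add: gY_def J_map_def sqrt_branch_def)
next
 case False
 note b = branch_props[OF assms]
 have u: "0 < u" using False assms by simp
 have su: "(complex_of_real (sqrt u))^2 = of_real u" using u by (simp flip: of_real_power)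
 have "sqrt_branch 1 (z / of_real (sqrt u)) = sqrt_branch u z / of_real (sqrt u)"
  using u b(9) by (simp add: sqrt_branch_def power_divide su)
 hence J: "J_map (z / of_real (sqrt u)) = (z - sqrt_branch u z) / of_real (sqrt u)" by (simp add: J_map_def diff_divide_distrib)
 have "(z - sqrt_branch u z) * (2 * lambda_plus u z) = of_real (sqrt u) * of_real (sqrt u)"
 proof -
  have "(z - sqrt_branch u z) * (2 * lambda_plus u z) = z^2 - (sqrt_branch u z)\<^sup>2"
  proof -
   have "2 * lambda_plus u z = z + sqrt_branch u z" by (simp add: lambda_plus_def)
   thus ?thesis by (simp add: power2_eq_square algebra_simps)
  qed
  thus ?thesis using sqrt_branch_squared[OF b(9), of u] su by (simp add: power2_eq_square)
 qed
 hence "(z - sqrt_branch u z) / of_real (sqrt u) = of_real (sqrt u) / (2 * lambda_plus u z)"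
  using u b(8) by (simp add: field_simps)
 thus ?thesis unfolding gY_def J by simp
qed

lemma sqrt_le_x: assumes "0 \<le> u" "u \<le> T" shows "sqrt u \<le> x"
 using gap_props(4)[OF assms(2)] x0 by (intro real_le_lsqrt) (auto simp: assms(1))

lemma g_le: assumes "0 \<le> u" "u \<le> T"
 shows "cmod (gX u) \<le> sqrt (real N) / sqrt (D u)" "cmod (gY u) \<le> sqrt (real N) / sqrt (D u)"
proof -
 note b = branch_props[OF assms] and g = gap_props[OF assms(2)]
 have q: "1 / sqrt (D u / real N) = sqrt (real N) / sqrt (D u)" by (simp add: real_sqrt_divide)
 show "cmod (gX u) \<le> sqrt (real N) / sqrt (D u)"
  unfolding gX_def norm_divide q[symmetric] using b(3,6) by (simp add: frac_le)
 have "cmod (gY u) = sqrt u / (2 * cmod (lambda_plus u z) * cmod (sqrt_branch u z))"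
  unfolding gY_eq[OF assms] using assms(1) by (simp add: norm_divide norm_mult)
 also have "\<dots> \<le> x / (2 * (x / 2) * sqrt (D u / real N))"
  using b sqrt_le_x[OF assms] x0 assms(1) by (intro frac_le mult_mono mult_pos_pos mult_nonneg_nonneg) auto
 also have "\<dots> = 1 / sqrt (D u / real N)" using x0 by simp
 finally show "cmod (gY u) \<le> sqrt (real N) / sqrt (D u)" unfolding q .
qed

lemma branch_diff: assumes "0 \<le> v" "v \<le> u" "u \<le> T" "u - v \<le> 1 / real N"
 shows "cmod (sqrt_branch u z - sqrt_branch v z) \<le> 1 / (real N * (2 * sqrt (D u / real N)))"
proof -
 have u: "0 \<le> u" and v: "v \<le> T" using assms by auto
 note bu = branch_props[OF u assms(3)] and bv = branch_props[OF assms(1) v]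
 define q where "q = sqrt (D u / real N)"
 have q0: "0 < q" using bu(6) by (simp add: q_def)
 have "D u \<le> D v" using assms Npos by (simp add: D_def)
 hence qv: "q \<le> sqrt (D v / real N)" using Npos unfolding q_def by (intro real_sqrt_le_mono divide_right_mono) auto
 have "2 * q \<le> Re (sqrt_branch u z + sqrt_branch v z)" using bu(1)[folded q_def] bv(1) qv unfolding plus_complex.sel by linarith
 hence s: "2 * q \<le> cmod (sqrt_branch u z + sqrt_branch v z)" using complex_Re_le_cmod order_trans by blast
 have "(sqrt_branch u z - sqrt_branch v z) * (sqrt_branch u z + sqrt_branch v z) = of_real (v - u)"
  using sqrt_branch_squared[OF bu(9), of u] sqrt_branch_squared[OF bu(9), of v] by (simp add: algebra_simps power2_eq_square)
 hence "cmod (sqrt_branch u z - sqrt_branch v z) * cmod (sqrt_branch u z + sqrt_branch v z) = u - v"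
  unfolding norm_mult[symmetric] using assms by (simp only: norm_of_real)
 moreover have "cmod (sqrt_branch u z - sqrt_branch v z) * (2 * q) \<le> cmod (sqrt_branch u z - sqrt_branch v z) * cmod (sqrt_branch u z + sqrt_branch v z)"
  using s by (intro mult_left_mono) auto
 ultimately have "cmod (sqrt_branch u z - sqrt_branch v z) * (2 * q) \<le> 1 / real N" using assms by linarith
 thus ?thesis using q0 Npos unfolding q_def[symmetric] by (simp add: field_simps)
qed

text \<open>The factor \<open>sqrt u\<close> of \<open>gY\<close> is not Lipschitz at 0. Its
  increment is therefore kept as a separate term, which telescopes when the increments are summed in
  \<open>gY_variation\<close>.\<close>

lemma g_diff: assumes "0 \<le> v" "v \<le> u" "u \<le> T" "u - v \<le> 1 / real N"
 shows "cmod (gX u - gX v) \<le> sqrt (real N) / (D u * sqrt (D u))"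
  "cmod (gY u - gY v) \<le> sqrt (real N) / sqrt (D u) * ((sqrt u - sqrt v) / x) + sqrt (real N) / (D u * sqrt (D u))"
proof -
 have u: "0 \<le> u" and v: "v \<le> T" using assms by auto
 note bu = branch_props[OF u assms(3)] and bv = branch_props[OF assms(1) v]
 define q where "q = sqrt (D u / real N)"
 define A B l k where "A = sqrt_branch u z" and "B = sqrt_branch v z" and "l = lambda_plus u z" and "k = lambda_plus v z"
 have q0: "0 < q" using bu(6) by (simp add: q_def)
 have "D u \<le> D v" using assms Npos by (simp add: D_def)
 hence qv: "q \<le> sqrt (D v / real N)" using Npos unfolding q_def by (intro real_sqrt_le_mono divide_right_mono) auto
 have AB: "q \<le> cmod A" "q \<le> cmod B" "A \<noteq> 0" "B \<noteq> 0"
  using bu(3)[folded q_def] bu(4) order_trans[OF qv bv(3)] bv(4) unfolding A_def B_def by blast+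
 have lk: "x / 2 \<le> cmod l" "x / 2 \<le> cmod k" "l \<noteq> 0" "k \<noteq> 0" using bu bv by (auto simp: l_def k_def)
 have dAB: "cmod (A - B) \<le> 1 / (real N * (2 * q))" using branch_diff[OF assms] by (simp add: A_def B_def q_def)
 have qq: "1 / (real N * q) / (q * q) = sqrt (real N) / (D u * sqrt (D u))"
 proof -
  define a d where "a = sqrt (real N)" and "d = sqrt (D u)"
  have ad: "0 < a" "0 < d" using Npos gap_props(2)[OF assms(3)] by (auto simp: a_def d_def)
  have N: "real N = a * a" and D: "D u = d * d" using Npos gap_props(2)[OF assms(3)] by (auto simp: a_def d_def)
  have "q = d / a" by (simp add: q_def a_def d_def real_sqrt_divide)
  moreover have "1 / (a * a * (d / a)) / ((d / a) * (d / a)) = a / (d * d * d)" using ad by (simp add: field_simps)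
  ultimately have "1 / (a * a * q) / (q * q) = a / (d * d * d)" by (simp only:)
  thus ?thesis unfolding a_def[symmetric] d_def[symmetric] unfolding N D .
 qed
 have x: "0 < x" by (rule x0)
 have "cmod (gX u - gX v) = cmod (A - B) / (cmod A * cmod B)"
  unfolding gX_def A_def[symmetric] B_def[symmetric] using AB by (simp add: norm_divide[symmetric] norm_mult[symmetric] norm_minus_commute[of A] diff_divide_distrib)
 also have "\<dots> \<le> 1 / (real N * (2 * q)) / (q * q)" using dAB AB q0 Npos by (intro frac_le mult_mono mult_pos_pos) auto
 also have "\<dots> \<le> 1 / (real N * q) / (q * q)" using q0 Npos by (intro divide_right_mono divide_left_mono) auto
 finally show "cmod (gX u - gX v) \<le> sqrt (real N) / (D u * sqrt (D u))" unfolding qq .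
 define h g where "h = 1 / (2 * l * A)" and "g = 1 / (2 * k * B)"
 have g: "cmod g \<le> 1 / (x * q)"
 proof -
  have "cmod g = 1 / (2 * cmod k * cmod B)" by (simp add: g_def norm_divide norm_mult)
  also have "\<dots> \<le> 1 / (2 * (x / 2) * q)" using lk AB q0 x by (intro divide_left_mono mult_mono mult_pos_pos) auto
  finally show ?thesis by simp
 qed
 have hg: "cmod (h - g) \<le> 1 / (real N * q) / (q * q) / x"
 proof -
  have lk2: "l = k + (A - B) / 2" unfolding l_def k_def A_def B_def lambda_plus_def by (simp add: field_simps)
  have "h - g = - (A - B) * (1 / (4 * l * k * B) + 1 / (2 * l * A * B))"
  proof -
   have "h - g = (k * B - l * A) / (2 * l * A * k * B)" unfolding h_def g_def using lk AB by (simp add: field_simps)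
   also have "k * B - l * A = - (A - B) * (A / 2 + k)" by (subst lk2) (simp add: field_simps)
   also have "- (A - B) * (A / 2 + k) / (2 * l * A * k * B) = - (A - B) * (1 / (4 * l * k * B) + 1 / (2 * l * A * B))"
    using lk AB by (simp add: field_simps)
   finally show ?thesis .
  qed
  hence "cmod (h - g) = cmod (A - B) * cmod (1 / (4 * l * k * B) + 1 / (2 * l * A * B))" by (simp add: norm_mult norm_minus_commute)
  also have "\<dots> \<le> 1 / (real N * (2 * q)) * (1 / (4 * (x / 2) * (q / 2) * q) + 1 / (2 * (x / 2) * q * q))"
  proof (intro mult_mono dAB)
   have kq: "q / 2 \<le> cmod k" using lk(2) bu(7) by (simp add: q_def)
   have "cmod (1 / (4 * l * k * B) + 1 / (2 * l * A * B)) \<le> 1 / (4 * cmod l * cmod k * cmod B) + 1 / (2 * cmod l * cmod A * cmod B)"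
    by (rule order_trans[OF norm_triangle_ineq]) (simp add: norm_divide norm_mult)
   also have "\<dots> \<le> 1 / (4 * (x / 2) * (q / 2) * q) + 1 / (2 * (x / 2) * q * q)"
    using lk AB q0 x kq by (intro add_mono divide_left_mono mult_mono mult_pos_pos mult_nonneg_nonneg) auto
   finally show "cmod (1 / (4 * l * k * B) + 1 / (2 * l * A * B)) \<le> 1 / (4 * (x / 2) * (q / 2) * q) + 1 / (2 * (x / 2) * q * q)" .
  qed (use q0 Npos in auto)
  also have "\<dots> = 1 / (real N * q) / (q * q) / x" using q0 x Npos by (simp add: field_simps)
  finally show ?thesis .
 qed
 have suv: "sqrt v \<le> sqrt u" using assms by simp
 have "gY u - gY v = of_real (sqrt u - sqrt v) * g + of_real (sqrt u) * (h - g)"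
 proof -
  have "gY u = of_real (sqrt u) * h" "gY v = of_real (sqrt v) * g"
   unfolding gY_eq[OF u assms(3)] gY_eq[OF assms(1) v] h_def g_def A_def B_def l_def k_def by simp_all
  thus ?thesis by (simp add: algebra_simps)
 qed
 hence "cmod (gY u - gY v) \<le> (sqrt u - sqrt v) * cmod g + sqrt u * cmod (h - g)"
  using norm_triangle_ineq[of "of_real (sqrt u - sqrt v) * g" "of_real (sqrt u) * (h - g)"] suv u by (simp add: norm_mult del: of_real_diff)
 also have "\<dots> \<le> (sqrt u - sqrt v) * (1 / (x * q)) + x * (1 / (real N * q) / (q * q) / x)"
  using suv g hg sqrt_le_x[OF u assms(3)] u x by (intro add_mono mult_mono) auto
 also have "x * (1 / (real N * q) / (q * q) / x) = sqrt (real N) / (D u * sqrt (D u))" using x unfolding qq by simp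
 also have "(sqrt u - sqrt v) * (1 / (x * q)) = sqrt (real N) / sqrt (D u) * ((sqrt u - sqrt v) / x)"
  using x by (simp add: q_def real_sqrt_divide mult_ac)
 finally show "cmod (gY u - gY v) \<le> sqrt (real N) / sqrt (D u) * ((sqrt u - sqrt v) / x) + sqrt (real N) / (D u * sqrt (D u))" .
qed

text \<open>A cruder form for single cells: \<open>sqrt u - sqrt v \<le> sqrt (u - v)\<close>
  replaces the increment of the square root by \<open>1 / sqrt N\<close>. It loses half a power of
  \<open>D\<close> but suffices for the mean square error.\<close>

lemma g_diff_le: assumes "0 \<le> v" "v \<le> u" "u \<le> T" "u - v \<le> 1 / real N"
 shows "cmod (gX u - gX v) \<le> 2 * sqrt (real N) / D u" "cmod (gY u - gY v) \<le> 2 * sqrt (real N) / D u"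
proof -
 note g = gap_props[OF assms(3)]
 have D1: "1 \<le> sqrt (D u)" using g \<omega>1 by simp
 have a: "sqrt (real N) / (D u * sqrt (D u)) \<le> sqrt (real N) / D u"
  using g D1 Npos by (intro divide_left_mono) (auto simp: mult_le_cancel_left1)
 have nn: "0 \<le> sqrt (real N) / D u" using g by simp
 show "cmod (gX u - gX v) \<le> 2 * sqrt (real N) / D u" using g_diff(1)[OF assms] a nn by simp
 have "sqrt u \<le> sqrt v + sqrt (u - v)" using sqrt_add_le_add_sqrt[of v "u - v"] assms by simp
 also have "sqrt (u - v) \<le> sqrt (1 / real N)" using assms by simp
 finally have "(sqrt u - sqrt v) / x \<le> sqrt (1 / real N) / x" using x0 by (intro divide_right_mono) auto
 also have "\<dots> = 1 / sqrt P" using x0 by (simp add: P_def real_sqrt_mult real_sqrt_divide)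
 also have "\<dots> \<le> 1 / sqrt (D u)" using g assms Npos Ppos by (intro divide_left_mono mult_pos_pos) (auto simp: D_def)
 finally have "sqrt (real N) / sqrt (D u) * ((sqrt u - sqrt v) / x) \<le> sqrt (real N) / sqrt (D u) * (1 / sqrt (D u))"
  using g by (intro mult_left_mono) auto
 also have "\<dots> = sqrt (real N) / D u" using g by simp
 finally show "cmod (gY u - gY v) \<le> 2 * sqrt (real N) / D u" using g_diff(2)[OF assms] a by simp
qed

lemma g_continuous: "continuous_on {0..T} gX" "continuous_on {0..T} gY"
proof -
 have np: "1 - of_real u / z^2 \<notin> \<real>\<^sub>\<le>\<^sub>0" if "u \<in> {0..T}" for u
 proof (rule cut_nonpos_Reals(2))
  have "sqrt u < x" using gap_props(4)[of u] that x0 by (intro real_less_lsqrt) auto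
  thus "z \<notin> cut u" by (auto simp: cut_def x_def)
 qed (use that in simp)
 have c: "continuous_on {0..T} (\<lambda>u. sqrt_branch u z)"
  unfolding sqrt_branch_def using xpos
  by (intro continuous_on_mult_left continuous_on_compose2[OF continuous_on_csqrt] continuous_intros) (use np in auto)
 show "continuous_on {0..T} gX"
  unfolding gX_def[abs_def] by (intro continuous_intros c) (use branch_props in auto)
 have "continuous_on {0..T} (\<lambda>u. of_real (sqrt u) / (2 * lambda_plus u z * sqrt_branch u z))"
 proof -
  have "continuous_on {0..T} (\<lambda>u. lambda_plus u z)" unfolding lambda_plus_def by (intro continuous_intros c) auto
  thus ?thesis using branch_props(4,8) by (intro continuous_intros c) auto
 qed
 thus "continuous_on {0..T} gY" by (rule continuous_on_eq) (simp add: gY_eq)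
qed

abbreviation xi :: "nat \<Rightarrow> real" where "xi k \<equiv> 1 / (\<Delta> (Suc k) * sqrt (\<Delta> (Suc k)))"

lemma sum_\<Delta>_Suc: "(\<Sum>k<n. xi k) \<le> 3 / sqrt \<omega>"
proof -
 define h where "h k = 1 / (\<Delta> k * sqrt (\<Delta> k))" for k
 have 1: "(\<Sum>k<n. h (Suc k)) = (\<Sum>k<n. h k) + h n - h 0"
  using sum.lessThan_Suc_shift[of h n] by simp
 have 2: "(\<Sum>k<n. h k) \<le> 2 / sqrt \<omega>"
  unfolding h_def \<Delta>_def using \<omega>1 gap by (intro sum_power_three_halves) (auto simp: P_def x_def)
 have 3: "h n \<le> 1 / sqrt \<omega>"
  unfolding h_def using \<Delta>_ge[of n] \<Delta>_pos[of n] \<omega>1 mult_mono[of 1 "\<Delta> n" "sqrt \<omega>" "sqrt (\<Delta> n)"] by (intro divide_left_mono) auto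
 have 4: "0 \<le> h 0" unfolding h_def using \<Delta>_pos[of 0] by simp
 have "2 / sqrt \<omega> + 1 / sqrt \<omega> = 3 / sqrt \<omega>" by (simp add: add_divide_distrib[symmetric])
 hence "(\<Sum>k<n. h (Suc k)) \<le> 3 / sqrt \<omega>" using 1 2 3 4 by linarith
 thus ?thesis by (simp add: h_def)
qed

lemma grid_pt: assumes "k \<le> n" shows "0 \<le> real k / real N" "real k / real N \<le> T" "D (real k / real N) = \<Delta> k"
 using assms Npos by (auto simp: T_def D_def \<Delta>_def divide_right_mono)

definition grid :: "(real \<Rightarrow> complex) \<Rightarrow> (real \<times> real \<times> complex) list" where
 "grid g = grid_steps (1 / real N) (\<lambda>k. g (real k / real N)) n"

lemma grid_bounds: "steps_within T (grid g)"
 unfolding grid_def by (intro grid_steps_bounds) (auto simp: T_def)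

context
 fixes g :: "real \<Rightarrow> complex"
 assumes gd: "\<And>u v. 0 \<le> v \<Longrightarrow> v \<le> u \<Longrightarrow> u \<le> T \<Longrightarrow> u - v \<le> 1 / real N \<Longrightarrow> cmod (g u - g v) \<le> 2 * sqrt (real N) / D u"
  and gb: "\<And>u. 0 \<le> u \<Longrightarrow> u \<le> T \<Longrightarrow> cmod (g u) \<le> sqrt (real N) / sqrt (D u)"
  and gc: "continuous_on {0..T} g"
begin

lemma cell_error: assumes "k < n" "1 / real N * real k < u" "u \<le> 1 / real N * real (Suc k)"
 shows "cmod (g u - step_fun (grid g) u) \<le> 2 * sqrt (real N) / \<Delta> (Suc k)"
  "cmod (g u + step_fun (grid g) u) \<le> 2 * (sqrt (real N) / sqrt (\<Delta> (Suc k)))"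
proof -
 note k1 = grid_pt[of k] and k2 = grid_pt[of "Suc k"]
 have u: "real k / real N \<le> u" "u \<le> real (Suc k) / real N" "u \<le> T" "u - real k / real N \<le> 1 / real N" "0 \<le> u"
 proof -
  have "real k / real N < u" "u \<le> real k / real N + 1 / real N" "real (Suc k) / real N = real k / real N + 1 / real N"
   using assms by (auto simp: add_divide_distrib distrib_left)
  moreover have "0 \<le> real k / real N" "real (Suc k) / real N \<le> T" using k1 k2 assms(1) by auto
  ultimately show "real k / real N \<le> u" "u \<le> real (Suc k) / real N" "u \<le> T" "u - real k / real N \<le> 1 / real N" "0 \<le> u"
   by linarith+
 qed
 have s: "step_fun (grid g) u = g (real k / real N)" unfolding grid_def using Npos by (intro grid_steps_eq assms) auto
 have "u * real N \<le> real (Suc k)" using u(2) Npos by (simp add: field_simps)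
 hence D: "\<Delta> (Suc k) \<le> D u" "0 < \<Delta> (Suc k)" "\<Delta> (Suc k) \<le> \<Delta> k" using \<Delta>_pos[of "Suc k"] assms(1) by (auto simp: D_def \<Delta>_def)
 have "cmod (g u - step_fun (grid g) u) \<le> 2 * sqrt (real N) / D u" unfolding s using gd[of "real k / real N" u] u k1 assms by auto
 also have "\<dots> \<le> 2 * sqrt (real N) / \<Delta> (Suc k)" using D by (intro divide_left_mono) auto
 finally show "cmod (g u - step_fun (grid g) u) \<le> 2 * sqrt (real N) / \<Delta> (Suc k)" .
 have "cmod (g u) \<le> sqrt (real N) / sqrt (\<Delta> (Suc k))"
  using gb[of u] u D by (intro order_trans[OF gb]) (auto intro!: divide_left_mono mult_pos_pos)
 moreover have "cmod (g (real k / real N)) \<le> sqrt (real N) / sqrt (\<Delta> (Suc k))"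
  using gb[of "real k / real N"] k1 assms D by (intro order_trans[OF gb]) (auto intro!: divide_left_mono mult_pos_pos)
 ultimately show "cmod (g u + step_fun (grid g) u) \<le> 2 * (sqrt (real N) / sqrt (\<Delta> (Suc k)))"
  unfolding s by (intro order_trans[OF norm_triangle_ineq]) simp
qed

text \<open>The cells contribute \<open>4 \<Delta>^(-2)\<close>, which is at most
  \<open>4 \<omega>^(-1/2) \<Delta>^(-3/2)\<close>; summing by \<open>sum_\<Delta>_Suc\<close> gives
  4 times 3. The discretization error of the stochastic integral is thus of order
  \<open>\<omega>^(-1/2)\<close>.\<close>

lemma nsq_grid: "nsq T (\<lambda>u. g u - step_fun (grid g) u) \<le> ennreal (12 / \<omega>)"
proof -
 have T: "T = 1 / real N * real n" by (simp add: T_def)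
 have "nsq T (\<lambda>u. g u - step_fun (grid g) u) = (\<integral>\<^sup>+u. ennreal (cmod ((g u - step_fun (grid g) u)^2)) * indicator {0..1 / real N * real n} u \<partial>lborel)"
  by (simp add: nsq_def norm_power T_def)
 also have "\<dots> \<le> ennreal (1 / real N * (\<Sum>k<n. (2 * sqrt (real N) / \<Delta> (Suc k))^2))"
  unfolding norm_power using Npos by (intro nn_integral_cells_le[where h = "\<lambda>u. (g u - step_fun (grid g) u)^2", unfolded norm_power] power_mono cell_error(1)) auto
 also have "1 / real N * (\<Sum>k<n. (2 * sqrt (real N) / \<Delta> (Suc k))^2) = 4 * (\<Sum>k<n. 1 / (\<Delta> (Suc k))^2)"
  using Npos by (simp add: power_divide power_mult_distrib sum_distrib_left)
 also have "(\<Sum>k<n. 1 / (\<Delta> (Suc k))^2) \<le> (\<Sum>k<n. 1 / sqrt \<omega> * xi k)"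
 proof (intro sum_mono)
  fix k assume "k \<in> {..<n}"
  hence k: "\<omega> \<le> \<Delta> (Suc k)" "0 < \<Delta> (Suc k)" using \<Delta>_ge \<Delta>_pos by auto
  have "sqrt \<omega> * (\<Delta> (Suc k) * sqrt (\<Delta> (Suc k))) \<le> sqrt (\<Delta> (Suc k)) * (\<Delta> (Suc k) * sqrt (\<Delta> (Suc k)))"
   using k by (intro mult_right_mono) auto
  also have "\<dots> = (\<Delta> (Suc k))^2" using k by (simp add: power2_eq_square)
  finally have "1 / (\<Delta> (Suc k))^2 \<le> 1 / (sqrt \<omega> * (\<Delta> (Suc k) * sqrt (\<Delta> (Suc k))))"
   using k \<omega>1 by (intro divide_left_mono) auto
  thus "1 / (\<Delta> (Suc k))^2 \<le> 1 / sqrt \<omega> * xi k" by simp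
 qed
 also have "\<dots> \<le> 1 / sqrt \<omega> * (3 / sqrt \<omega>)"
  unfolding sum_distrib_left[symmetric] using sum_\<Delta>_Suc \<omega>1 by (intro mult_left_mono) auto
 also have "4 * (1 / sqrt \<omega> * (3 / sqrt \<omega>)) = 12 / \<omega>" using \<omega>1 by simp
 finally show ?thesis by (simp add: ennreal_leI)
qed

text \<open>The difference of squares is split into difference times sum, giving
  \<open>4 N \<Delta>^(-3/2)\<close> on a cell of length \<open>1 / N\<close>. This compares the two
  normalizations, the mean of the exponential of the field and the factor from
  \<open>dd\<close>.\<close>

lemma square_integral_grid:
 "cmod ((LINT u:{0..T}|lborel. (g u)^2) - of_real (1 / real N) * (\<Sum>k<n. (g (real k / real N))^2)) \<le> 12 / sqrt \<omega>"
proof -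
 have T: "T = 1 / real N * real n" by (simp add: T_def)
 have ig: "integrable lborel (\<lambda>u. indicator {0..T} u *\<^sub>R (g u)^2)"
  using gc by (intro borel_integrable_compact continuous_intros) auto
 have ist: "integrable lborel (\<lambda>u. (step_fun (grid g) u)^2)"
 proof (rule Bochner_Integration.integrable_bound[OF nsq_step(1)[OF grid_bounds[of g]]])
  have [measurable]: "step_fun (grid g) \<in> borel_measurable borel" by (rule step_fun_meas)
  show "(\<lambda>u. (step_fun (grid g) u)^2) \<in> borel_measurable lborel" by measurable
 qed (simp add: norm_power)
 have sq: "(LINT u|lborel. (step_fun (grid g) u)^2) = of_real (1 / real N) * (\<Sum>k<n. (g (real k / real N))^2)"
  unfolding grid_def by (rule grid_steps_sq) simp
 have "ennreal (cmod ((LINT u:{0..T}|lborel. (g u)^2) - (LINT u|lborel. (step_fun (grid g) u)^2)))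
   = ennreal (cmod (LINT u|lborel. indicator {0..T} u *\<^sub>R (g u)^2 - (step_fun (grid g) u)\<^sup>2))"
  unfolding set_lebesgue_integral_def using ig ist by simp
 also have "\<dots> \<le> (\<integral>\<^sup>+u. ennreal (cmod (indicator {0..T} u *\<^sub>R (g u)^2 - (step_fun (grid g) u)\<^sup>2)) \<partial>lborel)"
  using ig ist by (intro integral_norm_bound_ennreal) auto
 also have "\<dots> = (\<integral>\<^sup>+u. ennreal (cmod ((g u)^2 - (step_fun (grid g) u)\<^sup>2)) * indicator {0..1 / real N * real n} u \<partial>lborel)"
 proof (intro nn_integral_cong)
  fix u show "ennreal (cmod (indicator {0..T} u *\<^sub>R (g u)^2 - (step_fun (grid g) u)\<^sup>2)) = ennreal (cmod ((g u)^2 - (step_fun (grid g) u)\<^sup>2)) * indicator {0..1 / real N * real n} u"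
   unfolding T[symmetric] using nsq_step(3)[OF grid_bounds[of g], of u] by (cases "u \<in> {0..T}") auto
 qed
 also have "\<dots> \<le> ennreal (1 / real N * (\<Sum>k<n. 4 * real N * xi k))"
 proof (intro nn_integral_cells_le)
  fix k u assume k: "k < n" "1 / real N * real k < u" "u \<le> 1 / real N * real (Suc k)"
  have D: "0 < \<Delta> (Suc k)" using k \<Delta>_pos[of "Suc k"] by simp
  have "(g u)^2 - (step_fun (grid g) u)\<^sup>2 = (g u - step_fun (grid g) u) * (g u + step_fun (grid g) u)"
   by (simp add: power2_eq_square algebra_simps)
  hence "cmod ((g u)^2 - (step_fun (grid g) u)\<^sup>2) \<le> 2 * sqrt (real N) / \<Delta> (Suc k) * (2 * (sqrt (real N) / sqrt (\<Delta> (Suc k))))"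
   unfolding norm_mult[symmetric] using cell_error[OF k] D by (simp only: norm_mult) (intro mult_mono, auto)
  also have "\<dots> = 4 * real N * xi k" by simp
  finally show "cmod ((g u)^2 - (step_fun (grid g) u)\<^sup>2) \<le> 4 * real N * xi k" .
 next
  fix k assume "k < n"
  thus "0 \<le> 4 * real N * xi k" using \<Delta>_pos[of "Suc k"] by simp
 qed (use Npos in simp)
 also have "1 / real N * (\<Sum>k<n. 4 * real N * xi k) = 4 * (\<Sum>k<n. xi k)"
  unfolding sum_distrib_left[symmetric] using Npos by simp
 also have "ennreal \<dots> \<le> ennreal (4 * (3 / sqrt \<omega>))" using sum_\<Delta>_Suc by (intro ennreal_leI mult_left_mono) auto
 finally show ?thesis unfolding sq using \<omega>1 by (simp add: ennreal_le_iff)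
qed

end

text \<open>The part from the square root telescopes to \<open>sqrt T / x \<le> 1\<close>, and the
  remaining part is the sum with constant 3.\<close>

lemma gY_variation: "(\<Sum>k<n. cmod (gY (real (Suc k) / real N) - gY (real k / real N))) \<le> 4 * sqrt (real N) / sqrt \<omega>"
proof -
 have "(\<Sum>k<n. cmod (gY (real (Suc k) / real N) - gY (real k / real N)))
   \<le> (\<Sum>k<n. sqrt (real N) / sqrt \<omega> * ((sqrt (real (Suc k) / real N) - sqrt (real k / real N)) / x) + sqrt (real N) * xi k)"
 proof (intro sum_mono)
  fix k assume "k \<in> {..<n}"
  hence k: "Suc k \<le> n" "k \<le> n" by auto
  note k1 = grid_pt[OF k(2)] and k2 = grid_pt[OF k(1)]
  have D: "\<omega> \<le> \<Delta> (Suc k)" using \<Delta>_ge k by simp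
  have le: "real k / real N \<le> real (Suc k) / real N" by (simp add: divide_right_mono)
  have "cmod (gY (real (Suc k) / real N) - gY (real k / real N)) \<le>
   sqrt (real N) / sqrt (\<Delta> (Suc k)) * ((sqrt (real (Suc k) / real N) - sqrt (real k / real N)) / x) + sqrt (real N) * xi k"
   using g_diff(2)[OF k1(1) le k2(2)] unfolding k2(3) by (simp add: add_divide_distrib)
  also have "\<dots> \<le> sqrt (real N) / sqrt \<omega> * ((sqrt (real (Suc k) / real N) - sqrt (real k / real N)) / x) + sqrt (real N) * xi k"
   using D \<omega>1 le x0 by (intro add_right_mono mult_right_mono divide_left_mono) auto
  finally show "cmod (gY (real (Suc k) / real N) - gY (real k / real N)) \<le> \<dots>" .
 qed
 also have "\<dots> = sqrt (real N) / sqrt \<omega> * ((\<Sum>k<n. sqrt (real (Suc k) / real N) - sqrt (real k / real N)) / x) + sqrt (real N) * (\<Sum>k<n. xi k)"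
  by (simp add: sum.distrib sum_distrib_left sum_divide_distrib)
 also have "(\<Sum>k<n. sqrt (real (Suc k) / real N) - sqrt (real k / real N)) = sqrt (real n / real N) - sqrt (real 0 / real N)"
  by (rule sum_lessThan_telescope)
 also have "sqrt (real N) / sqrt \<omega> * ((sqrt (real n / real N) - sqrt (real 0 / real N)) / x) + sqrt (real N) * (\<Sum>k<n. xi k)
   \<le> sqrt (real N) / sqrt \<omega> * 1 + sqrt (real N) * (3 / sqrt \<omega>)"
  using sqrt_le_x[of T] x0 \<omega>1 by (intro add_mono mult_left_mono sum_\<Delta>_Suc) (auto simp: T_def)
 finally show ?thesis using \<omega>1 by (simp add: add_divide_distrib[symmetric])
qed

end

lemma wiener_cong:
 assumes "is_wiener_integral M W T f I" "\<And>u. u \<in> {0..T} \<Longrightarrow> f u = f' u"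
 shows "is_wiener_integral M W T f' I"
proof -
 have "(\<integral>\<^sup>+u. ennreal ((cmod (step_fun \<phi> u - f u))^2) * indicator {0..T} u \<partial>lborel)
   = (\<integral>\<^sup>+u. ennreal ((cmod (step_fun \<phi> u - f' u))^2) * indicator {0..T} u \<partial>lborel)" for \<phi>
  by (intro nn_integral_cong) (auto simp: assms(2) indicator_def)
 thus ?thesis using assms(1) unfolding is_wiener_integral_def by simp
qed

text \<open>The factor 2 gives strict inequality, so that an admissible \<open>t\<close> below the
  bound exists even if the infimum is not attained; \<open>max C 1\<close> keeps the bound positive
  for every real \<open>C\<close>.\<close>

lemma (in beta_coupling) max_error_tail:
 assumes n: "2 \<le> n"
 shows "max_error \<beta> a BY n \<in> borel_measurable M"
  "0 \<le> y \<Longrightarrow> prob {w \<in> space M. y \<le> max_error \<beta> a BY n w} \<le> 2 * exp (- y / (2 * max C 1 * ln (real n)))"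
proof -
 have [measurable]: "BY (real k) \<in> borel_measurable M" for k using brownian_motion.measurable_W[OF BY_brownian, of "real k"] by simp
 have [measurable]: "Y_var \<beta> a k \<in> borel_measurable M" for k by (rule XY_meas)
 have "(\<lambda>w. Max ((\<lambda>k. \<bar>(\<Sum>j=1..k. Y_var \<beta> a j w) - BY (real k) w\<bar>) ` {1..n})) \<in> borel_measurable M"
  using n by (intro borel_measurable_Max) auto
 thus m[measurable]: "max_error \<beta> a BY n \<in> borel_measurable M" by (simp add: max_error_def[abs_def])
 assume y: "0 \<le> y"
 define B where "B = 2 * max C 1 * ln (real n)"
 have ln: "0 < ln (real n)" using n by simp
 have "C * ln (real n) \<le> max C 1 * ln (real n)" using ln by (intro mult_right_mono) auto
 moreover have "0 < max C 1 * ln (real n)" using ln by simp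
 ultimately have "ennreal (C * ln (real n)) < ennreal B" unfolding B_def by (intro ennreal_lessI) auto
 hence "Inf {ennreal t | t. 0 < t \<and> (\<integral>\<^sup>+w. ennreal (exp (\<bar>max_error \<beta> a BY n w\<bar> / t)) \<partial>M) \<le> 2} < ennreal B"
  using Y_embedding[OF n] unfolding psi1_norm_def by (rule le_less_trans[rotated])
 then obtain t where t: "0 < t" "(\<integral>\<^sup>+w. ennreal (exp (\<bar>max_error \<beta> a BY n w\<bar> / t)) \<partial>M) \<le> 2" "ennreal t < ennreal B"
  unfolding Inf_less_iff by auto
 hence tB: "t < B" by (metis ennreal_leI linorder_not_less)
 have "emeasure M {w \<in> space M. y \<le> max_error \<beta> a BY n w} \<le> emeasure M {w \<in> space M. 1 \<le> ennreal (exp (- y / t)) * ennreal (exp (\<bar>max_error \<beta> a BY n w\<bar> / t))}"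
 proof (intro emeasure_mono)
  show "{w \<in> space M. y \<le> max_error \<beta> a BY n w} \<subseteq> {w \<in> space M. 1 \<le> ennreal (exp (- y / t)) * ennreal (exp (\<bar>max_error \<beta> a BY n w\<bar> / t))}"
  proof safe
   fix w assume "y \<le> max_error \<beta> a BY n w"
   hence "y / t \<le> \<bar>max_error \<beta> a BY n w\<bar> / t" using t(1) by (intro divide_right_mono) auto
   thus "1 \<le> ennreal (exp (- y / t)) * ennreal (exp (\<bar>max_error \<beta> a BY n w\<bar> / t))"
    by (simp add: ennreal_mult[symmetric] exp_add[symmetric])
  qed
 qed measurable
 also have "\<dots> \<le> ennreal (exp (- y / t)) * (\<integral>\<^sup>+w. ennreal (exp (\<bar>max_error \<beta> a BY n w\<bar> / t)) * indicator (space M) w \<partial>M)"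
  by (rule nn_integral_Markov_inequality) auto
 also have "\<dots> = ennreal (exp (- y / t)) * (\<integral>\<^sup>+w. ennreal (exp (\<bar>max_error \<beta> a BY n w\<bar> / t)) \<partial>M)"
  by (intro arg_cong2[where f = "(*)"] nn_integral_cong refl) auto
 also have "\<dots> \<le> ennreal (exp (- y / t)) * 2" by (intro mult_left_mono t) auto
 also have "\<dots> = ennreal (2 * exp (- y / t))" by (simp add: ennreal_mult mult.commute)
 finally have "prob {w \<in> space M. y \<le> max_error \<beta> a BY n w} \<le> 2 * exp (- y / t)" by (simp add: emeasure_eq_measure)
 also have "\<dots> \<le> 2 * exp (- y / B)" using y t(1) tB by (auto intro!: divide_left_mono)
 finally show "prob {w \<in> space M. y \<le> max_error \<beta> a BY n w} \<le> 2 * exp (- y / (2 * max C 1 * ln (real n)))" by (simp add: B_def)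
qed

lemma summation_by_parts:
 fixes g e :: "nat \<Rightarrow> complex"
 shows "(\<Sum>k<n. g k * (e (Suc k) - e k)) = g n * e n - g 0 * e 0 - (\<Sum>k<n. (g (Suc k) - g k) * e (Suc k))"
 by (induction n) (simp_all add: algebra_simps)

text \<open>A Wiener integral depends on its integrand on \<open>[0, T]\<close> only; the truncation makes it measurable on the whole line.\<close>

definition trunc :: "real \<Rightarrow> (real \<Rightarrow> complex) \<Rightarrow> real \<Rightarrow> complex" where "trunc T g u = indicator {0..T} u *\<^sub>R g u"

lemma trunc_meas: assumes "continuous_on {0..T} g" shows "trunc T g \<in> borel_measurable borel"
 unfolding trunc_def[abs_def] by (rule borel_measurable_continuous_on_indicator[OF _ assms]) auto

lemma wiener_trunc: "is_wiener_integral M W T g I \<Longrightarrow> is_wiener_integral M W T (trunc T g) I"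
 by (erule wiener_cong) (simp add: trunc_def)

lemma nsq_trunc: "nsq T (\<lambda>u. trunc T g u - h u) = nsq T (\<lambda>u. g u - h u)" "nsq T (trunc T g) = nsq T g"
 unfolding nsq_def by (intro nn_integral_cong; auto simp: indicator_def trunc_def)+

section \<open>The field against the noise sums\<close>

context coupled begin

abbreviation "IX \<equiv> wiener_integral M (scaled N BX) T gX"
abbreviation "IY \<equiv> wiener_integral M (scaled N BY) T gY"
abbreviation "SX \<equiv> step_integral (scaled N BX) (grid gX)"
abbreviation "SY \<equiv> step_integral (scaled N BY) (grid gY)"

lemma scaled_BX: "brownian_motion M (scaled N BX)" and scaled_BY: "brownian_motion M (scaled N BY)"
 using brownian_motion.scaled_brownian[OF BX_brownian N] brownian_motion.scaled_brownian[OF BY_brownian N] by auto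

lemma wiener_IX: assumes "1 \<le> n" shows "is_wiener_integral M (scaled N BX) T gX IX"
proof -
 have "\<exists>I. is_wiener_integral M (scaled N BX) T gX I"
  using assms Npos by (intro brownian_motion.wiener_integral_exists[OF scaled_BX] g_continuous) (simp add: T_def)
 thus ?thesis unfolding wiener_integral_def by (rule someI_ex)
qed

lemma wiener_IY: assumes "1 \<le> n" shows "is_wiener_integral M (scaled N BY) T gY IY"
proof -
 have "\<exists>I. is_wiener_integral M (scaled N BY) T gY I"
  using assms Npos by (intro brownian_motion.wiener_integral_exists[OF scaled_BY] g_continuous) (simp add: T_def)
 thus ?thesis unfolding wiener_integral_def by (rule someI_ex)
qed

lemma SX_meas: "SX \<in> borel_measurable M" and SY_meas: "SY \<in> borel_measurable M"
proof -
 have "steps_nonneg (grid g)" for g using grid_bounds[of g] by auto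
 thus "SX \<in> borel_measurable M" "SY \<in> borel_measurable M"
  using brownian_motion.step_integral_meas[OF scaled_BX] brownian_motion.step_integral_meas[OF scaled_BY] by blast+
qed

lemma wiener_grid_tail:
 assumes W: "brownian_motion M W" and I: "is_wiener_integral M W T g J" and gc: "continuous_on {0..T} g"
  and ns: "nsq T (\<lambda>u. g u - step_fun (grid g) u) \<le> ennreal (12 / \<omega>)" and y: "0 \<le> y"
 shows "prob {w \<in> space M. y \<le> cmod (J w - step_integral W (grid g) w)} \<le> 4 * exp (- y\<^sup>2 * \<omega> / 104)"
proof -
 have "prob {w \<in> space M. y \<le> cmod (J w - step_integral W (grid g) w)} \<le> 4 * exp (- y\<^sup>2 / (8 * (13 / \<omega>)))"
 proof (rule brownian_motion.wiener_tail[OF W wiener_trunc[OF I] trunc_meas[OF gc] grid_bounds _ y])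
  have "nsq T (\<lambda>u. trunc T g u - step_fun (grid g) u) \<le> ennreal (12 / \<omega>)" unfolding nsq_trunc by (rule ns)
  \<comment> \<open>\<open>wiener_tail\<close> asks for a strict bound, which raises 12 to 13; the
    constant 104 is 8 times 13.\<close>
  also have "\<dots> < ennreal (13 / \<omega>)" using \<omega>1 by (intro ennreal_lessI divide_strict_right_mono) auto
  finally show "nsq T (\<lambda>u. trunc T g u - step_fun (grid g) u) < ennreal (13 / \<omega>)" .
 qed
 thus ?thesis by simp
qed

definition qX :: complex where "qX = (LINT u:{0..T}|lborel. (gX u)^2)"
definition qY :: complex where "qY = (LINT u:{0..T}|lborel. (gY u)^2)"

lemma wiener_mean: assumes n: "1 \<le> n"
 shows "(LINT w|M. exp (of_real t * (IX w + IY w))) = exp (of_real (t^2 / 2) * (qX + qY))"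
proof -
 have fin: "nsq T (trunc T g) < \<infinity>" if "\<And>u. 0 \<le> u \<Longrightarrow> u \<le> T \<Longrightarrow> cmod (g u) \<le> sqrt (real N) / sqrt (D u)" for g
 proof -
  have "nsq T g \<le> ennreal ((sqrt (real N))^2 * T)"
  proof (rule nsq_le)
   fix u assume u: "0 < u" "u \<le> T"
   have "cmod (g u) \<le> sqrt (real N) / sqrt (D u)" using that u by simp
   also have "\<dots> \<le> sqrt (real N) / 1" using gap_props(1)[OF u(2)] \<omega>1 by (intro divide_left_mono) auto
   finally show "cmod (g u) \<le> sqrt (real N)" by simp
  qed (auto simp: T_def)
  thus ?thesis unfolding nsq_trunc by (rule order_le_less_trans) simp
 qed
 have q: "qX = (LINT u:{0..T}|lborel. (trunc T gX u)^2)" "qY = (LINT u:{0..T}|lborel. (trunc T gY u)^2)"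
  unfolding qX_def qY_def set_lebesgue_integral_def by (intro Bochner_Integration.integral_cong refl; simp add: indicator_def trunc_def)+
 show ?thesis
  unfolding q
  by (rule wiener_pair_mgf[OF scaled_BX scaled_BY scaled_indep trunc_meas[OF g_continuous(1)] fin[OF g_le(1)] wiener_trunc[OF wiener_IX[OF n]]
    trunc_meas[OF g_continuous(2)] fin[OF g_le(2)] wiener_trunc[OF wiener_IY[OF n]]])
qed

definition gg :: "'a \<Rightarrow> complex" where "gg w = exp (of_real bb * g_field M N BX BY T z w)"

text \<open>The exponent that makes \<open>gg_chi\<close> exact: the first part compares the
  stochastic integrals with the noise sums, the second part compares the means of the two
  exponentials.\<close>

definition chi :: "'a \<Rightarrow> complex" where
 "chi w = - of_real (1 / sqrt (2 * \<beta>)) * ((IX w - (\<Sum>k<n. gX (real k / real N) * of_real (X (Suc k) w / sqrt (real N))))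
   + (IY w - (\<Sum>k<n. gY (real k / real N) * of_real (Y (Suc k) w / sqrt (real N)))))
  + of_real (1 / (4 * \<beta>)) * ((of_real (1 / real N) * (\<Sum>k<n. (gX (real k / real N))^2) - qX) + (of_real (1 / real N) * (\<Sum>k<n. (gY (real k / real N))^2) - qY))"

text \<open>The link between the recursion and the field: the noise coefficients of \<open>s\<close>
  are the integrands evaluated at the left end points of the grid.\<close>

lemma f_g: assumes "k \<le> n"
 shows "f1 k = of_real (1 / sqrt (2 * \<beta>) / sqrt (real N)) * gX (real k / real N)" "f2 k = of_real (1 / sqrt (2 * \<beta>) / sqrt (real N)) * gY (real k / real N)"
proof -
 show "f1 k = of_real (1 / sqrt (2 * \<beta>) / sqrt (real N)) * gX (real k / real N)"
  by (simp add: f1_def gX_def S_def real_sqrt_mult mult_ac)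
 have "yc k = 1 / sqrt (2 * \<beta>) / sqrt (real N) * sqrt (real k / real N) / 2"
 proof -
  define u v where "u = sqrt (2 * \<beta>)" and "v = sqrt (real N)"
  have uv: "0 < u" "0 < v" "2 * \<beta> = u * u" "real N = v * v" using \<beta> Npos by (auto simp: u_def v_def)
  have "yc k = u * sqrt (real k) / (2 * (v * v) * (u * u))"
   using uv(3,4) by (simp add: real_sqrt_mult u_def)
  also have "\<dots> = 1 / u / v * (sqrt (real k) / v) / 2" using uv(1,2) by (simp add: field_simps)
  finally show ?thesis by (simp add: real_sqrt_divide u_def v_def)
 qed
 hence c: "complex_of_real (yc k) = of_real (1 / sqrt (2 * \<beta>) / sqrt (real N)) * of_real (sqrt (real k / real N)) / 2"
  by (simp only: of_real_mult of_real_divide of_real_numeral)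
 show "f2 k = of_real (1 / sqrt (2 * \<beta>) / sqrt (real N)) * gY (real k / real N)"
  unfolding f2_def c gY_eq[OF grid_pt(1,2)[OF assms]] by (simp add: S_def lam_def mult_ac)
qed

lemma gg_chi: assumes n: "1 \<le> n" shows "gg w / (LINT w|M. gg w) = EE n w * exp (chi w)"
proof -
 define c where "c = 1 / sqrt (2 * \<beta>)"
 have c2: "c^2 = 1 / (2 * \<beta>)" using \<beta> by (simp add: c_def power_divide)
 have bc: "bb / 2 = c"
  unfolding c_def bb_def using \<beta> by (simp add: real_sqrt_mult real_sqrt_divide field_simps)
 have gg: "gg w = exp (of_real (- c) * (IX w + IY w))" for w
 proof -
  have "of_real bb * g_field M N BX BY T z w = - of_real (bb / 2) * (IX w + IY w)"
   by (simp add: g_field_def gX_def[abs_def] gY_def[abs_def] algebra_simps)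
  thus ?thesis unfolding gg_def bc by simp
 qed
 have mean: "(LINT w|M. gg w) = exp (of_real (1 / (4 * \<beta>)) * (qX + qY))"
  unfolding gg wiener_mean[OF n] using c2 by simp
 have FF: "(\<Sum>k<n. FF k w) = of_real c * ((\<Sum>k<n. gX (real k / real N) * of_real (X (Suc k) w / sqrt (real N))) + (\<Sum>k<n. gY (real k / real N) * of_real (Y (Suc k) w / sqrt (real N))))"
  unfolding sum.distrib[symmetric] sum_distrib_left
  by (intro sum.cong refl) (simp add: FF_def f_g c_def algebra_simps add_divide_distrib)
 have dd: "dd k = of_real (1 / (4 * \<beta>)) * of_real (1 / real N) * ((gX (real k / real N))^2 + (gY (real k / real N))^2)" if "k < n" for k
 proof -
  \<comment> \<open>The variance \<open>vv 0 = 0\<close> of the missing noise in the first step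
    makes no difference in \<open>dd\<close>, because its coefficient is zero too.\<close>
  have "f2 0 = 0" by (simp add: f2_def)
  hence "dd k = ((f1 k)^2 + (f2 k)^2) / 2" by (simp add: dd_def vv_def)
  also have "\<dots> = (of_real (c / sqrt (real N)))^2 / 2 * ((gX (real k / real N))^2 + (gY (real k / real N))^2)"
   using that by (simp add: f_g[folded c_def] power_mult_distrib power_divide algebra_simps add_divide_distrib)
  also have "(complex_of_real (c / sqrt (real N)))^2 / 2 = of_real (1 / (4 * \<beta>)) * of_real (1 / real N)"
   using c2 by (simp add: power_divide of_real_power[symmetric] del: of_real_power)
  finally show ?thesis .
 qed
 have dds: "(\<Sum>k<n. dd k) = of_real (1 / (4 * \<beta>)) * (of_real (1 / real N) * (\<Sum>k<n. (gX (real k / real N))^2) + of_real (1 / real N) * (\<Sum>k<n. (gY (real k / real N))^2))"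
  unfolding distrib_left[symmetric] sum.distrib[symmetric] sum_distrib_left
  by (intro sum.cong refl) (simp add: dd)
 have "EE n w * exp (chi w) = exp (- of_real c * (IX w + IY w) - of_real (1 / (4 * \<beta>)) * (qX + qY))"
  unfolding EE_def sum.distrib FF dds chi_def c_def[symmetric] exp_add[symmetric]
  by (intro arg_cong[where f = exp]) (simp add: algebra_simps)
 thus ?thesis unfolding mean unfolding gg by (simp add: exp_diff)
qed

lemma grid_integral: "step_integral (scaled N B) (grid g) w = (\<Sum>k<n. g (real k / real N) * of_real ((B (real (Suc k)) w - B (real k) w) / sqrt (real N)))"
 unfolding grid_def grid_steps_integral using Npos by (simp add: scaled_def diff_divide_distrib)

text \<open>The sums of \<open>X\<close> agree with the Brownian motion at integers, so the first
  integral carries a discretization error only. For \<open>Y\<close> summation by parts moves the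
  differences onto \<open>gY\<close>; the boundary term contributes 1 and the variation 4 to the
  factor 5. The means contribute \<open>(12 + 12) / (4 \<beta>)\<close>.\<close>

lemma chi_bound: assumes n: "2 \<le> n"
 shows "AE w in M. cmod (chi w) \<le> 1 / sqrt (2 * \<beta>) * (cmod (IX w - SX w) + cmod (IY w - SY w) + 5 * max_error \<beta> a BY n w / sqrt \<omega>) + 6 / (\<beta> * sqrt \<omega>)"
proof -
 have "AE w in M. \<forall>k\<in>{1..n}. (\<Sum>j=1..k. X j w) = BX (real k) w"
  by (intro AE_finite_allI X_embedding) auto
 thus ?thesis using brownian_motion.start_zero[OF BX_brownian] brownian_motion.start_zero[OF BY_brownian]
 proof eventually_elim
  case (elim w)
  have SX: "SX w = (\<Sum>k<n. gX (real k / real N) * of_real (X (Suc k) w / sqrt (real N)))"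
  proof -
   have "BX (real (Suc k)) w - BX (real k) w = X (Suc k) w" if "k < n" for k
   proof -
    have 1: "(\<Sum>j=1..Suc k. X j w) = BX (real (Suc k)) w" using elim(1) that by (intro bspec[OF elim(1)]) auto
    have 2: "(\<Sum>j=1..k. X j w) = BX (real k) w"
    proof (cases "k = 0")
     case False
     thus ?thesis using that by (intro bspec[OF elim(1)]) auto
    qed (use elim(2) in simp)
    have "(\<Sum>j=1..Suc k. X j w) = (\<Sum>j=1..k. X j w) + X (Suc k) w" by simp
    thus ?thesis unfolding 1 2 by linarith
   qed
   thus ?thesis unfolding grid_integral by (intro sum.cong) auto
  qed
  define e where "e k = (\<Sum>j=1..k. Y j w) - BY (real k) w" for k
  have e0: "e 0 = 0" using elim(3) by (simp add: e_def)
  have e: "\<bar>e k\<bar> \<le> max_error \<beta> a BY n w" if "k \<in> {1..n}" for k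
   unfolding max_error_def e_def using that by (intro Max_ge) auto
  have SY: "cmod ((\<Sum>k<n. gY (real k / real N) * of_real (Y (Suc k) w / sqrt (real N))) - SY w) \<le> 5 * max_error \<beta> a BY n w / sqrt \<omega>"
  proof -
   define G where "G k = gY (real k / real N)" for k
   have "(\<Sum>k<n. G k * of_real (Y (Suc k) w / sqrt (real N))) - (\<Sum>k<n. G k * of_real ((BY (real (Suc k)) w - BY (real k) w) / sqrt (real N)))
     = (\<Sum>k<n. G k * (of_real (e (Suc k)) - of_real (e k))) / of_real (sqrt (real N))"
    unfolding sum_subtractf[symmetric] sum_divide_distrib
    by (intro sum.cong refl) (simp add: e_def diff_divide_distrib add_divide_distrib algebra_simps)
   also have "\<dots> = (G n * of_real (e n) - (\<Sum>k<n. (G (Suc k) - G k) * of_real (e (Suc k)))) / of_real (sqrt (real N))"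
    using summation_by_parts[of G "\<lambda>k. of_real (e k)" n] e0 by simp
   finally have eq: "(\<Sum>k<n. G k * of_real (Y (Suc k) w / sqrt (real N))) - (\<Sum>k<n. G k * of_real ((BY (real (Suc k)) w - BY (real k) w) / sqrt (real N)))
     = (G n * of_real (e n) - (\<Sum>k<n. (G (Suc k) - G k) * of_real (e (Suc k)))) / of_real (sqrt (real N))" .
   have "cmod (G n * of_real (e n) - (\<Sum>k<n. (G (Suc k) - G k) * of_real (e (Suc k))))
     \<le> cmod (G n * of_real (e n)) + (\<Sum>k<n. cmod ((G (Suc k) - G k) * of_real (e (Suc k))))"
    by (intro order_trans[OF norm_triangle_ineq4] add_left_mono norm_sum)
   also have "\<dots> \<le> (sqrt (real N) / sqrt \<omega>) * max_error \<beta> a BY n w + (\<Sum>k<n. cmod (G (Suc k) - G k) * max_error \<beta> a BY n w)"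
   proof (intro add_mono sum_mono)
    have "cmod (G n) \<le> sqrt (real N) / sqrt (\<Delta> n)" using g_le(2)[OF grid_pt(1,2)[of n]] grid_pt(3)[of n] by (simp add: G_def)
    also have "\<dots> \<le> sqrt (real N) / sqrt \<omega>" using \<Delta>_ge[of n] \<omega>1 by (intro divide_left_mono) auto
    finally show "cmod (G n * of_real (e n)) \<le> (sqrt (real N) / sqrt \<omega>) * max_error \<beta> a BY n w"
     using e[of n] n \<omega>1 unfolding norm_mult norm_of_real by (intro mult_mono) auto
    fix k assume "k \<in> {..<n}"
    thus "cmod ((G (Suc k) - G k) * of_real (e (Suc k))) \<le> cmod (G (Suc k) - G k) * max_error \<beta> a BY n w"
     using e[of "Suc k"] unfolding norm_mult norm_of_real by (intro mult_left_mono) auto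
   qed
   also have "\<dots> \<le> (sqrt (real N) / sqrt \<omega>) * max_error \<beta> a BY n w + (4 * sqrt (real N) / sqrt \<omega>) * max_error \<beta> a BY n w"
    unfolding sum_distrib_right[symmetric] using gY_variation e[of n] n
    by (intro add_left_mono mult_right_mono) (auto simp: G_def)
   also have "\<dots> = 5 * max_error \<beta> a BY n w / sqrt \<omega> * sqrt (real N)" by simp
   finally show ?thesis
    unfolding grid_integral G_def[symmetric] eq norm_divide using Npos by (simp add: pos_divide_le_eq)
  qed
  define A where "A = of_real (1 / real N) * (\<Sum>k<n. (gX (real k / real N))^2) - qX"
  define B where "B = of_real (1 / real N) * (\<Sum>k<n. (gY (real k / real N))^2) - qY"
  have AB: "cmod A \<le> 12 / sqrt \<omega>" "cmod B \<le> 12 / sqrt \<omega>"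
   using square_integral_grid[OF g_diff_le(1) g_le(1) g_continuous(1)] square_integral_grid[OF g_diff_le(2) g_le(2) g_continuous(2)]
   unfolding A_def B_def qX_def qY_def by (auto simp: norm_minus_commute)
  define U where "U = (\<Sum>k<n. gY (real k / real N) * of_real (Y (Suc k) w / sqrt (real N)))"
  have "cmod (chi w) \<le> 1 / sqrt (2 * \<beta>) * (cmod (IX w - SX w) + (cmod (IY w - SY w) + cmod (U - SY w))) + 1 / (4 * \<beta>) * (cmod A + cmod B)"
  proof -
   have chi: "chi w = - of_real (1 / sqrt (2 * \<beta>)) * ((IX w - SX w) + ((IY w - SY w) - (U - SY w))) + of_real (1 / (4 * \<beta>)) * (A + B)"
    unfolding chi_def SX[symmetric] U_def[symmetric] A_def[symmetric] B_def[symmetric] by simp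
   show ?thesis
    unfolding chi
   proof (intro order_trans[OF norm_triangle_ineq] add_mono)
    show "cmod (- of_real (1 / sqrt (2 * \<beta>)) * ((IX w - SX w) + ((IY w - SY w) - (U - SY w)))) \<le> 1 / sqrt (2 * \<beta>) * (cmod (IX w - SX w) + (cmod (IY w - SY w) + cmod (U - SY w)))"
     unfolding norm_mult norm_minus_cancel norm_of_real using \<beta>
     by (intro mult_mono order_trans[OF norm_triangle_ineq] add_left_mono norm_triangle_ineq4) auto
    show "cmod (of_real (1 / (4 * \<beta>)) * (A + B)) \<le> 1 / (4 * \<beta>) * (cmod A + cmod B)"
     unfolding norm_mult norm_of_real using \<beta> by (intro mult_mono norm_triangle_ineq) auto
   qed
  qed
  also have "\<dots> \<le> 1 / sqrt (2 * \<beta>) * (cmod (IX w - SX w) + (cmod (IY w - SY w) + 5 * max_error \<beta> a BY n w / sqrt \<omega>)) + 1 / (4 * \<beta>) * (12 / sqrt \<omega> + 12 / sqrt \<omega>)"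
   using SY AB \<beta> unfolding U_def by (intro add_mono mult_left_mono) auto
  also have "1 / (4 * \<beta>) * (12 / sqrt \<omega> + 12 / sqrt \<omega>) = 6 / (\<beta> * sqrt \<omega>)" by simp
  finally show ?case by (simp add: add.assoc)
 qed
qed

lemma chi_meas: assumes "1 \<le> n" shows "chi \<in> borel_measurable M"
proof -
 have [measurable]: "IX \<in> borel_measurable M" "IY \<in> borel_measurable M"
  using wiener_IX[OF assms] wiener_IY[OF assms] by (auto simp: is_wiener_integral_def)
 have [measurable]: "X (Suc k) \<in> borel_measurable M" "Y k \<in> borel_measurable M" for k by (rule XY_meas; simp)+
 show ?thesis unfolding chi_def[abs_def] by measurable
qed

lemma chi_tail: assumes n: "2 \<le> n" and t: "0 < t" "6 / (\<beta> * sqrt \<omega>) \<le> t / 2"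
 shows "prob {w \<in> space M. t \<le> cmod (chi w)} \<le> 8 * exp (- \<beta> * t^2 * \<omega> / 1872) + 2 * exp (- sqrt (2 * \<beta>) * t * sqrt \<omega> / (60 * max C 1 * ln (real n)))"
proof -
 have n1: "1 \<le> n" using n by simp
 have [measurable]: "IX \<in> borel_measurable M" "IY \<in> borel_measurable M"
  using wiener_IX[OF n1] wiener_IY[OF n1] by (auto simp: is_wiener_integral_def)
 note [measurable] = SX_meas SY_meas max_error_tail(1)[OF n]
 \<comment> \<open>Half of \<open>t\<close> is reserved for the deterministic part of
   \<open>chi_bound\<close>; the other half is shared by three random terms. This yields
   \<open>1872 = 18 * 104\<close> and \<open>60 = 6 * 5 * 2\<close>.\<close>
 define s where "s = sqrt (2 * \<beta>) * t / 6"
 have s: "0 < s" "s^2 = \<beta> * t^2 / 18" using t \<beta> by (auto simp: s_def power_divide power_mult_distrib)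
 define A B E where "A = {w \<in> space M. s \<le> cmod (IX w - SX w)}" and "B = {w \<in> space M. s \<le> cmod (IY w - SY w)}"
  and "E = {w \<in> space M. s * sqrt \<omega> / 5 \<le> max_error \<beta> a BY n w}"
 have [measurable]: "A \<in> sets M" "B \<in> sets M" "E \<in> sets M" unfolding A_def B_def E_def by measurable
 have "prob {w \<in> space M. t \<le> cmod (chi w)} \<le> prob (A \<union> B \<union> E)"
 proof (rule finite_measure_mono_AE)
  show "AE w in M. w \<in> {w \<in> space M. t \<le> cmod (chi w)} \<longrightarrow> w \<in> A \<union> B \<union> E"
   using chi_bound[OF n]
  proof eventually_elim
   case (elim w)
   show ?case
   proof (intro impI, rule ccontr)
    assume w: "w \<in> {w \<in> space M. t \<le> cmod (chi w)}" "w \<notin> A \<union> B \<union> E"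
    hence lt: "cmod (IX w - SX w) < s" "cmod (IY w - SY w) < s" "max_error \<beta> a BY n w < s * sqrt \<omega> / 5" by (auto simp: A_def B_def E_def)
    have "5 * max_error \<beta> a BY n w / sqrt \<omega> < s" using lt(3) \<omega>1 by (simp add: pos_divide_less_eq)
    hence "1 / sqrt (2 * \<beta>) * (cmod (IX w - SX w) + cmod (IY w - SY w) + 5 * max_error \<beta> a BY n w / sqrt \<omega>) < 1 / sqrt (2 * \<beta>) * (3 * s)"
     using lt \<beta> by (intro mult_strict_left_mono) auto
    also have "\<dots> = t / 2" using \<beta> by (simp add: s_def)
    finally have "cmod (chi w) < t" using elim t(2) by linarith
    thus False using w(1) by simp
   qed
  qed
 qed measurable
 also have "\<dots> \<le> prob A + prob B + prob E" by (intro order_trans[OF measure_Un_le] add_right_mono measure_Un_le) auto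
 also have "prob A \<le> 4 * exp (- s\<^sup>2 * \<omega> / 104)"
  unfolding A_def using s by (intro wiener_grid_tail[OF scaled_BX wiener_IX[OF n1]] g_continuous nsq_grid g_diff_le g_le) auto
 also have "prob B \<le> 4 * exp (- s\<^sup>2 * \<omega> / 104)"
  unfolding B_def using s by (intro wiener_grid_tail[OF scaled_BY wiener_IY[OF n1]] g_continuous nsq_grid g_diff_le g_le) auto
 also have "prob E \<le> 2 * exp (- (s * sqrt \<omega> / 5) / (2 * max C 1 * ln (real n)))"
  unfolding E_def using s \<omega>1 by (intro max_error_tail(2)[OF n]) auto
 finally have "prob {w \<in> space M. t \<le> cmod (chi w)} \<le> 4 * exp (- s\<^sup>2 * \<omega> / 104) + 4 * exp (- s\<^sup>2 * \<omega> / 104) + 2 * exp (- (s * sqrt \<omega> / 5) / (2 * max C 1 * ln (real n)))"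
  by simp
 moreover have "- s\<^sup>2 * \<omega> / 104 = - \<beta> * t^2 * \<omega> / 1872" unfolding s(2) by simp
 moreover have "- (s * sqrt \<omega> / 5) / (2 * max C 1 * ln (real n)) = - sqrt (2 * \<beta>) * t * sqrt \<omega> / (60 * max C 1 * ln (real n))" by (simp add: s_def)
 ultimately show ?thesis by (simp only:)
qed

end

section \<open>Tail of the error\<close>

lemma norm_complex2: "norm (v :: complex^2) \<le> cmod (v $ 1) + cmod (v $ 2)"
 using L2_set_le_sum[of "UNIV :: 2 set" "\<lambda>i. norm (v $ i)"] by (simp add: norm_vec_def sum_2)

text \<open>Cramer's rule; it resolves the definite description in the definition of the error
  vector.\<close>

lemma matrix2_solution:
 fixes l1 l2 A B K :: complex
 assumes K: "K \<noteq> 0" and ne: "l1 \<noteq> l2"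
 shows "(THE v :: complex^2. (vector [A, B] :: complex^2) =
    K *s ((vector [vector [l1, l2], vector [1, 1]] :: complex^2^2) *v (vector [1, 0] + v)))
   = vector [(A / K - l2 * (B / K)) / (l1 - l2) - 1, (l1 * (B / K) - A / K) / (l1 - l2)]" (is "(THE v. ?Q v) = ?v")
proof -
 have Q: "?Q v \<longleftrightarrow> A = K * (l1 * (1 + v $ 1) + l2 * v $ 2) \<and> B = K * ((1 + v $ 1) + v $ 2)" for v
  by (simp add: Finite_Cartesian_Product.vec_eq_iff forall_2 matrix_vector_mult_def sum_2)
 have d: "l1 - l2 \<noteq> 0" using ne by simp
 have "v = ?v" if "?Q v" for v
 proof -
  have AB: "A / K = l1 * (1 + v $ 1) + l2 * v $ 2" "B / K = (1 + v $ 1) + v $ 2" using that K unfolding Q by auto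
  have "A / K - l2 * (B / K) = (l1 - l2) * (1 + v $ 1)" "l1 * (B / K) - A / K = (l1 - l2) * v $ 2" unfolding AB by (simp_all add: algebra_simps)
  thus ?thesis using d by (simp add: Finite_Cartesian_Product.vec_eq_iff forall_2)
 qed
 moreover have "?Q ?v"
 proof -
  define p q where "p = (A / K - l2 * (B / K)) / (l1 - l2)" and "q = (l1 * (B / K) - A / K) / (l1 - l2)"
  define x y where "x = A / K" and "y = B / K"
  have "l1 * p + l2 * q = (l1 * (x - l2 * y) + l2 * (l1 * y - x)) / (l1 - l2)" "p + q = ((x - l2 * y) + (l1 * y - x)) / (l1 - l2)"
   unfolding p_def q_def x_def[symmetric] y_def[symmetric] add_divide_distrib times_divide_eq_right by (rule refl)+
  moreover have "l1 * (x - l2 * y) + l2 * (l1 * y - x) = x * (l1 - l2)" "(x - l2 * y) + (l1 * y - x) = y * (l1 - l2)"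
   by (simp_all add: algebra_simps)
  ultimately have "l1 * p + l2 * q = x" "p + q = y" using d by auto
  hence "K * (l1 * p + l2 * q) = A" "K * (p + q) = B" using K by (auto simp: x_def y_def)
  thus ?thesis unfolding Q p_def q_def by simp
 qed
 ultimately show ?thesis by (intro the_equality) auto
qed

context coupled begin

definition GammaC :: "'a \<Rightarrow> complex^2" where
 "GammaC w = (THE v :: complex^2.
   (vector [Phi \<beta> N a b n z w, Phi \<beta> N a b (n - 1) z w] :: complex^2) =
   (pi_poly N (n - 1) z * (gg w / (LINT w'|M. gg w'))) *s
    ((vector [vector [lambda_plus T z, lambda_minus T z], vector [1, 1]] :: complex^2^2) *v (vector [1, 0] + v)))"

text \<open>Division by the normalized exponential leaves the factor \<open>E = exp (- chi)\<close>.
  The second component is governed by \<open>lam - r\<close>, whose quotient by \<open>S\<close> is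
  of order \<open>1 / LL\<close>, and by \<open>v\<close>, whose factor \<open>\<theta>\<close>
  cancels the one in the denominator \<open>S\<close>.\<close>

lemma GammaC_le:
 assumes n: "1 \<le> n" and \<epsilon>: "cmod (chi w) \<le> \<epsilon>" "\<epsilon> \<le> 1 / 4" and L: "64 \<le> LL"
 shows "norm (GammaC w) \<le> 4 / 3 * (\<epsilon> + 2 * cmod (fst (chain n w)) + 12 * cmod (snd (chain n w)) + 1 / LL)"
proof -
 define K where "K = pi_poly N (n - 1) z * (gg w / (LINT w'|M. gg w'))"
 define E where "E = exp (- chi w)"
 define y p where "y = fst (chain n w)" and "p = snd (chain n w)"
 obtain j where j: "n = Suc j" "j \<le> n" using n by (cases n) auto
 have pj: "pi_poly N n z = r n * pi_poly N (n - 1) z" "pi_poly N (n - 1) z \<noteq> 0"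
  using pi_poly_Suc[of "Ph w" "\<lambda>k. X k w" "\<lambda>k. Y k w", OF Ph_0 Ph_rec j(2)] by (auto simp: j(1) simp del: r.simps)
 have EE0: "EE n w \<noteq> 0" by (simp add: EE_def)
 have K: "K \<noteq> 0" "K = pi_poly N (n - 1) z * (EE n w / E)"
  unfolding K_def gg_chi[OF n] E_def using pj EE0 by (auto simp: exp_minus field_simps)
 have th: "0 < \<theta> n" "\<theta> n \<le> 1" by (rule \<theta>_pos \<theta>_le1; simp)+
 have S0: "S n \<noteq> 0" "x * \<theta> n \<le> cmod (S n)" by (rule S_nz S_props(3); simp)+
 have S: "lambda_plus T z - lambda_minus T z = S n" by (simp add: lambda_plus_def lambda_minus_def S_def T_def field_simps)
 hence ne: "lambda_plus T z \<noteq> lambda_minus T z" using S0 by auto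
 have rn0: "r n \<noteq> 0" by (rule r_ge(5)) simp
 define U where "U = 1 + y - \<kappa> n * of_real (\<theta> n) * p"
 define V where "V = of_real (\<theta> n) * p"
 have uv: "v (Ph w) n / EE n w = V" "u (Ph w) n / EE n w = U"
 proof -
  have c: "y = ss n w / EE n w - 1" "p = vs n w / (EE n w * of_real (\<theta> n))" using chain_eq[of n w] by (auto simp: y_def p_def)
  show v: "v (Ph w) n / EE n w = V" unfolding V_def c vs_def using th by simp
  have "ss n w / EE n w = u (Ph w) n / EE n w + \<kappa> n * (v (Ph w) n / EE n w)"
   unfolding ss_def s_def[of "Ph w" "\<lambda>k. X k w" "\<lambda>k. Y k w", OF Ph_0 Ph_rec] by (simp add: add_divide_distrib)
  thus "u (Ph w) n / EE n w = U" unfolding v U_def c V_def[unfolded c] by (simp add: algebra_simps c(2)[symmetric] V_def)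
 qed
 have A: "Phi \<beta> N a b n z w / K = r n * U * E"
 proof -
  have "Phi \<beta> N a b n z w = u (Ph w) n * (r n * pi_poly N (n - 1) z)"
   using pj rn0 unfolding u_def[of "Ph w" "\<lambda>k. X k w" "\<lambda>k. Y k w", OF Ph_0 Ph_rec] pj(1) by (simp add: Ph_def)
  thus ?thesis unfolding K(2) uv(2)[symmetric] using pj EE0 by (simp add: E_def)
 qed
 have B: "Phi \<beta> N a b (n - 1) z w / K = (U - V) * E"
 proof -
  have "v (Ph w) n = u (Ph w) n - u (Ph w) (n - 1)"
   using n v_def[of "Ph w" "\<lambda>k. X k w" "\<lambda>k. Y k w", OF Ph_0 Ph_rec] by simp
  hence "Phi \<beta> N a b (n - 1) z w = (u (Ph w) n - v (Ph w) n) * pi_poly N (n - 1) z"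
   using pj unfolding u_def[of "Ph w" "\<lambda>k. X k w" "\<lambda>k. Y k w", OF Ph_0 Ph_rec] by (simp add: Ph_def)
  thus ?thesis unfolding K(2) uv(1)[symmetric] uv(2)[symmetric] diff_divide_distrib[symmetric] using pj EE0 by (simp add: E_def)
 qed
 \<comment> \<open>The components of the error vector are \<open>E * (1 + G1) - 1\<close> and
   \<open>E * G2\<close>. The numerator \<open>lam * (U - V) - r * U\<close> is regrouped so that
   both summands are visibly small.\<close>
 define G2 where "G2 = ((lam n - r n) * U - lam n * V) / S n"
 define G1 where "G1 = y - (\<kappa> n * of_real (\<theta> n) + of_real (\<theta> n)) * p - G2"
 have lamT: "lambda_plus T z = lam n" by (simp add: lam_def T_def)
 have G: "GammaC w = vector [E * (1 + G1) - 1, E * G2]"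
 proof -
  have lm: "lambda_minus T z = lam n - S n" using S lamT by (simp add: algebra_simps)
  have 2: "(lam n * ((U - V) * E) - r n * U * E) / S n = E * G2"
   unfolding G2_def by (simp add: algebra_simps)
  have "(r n * U * E - (lam n - S n) * ((U - V) * E)) / S n = (U - V) * E - (lam n * ((U - V) * E) - r n * U * E) / S n"
   using S0 by (simp add: field_simps)
  hence 1: "(r n * U * E - (lam n - S n) * ((U - V) * E)) / S n = E * (1 + G1)"
  proof -
   assume e: "(r n * U * E - (lam n - S n) * ((U - V) * E)) / S n = (U - V) * E - (lam n * ((U - V) * E) - r n * U * E) / S n"
   have "1 + G1 = U - V - G2" unfolding U_def V_def G1_def by (simp add: algebra_simps)
   hence "E * (1 + G1) = E * (U - V - G2)" by (simp only:)
   thus ?thesis unfolding e 2 by (simp add: right_diff_distrib mult.commute)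
  qed
  show ?thesis
   unfolding GammaC_def K_def[symmetric] unfolding matrix2_solution[OF K(1) ne] unfolding A B S unfolding lamT lm 1 2 ..
 qed
 have kt: "cmod (\<kappa> n * of_real (\<theta> n)) \<le> 4"
  using \<kappa>_le[of n] th by (simp add: norm_mult pos_le_divide_eq)
 have U: "cmod U \<le> 1 + cmod y + 4 * cmod p"
 proof -
  have "cmod U \<le> cmod (1 + y) + cmod (\<kappa> n * of_real (\<theta> n) * p)" unfolding U_def by (rule norm_triangle_ineq4)
  also have "\<dots> \<le> (1 + cmod y) + 4 * cmod p"
   using norm_triangle_ineq[of 1 y] kt by (intro add_mono) (auto simp: norm_mult intro!: mult_right_mono)
  finally show ?thesis by simp
 qed
 have sl: "(\<sigma> n)^2 / \<theta> n \<le> 1 / LL"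
 proof -
  have D: "\<omega> \<le> \<Delta> n" "0 < \<Delta> n" by (rule \<Delta>_ge \<Delta>_pos; simp)+
  have "(\<sigma> n)^2 / \<theta> n = 1 / (\<Delta> n * sqrt (\<Delta> n / P))" using \<sigma>_sq[of n] by (simp add: \<theta>_def)
  also have "\<dots> \<le> 1 / (\<omega> * sqrt (\<omega> / P))"
   using D \<omega>1 Ppos by (intro divide_left_mono mult_mono real_sqrt_le_mono divide_right_mono mult_pos_pos) auto
  finally show ?thesis by (simp add: LL_def)
 qed
 have G2: "cmod G2 \<le> 1 / (2 * LL) * (1 + cmod y + 4 * cmod p) + 3 * cmod p"
 proof -
  have "cmod G2 \<le> cmod ((lam n - r n) * U / S n) + cmod (lam n * V / S n)"
   unfolding G2_def diff_divide_distrib by (rule norm_triangle_ineq4)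
  also have "cmod (lam n * V / S n) \<le> 3 * x * (\<theta> n * cmod p) / (x * \<theta> n)"
   unfolding norm_divide norm_mult using lam_le[of n] S0 x0 th by (intro frac_le mult_mono) (auto simp: V_def norm_mult)
  also have "\<dots> = 3 * cmod p" using x0 th by simp
  also have "cmod ((lam n - r n) * U / S n) \<le> x * (\<sigma> n)^2 / 2 * (1 + cmod y + 4 * cmod p) / (x * \<theta> n)"
   unfolding norm_divide norm_mult using r_lam[of n] U S0 x0 th
   by (intro frac_le mult_mono) (auto simp: norm_minus_commute intro!: mult_nonneg_nonneg add_nonneg_nonneg)
  also have "\<dots> = (\<sigma> n)^2 / \<theta> n / 2 * (1 + cmod y + 4 * cmod p)" using x0 by simp
  also have "\<dots> \<le> 1 / LL / 2 * (1 + cmod y + 4 * cmod p)"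
   using sl by (intro mult_right_mono divide_right_mono add_nonneg_nonneg) auto
  finally show ?thesis by simp
 qed
 have G1: "cmod G1 \<le> cmod y + 5 * cmod p + cmod G2"
 proof -
  have "cmod ((\<kappa> n * of_real (\<theta> n) + of_real (\<theta> n)) * p) \<le> 5 * cmod p"
   unfolding norm_mult[of "_ + _"] using kt th by (intro mult_right_mono order_trans[OF norm_triangle_ineq]) auto
  thus ?thesis unfolding G1_def
   using norm_triangle_ineq4[of "y - (\<kappa> n * of_real (\<theta> n) + of_real (\<theta> n)) * p" G2] norm_triangle_ineq4[of y "(\<kappa> n * of_real (\<theta> n) + of_real (\<theta> n)) * p"]
   by linarith
 qed
 have sum: "cmod G1 + cmod G2 \<le> 2 * cmod y + 12 * cmod p + 1 / LL"
 proof -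
  have l: "1 / LL \<le> 1 / 64" "0 < LL" using L by (auto simp: field_simps)
  have "cmod G1 + cmod G2 \<le> cmod y + 5 * cmod p + 2 * (1 / (2 * LL) * (1 + cmod y + 4 * cmod p) + 3 * cmod p)"
  proof -
   define W where "W = 1 / (2 * LL) * (1 + cmod y + 4 * cmod p) + 3 * cmod p"
   have "cmod G1 + cmod G2 \<le> cmod y + 5 * cmod p + 2 * W" using G1 G2[folded W_def] by linarith
   thus ?thesis by (simp only: W_def)
  qed
  also have "\<dots> = cmod y + 11 * cmod p + 1 / LL + 1 / LL * (cmod y + 4 * cmod p)" using l by (simp add: field_simps)
  also have "1 / LL * (cmod y + 4 * cmod p) \<le> 1 / 64 * (cmod y + 4 * cmod p)" using l by (intro mult_right_mono) auto
  finally have "cmod G1 + cmod G2 \<le> cmod y + 11 * cmod p + 1 / LL + 1 / 64 * (cmod y + 4 * cmod p)" by simp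
  moreover have "1 / 64 * (cmod y + 4 * cmod p) \<le> cmod y + cmod p" by simp
  ultimately show ?thesis by linarith
 qed
 have e43: "exp \<epsilon> \<le> 4 / 3"
 proof -
  have "exp \<epsilon> \<le> exp (1 / 4)" using \<epsilon>(2) by simp
  also have "exp (1 / 4 :: real) \<le> 1 + 1 / 4 + (1 / 4)^2" by (rule exp_bound) auto
  finally show ?thesis by (simp add: power2_eq_square)
 qed
 have e0: "0 \<le> \<epsilon>" using \<epsilon>(1) norm_ge_zero order_trans by blast
 have nE: "cmod E \<le> 4 / 3"
 proof -
  have "\<bar>Re (chi w)\<bar> \<le> \<epsilon>" using abs_Re_le_cmod[of "chi w"] \<epsilon>(1) by linarith
  hence "cmod E \<le> exp \<epsilon>" by (simp add: E_def)
  thus ?thesis using e43 by linarith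
 qed
 have E1: "cmod (E - 1) \<le> 4 / 3 * \<epsilon>"
 proof -
  have "cmod (E - 1) \<le> cmod (- chi w) * exp (cmod (- chi w))" unfolding E_def by (rule norm_exp_minus_1)
  also have "\<dots> \<le> \<epsilon> * exp \<epsilon>" using \<epsilon>(1) e0 by (intro mult_mono) auto
  also have "\<dots> \<le> \<epsilon> * (4 / 3)" using e43 e0 by (intro mult_left_mono) auto
  finally show ?thesis by simp
 qed
 have "norm (GammaC w) \<le> cmod (E * (1 + G1) - 1) + cmod (E * G2)" using norm_complex2[of "GammaC w"] unfolding G by simp
 also have "E * (1 + G1) - 1 = (E - 1) + E * G1" by (simp add: algebra_simps)
 also have "cmod ((E - 1) + E * G1) \<le> cmod (E - 1) + cmod (E * G1)" by (rule norm_triangle_ineq)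
 finally have "norm (GammaC w) \<le> cmod (E - 1) + cmod E * (cmod G1 + cmod G2)" by (simp add: norm_mult distrib_left)
 also have "\<dots> \<le> 4 / 3 * \<epsilon> + 4 / 3 * (2 * cmod y + 12 * cmod p + 1 / LL)"
  by (rule add_mono[OF E1 mult_mono[OF nE sum]]) auto
 also have "\<dots> = 4 / 3 * (\<epsilon> + 2 * cmod y + 12 * cmod p + 1 / LL)" by (simp only: distrib_left add.assoc)
 finally show ?thesis unfolding y_def p_def .
qed

lemma chain_meas: "chain k \<in> borel_measurable M"
proof (induction k)
 case 0
 have "chain 0 = (\<lambda>w. (0, 0))" by auto
 thus ?case by simp
next
 case (Suc k)
 have XY: "(\<lambda>w. (complex_of_real (X (Suc k) w), complex_of_real (Y (Suc k) w))) \<in> borel_measurable M"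
 proof -
  have [measurable]: "X (Suc k) \<in> borel_measurable M" "Y (Suc k) \<in> borel_measurable M" by (rule XY_meas; simp)+
  show ?thesis by (intro borel_measurable_Pair) auto
 qed
 have "(\<lambda>w. step k (chain k w, (complex_of_real (X (Suc k) w), complex_of_real (Y (Suc k) w)))) \<in> borel_measurable M"
  by (rule measurable_compose[OF measurable_Pair[OF Suc.IH XY] step_meas])
 moreover have "chain (Suc k) = (\<lambda>w. step k (chain k w, (complex_of_real (X (Suc k) w), complex_of_real (Y (Suc k) w))))" by auto
 ultimately show ?case by (simp only:)
qed

definition K1 :: real where "K1 = 1100 * (KK * exp (256 * GG^2))"

text \<open>Either \<open>chi\<close> or the state of the chain is large. The first event is covered
  by \<open>chi_tail\<close>, the second by Markov's inequality for the \<open>m\<close>-th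
  moment.\<close>

lemma GammaC_tail:
 assumes n: "2 \<le> n" and m: "1 \<le> m" "KK * real m \<le> LL" and \<omega>: "cc^2 \<le> \<omega>" and L: "64 \<le> LL"
  and small: "6 * 10^6 * cc * (\<omega> / sqrt P) \<le> hh / 4"
  and \<eta>: "8 / LL \<le> \<eta>" and t: "t = min \<eta> 1 / 4" "6 / (\<beta> * sqrt \<omega>) \<le> t / 2"
 shows "measure M {w \<in> space M. \<eta> \<le> norm (GammaC w)}
  \<le> 8 * exp (- \<beta> * t^2 * \<omega> / 1872) + 2 * exp (- sqrt (2 * \<beta>) * t * sqrt \<omega> / (60 * max C 1 * ln (real n))) + (K1 * real m / (LL * \<eta>^2))^m"
proof -
 have n1: "1 \<le> n" using n by simp
 have LL0: "0 < LL" using L by simp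
 have \<eta>0: "0 < \<eta>" using \<eta> LL0 divide_pos_pos[of 8 LL] by linarith
 have t0: "0 < t" "t \<le> 1 / 4" using \<eta>0 t by auto
 \<comment> \<open>Off both events \<open>2 |y| + 12 |p|\<close> would be at least
   \<open>3/8 \<eta>\<close>, while its square is at most \<open>148 (|y|^2 + |p|^2)\<close>. The
   constant 1100 is chosen so that \<open>148 / 1100 < 9 / 64\<close>.\<close>
 define q where "q = \<eta>^2 / 1100"
 have q0: "0 < q" using \<eta>0 by (simp add: q_def)
 define R where "R w = (cmod (fst (chain n w)))^2 + (cmod (snd (chain n w)))^2" for w
 have cm[measurable]: "(\<lambda>w. fst (chain n w)) \<in> borel_measurable M" "(\<lambda>w. snd (chain n w)) \<in> borel_measurable M"
  by (intro measurable_compose[OF chain_meas] borel_measurable_continuous_onI continuous_intros)+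
 have [measurable]: "R \<in> borel_measurable M" unfolding R_def by measurable
 note [measurable] = chi_meas[OF n1]
 define A B where "A = {w \<in> space M. t \<le> cmod (chi w)}" and "B = {w \<in> space M. q \<le> R w}"
 have [measurable]: "A \<in> sets M" "B \<in> sets M" unfolding A_def B_def by measurable
 have "measure M {w \<in> space M. \<eta> \<le> norm (GammaC w)} \<le> measure M (A \<union> B)"
 proof (rule finite_measure_mono_AE)
  show "AE w in M. w \<in> {w \<in> space M. \<eta> \<le> norm (GammaC w)} \<longrightarrow> w \<in> A \<union> B"
  proof (intro AE_I2 impI, rule ccontr)
   fix w assume w: "w \<in> space M" "w \<in> {w \<in> space M. \<eta> \<le> norm (GammaC w)}" "w \<notin> A \<union> B"
   hence lt: "cmod (chi w) < t" "R w < q" by (auto simp: A_def B_def)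
   define Q where "Q = 2 * cmod (fst (chain n w)) + 12 * cmod (snd (chain n w))"
   have "\<eta> \<le> 4 / 3 * (t + Q + 1 / LL)"
    using GammaC_le[OF n1 less_imp_le[OF lt(1)] t0(2) L] w(2) unfolding Q_def by (simp only: mem_Collect_eq add.assoc) linarith
   moreover have "1 / LL \<le> \<eta> / 8" using \<eta> by simp
   ultimately have "3 / 8 * \<eta> \<le> Q" using t(1) by (auto simp: min_def split: if_splits)
   hence "(3 / 8 * \<eta>)^2 \<le> Q^2" using \<eta>0 by (intro power_mono) auto
   also have "Q^2 \<le> 148 * R w"
   proof -
    have "(2 * a + 12 * b)^2 \<le> 148 * (a^2 + b^2)" for a b :: real
    proof -
     have "0 \<le> (12 * a - 2 * b)^2" by simp
     thus ?thesis by (simp add: power2_eq_square algebra_simps)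
    qed
    thus ?thesis unfolding Q_def R_def by blast
   qed
   also have "\<dots> < 148 * q" using lt by simp
   finally show False using \<eta>0 by (simp add: q_def power_mult_distrib power_divide)
  qed
 qed measurable
 also have "\<dots> \<le> measure M A + measure M B" by (intro measure_Un_le) auto
 also have "measure M A \<le> 8 * exp (- \<beta> * t^2 * \<omega> / 1872) + 2 * exp (- sqrt (2 * \<beta>) * t * sqrt \<omega> / (60 * max C 1 * ln (real n)))"
  unfolding A_def by (rule chi_tail[OF n t0(1) t(2)])
 also have "measure M B \<le> (K1 * real m / (LL * \<eta>^2))^m"
 proof -
  have "emeasure M B \<le> emeasure M {w \<in> space M. 1 \<le> ennreal ((1 / q)^m) * ennreal (R w^m)}"
  proof (intro emeasure_mono)
   show "B \<subseteq> {w \<in> space M. 1 \<le> ennreal ((1 / q)^m) * ennreal (R w^m)}"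
   proof
    fix w assume w: "w \<in> B"
    hence "1 \<le> 1 / q * R w" using q0 by (simp add: B_def)
    hence "1 \<le> (1 / q * R w)^m" by (rule one_le_power)
    hence "1 \<le> ennreal ((1 / q * R w)^m)" by simp
    also have "ennreal ((1 / q * R w)^m) = ennreal ((1 / q)^m) * ennreal (R w^m)"
     unfolding power_mult_distrib using q0 by (intro ennreal_mult) (auto simp: R_def)
    finally show "w \<in> {w \<in> space M. 1 \<le> ennreal ((1 / q)^m) * ennreal (R w^m)}" using w by (simp add: B_def)
   qed
  qed measurable
  also have "\<dots> \<le> ennreal ((1 / q)^m) * (\<integral>\<^sup>+w. ennreal (R w^m) * indicator (space M) w \<partial>M)"
   by (rule nn_integral_Markov_inequality) auto
  also have "\<dots> = ennreal ((1 / q)^m) * (\<integral>\<^sup>+w. ennreal (R w^m) \<partial>M)"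
   by (intro arg_cong2[where f = "(*)"] nn_integral_cong refl) auto
  also have "\<dots> \<le> ennreal ((1 / q)^m) * ennreal ((KK * exp (256 * GG^2) * real m / LL)^m)"
   unfolding R_def using moment_bound[OF m \<omega> L small] by (intro mult_left_mono) auto
  also have "\<dots> = ennreal ((1 / q * (KK * exp (256 * GG^2) * real m / LL))^m)"
   unfolding power_mult_distrib using q0 LL0 GK by (intro ennreal_mult[symmetric]) auto
  also have "1 / q * (KK * exp (256 * GG^2) * real m / LL) = K1 * real m / (LL * \<eta>^2)"
   by (simp add: q_def K1_def mult_ac)
  finally show ?thesis using LL0 GK \<eta>0 by (simp add: emeasure_eq_measure K1_def)
 qed
 finally show ?thesis by simp
qed

end

section \<open>The asymptotic regime\<close>

text \<open>Both exponents dominate \<open>W\<close>. The two constants are \<open>16 * 1872\<close>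
  and \<open>4 * 60\<close>; in the second tail one factor \<open>4 t \<le> 1\<close> is added to
  turn the linear dependence on \<open>t\<close> into the quadratic one.\<close>

lemma tail_exponent:
 fixes \<beta> C' R1 \<Lambda> LL l ln_n \<omega> \<eta> t :: real
 assumes \<beta>: "0 < \<beta>" and C': "1 \<le> C'" and R1: "0 < R1" and \<Lambda>: "0 < \<Lambda>" "29952 * (1 + R1) / \<beta> \<le> \<Lambda>\<^sup>2" "240 * C' * (1 + R1) / sqrt (2 * \<beta>) \<le> \<Lambda>"
  and LL: "1 \<le> LL" and l: "1 \<le> l" "0 < ln_n" "ln_n \<le> l" and \<omega>: "0 < \<omega>" "\<Lambda> * LL * l \<le> sqrt \<omega>"
  and t: "0 < \<eta>" "t = min \<eta> 1 / 4"
 shows "exp (- \<beta> * t^2 * \<omega> / 1872) \<le> exp (- \<eta>\<^sup>2 * LL) + exp (- R1 * LL)"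
  "exp (- sqrt (2 * \<beta>) * t * sqrt \<omega> / (60 * C' * ln_n)) \<le> exp (- \<eta>\<^sup>2 * LL) + exp (- R1 * LL)"
proof -
 have t0: "0 < t" "4 * t \<le> 1" using t by auto
 have t16: "16 * t^2 = (4 * t)^2" by (simp add: power_mult_distrib)
 \<comment> \<open>For \<open>\<eta> \<le> 1\<close> the prefactor is \<open>\<eta>^2\<close> and
   \<open>W\<close> exceeds \<open>\<eta>^2 LL\<close>; for larger \<open>\<eta>\<close> it is
   frozen at 1, and the summand \<open>R1\<close> supplies the second exponential.\<close>
 define W where "W = 16 * t^2 * (1 + R1) * LL"
 have W: "exp (- W) \<le> exp (- \<eta>\<^sup>2 * LL) + exp (- R1 * LL)"
 proof (cases "\<eta> \<le> 1")
  case True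
  hence "4 * t = \<eta>" using t by simp
  hence "16 * t^2 = \<eta>^2" unfolding t16 by simp
  hence "W = \<eta>^2 * LL + \<eta>^2 * (R1 * LL)" unfolding W_def by (simp add: algebra_simps)
  moreover have "0 \<le> \<eta>^2 * (R1 * LL)" using R1 LL by simp
  ultimately have "exp (- W) \<le> exp (- \<eta>\<^sup>2 * LL)" by simp
  thus ?thesis by (simp add: add_increasing2)
 next
  case False
  hence "4 * t = 1" using t by simp
  hence "16 * t^2 = 1" unfolding t16 by simp
  hence "W = R1 * LL + LL" unfolding W_def by (simp add: algebra_simps)
  hence "exp (- W) \<le> exp (- R1 * LL)" using LL by simp
  thus ?thesis by (simp add: add_increasing)
 qed
 have \<Lambda>LL: "\<Lambda> * LL \<le> sqrt \<omega>"
 proof -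
  have "0 \<le> \<Lambda> * LL" using \<Lambda>(1) LL by simp
  thus ?thesis using \<omega>(2) mult_left_mono[OF l(1), of "\<Lambda> * LL"] by simp
 qed
 have "W \<le> \<beta> * t^2 * \<omega> / 1872"
 proof -
  have "29952 * (1 + R1) * LL \<le> \<beta> * \<Lambda>\<^sup>2 * LL" using \<Lambda>(2) \<beta> LL by (simp add: pos_divide_le_eq mult.commute mult_right_mono)
  also have "\<dots> \<le> \<beta> * \<Lambda>\<^sup>2 * LL^2" using LL \<beta> by (intro mult_left_mono) (auto simp: power2_eq_square)
  also have "\<dots> = \<beta> * (\<Lambda> * LL)^2" by (simp add: power_mult_distrib)
  also have "\<dots> \<le> \<beta> * (sqrt \<omega>)^2" using \<Lambda>LL \<Lambda>(1) LL \<beta> by (intro mult_left_mono power_mono) auto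
  finally have "29952 * (1 + R1) * LL \<le> \<beta> * \<omega>" using \<omega> by simp
  hence "t^2 / 1872 * (29952 * (1 + R1) * LL) \<le> t^2 / 1872 * (\<beta> * \<omega>)" by (intro mult_left_mono) auto
  moreover have "t^2 / 1872 * (29952 * (1 + R1) * LL) = W" by (simp add: W_def)
  moreover have "t^2 / 1872 * (\<beta> * \<omega>) = \<beta> * t^2 * \<omega> / 1872" by simp
  ultimately show ?thesis by linarith
 qed
 hence "exp (- \<beta> * t^2 * \<omega> / 1872) \<le> exp (- W)" by simp
 thus "exp (- \<beta> * t^2 * \<omega> / 1872) \<le> exp (- \<eta>\<^sup>2 * LL) + exp (- R1 * LL)" using W by linarith
 have "W \<le> sqrt (2 * \<beta>) * t * sqrt \<omega> / (60 * C' * ln_n)"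
 proof -
  have sb: "0 < sqrt (2 * \<beta>)" using \<beta> by simp
  have "W = 4 * t * (4 * t) * (1 + R1) * LL" by (simp add: W_def power2_eq_square)
  also have "\<dots> \<le> 4 * t * 1 * (1 + R1) * LL" using t0 R1 LL by (intro mult_right_mono mult_left_mono) auto
  also have "\<dots> = t / (60 * C') * (240 * C' * (1 + R1)) * LL" using C' by (simp add: field_simps)
  also have "\<dots> \<le> t / (60 * C') * (sqrt (2 * \<beta>) * \<Lambda>) * LL"
   using \<Lambda>(3) sb t0 C' LL by (intro mult_right_mono mult_left_mono) (auto simp: pos_divide_le_eq mult.commute)
  also have "\<dots> = sqrt (2 * \<beta>) * t / (60 * C') * (\<Lambda> * LL)" by (simp add: mult_ac)
  also have "\<dots> \<le> sqrt (2 * \<beta>) * t / (60 * C') * (sqrt \<omega> / ln_n)"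
  proof (rule mult_left_mono)
   have "\<Lambda> * LL * ln_n \<le> \<Lambda> * LL * l" using l \<Lambda>(1) LL by (intro mult_left_mono) auto
   hence "\<Lambda> * LL * ln_n \<le> sqrt \<omega>" using \<omega>(2) by linarith
   thus "\<Lambda> * LL \<le> sqrt \<omega> / ln_n" using l by (simp add: pos_le_divide_eq)
  qed (use sb t0 C' in auto)
  finally show ?thesis by simp
 qed
 hence "exp (- sqrt (2 * \<beta>) * t * sqrt \<omega> / (60 * C' * ln_n)) \<le> exp (- W)" by simp
 thus "exp (- sqrt (2 * \<beta>) * t * sqrt \<omega> / (60 * C' * ln_n)) \<le> exp (- \<eta>\<^sup>2 * LL) + exp (- R1 * LL)" using W by linarith
qed

text \<open>The free moment \<open>m\<close> is taken proportional to \<open>\<eta>\<^sup>2 L\<close> for bounded \<open>\<eta>\<close> and maximal for large \<open>\<eta>\<close>.\<close>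

lemma optimal_moment:
 fixes K1 KK R1 :: real
 assumes K1: "0 < K1" and KK: "1 \<le> KK" and R1: "0 < R1"
 obtains c K where "0 < c" "c \<le> 1" "0 < K"
  "\<forall>L q p Q. KK \<le> L \<longrightarrow> 0 < q \<longrightarrow> p \<le> 1 \<longrightarrow> 0 \<le> Q \<longrightarrow> (\<forall>m :: nat. 1 \<le> m \<longrightarrow> KK * real m \<le> L \<longrightarrow> p \<le> Q + (K1 * real m / (L * q))^m)
   \<longrightarrow> p \<le> Q + K * (exp (- c * q * L) + exp (- R1 * L))"
proof -
 \<comment> \<open>\<open>B\<close> is the threshold for \<open>q\<close>, which stands for
   \<open>\<eta>^2\<close>. Above it the maximal \<open>m\<close>, about \<open>L / KK\<close>,
   makes the base at most \<open>exp (- R1 KK)\<close>. Below it \<open>c1\<close> ensures that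
   \<open>m\<close> of size \<open>c1 q L\<close> is admissible and makes the base at most
   \<open>1 / e\<close>.\<close>
 define B where "B = K1 / KK * exp (R1 * KK)"
 define c1 where "c1 = min (1 / (exp 1 * K1)) (1 / (KK * B))"
 define c where "c = min 1 c1"
 define K where "K = exp 1 + exp (R1 * KK)"
 have B: "0 < B" using K1 KK by (simp add: B_def)
 have c1: "0 < c1" "c1 \<le> 1 / (exp 1 * K1)" "c1 \<le> 1 / (KK * B)" using K1 KK B by (auto simp: c1_def)
 have K1c: "K1 * c1 \<le> exp (- 1)"
  using mult_left_mono[OF c1(2), of K1] K1 by (simp add: exp_minus field_simps)
 have KKc: "KK * c1 * B \<le> 1"
  using mult_right_mono[OF c1(3), of "KK * B"] KK B by (simp add: mult_ac)
 show thesis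
 proof (rule that[of c K]; (intro allI impI)?)
  show "0 < c" "c \<le> 1" using c1 by (auto simp: c_def)
  show "0 < K" by (simp add: K_def add_pos_pos)
  fix L q p Q :: real
  assume L: "KK \<le> L" and q: "0 < q" and p: "p \<le> 1" and Q: "0 \<le> Q"
   and bnd: "\<forall>m :: nat. 1 \<le> m \<longrightarrow> KK * real m \<le> L \<longrightarrow> p \<le> Q + (K1 * real m / (L * q))^m"
  note bound = bnd[rule_format]
  have L0: "0 < L" using L KK by simp
  have e0: "0 \<le> exp (- c * q * L)" "0 \<le> exp (- R1 * L)" by auto
  show "p \<le> Q + K * (exp (- c * q * L) + exp (- R1 * L))"
  proof (cases "B \<le> q")
   case True
   define m where "m = nat \<lfloor>L / KK\<rfloor>"
   have LK: "1 \<le> L / KK" using L KK by simp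
   have m: "1 \<le> m" "real m \<le> L / KK" "L / KK - 1 \<le> real m"
    using LK unfolding m_def by linarith+
   have mL: "KK * real m \<le> L" using m(2) KK by (simp add: field_simps)
   have "K1 * real m / (L * q) \<le> exp (- (R1 * KK))"
   proof -
    have "K1 * real m / (L * q) \<le> K1 * (L / KK) / (L * B)" using m K1 KK L0 q B True by (intro frac_le mult_mono) auto
    also have "\<dots> = exp (- (R1 * KK))" using L0 K1 KK by (simp add: B_def exp_minus field_simps)
    finally show ?thesis .
   qed
   hence "(K1 * real m / (L * q))^m \<le> exp (- (R1 * KK))^m" using K1 L0 q by (intro power_mono) auto
   also have "\<dots> = exp (- (R1 * KK) * real m)" by (simp add: exp_of_nat_mult[symmetric] mult.commute)
   also have "\<dots> \<le> exp (R1 * KK + - R1 * L)"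
   proof -
    have "L - KK \<le> KK * real m" using mult_left_mono[OF m(3), of KK] KK by (simp add: algebra_simps)
    hence "R1 * (L - KK) \<le> R1 * (KK * real m)" using R1 by (intro mult_left_mono) auto
    thus ?thesis by (simp add: algebra_simps)
   qed
   also have "\<dots> = exp (R1 * KK) * exp (- R1 * L)" by (rule exp_add)
   also have "\<dots> \<le> K * (exp (- c * q * L) + exp (- R1 * L))" by (intro mult_mono) (auto simp: K_def add_increasing)
   finally show ?thesis using bound[OF m(1) mL] by linarith
  next
   case False
   define m where "m = nat \<lfloor>c1 * q * L\<rfloor>"
   have nn: "0 \<le> c1 * q * L" using c1 q L0 by simp
   have m: "real m \<le> c1 * q * L" "c1 * q * L \<le> real m + 1" using nn unfolding m_def by linarith+
   have e: "exp (- real m) \<le> exp 1 * exp (- c * q * L)"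
   proof -
    have "c * (q * L) \<le> c1 * (q * L)" using q L0 by (intro mult_right_mono) (auto simp: c_def)
    hence "- real m \<le> 1 + - c * q * L" using m(2) by (simp add: mult.assoc)
    thus ?thesis unfolding exp_add[symmetric] by simp
   qed
   have eK: "exp 1 * exp (- c * q * L) \<le> K * (exp (- c * q * L) + exp (- R1 * L))"
    by (intro mult_mono) (auto simp: K_def)
   show ?thesis
   proof (cases "m = 0")
    \<comment> \<open>No positive \<open>m\<close> is available; then \<open>c1 q L \<le> 1\<close>,
      and the trivial bound \<open>p \<le> 1\<close> suffices.\<close>
    case True
    hence "p \<le> exp (- real m)" using p by simp
    thus ?thesis using e eK Q by linarith
   next
    case False
    hence m1: "1 \<le> m" by simp
    have "KK * real m \<le> KK * (c1 * q * L)" using m KK by (intro mult_left_mono) auto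
    also have "\<dots> \<le> KK * (c1 * B * L)" using \<open>\<not> B \<le> q\<close> c1 L0 KK by (intro mult_left_mono mult_right_mono) auto
    also have "\<dots> = KK * c1 * B * L" by simp
    also have "\<dots> \<le> 1 * L" using KKc L0 by (intro mult_right_mono) auto
    finally have mL: "KK * real m \<le> L" by simp
    have "K1 * real m / (L * q) \<le> exp (- 1)"
    proof -
     have "K1 * real m \<le> K1 * (c1 * q * L)" using m K1 by (intro mult_left_mono) auto
     also have "\<dots> = K1 * c1 * (L * q)" by (simp add: mult_ac)
     also have "\<dots> \<le> exp (- 1) * (L * q)" using K1c L0 q by (intro mult_right_mono) auto
     finally show ?thesis using L0 q by (simp add: pos_divide_le_eq)
    qed
    hence "(K1 * real m / (L * q))^m \<le> exp (- 1)^m" using K1 L0 q by (intro power_mono) auto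
    also have "\<dots> = exp (- real m)" by (simp add: exp_of_nat_mult[symmetric])
    finally show ?thesis using bound[OF m1 mL] e eK by linarith
   qed
  qed
 qed
qed

text \<open>The conditions of the tail bound at the largest admissible \<open>L\<close>: since
  \<open>\<Omega>\<close> is at most \<open>N^(\<delta>/6)\<close>, which is at most
  \<open>P^(1/12)\<close>, one has \<open>L \<le> P^(1/12) ln P\<close>, and
  \<open>\<omega> \<ge> (P / 2)^(1/3)\<close>. The exponents \<open>1/12 < 1/6\<close> and
  \<open>7/18 < 1/2\<close> decide.\<close>

definition regime :: "real \<Rightarrow> real \<Rightarrow> real \<Rightarrow> real \<Rightarrow> bool" where
 "regime K A h P \<longleftrightarrow> 1 \<le> ln P \<and> K * (P powr (1 / 12) * ln P) * ln P \<le> sqrt ((P / 2) powr (1 / 3))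
   \<and> 6 * 10^6 * A * (P powr (1 / 3) * (P powr (1 / 12) * ln P) powr (2 / 3) / sqrt P) \<le> h / 4
   \<and> A^2 \<le> (P / 2) powr (1 / 3) \<and> 1 \<le> (P / 2) powr (1 / 3)"

lemma asymptotic_conditions:
 fixes \<Lambda> A h :: real
 assumes "0 < \<Lambda>" "0 < A" "0 < h"
 obtains P0 where "2 \<le> P0" "\<And>P. P0 \<le> P \<Longrightarrow> regime \<Lambda> A h P"
proof -
 have "eventually (\<lambda>P :: real. 1 \<le> ln P) at_top" by real_asymp
 moreover have "eventually (\<lambda>P. \<Lambda> * (P powr (1 / 12) * ln P) * ln P \<le> sqrt ((P / 2) powr (1 / 3))) at_top"
  using assms by real_asymp
 moreover have "((\<lambda>P. 6 * 10^6 * A * (P powr (1 / 3) * (P powr (1 / 12) * ln P) powr (2 / 3) / sqrt P)) \<longlongrightarrow> 0) at_top"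
  using assms by real_asymp
 hence "eventually (\<lambda>P. 6 * 10^6 * A * (P powr (1 / 3) * (P powr (1 / 12) * ln P) powr (2 / 3) / sqrt P) < h / 4) at_top"
  using assms by (intro order_tendstoD(2)) auto
 moreover have "eventually (\<lambda>P :: real. A^2 \<le> (P / 2) powr (1 / 3)) at_top" using assms by real_asymp
 moreover have "eventually (\<lambda>P :: real. 1 \<le> (P / 2) powr (1 / 3)) at_top" by real_asymp
 ultimately have "eventually (\<lambda>P. regime \<Lambda> A h P) at_top"
  by eventually_elim (simp add: regime_def)
 then obtain P1 where P1: "\<And>P. P1 \<le> P \<Longrightarrow> regime \<Lambda> A h P" unfolding eventually_at_top_linorder by blast
 show thesis by (rule that[of "max 2 P1"]) (use P1 in auto)
qed

text \<open>The powers are chosen so that \<open>\<omega>^3 = Np * L^2\<close>, hence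
  \<open>\<omega> * sqrt (\<omega> / P) = L * sqrt (Np / P)\<close>; the floor in \<open>Np\<close>
  costs at most a factor 2 inside the root.\<close>

lemma omega_scale:
 fixes Np L P \<omega> :: real
 assumes Np: "1 \<le> Np" "P / 2 \<le> Np" "Np \<le> P" and L: "1 \<le> L" and \<omega>: "\<omega> = Np powr (1 / 3) * L powr (2 / 3)"
 shows "L / 2 \<le> \<omega> * sqrt (\<omega> / P)" "\<omega> * sqrt (\<omega> / P) \<le> L" "(P / 2) powr (1 / 3) \<le> \<omega>" "\<omega> \<le> P powr (1 / 3) * L powr (2 / 3)"
proof -
 have P: "0 < P" using Np by simp
 have \<omega>0: "0 < \<omega>" unfolding \<omega> using Np L by simp
 have "\<omega>^3 = Np * L^2"
  unfolding \<omega> power_mult_distrib using Np L by (simp add: powr_power)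
 hence "\<omega> * sqrt (\<omega> / P) = sqrt (Np * L^2 / P)"
 proof -
  assume 3: "\<omega>^3 = Np * L^2"
  have "\<omega> * sqrt (\<omega> / P) = sqrt (\<omega>^2) * sqrt (\<omega> / P)" using \<omega>0 by simp
  also have "\<dots> = sqrt (\<omega>^3 / P)" unfolding real_sqrt_mult[symmetric] by (simp add: power2_eq_square power3_eq_cube)
  finally show ?thesis unfolding 3 .
 qed
 also have "\<dots> = L * sqrt (Np / P)"
 proof -
  have "Np * L^2 / P = L^2 * (Np / P)" by simp
  thus ?thesis using L by (simp only: real_sqrt_mult real_sqrt_abs abs_of_nonneg)
 qed
 finally have eq: "\<omega> * sqrt (\<omega> / P) = L * sqrt (Np / P)" .
 have "1 / 2 \<le> sqrt (Np / P)"
 proof (rule real_le_rsqrt)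
  have "1 / 2 \<le> Np / P" using Np(2) P by (simp add: field_simps)
  moreover have "(1 / 2 :: real)^2 = 1 / 4" by (simp add: power2_eq_square)
  ultimately show "(1 / 2)^2 \<le> Np / P" by linarith
 qed
 thus "L / 2 \<le> \<omega> * sqrt (\<omega> / P)" unfolding eq using mult_left_mono[of "1 / 2" _ L] L by simp
 have "sqrt (Np / P) \<le> 1" using Np P by simp
 thus "\<omega> * sqrt (\<omega> / P) \<le> L" unfolding eq using mult_left_mono[of _ 1 L] L by simp
 have "(P / 2) powr (1 / 3) * 1 \<le> Np powr (1 / 3) * L powr (2 / 3)"
  using Np L P by (intro mult_mono powr_mono2 ge_one_powr_ge_zero) auto
 thus "(P / 2) powr (1 / 3) \<le> \<omega>" by (simp add: \<omega>)
 show "\<omega> \<le> P powr (1 / 3) * L powr (2 / 3)" unfolding \<omega> using Np by (intro mult_right_mono powr_mono2) auto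
qed

lemma (in coupled) tail_bound:
 fixes c K R1 \<Lambda> \<eta> l :: real
 assumes mom: "\<forall>L q p Q. KK \<le> L \<longrightarrow> 0 < q \<longrightarrow> p \<le> 1 \<longrightarrow> 0 \<le> Q \<longrightarrow> (\<forall>m :: nat. 1 \<le> m \<longrightarrow> KK * real m \<le> L \<longrightarrow> p \<le> Q + (K1 * real m / (L * q))^m)
   \<longrightarrow> p \<le> Q + K * (exp (- c * q * L) + exp (- R1 * L))"
  and c: "c \<le> 1" and R1: "0 < R1" and n: "2 \<le> n"
  and \<Lambda>: "0 < \<Lambda>" "29952 * (1 + R1) / \<beta> \<le> \<Lambda>\<^sup>2" "240 * max C 1 * (1 + R1) / sqrt (2 * \<beta>) \<le> \<Lambda>" "6 / \<beta> \<le> \<Lambda>"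
  and LL: "64 \<le> LL" "KK \<le> LL" and l: "1 \<le> l" "ln (real n) \<le> l" "\<Lambda> * LL * l \<le> sqrt \<omega>"
  and \<omega>: "cc^2 \<le> \<omega>" and small: "6 * 10^6 * cc * (\<omega> / sqrt P) \<le> hh / 4" and \<eta>: "8 / LL \<le> \<eta>"
 shows "measure M {w \<in> space M. \<eta> \<le> norm (GammaC w)} \<le> (10 + K) * (exp (- c * \<eta>^2 * LL) + exp (- R1 * LL))"
proof -
 have L0: "0 < LL" "1 \<le> LL" using LL by auto
 have \<eta>0: "0 < \<eta>" using \<eta> L0 divide_pos_pos[of 8 LL] by linarith
 have \<omega>0: "0 < \<omega>" using \<omega>1 by simp
 have lnn: "0 < ln (real n)" using n by simp
 define t where "t = min \<eta> 1 / 4"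
 have \<Lambda>L: "6 / \<beta> * LL \<le> sqrt \<omega>"
 proof -
  have "6 / \<beta> * LL * 1 \<le> \<Lambda> * LL * l" using \<Lambda>(1,4) L0 l(1) \<beta> by (intro mult_mono) auto
  thus ?thesis using l(3) by simp
 qed
 have t2: "6 / (\<beta> * sqrt \<omega>) \<le> t / 2"
 proof -
  have "6 / (\<beta> * sqrt \<omega>) \<le> 1 / LL"
  proof -
   have "6 / \<beta> * LL / (sqrt \<omega> * LL) \<le> sqrt \<omega> / (sqrt \<omega> * LL)" using \<Lambda>L L0 \<omega>0 by (intro divide_right_mono) auto
   thus ?thesis using L0 \<omega>0 by simp
  qed
  also have "\<dots> \<le> t / 2"
  proof -
   have "8 / LL \<le> min \<eta> 1" using \<eta> LL(1) by (simp add: pos_divide_le_eq)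
   thus ?thesis by (simp add: t_def)
  qed
  finally show ?thesis .
 qed
 define E where "E = exp (- \<eta>\<^sup>2 * LL) + exp (- R1 * LL)"
 note ex = tail_exponent[OF \<beta> _ R1 \<Lambda>(1,2,3) L0(2) l(1) lnn l(2) \<omega>0 l(3) \<eta>0 t_def, folded E_def]
 have "measure M {w \<in> space M. \<eta> \<le> norm (GammaC w)} \<le> 10 * E + K * (exp (- c * \<eta>^2 * LL) + exp (- R1 * LL))"
 proof (rule mom[rule_format, OF LL(2)])
  show "0 < \<eta>^2" "measure M {w \<in> space M. \<eta> \<le> norm (GammaC w)} \<le> 1" "0 \<le> 10 * E" using \<eta>0 by (auto simp: E_def)
  fix m :: nat assume m: "1 \<le> m" "KK * real m \<le> LL"
  from GammaC_tail[OF n m \<omega> LL(1) small \<eta> t_def t2]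
  show "measure M {w \<in> space M. \<eta> \<le> norm (GammaC w)} \<le> 10 * E + (K1 * real m / (LL * \<eta>^2))^m"
   using ex by linarith
 qed
 also have "10 * E \<le> 10 * (exp (- c * \<eta>^2 * LL) + exp (- R1 * LL))"
 proof -
  have "c * (\<eta>^2 * LL) \<le> 1 * (\<eta>^2 * LL)" using c L0 by (intro mult_right_mono) auto
  thus ?thesis by (simp add: E_def mult.assoc)
 qed
 finally show ?thesis by (simp add: distrib_right)
qed

lemma (in coupled) Gamma_N_eq:
 assumes "n = N_H \<Omega> N z"
 shows "Gamma_N M \<beta> a b BX BY \<Omega> N z w = GammaC w"
 unfolding Gamma_N_def Let_def t_H_def assms[symmetric] GammaC_def gg_def bb_def T_def ..

theorem theorem1p7:
  fixes \<beta> \<delta> C R :: real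
  assumes "0 < \<beta>" and "0 < \<delta>" and "\<delta> < 1 / 2" and "0 < R"
  shows "\<exists>c>0. \<forall>(M :: 'a measure) a b BX BY. beta_coupling M \<beta> C a b BX BY \<longrightarrow>
    (\<forall>(N :: nat) (\<Omega> :: real) (\<eta> :: real).
       1 \<le> N \<longrightarrow> 0 < \<Omega> \<longrightarrow> \<Omega> \<le> real N powr (\<delta> / 6) \<longrightarrow> N_large \<delta> \<Omega> N \<longrightarrow> 0 < \<eta> \<longrightarrow>
       (\<forall>z\<in>D_H \<delta> N.
          measure M {\<omega> \<in> space M. \<eta> \<le> norm (Gamma_N M \<beta> a b BX BY \<Omega> N z \<omega>)}
            \<le> inverse c * (real N powr (- c * \<eta>\<^sup>2 * \<Omega>) + real N powr (4 - R * \<Omega>))))"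
proof -
 note \<beta> = assms(1) and \<delta> = assms(2,3) and R = assms(4)
 \<comment> \<open>The next definitions repeat the locale constants \<open>cc\<close>,
   \<open>hh\<close>, \<open>GG\<close>, \<open>KK\<close> and \<open>K1\<close> outside the locale:
   they depend on \<open>\<beta>\<close> only, and \<open>c\<close> has to be fixed before the
   probability space.\<close>
 define cb where "cb = 15 * sqrt (2 / \<beta>) + 4"
 define hb where "hb = min 1 (sqrt (2 * \<beta>) / 4) / 2"
 define Gb where "Gb = max 1 (1920 * cb^4 * (24 * (4 / hb)^4 * exp hb * (2 * exp 2)))"
 define KKb where "KKb = 400 * Gb"
 define K1b where "K1b = 1100 * (KKb * exp (256 * Gb^2))"
 have pos: "0 < hb" "0 < cb" "1 \<le> KKb" "0 < K1b"
  using \<beta> by (auto simp: hb_def cb_def KKb_def K1b_def Gb_def intro!: add_pos_pos)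
 \<comment> \<open>The tail is obtained in terms of \<open>LL\<close>, and
   \<open>\<Omega> ln N \<le> (2 / \<delta>) LL\<close>: one factor \<open>1 / \<delta>\<close>
   comes from passing to \<open>ln Np\<close>, the factor 2 from
   \<open>L / 2 \<le> LL\<close>.\<close>
 define R1 where "R1 = 2 * R / \<delta>"
 have R1: "0 < R1" using R \<delta> by (simp add: R1_def)
 obtain c0 K where c0: "0 < c0" "c0 \<le> 1" and K: "0 < K"
  and mom: "\<forall>L q p Q. KKb \<le> L \<longrightarrow> 0 < q \<longrightarrow> p \<le> 1 \<longrightarrow> 0 \<le> Q \<longrightarrow> (\<forall>m :: nat. 1 \<le> m \<longrightarrow> KKb * real m \<le> L \<longrightarrow> p \<le> Q + (K1b * real m / (L * q))^m)
   \<longrightarrow> p \<le> Q + K * (exp (- c0 * q * L) + exp (- R1 * L))"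
  by (rule optimal_moment[OF pos(4,3) R1])
 define \<Lambda> where "\<Lambda> = max (max 1 (sqrt (29952 * (1 + R1) / \<beta>))) (max (240 * max C 1 * (1 + R1) / sqrt (2 * \<beta>)) (6 / \<beta>))"
 have \<Lambda>: "0 < \<Lambda>" "240 * max C 1 * (1 + R1) / sqrt (2 * \<beta>) \<le> \<Lambda>" "6 / \<beta> \<le> \<Lambda>" "sqrt (29952 * (1 + R1) / \<beta>) \<le> \<Lambda>"
  by (auto simp: \<Lambda>_def)
 have \<Lambda>2: "29952 * (1 + R1) / \<beta> \<le> \<Lambda>\<^sup>2"
  using power_mono[OF \<Lambda>(4), of 2] \<beta> R1 by simp
 obtain P0 where P0: "2 \<le> P0" "\<And>P. P0 \<le> P \<Longrightarrow> regime \<Lambda> cb hb P"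
  by (rule asymptotic_conditions[OF \<Lambda>(1) pos(2,1)]) (rule that)
 define l0 where "l0 = max 64 KKb"
 \<comment> \<open>The first part guarantees \<open>P \<ge> P0\<close>, the second
   \<open>N^\<delta> \<ge> 2\<close>.\<close>
 define N0 where "N0 = max (P0 powr (1 / (2 * \<delta>))) (2 powr (1 / \<delta>))"
 have N0: "1 \<le> N0" using P0(1) \<delta> by (simp add: N0_def ge_one_powr_ge_zero le_max_iff_disj)
 \<comment> \<open>Three cases are trivial because the right-hand side stays above a fixed positive
   number: small \<open>N\<close>, small \<open>L\<close>, and \<open>\<eta>\<close> below
   \<open>8 / LL\<close>. \<open>Q\<close> covers all three, and \<open>c \<le> exp (- Q)\<close>
   makes the claimed bound at least 1 there.\<close>
 define Q where "Q = max (R * N0 * ln N0) (max (2 * l0 * R / \<delta>) (2 / \<delta>))"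
 define c where "c = min (min (1 / (10 + K)) (c0 * \<delta> / 2)) (exp (- Q))"
 have Q0: "0 \<le> Q" using \<delta> by (simp add: Q_def le_max_iff_disj)
 have c: "0 < c" "c \<le> 1 / (10 + K)" "c \<le> c0 * \<delta> / 2" "c \<le> exp (- Q)"
  using c0 K \<delta> unfolding c_def by auto
 have c1: "c \<le> 1" using c(4) Q0 order_trans[of c "exp (- Q)" 1] by simp
 have trivial: "1 \<le> inverse c * A" if "exp (- Q) \<le> A" for A
 proof -
  have "c \<le> A" using c(4) that by linarith
  hence "inverse c * c \<le> inverse c * A" using c(1) by (intro mult_left_mono) auto
  thus ?thesis using c(1) by simp
 qed
 show ?thesis
 proof (intro exI[of _ c] conjI c(1) allI impI ballI)
  fix M :: "'a measure" and a b BX BY and N :: nat and \<Omega> \<eta> :: real and z :: complex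
  assume bc: "beta_coupling M \<beta> C a b BX BY" and N: "1 \<le> N" and \<Omega>: "0 < \<Omega>" "\<Omega> \<le> real N powr (\<delta> / 6)"
   and large: "N_large \<delta> \<Omega> N" and \<eta>: "0 < \<eta>" and z: "z \<in> D_H \<delta> N"
  interpret bc: beta_coupling M \<beta> C a b BX BY by (rule bc)
  define m where "m = measure M {\<omega> \<in> space M. \<eta> \<le> norm (Gamma_N M \<beta> a b BX BY \<Omega> N z \<omega>)}"
  define A B where "A = real N powr (- c * \<eta>^2 * \<Omega>)" and "B = real N powr (4 - R * \<Omega>)"
  have AB: "0 \<le> A" "0 \<le> B" by (auto simp: A_def B_def)
  define lnN where "lnN = ln (real N)"
  have lnN: "0 \<le> lnN" using N by (simp add: lnN_def)
  have A_exp: "A = exp (- c * \<eta>^2 * (\<Omega> * lnN))" using N by (simp add: A_def powr_def lnN_def mult_ac)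
  have B_exp: "exp (- R * (\<Omega> * lnN)) \<le> B" using N lnN by (simp add: B_def powr_def lnN_def algebra_simps)
  have m1: "m \<le> 1" unfolding m_def by (rule bc.prob_le_1)
  have trivA: "m \<le> inverse c * (A + B)" if "exp (- Q) \<le> A" using trivial[of "A + B"] that AB m1 by linarith
  have trivB: "m \<le> inverse c * (A + B)" if "R * (\<Omega> * lnN) \<le> Q"
  proof -
   have "exp (- Q) \<le> exp (- R * (\<Omega> * lnN))" using that by simp
   thus ?thesis using trivial[of "A + B"] B_exp AB m1 by linarith
  qed
  define x where "x = Re z"
  define P where "P = real N * x^2"
  have zD: "0 \<le> Im z" "Im z \<le> 2 * x" "real N powr (\<delta> - 1 / 2) \<le> x" using z by (auto simp: D_H_def x_def)
  have N1: "1 \<le> real N" using N by simp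
  have x0: "0 < x" using zD(3) N1 less_le_trans[of 0 "real N powr (\<delta> - 1 / 2)" x] by simp
  have P2: "real N powr (2 * \<delta>) \<le> P"
  proof -
   have "real N powr (2 * \<delta>) = real N * (real N powr (\<delta> - 1 / 2))^2"
   proof -
    have "(real N powr (\<delta> - 1 / 2))^2 = real N powr (2 * \<delta> - 1)" using N1 by (simp add: powr_power algebra_simps)
    thus ?thesis using N1 by (simp add: powr_diff)
   qed
   also have "\<dots> \<le> P" unfolding P_def using zD(3) by (intro mult_left_mono power_mono) auto
   finally show ?thesis .
  qed
  have "m \<le> inverse c * (A + B)"
  proof (cases "real N < N0")
   case True
   have "\<Omega> \<le> real N powr 1" using \<Omega>(2) \<delta> N1 by (intro order_trans[OF \<Omega>(2)] powr_mono) auto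
   hence "\<Omega> \<le> N0" using True N1 by simp
   moreover have "lnN \<le> ln N0" unfolding lnN_def using True N1 by simp
   ultimately have "\<Omega> * lnN \<le> N0 * ln N0" using \<Omega>(1) lnN N0 by (intro mult_mono) auto
   hence "R * (\<Omega> * lnN) \<le> R * (N0 * ln N0)" using R by (intro mult_left_mono) auto
   thus ?thesis by (intro trivB) (simp add: Q_def le_max_iff_disj mult.assoc)
  next
   case False
   define Np where "Np = real_of_int (N_p N z)"
   define L where "L = \<Omega> * ln Np"
   have PP0: "P0 \<le> P"
   proof -
    have "P0 = (P0 powr (1 / (2 * \<delta>))) powr (2 * \<delta>)" using P0(1) \<delta> by (simp add: powr_powr)
    also have "\<dots> \<le> real N powr (2 * \<delta>)" using False \<delta> by (intro powr_mono2) (auto simp: N0_def)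
    finally show ?thesis using P2 by linarith
   qed
   note asy = P0(2)[OF PP0, unfolded regime_def]
   have Np: "1 \<le> Np" "P / 2 \<le> Np" "Np \<le> P" using PP0 P0(1) unfolding Np_def N_p_def P_def[symmetric] x_def[symmetric] by linarith+
   \<comment> \<open>\<open>Np \<ge> P / 2\<close> and \<open>P \<ge> N^(2 \<delta>)\<close>; one of
     the two factors \<open>N^\<delta>\<close> absorbs the loss of 2.\<close>
   have lnNp: "\<delta> * lnN \<le> ln Np"
   proof -
    have "2 = (2 powr (1 / \<delta>)) powr \<delta>" using \<delta> by (simp add: powr_powr)
    also have "\<dots> \<le> real N powr \<delta>" using False \<delta> by (intro powr_mono2) (auto simp: N0_def)
    finally have "2 * real N powr \<delta> \<le> real N powr \<delta> * real N powr \<delta>" by (intro mult_right_mono) auto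
    also have "\<dots> = real N powr (2 * \<delta>)" by (simp add: powr_add[symmetric])
    finally have "real N powr \<delta> \<le> Np" using P2 Np by linarith
    hence "ln (real N powr \<delta>) \<le> ln Np" using N1 by (intro ln_mono) auto
    thus ?thesis using N1 by (simp add: lnN_def ln_powr)
   qed
   have \<Omega>L: "\<Omega> * lnN \<le> L / \<delta>"
    using mult_left_mono[OF lnNp, of \<Omega>] \<Omega>(1) \<delta> by (simp add: L_def pos_le_divide_eq mult_ac)
   show ?thesis
   proof (cases "L < 2 * l0")
    case True
    have "\<Omega> * lnN \<le> 2 * l0 / \<delta>" using \<Omega>L True \<delta> by (meson divide_right_mono less_imp_le order_trans)
    hence "R * (\<Omega> * lnN) \<le> 2 * l0 * R / \<delta>" using mult_left_mono[of "\<Omega> * lnN" "2 * l0 / \<delta>" R] R by (simp add: mult_ac)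
    thus ?thesis by (intro trivB) (simp add: Q_def le_max_iff_disj)
   next
    case False
    hence L: "1 \<le> L" "l0 \<le> L / 2" by (auto simp: l0_def)
    define \<omega> where "\<omega> = omega_N \<Omega> N z"
    have \<omega>_eq: "\<omega> = Np powr (1 / 3) * L powr (2 / 3)" by (simp add: \<omega>_def omega_N_def Np_def L_def)
    note sc = omega_scale[OF Np L(1) \<omega>_eq]
    define n where "n = N_H \<Omega> N z"
    have n2: "2 \<le> n" using large z by (simp add: N_large_def n_def)
    have n_le: "real n + \<omega> \<le> P"
    proof -
     \<comment> \<open>As \<open>n\<close> is at least 2, the truncation by \<open>nat\<close> in
       \<open>N_H\<close> has not acted.\<close>
     have "int n \<le> \<lfloor>Np - \<omega>\<rfloor>" using n2 unfolding n_def N_H_def Np_def \<omega>_def by linarith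
     hence "real n \<le> Np - \<omega>" by linarith
     thus ?thesis using Np by linarith
    qed
    have co: "coupled M \<beta> C a b BX BY N n z \<omega>"
    proof (intro coupled.intro bc hyperbolic_beta.intro hyperbolic.intro hyperbolic_beta_axioms.intro \<beta> N)
     show "1 \<le> \<omega>" using asy sc(3) by linarith
     show "real n + \<omega> \<le> real N * (Re z)^2" using n_le by (simp add: P_def x_def)
    qed (use zD x0 in \<open>auto simp: x_def\<close>)
    interpret co: coupled M \<beta> C a b BX BY N n z \<omega> by (rule co)
    have cons: "co.cc = cb" "bc.hh = hb" by (simp_all add: co.cc_def co.bb_def cb_def bc.hh_def hb_def)
    have KK: "co.KK = KKb" "co.K1 = K1b"
     unfolding co.K1_def co.KK_def co.GG_def cons KKb_def K1b_def Gb_def by (rule refl)+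
    have coP: "co.P = P" by (simp add: co.P_def co.x_def P_def x_def)
    have LLe: "L / 2 \<le> co.LL" "co.LL \<le> L" using sc(1,2) by (simp_all add: co.LL_def coP)
    have LL: "64 \<le> co.LL" "KKb \<le> co.LL" using L(2) LLe(1) by (auto simp: l0_def)
    have N12: "real N powr (\<delta> / 6) \<le> P powr (1 / 12)"
    proof -
     have "real N powr (\<delta> / 6) = (real N powr (2 * \<delta>)) powr (1 / 12)" by (simp add: powr_powr)
     also have "\<dots> \<le> P powr (1 / 12)" using P2 by (intro powr_mono2) auto
     finally show ?thesis .
    qed
    have LP: "L \<le> P powr (1 / 12) * ln P"
     unfolding L_def using \<Omega> N12 Np by (intro mult_mono) auto
    have cond: "\<Lambda> * co.LL * ln P \<le> sqrt \<omega>"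
    proof -
     have "\<Lambda> * co.LL * ln P \<le> \<Lambda> * (P powr (1 / 12) * ln P) * ln P"
      using LLe(2) LP \<Lambda>(1) asy by (intro mult_right_mono mult_left_mono) auto
     also have "\<dots> \<le> sqrt ((P / 2) powr (1 / 3))" using asy by blast
     also have "\<dots> \<le> sqrt \<omega>" using sc(3) by simp
     finally show ?thesis .
    qed
    have small: "6 * 10^6 * co.cc * (\<omega> / sqrt co.P) \<le> bc.hh / 4"
    proof -
     have "\<omega> \<le> P powr (1 / 3) * (P powr (1 / 12) * ln P) powr (2 / 3)"
      using LP L by (intro order_trans[OF sc(4)] mult_left_mono powr_mono2) auto
     hence "6 * 10^6 * cb * (\<omega> / sqrt P) \<le> 6 * 10^6 * cb * (P powr (1 / 3) * (P powr (1 / 12) * ln P) powr (2 / 3) / sqrt P)"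
      using pos Np by (intro mult_left_mono divide_right_mono) auto
     also have "\<dots> \<le> hb / 4" using asy by blast
     finally show ?thesis by (simp add: coP cons)
    qed
    have m_eq: "m = measure M {w \<in> space M. \<eta> \<le> norm (co.GammaC w)}"
     unfolding m_def co.Gamma_N_eq[OF n_def] ..
    have OL: "\<Omega> * lnN \<le> 2 / \<delta> * co.LL"
    proof -
     have "L / \<delta> \<le> 2 * co.LL / \<delta>" using LLe(1) \<delta> by (intro divide_right_mono) auto
     thus ?thesis using \<Omega>L by simp
    qed
    show ?thesis
    proof (cases "8 / co.LL \<le> \<eta>")
     case False
     \<comment> \<open>For \<open>\<eta> < 8 / LL\<close> the exponent
       \<open>\<eta>^2 \<Omega> ln N\<close> is at most \<open>128 / (\<delta> LL)\<close>, so the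
       first term of the bound is not small and nothing has to be proved.\<close>
     have "c * \<eta>^2 * (\<Omega> * lnN) \<le> 1 * (8 / co.LL)^2 * (2 / \<delta> * co.LL)"
      by (rule mult_mono[OF mult_mono[OF c1 power_mono] OL]) (use False \<eta> c \<Omega> lnN in auto)
     also have "\<dots> = 2 / \<delta> * (64 / co.LL)" using LL by (simp add: power2_eq_square field_simps)
     also have "\<dots> \<le> 2 / \<delta> * 1" using LL \<delta> by (intro mult_left_mono) auto
     also have "\<dots> \<le> Q" by (simp add: Q_def)
     finally show ?thesis by (intro trivA) (simp add: A_exp)
    next
     case True
     have "m \<le> (10 + K) * (exp (- c0 * \<eta>^2 * co.LL) + exp (- R1 * co.LL))"
      unfolding m_eq
     proof (rule co.tail_bound[OF mom[folded KK] c0(2) R1 n2 \<Lambda>(1) \<Lambda>2 \<Lambda>(2,3) LL(1) LL(2)[folded KK] _ _ cond _ small True])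
      show "1 \<le> ln P" using asy by blast
      show "ln (real n) \<le> ln P" using n_le n2 asy sc(3) by (intro ln_mono) auto
      show "co.cc^2 \<le> \<omega>" using asy sc(3) by (simp add: cons)
     qed
     also have "\<dots> \<le> (10 + K) * (A + B)"
     proof (intro mult_left_mono add_mono)
      \<comment> \<open>Conversion from \<open>LL\<close> back to \<open>\<Omega> ln N\<close>; the
        bound \<open>c \<le> c0 \<delta> / 2\<close> in the choice of \<open>c\<close> serves this
        step.\<close>
      have "c * \<eta>^2 * (\<Omega> * lnN) \<le> c0 * \<delta> / 2 * \<eta>^2 * (2 / \<delta> * co.LL)"
       by (rule mult_mono[OF mult_right_mono[OF c(3)] OL]) (use c0 \<delta> \<Omega> lnN in auto)
      also have "\<dots> = c0 * \<eta>^2 * co.LL" using \<delta> by simp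
      finally show "exp (- c0 * \<eta>^2 * co.LL) \<le> A" by (simp add: A_exp)
      have "R * (\<Omega> * lnN) \<le> R * (2 / \<delta> * co.LL)" using OL R by (intro mult_left_mono) auto
      also have "\<dots> = R1 * co.LL" by (simp add: R1_def)
      finally have "exp (- R1 * co.LL) \<le> exp (- R * (\<Omega> * lnN))" by simp
      thus "exp (- R1 * co.LL) \<le> B" using B_exp by linarith
     qed (use K in simp)
     also have "\<dots> \<le> inverse c * (A + B)"
     proof (rule mult_right_mono)
      have "c * (10 + K) \<le> 1" using c(2) K by (simp add: pos_le_divide_eq)
      thus "10 + K \<le> inverse c" using c(1) by (simp add: inverse_eq_divide pos_le_divide_eq mult.commute)
     qed (use AB in simp)
     finally show ?thesis .
    qed
   qed
  qed
  thus "measure M {\<omega> \<in> space M. \<eta> \<le> norm (Gamma_N M \<beta> a b BX BY \<Omega> N z \<omega>)}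
    \<le> inverse c * (real N powr (- c * \<eta>^2 * \<Omega>) + real N powr (4 - R * \<Omega>))"
   by (simp only: m_def A_def B_def)
 qed
qed

end
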